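(* Let $X,U,V$, $A$, $B$, $C$, $Q$, $\Pi$, $y_d$, $u_d$, $y_0\in X$ and the problems $(LQ^T)$ and $(LQ^\Pi)$ be as in the context. Assume that the pair $(A,B)$ is exponentially stabilizable and that the pair $(A,C)$ is exponentially detectable. Then: (1) The problem $(LQ^\Pi)$ has a unique solution $(y^\Pi(\cdot),u^\Pi(\cdot))$, which has a unique extremal lift $(y^\Pi(\cdot),u^\Pi(\cdot),\lambda^\Pi(\cdot))$, i.e. there is a unique $\lambda^\Pi\in C([0,\Pi];X)$ such that, in the mild sense on $[0,\Pi]$, $$\dot y^\Pi=Ay^\Pi+BQ^{-1}B^*\lambda^\Pi+Bu_d,\quad y^\Pi(0)=y^\Pi(\Pi),$$ $$\dot\lambda^\Pi=C^*Cy^\Pi-A^*\lambda^\Pi-C^*Cy_d,\quad \lambda^\Pi(0)=\lambda^\Pi(\Pi),$$ and $u^\Pi(t)=u_d(t)+Q^{-1}B^*\lambda^\Pi(t)$ for a.e. $t\in[0,\Pi]$. (2) Extend $(y^\Pi,u^\Pi,\lambda^\Pi)$ by $\Pi$-periodicity over $[0,+\infty)$. There exist positive constants $c$ and $\nu$ such that, for any $T>0$, the optimal triple $(y^T(\cdot),u^T(\cdot),\lambda^T(\cdot))$ of $(LQ^T)$ satisfies $$\|y^T(t)-y^\Pi(t)\|_X+\|u^T(t)-u^\Pi(t)\|_U+\|\lambda^T(t)-\lambda^\Pi(t)\|_X\le c\left(e^{-\nu t}+e^{-\nu(T-t)}\right)$$ for almost every $t\in[0,T]$.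
   Context: $X$, $U$, $V$ are Hilbert spaces identified with their duals; $L(Y,Z)$ denotes bounded linear operators from $Y$ to $Z$. $A:D(A)\subset X\to X$ generates a $C_0$ semigroup $(e^{At})_{t\ge0}$ on $X$; $B\in L(U,X)$; $C\in L(X,V)$; $Q\in L(U,U)$ is an invertible positive definite (self-adjoint) operator. $\Pi>0$ is fixed; $y_d\in C([0,+\infty);X)$ and $u_d\in L^2_{loc}(0,+\infty;U)$ are $\Pi$-periodic. The initial state $y_0\in X$ is given. **Problem $(LQ^T)$** ($T>0$): minimize over $u\in L^2(0,T;U)$ $$J^T(u)=\frac12\int_0^T\left(\|C(y(t)-y_d(t))\|_V^2+\|Q^{1/2}(u(t)-u_d(t))\|_U^2\right)dt,$$ where $y\in C([0,T];X)$ is the mild solution of $\dot y=Ay+Bu$, $y(0)=y_0$. It has a unique optimal solution $(y^T,u^T)$, and there is $\lambda^T\in C([0,T];X)$ such that, in the mild sense on $[0,T]$, $$\dot y^T=Ay^T+BQ^{-1}B^*\lambda^T+Bu_d,\ y^T(0)=y_0,\qquad \dot\lambda^T=C^*Cy^T-A^*\lambda^T-C^*Cy_d,\ \lambda^T(T)=0,$$ and $u^T(t)=u_d(t)+Q^{-1}B^*\lambda^T(t)$ for a.e. $t\in[0,T]$. The triple $(y^T,u^T,\lambda^T)$ is the optimal triple of $(LQ^T)$. **Problem $(LQ^\Pi)$**: minimize $$J^\Pi(y,u)=\frac12\int_0^\Pi\left(\|C(y(t)-y_d(t))\|_V^2+\|Q^{1/2}(u(t)-u_d(t))\|_U^2\right)dt$$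 over $(y,u)\in C([0,\Pi];X)\times L^2(0,\Pi;U)$ that are mild solutions of $\dot y=Ay+Bu$ on $[0,\Pi]$ with $y(0)=y(\Pi)$. **Mild sense** on $[0,\tau]$: $\dot y=Ay+g$ means $y(t)=e^{At}y(0)+\int_0^te^{A(t-s)}g(s)\,ds$, and $\dot\lambda=-A^*\lambda+h$ means $\lambda(t)=e^{A^*(\tau-t)}\lambda(\tau)-\int_t^\tau e^{A^*(s-t)}h(s)\,ds$. **Stabilizability and detectability.** $(A,B)$ is exponentially stabilizable if there is $K\in L(X,U)$ such that $A+BK$ generates a $C_0$ semigroup $(S(t))_{t\ge0}$ with $\|S(t)\|_{L(X,X)}\le c'e^{-\nu' t}$ for all $t\ge0$, for some $c',\nu'>0$. $(A,C)$ is exponentially detectable if $(A^*,C^* )$ is exponentially stabilizable. *)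

theory Defs
  imports "HOL-Analysis.Analysis" "HOL-Library.Real_Mod"
begin

(* Hilbert spaces are real and not assumed separable: types of sort {real_inner, banach}. *)

section \<open>Bochner integral and square-integrable functions\<close>

(* The library constants has_bochner_integral and lebesgue_integral require a
   second countable codomain.  The definitions below copy them without this restriction. *)

definition has_bint :: "'a measure \<Rightarrow> ('a \<Rightarrow> 'b::real_normed_vector) \<Rightarrow> 'b \<Rightarrow> bool" where
  "has_bint M f x \<longleftrightarrow> f \<in> borel_measurable M \<and>
     (\<exists>s. (\<forall>i. Bochner_Integration.simple_bochner_integrable M (s i)) \<and>
          (\<lambda>i. \<integral>\<^sup>+ t. ennreal (norm (f t - s i t)) \<partial>M) \<longlonglongrightarrow> 0 \<and>
          (\<lambda>i. Bochner_Integration.simple_bochner_integral M (s i)) \<longlonglongrightarrow> x)"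

definition bint :: "'a measure \<Rightarrow> ('a \<Rightarrow> 'b::real_normed_vector) \<Rightarrow> 'b" where
  "bint M f = (if \<exists>x. has_bint M f x then THE x. has_bint M f x else 0)"

definition strongly_measurable :: "'a measure \<Rightarrow> ('a \<Rightarrow> 'b::real_normed_vector) \<Rightarrow> bool" where
  "strongly_measurable M f \<longleftrightarrow>
     (\<exists>s. (\<forall>i. simple_function M (s i)) \<and> (AE t in M. (\<lambda>i. s i t) \<longlonglongrightarrow> f t))"

(* Functions, not classes: elements of L2 are compared almost everywhere. *)
definition L2_on :: "real \<Rightarrow> (real \<Rightarrow> 'b::real_normed_vector) \<Rightarrow> bool" where
  "L2_on \<tau> u \<longleftrightarrow> strongly_measurable (lebesgue_on {0..\<tau>}) u \<and>
     integrable (lebesgue_on {0..\<tau>}) (\<lambda>t. (norm (u t))\<^sup>2)"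

section \<open>Bounded operators\<close>

definition adj :: "('a::real_inner \<Rightarrow>\<^sub>L 'b::real_inner) \<Rightarrow> ('b \<Rightarrow>\<^sub>L 'a)" where
  "adj F = Blinfun (adjoint (blinfun_apply F))"

definition invertible_op :: "('a::real_normed_vector \<Rightarrow>\<^sub>L 'a) \<Rightarrow> bool" where
  "invertible_op Q \<longleftrightarrow> (\<exists>R. R o\<^sub>L Q = id_blinfun \<and> Q o\<^sub>L R = id_blinfun)"

definition inv_op :: "('a::real_normed_vector \<Rightarrow>\<^sub>L 'a) \<Rightarrow> ('a \<Rightarrow>\<^sub>L 'a)" where
  "inv_op Q = (THE R. R o\<^sub>L Q = id_blinfun \<and> Q o\<^sub>L R = id_blinfun)"

definition self_adjoint :: "('a::real_inner \<Rightarrow>\<^sub>L 'a) \<Rightarrow> bool" where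
  "self_adjoint Q \<longleftrightarrow> (\<forall>x y. Q x \<bullet> y = x \<bullet> Q y)"

definition positive_definite :: "('a::real_inner \<Rightarrow>\<^sub>L 'a) \<Rightarrow> bool" where
  "positive_definite Q \<longleftrightarrow> self_adjoint Q \<and> (\<forall>x. x \<noteq> 0 \<longrightarrow> 0 < Q x \<bullet> x)"

definition pos_sqrt :: "('a::real_inner \<Rightarrow>\<^sub>L 'a) \<Rightarrow> ('a \<Rightarrow>\<^sub>L 'a)" where
  "pos_sqrt Q = (SOME R. self_adjoint R \<and> (\<forall>x. 0 \<le> R x \<bullet> x) \<and> R o\<^sub>L R = Q)"

section \<open>Unbounded operators and semigroups\<close>

(* An operator A with domain D(A) is a partial function: dom A = D(A). *)

definition C0_semigroup :: "(real \<Rightarrow> ('x::real_normed_vector \<Rightarrow>\<^sub>L 'x)) \<Rightarrow> bool" where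
  "C0_semigroup S \<longleftrightarrow> S 0 = id_blinfun \<and>
     (\<forall>s\<ge>0. \<forall>t\<ge>0. S (s + t) = S s o\<^sub>L S t) \<and>
     (\<forall>x. ((\<lambda>t. S t x) \<longlongrightarrow> x) (at_right 0))"

definition generates :: "('x::real_normed_vector \<rightharpoonup> 'x) \<Rightarrow> (real \<Rightarrow> ('x \<Rightarrow>\<^sub>L 'x)) \<Rightarrow> bool" where
  "generates A S \<longleftrightarrow> C0_semigroup S \<and>
     (\<forall>x z. A x = Some z \<longleftrightarrow> ((\<lambda>h. (S h x - x) /\<^sub>R h) \<longlongrightarrow> z) (at_right 0))"

(* The semigroup exp (t A) for t >= 0; values at t < 0 are irrelevant, hence SOME. *)
definition semigroup_of :: "('x::real_normed_vector \<rightharpoonup> 'x) \<Rightarrow> real \<Rightarrow> ('x \<Rightarrow>\<^sub>L 'x)" where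
  "semigroup_of A = (SOME S. generates A S)"

(* A + F with domain D(A), for bounded F. *)
definition op_plus :: "('x::real_normed_vector \<rightharpoonup> 'x) \<Rightarrow> ('x \<Rightarrow>\<^sub>L 'x) \<Rightarrow> ('x \<rightharpoonup> 'x)" where
  "op_plus A F = (\<lambda>x. map_option (\<lambda>z. z + F x) (A x))"

(* The adjoint of a densely defined operator. *)
definition op_adj :: "('x::real_inner \<rightharpoonup> 'x) \<Rightarrow> ('x \<rightharpoonup> 'x)" where
  "op_adj A = (\<lambda>y. if \<exists>w. \<forall>x z. A x = Some z \<longrightarrow> z \<bullet> y = x \<bullet> w
                   then Some (THE w. \<forall>x z. A x = Some z \<longrightarrow> z \<bullet> y = x \<bullet> w) else None)"

definition exp_stabilizable ::
  "('x::real_normed_vector \<rightharpoonup> 'x) \<Rightarrow> ('u::real_normed_vector \<Rightarrow>\<^sub>L 'x) \<Rightarrow> bool" where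
  "exp_stabilizable A B \<longleftrightarrow>
     (\<exists>K S. generates (op_plus A (B o\<^sub>L K)) S \<and>
        (\<exists>c>0. \<exists>\<nu>>0. \<forall>t\<ge>0. norm (S t) \<le> c * exp (- \<nu> * t)))"

definition exp_detectable ::
  "('x::real_inner \<rightharpoonup> 'x) \<Rightarrow> ('x \<Rightarrow>\<^sub>L 'v::real_inner) \<Rightarrow> bool" where
  "exp_detectable A C \<longleftrightarrow> exp_stabilizable (op_adj A) (adj C)"

section \<open>Mild solutions on a compact interval\<close>

(* y' = A y + g *)
definition mild_forward ::
  "('x::{real_inner,banach} \<rightharpoonup> 'x) \<Rightarrow> real \<Rightarrow> (real \<Rightarrow> 'x) \<Rightarrow> (real \<Rightarrow> 'x) \<Rightarrow> bool" where
  "mild_forward A \<tau> g y \<longleftrightarrow> (\<forall>t\<in>{0..\<tau>}.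
     y t = semigroup_of A t (y 0)
           + bint (lebesgue_on {0..t}) (\<lambda>s. semigroup_of A (t - s) (g s)))"

(* \<lambda>' = - A* \<lambda> + h *)
definition mild_adjoint ::
  "('x::{real_inner,banach} \<rightharpoonup> 'x) \<Rightarrow> real \<Rightarrow> (real \<Rightarrow> 'x) \<Rightarrow> (real \<Rightarrow> 'x) \<Rightarrow> bool" where
  "mild_adjoint A \<tau> h l \<longleftrightarrow> (\<forall>t\<in>{0..\<tau>}.
     l t = semigroup_of (op_adj A) (\<tau> - t) (l \<tau>)
           - bint (lebesgue_on {t..\<tau>}) (\<lambda>s. semigroup_of (op_adj A) (s - t) (h s)))"

section \<open>The optimal control problems\<close>

definition lq_cost ::
  "('x::{real_inner,banach} \<Rightarrow>\<^sub>L 'v::{real_inner,banach}) \<Rightarrow> ('u::{real_inner,banach} \<Rightarrow>\<^sub>L 'u) \<Rightarrow>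
   (real \<Rightarrow> 'x) \<Rightarrow> (real \<Rightarrow> 'u) \<Rightarrow> real \<Rightarrow> (real \<Rightarrow> 'x) \<Rightarrow> (real \<Rightarrow> 'u) \<Rightarrow> real" where
  "lq_cost C Q yd ud \<tau> y u = 1/2 * (LINT t|lebesgue_on {0..\<tau>}.
     (norm (C (y t - yd t)))\<^sup>2 + (norm (pos_sqrt Q (u t - ud t)))\<^sup>2)"

definition admissible ::
  "('x::{real_inner,banach} \<rightharpoonup> 'x) \<Rightarrow> ('u::{real_inner,banach} \<Rightarrow>\<^sub>L 'x) \<Rightarrow>
   real \<Rightarrow> (real \<Rightarrow> 'x) \<Rightarrow> (real \<Rightarrow> 'u) \<Rightarrow> bool" where
  "admissible A B \<tau> y u \<longleftrightarrow>
     continuous_on {0..\<tau>} y \<and> L2_on \<tau> u \<and> mild_forward A \<tau> (\<lambda>t. B (u t)) y"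

definition LQT_solution ::
  "('x::{real_inner,banach} \<rightharpoonup> 'x) \<Rightarrow> ('u::{real_inner,banach} \<Rightarrow>\<^sub>L 'x) \<Rightarrow>
   ('x \<Rightarrow>\<^sub>L 'v::{real_inner,banach}) \<Rightarrow> ('u \<Rightarrow>\<^sub>L 'u) \<Rightarrow> (real \<Rightarrow> 'x) \<Rightarrow> (real \<Rightarrow> 'u) \<Rightarrow>
   'x \<Rightarrow> real \<Rightarrow> (real \<Rightarrow> 'x) \<Rightarrow> (real \<Rightarrow> 'u) \<Rightarrow> bool" where
  "LQT_solution A B C Q yd ud y0 T y u \<longleftrightarrow>
     admissible A B T y u \<and> y 0 = y0 \<and>
     (\<forall>y' u'. admissible A B T y' u' \<and> y' 0 = y0 \<longrightarrow>
        lq_cost C Q yd ud T y u \<le> lq_cost C Q yd ud T y' u')"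

definition LQPi_solution ::
  "('x::{real_inner,banach} \<rightharpoonup> 'x) \<Rightarrow> ('u::{real_inner,banach} \<Rightarrow>\<^sub>L 'x) \<Rightarrow>
   ('x \<Rightarrow>\<^sub>L 'v::{real_inner,banach}) \<Rightarrow> ('u \<Rightarrow>\<^sub>L 'u) \<Rightarrow> (real \<Rightarrow> 'x) \<Rightarrow> (real \<Rightarrow> 'u) \<Rightarrow>
   real \<Rightarrow> (real \<Rightarrow> 'x) \<Rightarrow> (real \<Rightarrow> 'u) \<Rightarrow> bool" where
  "LQPi_solution A B C Q yd ud P y u \<longleftrightarrow>
     admissible A B P y u \<and> y 0 = y P \<and>
     (\<forall>y' u'. admissible A B P y' u' \<and> y' 0 = y' P \<longrightarrow>
        lq_cost C Q yd ud P y u \<le> lq_cost C Q yd ud P y' u')"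

(* Optimality system on [0,\<tau>], without its boundary conditions. *)
definition extremal_system ::
  "('x::{real_inner,banach} \<rightharpoonup> 'x) \<Rightarrow> ('u::{real_inner,banach} \<Rightarrow>\<^sub>L 'x) \<Rightarrow>
   ('x \<Rightarrow>\<^sub>L 'v::{real_inner,banach}) \<Rightarrow> ('u \<Rightarrow>\<^sub>L 'u) \<Rightarrow> (real \<Rightarrow> 'x) \<Rightarrow> (real \<Rightarrow> 'u) \<Rightarrow>
   real \<Rightarrow> (real \<Rightarrow> 'x) \<Rightarrow> (real \<Rightarrow> 'u) \<Rightarrow> (real \<Rightarrow> 'x) \<Rightarrow> bool" where
  "extremal_system A B C Q yd ud \<tau> y u l \<longleftrightarrow>
     continuous_on {0..\<tau>} l \<and>
     mild_forward A \<tau> (\<lambda>t. B (inv_op Q (adj B (l t))) + B (ud t)) y \<and>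
     mild_adjoint A \<tau> (\<lambda>t. adj C (C (y t)) - adj C (C (yd t))) l \<and>
     (AE t in lebesgue_on {0..\<tau>}. u t = ud t + inv_op Q (adj B (l t)))"

definition LQT_optimal_triple ::
  "('x::{real_inner,banach} \<rightharpoonup> 'x) \<Rightarrow> ('u::{real_inner,banach} \<Rightarrow>\<^sub>L 'x) \<Rightarrow>
   ('x \<Rightarrow>\<^sub>L 'v::{real_inner,banach}) \<Rightarrow> ('u \<Rightarrow>\<^sub>L 'u) \<Rightarrow> (real \<Rightarrow> 'x) \<Rightarrow> (real \<Rightarrow> 'u) \<Rightarrow>
   'x \<Rightarrow> real \<Rightarrow> (real \<Rightarrow> 'x) \<Rightarrow> (real \<Rightarrow> 'u) \<Rightarrow> (real \<Rightarrow> 'x) \<Rightarrow> bool" where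
  "LQT_optimal_triple A B C Q yd ud y0 T y u l \<longleftrightarrow>
     LQT_solution A B C Q yd ud y0 T y u \<and>
     extremal_system A B C Q yd ud T y u l \<and> l T = 0"

definition LQPi_extremal_lift ::
  "('x::{real_inner,banach} \<rightharpoonup> 'x) \<Rightarrow> ('u::{real_inner,banach} \<Rightarrow>\<^sub>L 'x) \<Rightarrow>
   ('x \<Rightarrow>\<^sub>L 'v::{real_inner,banach}) \<Rightarrow> ('u \<Rightarrow>\<^sub>L 'u) \<Rightarrow> (real \<Rightarrow> 'x) \<Rightarrow> (real \<Rightarrow> 'u) \<Rightarrow>
   real \<Rightarrow> (real \<Rightarrow> 'x) \<Rightarrow> (real \<Rightarrow> 'u) \<Rightarrow> (real \<Rightarrow> 'x) \<Rightarrow> bool" where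
  "LQPi_extremal_lift A B C Q yd ud P y u l \<longleftrightarrow>
     extremal_system A B C Q yd ud P y u l \<and> y 0 = y P \<and> l 0 = l P"

(* Periodic extension of the restriction of f to [0,P). *)
definition per_ext :: "real \<Rightarrow> (real \<Rightarrow> 'a) \<Rightarrow> real \<Rightarrow> 'a" where
  "per_ext P f t = f (t rmod P)"

end

theory Submission
  imports Defs
begin

text \<open>The difference \<open>(y, \<lambda>)\<close> of two extremals solves the homogeneous Hamiltonian system
  \<open>y' = A y + B Q\<^sup>-\<^sup>1 B\<^sup>* \<lambda>\<close>, \<open>\<lambda>' = C\<^sup>* C y - A\<^sup>* \<lambda>\<close>. Pairing the two equations gives
  \<open>\<integral> \<langle>Q\<^sup>-\<^sup>1 B\<^sup>* \<lambda>, B\<^sup>* \<lambda>\<rangle> + \<parallel>C y\<parallel>\<^sup>2\<close> as a boundary term \<open>[\<langle>y, \<lambda>\<rangle>]\<close>. Detectability and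
  stabilizability turn control of this integral into control of \<open>y\<close> and \<open>\<lambda>\<close> in \<open>L\<^sup>2\<close>, and applying
  this estimate on every subinterval \<open>[t, T - t]\<close> forces \<open>\<parallel>y\<parallel> + \<parallel>\<lambda>\<parallel>\<close> to decay exponentially from both ends;
  no Riccati operator is needed. For periodic trajectories the boundary term vanishes, so the
  same identity gives uniqueness of the periodic extremal. Existence: in the feedback form
  \<open>u = F y + v\<close> the gradient of the periodic cost is \<open>Q v + G v - f\<close> with \<open>Q + \<theta> G\<close> coercive for
  \<open>0 \<le> \<theta> \<le> 1\<close>, and the method of continuity in \<open>\<theta>\<close> finds its zero. As the spaces need not be separable,
  the equations are tested against vectors, which makes all integrals scalar.\<close>

section \<open>Riesz representation and adjoints\<close>

text \<open>The obstacle is regularity. Neither \<open>y\<close> nor \<open>\<lambda>\<close> is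
  differentiable, so the pairing identity cannot come from a product rule; it is derived from
  Duhamel's formula by differentiating a parametrised integral. It asks for an integrable source on
  the forward side and a continuous one on the backward side, which fits a control that is merely
  square integrable and a continuous multiplier. Exponential decay appears because the integral of
  \<open>\<parallel>y\<parallel>\<^sup>2 + \<parallel>\<lambda>\<parallel>\<^sup>2\<close> over
  {s..T - s}, as a function of s, is at most \<open>c\<close> times the negative of its own
  derivative. In the existence proof two norms meet: coercivity is an estimate in the mean square,
  while the gradient equation is solved among continuous functions with the sup norm. They are
  reconciled by smoothing, since \<open>G\<close> maps the integral norm to the sup norm. The rough
  reference control never enters that equation: it is absorbed into a periodic state of its own,
  which is continuous. The constants do not depend on the horizon because the mismatch of the
  multipliers at the final time is a value of a periodic continuous function.\<close>

lemma riesz_representation: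
  fixes f :: "'a::{real_inner,banach} \<Rightarrow> real"
  assumes "bounded_linear f"
  shows "\<exists>v. \<forall>x. f x = x \<bullet> v"
proof -
  interpret f: bounded_linear f by fact
  obtain K where K: "\<And>x. norm (f x) \<le> norm x * K" "K \<ge> 0"
    using f.nonneg_bounded by blast
  \<comment> \<open>The minimiser of this functional is the representing vector: its derivative at
    \<open>v\<close> in direction \<open>h\<close> is twice
    \<open>h \<bullet> v - f h\<close>.\<close>
  define F where "F x = (norm x)\<^sup>2 - 2 * f x" for x
  have lower: "F x \<ge> - K\<^sup>2" for x
  proof -
    have "0 \<le> (norm x - K)\<^sup>2" by simp
    also have "\<dots> = (norm x)\<^sup>2 - 2 * (norm x * K) + K\<^sup>2"
      by (simp add: power2_diff)
    also have "\<dots> \<le> F x + K\<^sup>2"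
      using K(1)[of x] by (simp add: F_def)
    finally show ?thesis by simp
  qed
  define m where "m = (INF x. F x)"
  have bdd: "bdd_below (range F)"
    using lower by (meson bdd_belowI2)
  have m: "m \<le> F x" for x
    unfolding m_def by (intro cINF_lower bdd) simp
  have "\<exists>x. F x < m + 1 / real (Suc n)" for n
    using cINF_less_iff[OF _ bdd, of "m + 1 / real (Suc n)"] by (auto simp: m_def)
  then obtain X where X: "\<And>n. F (X n) < m + 1 / real (Suc n)" by metis
  \<comment> \<open>The parallelogram identity, with the midpoint value bounded below by the
    infimum: near-minimisers are close to each other.\<close>
  have par: "(norm (x - y))\<^sup>2 \<le> 2 * (F x - m) + 2 * (F y - m)" for x y
  proof -
    have "(norm (x - y))\<^sup>2 + 4 * (norm ((1/2) *\<^sub>R (x + y)))\<^sup>2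
        = 2 * (norm x)\<^sup>2 + 2 * (norm y)\<^sup>2"
      unfolding power2_norm_eq_inner by (simp add: inner_simps inner_commute field_simps)
    then have "(norm (x - y))\<^sup>2 = 2 * F x + 2 * F y - 4 * F ((1/2) *\<^sub>R (x + y))"
      by (simp add: F_def f.scaleR f.add algebra_simps)
    with m[of "(1/2) *\<^sub>R (x + y)"] show ?thesis by simp
  qed
  have "Cauchy X"
  proof (rule metric_CauchyI)
    fix e :: real assume "e > 0"
    then obtain N where N: "inverse (real (Suc N)) < e\<^sup>2 / 4"
      using reals_Archimedean[of "e\<^sup>2/4"] by auto
    show "\<exists>M. \<forall>k\<ge>M. \<forall>n\<ge>M. dist (X k) (X n) < e"
    proof (intro exI allI impI)
      fix k n assume "k \<ge> N" "n \<ge> N"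
      have le: "1 / real (Suc j) \<le> 1 / real (Suc N)" if "j \<ge> N" for j
        using that by (simp add: frac_le)
      have "F (X k) - m < e\<^sup>2/4" "F (X n) - m < e\<^sup>2/4"
        using X[of k] X[of n] le[OF \<open>k \<ge> N\<close>] le[OF \<open>n \<ge> N\<close>] N by (auto simp: inverse_eq_divide)
      with par[of "X k" "X n"] have "(norm (X k - X n))\<^sup>2 < e\<^sup>2" by simp
      then show "dist (X k) (X n) < e"
        using \<open>e > 0\<close> by (simp add: dist_norm power_less_imp_less_base)
    qed
  qed
  then obtain v where v: "X \<longlonglongrightarrow> v"
    by (meson Cauchy_convergent convergentD)
  have "(\<lambda>n. F (X n)) \<longlonglongrightarrow> F v"
    unfolding F_def by (intro tendsto_intros f.tendsto v)
  moreover have "(\<lambda>n. m + 1 / real (Suc n)) \<longlonglongrightarrow> m + 0"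
    by (intro tendsto_intros LIMSEQ_Suc[OF lim_1_over_n])
  ultimately have Fv: "F v \<le> m"
    by (metis (no_types, lifting) LIMSEQ_le X add.right_neutral order_less_imp_le)
  have "f h = h \<bullet> v" for h
  proof (rule ccontr)
    assume "f h \<noteq> h \<bullet> v"
    define d where "d = f h - h \<bullet> v"
    have d: "d \<noteq> 0" using \<open>f h \<noteq> h \<bullet> v\<close> by (simp add: d_def)
    have "0 \<le> F (v + t *\<^sub>R h) - F v" for t
      using Fv m[of "v + t *\<^sub>R h"] by linarith
    moreover have "F (v + t *\<^sub>R h) - F v = t\<^sup>2 * (norm h)\<^sup>2 - 2 * t * d" for t
      unfolding F_def d_def power2_norm_eq_inner
      by (simp add: f.scaleR f.add inner_simps inner_commute power2_eq_square algebra_simps)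
    ultimately have *: "2 * t * d \<le> t\<^sup>2 * (norm h)\<^sup>2" for t by (metis diff_ge_0_iff_ge)
    \<comment> \<open>The step d / (1 + norm h ^ 2) is essentially the optimal one; the summand 1
      keeps the denominator positive and costs only a factor that the linear term can
      afford.\<close>
    have "2 * (d / (1 + (norm h)\<^sup>2)) * d \<le> (d / (1 + (norm h)\<^sup>2))\<^sup>2 * (norm h)\<^sup>2" by (rule *)
    also have "\<dots> \<le> (d / (1 + (norm h)\<^sup>2))\<^sup>2 * (1 + (norm h)\<^sup>2)"
      by (intro mult_left_mono) auto
    also have "\<dots> = d\<^sup>2 / (1 + (norm h)\<^sup>2)"
      by (simp add: power2_eq_square add_nonneg_eq_0_iff)
    finally have "2 * d\<^sup>2 / (1 + (norm h)\<^sup>2) \<le> d\<^sup>2 / (1 + (norm h)\<^sup>2)"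
      by (simp add: power2_eq_square)
    then have "2 * d\<^sup>2 \<le> d\<^sup>2"
      by (smt (verit, best) divide_right_mono divide_strict_right_mono zero_le_power2)
    with d show False by simp
  qed
  then show ?thesis by blast
qed

text \<open>\<open>adjoint\<close> is a Hilbert choice, which means something once Riesz supplies a
  candidate. Before \<open>Blinfun\<close> can be evaluated the chosen map must be bounded; this
  follows by testing it against its own value.\<close>

lemma adj_inner:
  fixes F :: "'a::{real_inner,banach} \<Rightarrow>\<^sub>L 'b::real_inner"
  shows "F x \<bullet> y = x \<bullet> adj F y"
proof -
  have "\<exists>v. \<forall>x. F x \<bullet> y = x \<bullet> v" for y
    by (rule riesz_representation) (intro bounded_linear_intros)
  then have "\<exists>f'. \<forall>x y. F x \<bullet> y = x \<bullet> f' y" by metis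
  then have "\<forall>x y. F x \<bullet> y = x \<bullet> adjoint (blinfun_apply F) y"
    unfolding adjoint_def by (rule someI_ex)
  then have *: "F x \<bullet> y = x \<bullet> adjoint (blinfun_apply F) y" for x y by blast
  let ?G = "adjoint (blinfun_apply F)"
  have "bounded_linear ?G"
  proof (rule bounded_linear_intro[where K = "norm F"])
    have eqI: "u = v" if "\<And>x. x \<bullet> u = x \<bullet> v" for u v :: 'a
      using that by (metis inner_eq_zero_iff inner_diff_right right_minus_eq)
    show "?G (u + v) = ?G u + ?G v" for u v
      by (rule eqI) (metis * inner_add_right)
    show "?G (r *\<^sub>R u) = r *\<^sub>R ?G u" for r u
      by (rule eqI) (metis * inner_scaleR_right)
    show "norm (?G u) \<le> norm u * norm F" for u
    proof (cases "?G u = 0")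
      case False
      have "norm (?G u) * norm (?G u) = F (?G u) \<bullet> u"
        by (simp add: * power2_norm_eq_inner[symmetric] power2_eq_square)
      also have "\<dots> \<le> norm (F (?G u)) * norm u" by (rule norm_cauchy_schwarz)
      also have "\<dots> \<le> norm F * norm (?G u) * norm u"
        by (intro mult_right_mono norm_blinfun) auto
      finally have "norm (?G u) * norm (?G u) \<le> norm (?G u) * (norm u * norm F)"
        by (simp add: mult_ac)
      with False show ?thesis by (simp add: mult_le_cancel_left_pos)
    qed simp
  qed
  then show ?thesis by (simp add: adj_def bounded_linear_Blinfun_apply *)
qed

lemma adj_inner_left:
  fixes F :: "'a::{real_inner,banach} \<Rightarrow>\<^sub>L 'b::real_inner"
  shows "adj F y \<bullet> x = y \<bullet> F x"
  by (metis adj_inner inner_commute)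

lemma eq_if_inner_eq:
  fixes u v :: "'a::real_inner"
  assumes "\<And>x. u \<bullet> x = v \<bullet> x"
  shows "u = v"
  using assms by (metis inner_eq_zero_iff inner_diff_left right_minus_eq)

text \<open>Take \<open>x = u\<close>. This is how bounds on vectors are recovered from scalar
  integrals against test vectors; a one-sided bound is enough because \<open>x\<close> ranges over a
  linear space.\<close>

lemma norm_le_if_inner_le:
  fixes u :: "'a::real_inner"
  assumes "\<And>x. u \<bullet> x \<le> c * norm x" and "c \<ge> 0"
  shows "norm u \<le> c"
proof (cases "u = 0")
  case False
  have "norm u * norm u \<le> c * norm u"
    using assms(1)[of u] by (simp add: power2_norm_eq_inner[symmetric] power2_eq_square)
  with False show ?thesis by simp
qed (simp add: assms)

lemma norm_adj_le:
  fixes F :: "'a::{real_inner,banach} \<Rightarrow>\<^sub>L 'b::real_inner"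
  shows "norm (adj F) \<le> norm F"
proof (rule norm_blinfun_bound)
  show "norm (adj F y) \<le> norm F * norm y" for y
  proof (rule norm_le_if_inner_le)
    fix x
    have "adj F y \<bullet> x \<le> norm y * norm (F x)"
      unfolding adj_inner_left by (rule norm_cauchy_schwarz)
    also have "\<dots> \<le> norm y * (norm F * norm x)"
      by (intro mult_left_mono norm_blinfun) auto
    finally show "adj F y \<bullet> x \<le> norm F * norm y * norm x" by (simp add: mult_ac)
  qed auto
qed auto

section \<open>Positive operators\<close>

lemma inv_op_works:
  assumes "invertible_op Q"
  shows "Q (inv_op Q x) = x" "inv_op Q (Q x) = x"
proof -
  from assms obtain R where R: "R o\<^sub>L Q = id_blinfun \<and> Q o\<^sub>L R = id_blinfun"
    by (auto simp: invertible_op_def)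
  have "R' = R" if "R' o\<^sub>L Q = id_blinfun \<and> Q o\<^sub>L R' = id_blinfun" for R'
  proof (rule blinfun_eqI)
    fix x
    have "R' (Q (R x)) = R x" using that by (metis blinfun_apply_blinfun_compose blinfun_apply_id_blinfun id_apply)
    moreover have "Q (R x) = x" using R by (metis blinfun_apply_blinfun_compose blinfun_apply_id_blinfun id_apply)
    ultimately show "R' x = R x" by simp
  qed
  with R have "inv_op Q o\<^sub>L Q = id_blinfun \<and> Q o\<^sub>L inv_op Q = id_blinfun"
    unfolding inv_op_def by (metis (mono_tags, lifting) the_equality)
  then show "Q (inv_op Q x) = x" "inv_op Q (Q x) = x"
    by (metis blinfun_apply_blinfun_compose blinfun_apply_id_blinfun id_apply)+
qed

text \<open>The quadratic polynomial \<open>N (t x + y) \<bullet> (t x + y)\<close> in t is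
  nonnegative, so its discriminant is not positive. If the leading coefficient vanishes the
  polynomial is affine, which forces \<open>N x \<bullet> y = 0\<close>.\<close>

lemma semidefinite_cauchy_schwarz:
  fixes N :: "'a::real_inner \<Rightarrow>\<^sub>L 'a"
  assumes "self_adjoint N" and nonneg: "\<And>x. 0 \<le> N x \<bullet> x"
  shows "(N x \<bullet> y)\<^sup>2 \<le> (N x \<bullet> x) * (N y \<bullet> y)"
proof -
  have sym: "N y \<bullet> x = N x \<bullet> y"
    using assms(1) by (metis self_adjoint_def inner_commute)
  have *: "0 \<le> (N x \<bullet> x) * t\<^sup>2 + 2 * t * (N x \<bullet> y) + N y \<bullet> y" for t
  proof -
    have "0 \<le> N (t *\<^sub>R x + y) \<bullet> (t *\<^sub>R x + y)" by (rule nonneg)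
    also have "\<dots> = (N x \<bullet> x) * t\<^sup>2 + 2 * t * (N x \<bullet> y) + N y \<bullet> y"
      by (simp add: blinfun.add_right blinfun.scaleR_right inner_simps sym power2_eq_square
          algebra_simps)
    finally show ?thesis .
  qed
  show ?thesis
  proof (cases "N x \<bullet> x = 0")
    case True
    have "N x \<bullet> y = 0"
    proof (rule ccontr)
      assume ne: "N x \<bullet> y \<noteq> 0"
      show False
        using *[of "- (N y \<bullet> y + 1) / (2 * (N x \<bullet> y))"] ne True by (simp add: field_simps)
    qed
    with True show ?thesis by simp
  next
    case False
    then have pos: "N x \<bullet> x > 0" using nonneg[of x] by simp
    have "0 \<le> (N x \<bullet> x) * (- (N x \<bullet> y) / (N x \<bullet> x))\<^sup>2
               + 2 * (- (N x \<bullet> y) / (N x \<bullet> x)) * (N x \<bullet> y) + N y \<bullet> y"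
      by (rule *)
    also have "\<dots> = N y \<bullet> y - (N x \<bullet> y)\<^sup>2 / (N x \<bullet> x)"
      using pos by (simp add: power2_eq_square field_simps)
    finally have "(N x \<bullet> y)\<^sup>2 / (N x \<bullet> x) \<le> N y \<bullet> y" by simp
    with pos show ?thesis by (simp add: pos_divide_le_eq mult.commute)
  qed
qed

text \<open>Cauchy-Schwarz for the form of \<open>N\<close>, used with \<open>y = N x\<close>; one
  factor (norm (N x))^2 cancels.\<close>

lemma semidefinite_norm_square_le:
  fixes N :: "'a::real_inner \<Rightarrow>\<^sub>L 'a"
  assumes "self_adjoint N" and nonneg: "\<And>x. 0 \<le> N x \<bullet> x"
    and upper: "\<And>x. N x \<bullet> x \<le> q * (norm x)\<^sup>2"
  shows "(norm (N x))\<^sup>2 \<le> q * (N x \<bullet> x)"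
proof (cases "N x = 0")
  case False
  have "((norm (N x))\<^sup>2)\<^sup>2 = (N x \<bullet> N x)\<^sup>2" by (simp add: power2_norm_eq_inner)
  also have "\<dots> \<le> (N x \<bullet> x) * (N (N x) \<bullet> N x)"
    by (rule semidefinite_cauchy_schwarz[OF assms(1) nonneg])
  also have "\<dots> \<le> (N x \<bullet> x) * (q * (norm (N x))\<^sup>2)"
    by (intro mult_left_mono upper nonneg)
  finally have "(norm (N x))\<^sup>2 * (norm (N x))\<^sup>2 \<le> (norm (N x))\<^sup>2 * (q * (N x \<bullet> x))"
    by (simp add: power2_eq_square mult_ac)
  moreover have "(norm (N x))\<^sup>2 > 0" using False by simp
  ultimately show ?thesis using mult_le_cancel_left_pos by blast
qed simp

lemma inner_le_norm_op: "F x \<bullet> x \<le> norm F * (norm x)\<^sup>2"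
  for F :: "'a::real_inner \<Rightarrow>\<^sub>L 'a"
proof -
  have "F x \<bullet> x \<le> norm (F x) * norm x" by (rule norm_cauchy_schwarz)
  also have "\<dots> \<le> norm F * norm x * norm x" by (intro mult_right_mono norm_blinfun) auto
  finally show ?thesis by (simp add: power2_eq_square mult_ac)
qed

text \<open>In infinite dimension pointwise positivity does not bound the form away from zero.
  Invertibility does: norm x is controlled by norm (Q x), whose square is controlled by the form.
  The summand 1 in \<open>?k\<close> avoids a division by zero.\<close>

lemma positive_definite_coercive:
  fixes Q :: "'a::{real_inner,banach} \<Rightarrow>\<^sub>L 'a"
  assumes "positive_definite Q" "invertible_op Q"
  shows "\<exists>q>0. \<forall>x. q * (norm x)\<^sup>2 \<le> Q x \<bullet> x"
proof -
  have nonneg: "0 \<le> Q x \<bullet> x" for x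
    using assms(1) by (cases "x = 0") (auto simp: positive_definite_def less_imp_le)
  have sa: "self_adjoint Q" using assms(1) by (simp add: positive_definite_def)
  let ?k = "1 + (norm (inv_op Q))\<^sup>2 * norm Q"
  have k: "?k > 0" by (metis add_pos_nonneg mult_nonneg_nonneg norm_ge_zero zero_le_power2 zero_less_one)
  have "(1 / ?k) * (norm x)\<^sup>2 \<le> Q x \<bullet> x" for x
  proof -
    have "norm x \<le> norm (inv_op Q) * norm (Q x)"
      using norm_blinfun[of "inv_op Q" "Q x"] by (simp add: inv_op_works[OF assms(2)])
    then have "(norm x)\<^sup>2 \<le> (norm (inv_op Q))\<^sup>2 * (norm (Q x))\<^sup>2"
      by (metis norm_ge_zero power_mono power_mult_distrib)
    also have "\<dots> \<le> (norm (inv_op Q))\<^sup>2 * (norm Q * (Q x \<bullet> x))"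
      by (intro mult_left_mono semidefinite_norm_square_le sa nonneg inner_le_norm_op) auto
    also have "\<dots> \<le> ?k * (Q x \<bullet> x)" using nonneg[of x] by (simp add: algebra_simps)
    finally show ?thesis using k by (simp add: pos_divide_le_eq mult.commute)
  qed
  with k show ?thesis by (metis zero_less_divide_1_iff)
qed

text \<open>With \<open>Q = \<alpha> (1 - N)\<close> and \<open>\<parallel>N\<parallel> < 1\<close>, a root is \<open>\<surd>\<alpha> (1 - Y)\<close> for the
  fixed point \<open>Y\<close> of the contraction \<open>Y \<mapsto> (N + Y\<^sup>2) / 2\<close>.\<close>

lemma pos_sqrt_exists:
  fixes Q :: "'a::{real_inner,banach} \<Rightarrow>\<^sub>L 'a"
  assumes "positive_definite Q" "invertible_op Q"
  shows "\<exists>R. self_adjoint R \<and> (\<forall>x. 0 \<le> R x \<bullet> x) \<and> R o\<^sub>L R = Q"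
proof -
  obtain q where q: "q > 0" "\<And>x. q * (norm x)\<^sup>2 \<le> Q x \<bullet> x"
    using positive_definite_coercive[OF assms] by blast
  have sa: "self_adjoint Q" using assms(1) by (simp add: positive_definite_def)
  \<comment> \<open>The norm of \<open>Q\<close> makes \<open>N\<close> nonnegative; the extra
    \<open>q\<close> makes \<open>\<alpha>\<close> positive in any case.\<close>
  define \<alpha> where "\<alpha> = norm Q + q"
  have \<alpha>: "\<alpha> > 0" "q / \<alpha> \<le> 1" using q by (auto simp: \<alpha>_def add_nonneg_pos)
  define N where "N = id_blinfun - (1/\<alpha>) *\<^sub>R Q"
  define p where "p = 1 - q / \<alpha>"
  have p: "0 \<le> p" "p < 1" using \<alpha> q by (auto simp: p_def)
  have N_app: "N x = x - (1/\<alpha>) *\<^sub>R Q x" for x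
    by (simp add: N_def blinfun.diff_left blinfun.scaleR_left)
  have N_sa: "self_adjoint N"
    using sa by (auto simp: self_adjoint_def N_app inner_simps)
  have N_nonneg: "0 \<le> N x \<bullet> x" for x
  proof -
    have "0 \<le> q * (norm x)\<^sup>2" using q(1) by simp
    then have "Q x \<bullet> x \<le> \<alpha> * (norm x)\<^sup>2"
      unfolding \<alpha>_def distrib_right using inner_le_norm_op[of Q x] by linarith
    then show ?thesis using \<alpha> by (simp add: N_app inner_simps power2_norm_eq_inner field_simps)
  qed
  have N_le: "N x \<bullet> x \<le> p * (norm x)\<^sup>2" for x
    using q(2)[of x] \<alpha>(1) by (simp add: N_app p_def inner_simps power2_norm_eq_inner field_simps)
  have norm_N: "norm N \<le> p"
  proof (rule norm_blinfun_bound)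
    fix x
    have "(norm (N x))\<^sup>2 \<le> p * (N x \<bullet> x)"
      by (rule semidefinite_norm_square_le[OF N_sa N_nonneg N_le])
    also have "\<dots> \<le> p * (p * (norm x)\<^sup>2)" by (intro mult_left_mono N_le p)
    finally have "(norm (N x))\<^sup>2 \<le> (p * norm x)\<^sup>2" by (simp add: power2_eq_square mult_ac)
    then show "norm (N x) \<le> p * norm x" by (rule power2_le_imp_le) (use p in auto)
  qed (use p in auto)
  \<comment> \<open>The smaller root of r = (p + r^2) / 2. The ball of radius \<open>r\<close> is
    therefore mapped to itself, and the same number \<open>r < 1\<close> serves as the contraction
    constant.\<close>
  define r where "r = 1 - sqrt (1 - p)"
  have "(1 - r)\<^sup>2 = 1 - p" using p by (simp add: r_def)
  then have r: "0 \<le> r" "r < 1" "(p + r\<^sup>2) / 2 = r"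
    using p by (auto simp: r_def power2_diff)
  \<comment> \<open>Self-adjointness is built into the set as a closed condition, so that the fixed
    point inherits it.\<close>
  define S where "S = {Y :: 'a \<Rightarrow>\<^sub>L 'a. norm Y \<le> r \<and> self_adjoint Y}"
  define \<Phi> where "\<Phi> Y = (1/2) *\<^sub>R (N + (Y o\<^sub>L Y))" for Y
  have "closed S"
  proof -
    have "S = {Y. norm Y \<le> r} \<inter> (\<Inter>x. \<Inter>y. {Y :: 'a \<Rightarrow>\<^sub>L 'a. Y x \<bullet> y = x \<bullet> Y y})"
      by (auto simp: S_def self_adjoint_def)
    moreover have "closed {Y :: 'a \<Rightarrow>\<^sub>L 'a. norm Y \<le> r}"
      by (intro closed_Collect_le continuous_intros)
    moreover have "closed {Y :: 'a \<Rightarrow>\<^sub>L 'a. Y x \<bullet> y = x \<bullet> Y y}" for x y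
      by (intro closed_Collect_eq continuous_intros)
    ultimately show ?thesis by (auto intro!: closed_Int closed_INT)
  qed
  then have "complete S" by (simp add: complete_eq_closed)
  moreover have "S \<noteq> {}"
    using r by (auto simp: S_def self_adjoint_def intro!: exI[of _ 0])
  moreover have "\<Phi> ` S \<subseteq> S"
  proof safe
    fix Y assume "Y \<in> S"
    then have Y: "norm Y \<le> r" "self_adjoint Y" by (auto simp: S_def)
    have "norm (\<Phi> Y) \<le> (norm N + norm (Y o\<^sub>L Y)) / 2"
      by (simp add: \<Phi>_def norm_triangle_ineq)
    also have "\<dots> \<le> (p + r * r) / 2"
      using norm_blinfun_compose[of Y Y] mult_mono[OF Y(1) Y(1)] r norm_N by auto
    finally have "norm (\<Phi> Y) \<le> r" using r(3) by (simp add: power2_eq_square)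
    moreover have "self_adjoint (\<Phi> Y)"
      using Y(2) N_sa by (simp add: self_adjoint_def \<Phi>_def blinfun.scaleR_left blinfun.add_left inner_simps)
    ultimately show "\<Phi> Y \<in> S" by (simp add: S_def)
  qed
  moreover have "dist (\<Phi> Y) (\<Phi> Z) \<le> r * dist Y Z" if "Y \<in> S" "Z \<in> S" for Y Z
  proof -
    \<comment> \<open>A difference of squares of operators that need not commute: Y Y - Z Z = Y (Y -
      Z) + (Y - Z) Z.\<close>
    have "\<Phi> Y - \<Phi> Z = (1/2) *\<^sub>R ((Y o\<^sub>L (Y - Z)) + ((Y - Z) o\<^sub>L Z))"
      by (rule blinfun_eqI)
         (simp add: \<Phi>_def blinfun.scaleR_left blinfun.add_left blinfun.diff_left blinfun.diff_right
           scaleR_diff_right[symmetric])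
    then have "norm (\<Phi> Y - \<Phi> Z) \<le> (norm (Y o\<^sub>L (Y - Z)) + norm ((Y - Z) o\<^sub>L Z)) / 2"
      by (simp add: norm_triangle_ineq)
    also have "norm (Y o\<^sub>L (Y - Z)) \<le> r * norm (Y - Z)"
      using that by (intro order_trans[OF norm_blinfun_compose] mult_right_mono) (auto simp: S_def)
    also have "norm ((Y - Z) o\<^sub>L Z) \<le> norm (Y - Z) * r"
      using that by (intro order_trans[OF norm_blinfun_compose] mult_left_mono) (auto simp: S_def)
    finally show ?thesis by (simp add: dist_norm mult.commute)
  qed
  ultimately have "\<exists>!Y\<in>S. \<Phi> Y = Y"
    by (intro Banach_fix[where c = r]) (use r in auto)
  then obtain Y where Y: "norm Y \<le> r" "self_adjoint Y" "\<Phi> Y = Y" by (auto simp: S_def)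
  define R where "R = sqrt \<alpha> *\<^sub>R (id_blinfun - Y)"
  have R_app: "R x = sqrt \<alpha> *\<^sub>R (x - Y x)" for x
    by (simp add: R_def blinfun.diff_left blinfun.scaleR_left)
  have "self_adjoint R"
    using Y(2) by (simp add: self_adjoint_def R_app inner_simps)
  moreover have "0 \<le> R x \<bullet> x" for x
  proof -
    have "Y x \<bullet> x \<le> r * (norm x)\<^sup>2"
      using inner_le_norm_op[of Y x] mult_right_mono[OF Y(1), of "(norm x)\<^sup>2"] by simp
    also have "\<dots> \<le> x \<bullet> x" using r by (simp add: power2_norm_eq_inner mult_left_le_one_le)
    finally show ?thesis using \<alpha> by (simp add: R_app inner_simps)
  qed
  moreover have "R (R x) = Q x" for x
  proof -
    have YY: "2 *\<^sub>R Y x = N x + Y (Y x)"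
      using arg_cong[OF Y(3), of "\<lambda>F. 2 *\<^sub>R F x"]
      by (simp add: \<Phi>_def blinfun.scaleR_left blinfun.add_left)
    have "R (R x) = \<alpha> *\<^sub>R (x - 2 *\<^sub>R Y x + Y (Y x))"
      using \<alpha>(1) by (simp add: R_app blinfun.scaleR_right blinfun.diff_right scaleR_2 algebra_simps)
    also have "\<dots> = \<alpha> *\<^sub>R (x - N x)" by (simp add: YY)
    also have "\<dots> = Q x" using \<alpha>(1) by (simp add: N_app)
    finally show ?thesis .
  qed
  ultimately show ?thesis by (intro exI[of _ R]) (auto intro: blinfun_eqI)
qed

text \<open>Every self-adjoint square root gives the same value, so the choice made in
  \<open>pos_sqrt\<close> leaves no trace in the cost.\<close>

lemma pos_sqrt_norm:
  fixes Q :: "'a::{real_inner,banach} \<Rightarrow>\<^sub>L 'a"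
  assumes "positive_definite Q" "invertible_op Q"
  shows "(norm (pos_sqrt Q x))\<^sup>2 = Q x \<bullet> x"
proof -
  let ?R = "pos_sqrt Q"
  have "self_adjoint ?R \<and> (\<forall>x. 0 \<le> ?R x \<bullet> x) \<and> ?R o\<^sub>L ?R = Q"
    unfolding pos_sqrt_def by (rule someI_ex[OF pos_sqrt_exists[OF assms]])
  then have "?R x \<bullet> ?R x = ?R (?R x) \<bullet> x" "?R (?R x) = Q x"
    by (simp_all add: self_adjoint_def inner_commute flip: blinfun_apply_blinfun_compose)
  then show ?thesis by (simp add: power2_norm_eq_inner)
qed

section \<open>The Bochner integral in Hilbert spaces\<close>

text \<open>In a non-separable space the difference of two Borel functions can fail to be Borel. A
  simple function has finitely many values, and subtracting one fixed value is continuous, so gluing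
  over these values is safe.\<close>

lemma borel_measurable_norm_diff_simple:
  fixes f :: "'a \<Rightarrow> 'b::real_normed_vector"
  assumes f: "f \<in> borel_measurable M" and s: "simple_function M s"
  shows "(\<lambda>t. norm (f t - s t)) \<in> borel_measurable M"
proof (rule measurable_compose_countable'[where I = "s ` space M" and f = "\<lambda>y t. norm (f t - y)"])
  show "(\<lambda>t. norm (f t - y)) \<in> borel_measurable M" for y
    by (rule measurable_compose[OF f])
      (intro borel_measurable_continuous_onI continuous_intros)
  show "s \<in> measurable M (count_space (s ` space M))"
    using s by (auto simp: simple_function_def measurable_def intro: simple_functionD)
  show "countable (s ` space M)"
    using s by (auto simp: simple_function_def countable_finite)
qed

text \<open>The approximating simple functions are paired with \<open>w\<close>; Cauchy-Schwarz
  multiplies their integral error by \<open>norm w\<close> only. This turns the vector integral into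
  a family of ordinary scalar ones.\<close>

lemma has_bint_inner:
  fixes f :: "'a \<Rightarrow> 'b::real_inner"
  assumes "has_bint M f x"
  shows "has_bochner_integral M (\<lambda>t. f t \<bullet> w) (x \<bullet> w)"
proof -
  from assms obtain s where f: "f \<in> borel_measurable M"
    and s: "\<And>i. Bochner_Integration.simple_bochner_integrable M (s i)"
    and lim: "(\<lambda>i. \<integral>\<^sup>+ t. ennreal (norm (f t - s i t)) \<partial>M) \<longlonglongrightarrow> 0"
    and limx: "(\<lambda>i. Bochner_Integration.simple_bochner_integral M (s i)) \<longlonglongrightarrow> x"
    by (auto simp: has_bint_def)
  have sf: "simple_function M (s i)" for i
    using s[of i] by (auto elim: simple_bochner_integrable.cases)
  note [measurable] = borel_measurable_norm_diff_simple[OF f sf]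
  show ?thesis
  proof (rule has_bochner_integral.intros[where s = "\<lambda>i t. s i t \<bullet> w"])
    show "(\<lambda>t. f t \<bullet> w) \<in> borel_measurable M"
      by (rule measurable_compose[OF f])
        (intro borel_measurable_continuous_onI continuous_intros)
    show "Bochner_Integration.simple_bochner_integrable M (\<lambda>t. s i t \<bullet> w)" for i
      using simple_bochner_integrable_compose2[OF _ s[of i] s[of i], of "\<lambda>x y. x \<bullet> w"] by simp
    have "(\<lambda>i. ennreal (norm w) * (\<integral>\<^sup>+ t. ennreal (norm (f t - s i t)) \<partial>M)) \<longlonglongrightarrow> ennreal (norm w) * 0"
      by (intro ennreal_tendsto_cmult lim) auto
    then have lim0: "(\<lambda>i. ennreal (norm w) * (\<integral>\<^sup>+ t. ennreal (norm (f t - s i t)) \<partial>M)) \<longlonglongrightarrow> 0"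
      by simp
    have "(\<integral>\<^sup>+ t. ennreal (norm (f t \<bullet> w - s i t \<bullet> w)) \<partial>M)
        \<le> ennreal (norm w) * (\<integral>\<^sup>+ t. ennreal (norm (f t - s i t)) \<partial>M)" for i
    proof -
      have "(\<integral>\<^sup>+ t. ennreal (norm (f t \<bullet> w - s i t \<bullet> w)) \<partial>M)
          \<le> (\<integral>\<^sup>+ t. ennreal (norm w) * ennreal (norm (f t - s i t)) \<partial>M)"
        using Cauchy_Schwarz_ineq2[of _ w] by (intro nn_integral_mono)
          (auto simp: ennreal_mult[symmetric] inner_diff_left[symmetric] mult.commute[of "norm w"] intro!: ennreal_leI)
      also have "\<dots> = ennreal (norm w) * (\<integral>\<^sup>+ t. ennreal (norm (f t - s i t)) \<partial>M)"
        by (rule nn_integral_cmult) simp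
      finally show ?thesis .
    qed
    then show "(\<lambda>i. \<integral>\<^sup>+ t. ennreal (norm (f t \<bullet> w - s i t \<bullet> w)) \<partial>M) \<longlonglongrightarrow> 0"
      by (intro tendsto_sandwich[OF _ _ tendsto_const lim0] always_eventually allI zero_le)
    have "(\<lambda>i. Bochner_Integration.simple_bochner_integral M (s i) \<bullet> w) \<longlonglongrightarrow> x \<bullet> w"
      by (intro tendsto_intros limx)
    moreover have "Bochner_Integration.simple_bochner_integral M (\<lambda>t. s i t \<bullet> w)
        = Bochner_Integration.simple_bochner_integral M (s i) \<bullet> w" for i
      by (intro simple_bochner_integral_linear s)
        (auto intro!: linearI simp: inner_simps)
    ultimately show "(\<lambda>i. Bochner_Integration.simple_bochner_integral M (\<lambda>t. s i t \<bullet> w)) \<longlonglongrightarrow> x \<bullet> w"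
      by simp
  qed
qed

text \<open>Two values of the integral have the same inner products with all vectors by uniqueness
  of scalar integrals, hence the definite description is well defined.\<close>

lemma bint_eq:
  fixes f :: "'a \<Rightarrow> 'b::real_inner"
  assumes "has_bint M f x"
  shows "bint M f = x"
proof -
  have "y = x" if "has_bint M f y" for y
    by (rule eq_if_inner_eq)
      (rule has_bochner_integral_eq[OF has_bint_inner[OF that] has_bint_inner[OF assms]])
  with assms show ?thesis
    unfolding bint_def by (metis (mono_tags, lifting) the_equality)
qed

lemma strongly_measurable_borel_measurable:
  fixes f :: "'a \<Rightarrow> 'b::real_normed_vector"
  assumes M: "complete_measure M" and "strongly_measurable M f"
  shows "f \<in> borel_measurable M"
proof -
  from assms(2) obtain s where s: "\<And>i. simple_function M (s i)"
    and "AE t in M. (\<lambda>i. s i t) \<longlonglongrightarrow> f t"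
    by (auto simp: strongly_measurable_def)
  then obtain N where N: "{t\<in>space M. \<not> (\<lambda>i. s i t) \<longlonglongrightarrow> f t} \<subseteq> N" "N \<in> null_sets M"
    by (auto elim!: AE_E simp: null_sets_def)
  \<comment> \<open>Zero on the exceptional null set: the simple functions, cut off in the same way,
    now converge everywhere, and a pointwise limit in a metric space is Borel. Completeness of the
    measure restores \<open>f\<close>.\<close>
  define g where "g t = (if t \<in> N then 0 else f t)" for t
  have [measurable]: "N \<in> sets M" using N by auto
  have "g \<in> borel_measurable M"
  proof (rule borel_measurable_LIMSEQ_metric)
    have "simple_function M (\<lambda>t. if t \<in> N then 0 else s i t)" for i
      by (intro simple_function_If s) auto
    then show "(\<lambda>t. if t \<in> N then 0 else s i t) \<in> borel_measurable M" for i
      by (rule borel_measurable_simple_function)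
    show "(\<lambda>i. if t \<in> N then 0 else s i t) \<longlonglongrightarrow> g t" if "t \<in> space M" for t
      using that N by (auto simp: g_def)
  qed
  show ?thesis
  proof (rule measurableI)
    fix B :: "'b set" assume B: "B \<in> sets borel"
    have "f -` B \<inter> space M \<inter> N \<in> null_sets M"
      using complete_measure.complete2[OF M _ N(2)] by auto
    moreover have "g -` B \<inter> space M - N \<in> sets M"
      using measurable_sets[OF \<open>g \<in> _\<close> B] by auto
    moreover have "f -` B \<inter> space M = (g -` B \<inter> space M - N) \<union> (f -` B \<inter> space M \<inter> N)"
      by (auto simp: g_def)
    ultimately show "f -` B \<inter> space M \<in> sets M"
      by (metis null_setsD2 sets.Un)
  qed auto
qed

text \<open>The given simple functions converge almost everywhere without any domination. Truncation
  supplies a majorant, dominated convergence then gives convergence in mean, and the integrals form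
  a Cauchy sequence.\<close>

lemma has_bint_exists:
  fixes f :: "'a \<Rightarrow> 'b::{real_inner,banach}"
  assumes M: "complete_measure M" and f: "strongly_measurable M f"
    and fin: "integrable M (\<lambda>t. norm (f t))"
  shows "\<exists>x. has_bint M f x"
proof -
  from f obtain s where s: "\<And>i. simple_function M (s i)"
    and lim: "AE t in M. (\<lambda>i. s i t) \<longlonglongrightarrow> f t"
    by (auto simp: strongly_measurable_def)
  have fm: "f \<in> borel_measurable M"
    by (rule strongly_measurable_borel_measurable[OF M f])
  have nfm [measurable]: "(\<lambda>t. norm (f t)) \<in> borel_measurable M"
    using fin by auto
  \<comment> \<open>The factor 2 leaves room: where \<open>f t\<close> is nonzero,
    \<open>s i t\<close> passes the test eventually, and where \<open>f t = 0\<close> the truncated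
    value is zero.\<close>
  define \<sigma> where "\<sigma> i t = (if norm (s i t) \<le> 2 * norm (f t) then s i t else 0)" for i t
  have [measurable]: "(\<lambda>t. norm (s i t)) \<in> borel_measurable M" for i
    using simple_function_compose1[OF s, of norm i] by (rule borel_measurable_simple_function)
  have \<sigma>: "simple_function M (\<sigma> i)" for i
    unfolding \<sigma>_def by (intro simple_function_If s) auto
  have finf: "(\<integral>\<^sup>+ t. ennreal (norm (f t)) \<partial>M) < \<infinity>"
    using fin by (simp add: integrable_iff_bounded)
  have fin2: "(\<integral>\<^sup>+ t. ennreal (c * norm (f t)) \<partial>M) < \<infinity>" if "c \<ge> 0" for c
    using finf that by (simp add: ennreal_mult nn_integral_cmult ennreal_mult_less_top)
  have sb: "Bochner_Integration.simple_bochner_integrable M (\<sigma> i)" for i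
  proof (rule simple_bochner_integrableI_bounded[OF \<sigma>])
    have "(\<integral>\<^sup>+ t. ennreal (norm (\<sigma> i t)) \<partial>M) \<le> (\<integral>\<^sup>+ t. ennreal (2 * norm (f t)) \<partial>M)"
      by (intro nn_integral_mono) (auto simp: \<sigma>_def)
    also have "\<dots> < \<infinity>" using fin2[of 2] by simp
    finally show "(\<integral>\<^sup>+ t. ennreal (norm (\<sigma> i t)) \<partial>M) < \<infinity>" .
  qed
  note [measurable] = borel_measurable_norm_diff_simple[OF fm \<sigma>]
  have L1: "(\<lambda>i. \<integral>\<^sup>+ t. ennreal (norm (f t - \<sigma> i t)) \<partial>M) \<longlonglongrightarrow> (\<integral>\<^sup>+ t. 0 \<partial>M)"
  proof (rule nn_integral_dominated_convergence[where w = "\<lambda>t. ennreal (3 * norm (f t))"])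
    show "AE t in M. ennreal (norm (f t - \<sigma> i t)) \<le> ennreal (3 * norm (f t))" for i
    proof (intro AE_I2 ennreal_leI)
      fix t show "norm (f t - \<sigma> i t) \<le> 3 * norm (f t)"
        using norm_triangle_ineq4[of "f t" "\<sigma> i t"] by (auto simp: \<sigma>_def split: if_splits)
    qed
    show "(\<integral>\<^sup>+ t. ennreal (3 * norm (f t)) \<partial>M) < \<infinity>" using fin2[of 3] by simp
    show "AE t in M. (\<lambda>i. ennreal (norm (f t - \<sigma> i t))) \<longlonglongrightarrow> 0"
      using lim
    proof eventually_elim
      case (elim t)
      have "(\<lambda>i. norm (f t - \<sigma> i t)) \<longlonglongrightarrow> 0"
      proof (cases "f t = 0")
        case False
        have "(\<lambda>i. norm (s i t)) \<longlonglongrightarrow> norm (f t)" by (intro tendsto_intros elim)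
        then have "\<forall>\<^sub>F i in sequentially. norm (s i t) < 2 * norm (f t)"
          using False by (intro order_tendstoD(2)) auto
        then have "\<forall>\<^sub>F i in sequentially. norm (f t - s i t) = norm (f t - \<sigma> i t)"
          by eventually_elim (auto simp: \<sigma>_def)
        moreover have "(\<lambda>i. norm (f t - s i t)) \<longlonglongrightarrow> norm (f t - f t)"
          by (intro tendsto_intros elim)
        ultimately show ?thesis
          by (simp add: tendsto_cong)
      next
        case True
        then have "norm (f t - \<sigma> i t) = 0" for i by (simp add: \<sigma>_def)
        then show ?thesis by simp
      qed
      then show ?case by (metis tendsto_ennrealI ennreal_0)
    qed
  qed auto
  define I where "I i = Bochner_Integration.simple_bochner_integral M (\<sigma> i)" for i
  have bnd: "ennreal (norm (I i - I j)) \<le> (\<integral>\<^sup>+ t. ennreal (norm (f t - \<sigma> i t)) \<partial>M)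
      + (\<integral>\<^sup>+ t. ennreal (norm (f t - \<sigma> j t)) \<partial>M)" for i j
  proof -
    have "ennreal (norm (I i - I j)) = norm (Bochner_Integration.simple_bochner_integral M (\<lambda>t. \<sigma> i t - \<sigma> j t))"
      unfolding I_def by (subst simple_bochner_integral_diff) (auto intro: sb)
    also have "\<dots> \<le> Bochner_Integration.simple_bochner_integral M (\<lambda>t. norm (\<sigma> i t - \<sigma> j t))"
      by (intro ennreal_leI simple_bochner_integral_norm_bound
          simple_bochner_integrable_compose2[where p = "(-)"] sb) simp
    also have "\<dots> = (\<integral>\<^sup>+ t. norm (\<sigma> i t - \<sigma> j t) \<partial>M)"
      using simple_bochner_integrable_compose2[of "\<lambda>x y. norm (x - y)" M "\<sigma> i" "\<sigma> j"] sb
      by (intro simple_bochner_integral_eq_nn_integral) auto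
    also have "\<dots> \<le> (\<integral>\<^sup>+ t. ennreal (norm (f t - \<sigma> i t)) + ennreal (norm (f t - \<sigma> j t)) \<partial>M)"
    proof (intro nn_integral_mono)
      fix t
      have "norm (\<sigma> i t - \<sigma> j t) \<le> norm (f t - \<sigma> i t) + norm (f t - \<sigma> j t)"
        by (metis norm_diff_triangle_le norm_minus_commute order_refl)
      then show "ennreal (norm (\<sigma> i t - \<sigma> j t)) \<le> ennreal (norm (f t - \<sigma> i t)) + ennreal (norm (f t - \<sigma> j t))"
        by (metis ennreal_leI ennreal_plus norm_ge_zero)
    qed
    also have "\<dots> = (\<integral>\<^sup>+ t. ennreal (norm (f t - \<sigma> i t)) \<partial>M) + (\<integral>\<^sup>+ t. ennreal (norm (f t - \<sigma> j t)) \<partial>M)"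
      by (rule nn_integral_add) auto
    finally show ?thesis .
  qed
  have "Cauchy I"
  proof (rule metric_CauchyI)
    fix e :: real assume "e > 0"
    then have "\<forall>\<^sub>F i in sequentially. (\<integral>\<^sup>+ t. ennreal (norm (f t - \<sigma> i t)) \<partial>M) < ennreal (e/2)"
      using order_tendstoD(2)[OF L1, of "ennreal (e/2)"] by simp
    then obtain N where N: "\<And>i. i \<ge> N \<Longrightarrow> (\<integral>\<^sup>+ t. ennreal (norm (f t - \<sigma> i t)) \<partial>M) < ennreal (e/2)"
      by (auto simp: eventually_sequentially)
    show "\<exists>M. \<forall>m\<ge>M. \<forall>n\<ge>M. dist (I m) (I n) < e"
    proof (intro exI allI impI)
      fix m n assume mn: "N \<le> m" "N \<le> n"
      have "ennreal (norm (I m - I n)) < ennreal (e/2) + ennreal (e/2)"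
        using bnd[of m n] N[OF mn(1)] N[OF mn(2)] add_strict_mono order_le_less_trans by blast
      also have "\<dots> = ennreal e" using \<open>e > 0\<close> by (simp flip: ennreal_plus)
      finally show "dist (I m) (I n) < e" by (simp add: dist_norm ennreal_less_iff)
    qed
  qed
  then obtain x where "I \<longlonglongrightarrow> x" by (meson Cauchy_convergent convergentD)
  then show ?thesis
    using fm sb L1 unfolding has_bint_def I_def by auto
qed

lemma complete_measure_lebesgue_on:
  assumes "S \<in> sets lebesgue"
  shows "complete_measure (lebesgue_on S)"
proof
  fix A B assume "B \<subseteq> A" "A \<in> null_sets (lebesgue_on S)"
  then show "B \<in> sets (lebesgue_on S)"
    using assms completion.complete2[of B A lborel]
    by (metis null_setsD2 null_sets_restrict_space subset_trans sets_restrict_space_iff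
        sets.Int_space_eq2 null_sets_completion_subset)
qed

subsection \<open>Strong measurability\<close>

lemma strongly_measurable_compose2:
  assumes "strongly_measurable M f" "strongly_measurable M g"
    and "continuous_on UNIV (\<lambda>(x, y). h x y)"
  shows "strongly_measurable M (\<lambda>t. h (f t) (g t))"
proof -
  from assms obtain s r where s: "\<And>i. simple_function M (s i)" "AE t in M. (\<lambda>i. s i t) \<longlonglongrightarrow> f t"
    and r: "\<And>i. simple_function M (r i)" "AE t in M. (\<lambda>i. r i t) \<longlonglongrightarrow> g t"
    by (auto simp: strongly_measurable_def)
  have "simple_function M (\<lambda>t. h (s i t) (r i t))" for i
    by (rule simple_function_compose2[where h = h, OF s(1) r(1)])
  moreover have "AE t in M. (\<lambda>i. h (s i t) (r i t)) \<longlonglongrightarrow> h (f t) (g t)"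
    using s(2) r(2)
  proof eventually_elim
    case (elim t)
    have "(\<lambda>i. (s i t, r i t)) \<longlonglongrightarrow> (f t, g t)" by (intro tendsto_Pair elim)
    moreover have "isCont (\<lambda>(x, y). h x y) (f t, g t)"
      using assms(3) by (simp add: continuous_on_eq_continuous_at)
    ultimately show ?case
      using isCont_tendsto_compose[of "(f t, g t)" "\<lambda>(x, y). h x y"] by fastforce
  qed
  ultimately show ?thesis
    unfolding strongly_measurable_def by (intro exI[of _ "\<lambda>i t. h (s i t) (r i t)"]) simp
qed

lemma strongly_measurable_const: "strongly_measurable M (\<lambda>_. c)"
  unfolding strongly_measurable_def by (intro exI[of _ "\<lambda>_ _. c"]) auto

lemma strongly_measurable_blinfun:
  assumes "strongly_measurable M f"
  shows "strongly_measurable M (\<lambda>t. blinfun_apply F (f t))"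
  by (rule strongly_measurable_compose2[OF assms assms, of "\<lambda>x y. F x"])
    (auto simp: case_prod_unfold intro!: continuous_intros)

lemma strongly_measurable_add:
  assumes "strongly_measurable M f" "strongly_measurable M g"
  shows "strongly_measurable M (\<lambda>t. f t + g t)"
  by (rule strongly_measurable_compose2[OF assms])
    (auto simp: case_prod_unfold intro!: continuous_intros)

lemma strongly_measurable_diff:
  assumes "strongly_measurable M f" "strongly_measurable M g"
  shows "strongly_measurable M (\<lambda>t. f t - g t)"
  by (rule strongly_measurable_compose2[OF assms])
    (auto simp: case_prod_unfold intro!: continuous_intros)

lemma AE_lebesgue_on_subset:
  assumes "AE t in lebesgue_on T. P t" "S \<subseteq> T" "S \<in> sets lebesgue" "T \<in> sets lebesgue"
  shows "AE t in lebesgue_on S. P t"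
proof -
  have "AE t in lebesgue. t \<in> T \<longrightarrow> P t"
    using assms(1,4) by (simp add: AE_restrict_space_iff)
  then have "AE t in lebesgue. t \<in> S \<longrightarrow> P t"
    by eventually_elim (use assms(2) in blast)
  then show ?thesis using assms(3) by (simp add: AE_restrict_space_iff)
qed

lemma simple_function_lebesgue_on_subset:
  assumes "simple_function (lebesgue_on T) s" "S \<subseteq> T" "S \<in> sets lebesgue" "T \<in> sets lebesgue"
  shows "simple_function (lebesgue_on S) s"
  unfolding simple_function_def
proof safe
  have sp: "space (lebesgue_on S) = S" "space (lebesgue_on T) = T" by auto
  have fin: "finite (s ` T)" and m: "\<And>x. x \<in> s ` T \<Longrightarrow> s -` {x} \<inter> T \<in> sets (lebesgue_on T)"
    using assms(1) by (auto simp: simple_function_def)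
  show "finite (s ` space (lebesgue_on S))"
    unfolding sp using finite_subset[OF image_mono[OF assms(2)] fin] .
  fix x assume "x \<in> space (lebesgue_on S)"
  then have "x \<in> T" using assms(2) by auto
  then have "s -` {s x} \<inter> T \<in> sets lebesgue"
    using m[of "s x"] assms(4) by (simp add: sets_restrict_space_iff)
  then have "(s -` {s x} \<inter> T) \<inter> S \<in> sets lebesgue" using assms(3) by (rule sets.Int)
  moreover have "(s -` {s x} \<inter> T) \<inter> S = s -` {s x} \<inter> space (lebesgue_on S)" using assms(2) by auto
  ultimately show "s -` {s x} \<inter> space (lebesgue_on S) \<in> sets (lebesgue_on S)"
    using assms(3) by (simp add: sets_restrict_space_iff)
qed

lemma strongly_measurable_subset:
  assumes "strongly_measurable (lebesgue_on T) f" "S \<subseteq> T" "S \<in> sets lebesgue" "T \<in> sets lebesgue"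
  shows "strongly_measurable (lebesgue_on S) f"
  using assms unfolding strongly_measurable_def
  by (meson AE_lebesgue_on_subset simple_function_lebesgue_on_subset)

text \<open>Freezing the operator at the grid points \<open>\<lfloor>nt\<rfloor>/n\<close> keeps simple functions simple.\<close>

lemma strongly_measurable_operator_family:
  fixes F :: "real \<Rightarrow> 'a::real_normed_vector \<Rightarrow>\<^sub>L 'b::real_normed_vector"
  assumes f: "strongly_measurable (lebesgue_on {a..b}) f"
    and cont: "\<And>x. continuous_on {a..b} (\<lambda>t. F t x)"
    and bound: "\<And>t. t \<in> {a..b} \<Longrightarrow> norm (F t) \<le> K"
  shows "strongly_measurable (lebesgue_on {a..b}) (\<lambda>t. F t (f t))"
proof -
  from f obtain s where s: "\<And>i. simple_function (lebesgue_on {a..b}) (s i)"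
    "AE t in lebesgue_on {a..b}. (\<lambda>i. s i t) \<longlonglongrightarrow> f t"
    by (auto simp: strongly_measurable_def)
  define \<tau> where "\<tau> n t = a + real_of_int \<lfloor>(t - a) * real (Suc n)\<rfloor> / real (Suc n)" for n t
  have \<tau>: "a \<le> \<tau> n t" "\<tau> n t \<le> t" "t - \<tau> n t \<le> 1 / real (Suc n)" if "a \<le> t" for n t
  proof -
    have "(0::int) \<le> \<lfloor>(t - a) * real (Suc n)\<rfloor>"
      using that by (simp add: zero_le_floor zero_le_mult_iff)
    then show "a \<le> \<tau> n t" by (simp add: \<tau>_def)
    have "real_of_int \<lfloor>(t - a) * real (Suc n)\<rfloor> \<le> (t - a) * real (Suc n)" by (rule of_int_floor_le)
    then have "real_of_int \<lfloor>(t - a) * real (Suc n)\<rfloor> / real (Suc n) \<le> t - a"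
      by (subst pos_divide_le_eq) auto
    then show "\<tau> n t \<le> t" by (simp add: \<tau>_def)
    have "(t - a) * real (Suc n) \<le> real_of_int \<lfloor>(t - a) * real (Suc n)\<rfloor> + 1" by linarith
    then have "t - a \<le> (real_of_int \<lfloor>(t - a) * real (Suc n)\<rfloor> + 1) / real (Suc n)"
      by (subst pos_le_divide_eq) auto
    then show "t - \<tau> n t \<le> 1 / real (Suc n)" by (simp add: \<tau>_def add_divide_distrib)
  qed
  have "simple_function (lebesgue_on {a..b}) (\<tau> n)" for n
  proof (rule simple_function_borel_measurable)
    have "\<tau> n \<in> borel_measurable borel" unfolding \<tau>_def by measurable
    then show "\<tau> n \<in> borel_measurable (lebesgue_on {a..b})"
      by (intro measurable_restrict_space1 measurable_completion) simp
    have "\<tau> n ` {a..b} \<subseteq> (\<lambda>k. a + real_of_int k / real (Suc n)) ` {0..\<lfloor>(b - a) * real (Suc n)\<rfloor>}"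
    proof safe
      fix t assume t: "t \<in> {a..b}"
      have "\<lfloor>(t - a) * real (Suc n)\<rfloor> \<in> {0..\<lfloor>(b - a) * real (Suc n)\<rfloor>}"
        using t by (auto simp: zero_le_floor zero_le_mult_iff intro!: floor_mono mult_right_mono)
      then show "\<tau> n t \<in> (\<lambda>k. a + real_of_int k / real (Suc n)) ` {0..\<lfloor>(b - a) * real (Suc n)\<rfloor>}"
        unfolding \<tau>_def by blast
    qed
    then have "finite (\<tau> n ` {a..b})"
      by (rule finite_subset) (intro finite_imageI finite_atLeastAtMost_int)
    then show "finite (\<tau> n ` space (lebesgue_on {a..b}))" by simp
  qed
  then have "simple_function (lebesgue_on {a..b}) (\<lambda>t. F (\<tau> n t) (s n t))" for n
    by (intro simple_function_compose2[where h = "\<lambda>r x. F r x"] s)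
  moreover have "AE t in lebesgue_on {a..b}. (\<lambda>n. F (\<tau> n t) (s n t)) \<longlonglongrightarrow> F t (f t)"
    using s(2) AE_space
  proof eventually_elim
    case (elim t)
    then have t: "t \<in> {a..b}" by simp
    have lim\<tau>: "(\<lambda>n. \<tau> n t) \<longlonglongrightarrow> t"
    proof (rule real_tendsto_sandwich[where f = "\<lambda>n. t - 1 / real (Suc n)" and h = "\<lambda>_. t"])
      have "(\<lambda>n. t - 1 / real (Suc n)) \<longlonglongrightarrow> t - 0"
        by (intro tendsto_intros LIMSEQ_Suc[OF lim_1_over_n])
      then show "(\<lambda>n. t - 1 / real (Suc n)) \<longlonglongrightarrow> t" by simp
      show "\<forall>\<^sub>F n in sequentially. t - 1 / real (Suc n) \<le> \<tau> n t"
        "\<forall>\<^sub>F n in sequentially. \<tau> n t \<le> t"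
        using \<tau>[of t] t by (auto simp: field_simps intro!: always_eventually) 
    qed simp
    have mem: "\<tau> n t \<in> {a..b}" for n using \<tau>[of t n] t by auto
    \<comment> \<open>Strong continuity moves the operator on the fixed vector \<open>f t\<close>;
      the uniform bound \<open>K\<close> pays for replacing \<open>f t\<close> by
      \<open>s n t\<close>.\<close>
    have "(\<lambda>n. F (\<tau> n t) (f t)) \<longlonglongrightarrow> F t (f t)"
      using continuous_on_tendsto_compose[OF cont lim\<tau> t] mem by auto
    moreover have "(\<lambda>n. F (\<tau> n t) (s n t - f t)) \<longlonglongrightarrow> 0"
    proof (rule Lim_null_comparison)
      show "\<forall>\<^sub>F n in sequentially. norm (F (\<tau> n t) (s n t - f t)) \<le> K * norm (s n t - f t)"
        using bound[OF mem] by (intro always_eventually allI)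
          (meson norm_blinfun norm_ge_zero mult_right_mono order_trans)
      have "(\<lambda>n. K * norm (s n t - f t)) \<longlonglongrightarrow> K * norm (f t - f t)"
        by (intro tendsto_intros elim)
      then show "(\<lambda>n. K * norm (s n t - f t)) \<longlonglongrightarrow> 0" by simp
    qed
    ultimately have "(\<lambda>n. F (\<tau> n t) (f t) + F (\<tau> n t) (s n t - f t)) \<longlonglongrightarrow> F t (f t) + 0"
      by (rule tendsto_add)
    then show ?case by (simp add: blinfun.diff_right)
  qed
  ultimately show ?thesis
    unfolding strongly_measurable_def by (intro exI[of _ "\<lambda>n t. F (\<tau> n t) (s n t)"]) simp
qed

text \<open>A continuous function is read as the operator family
  \<open>r \<mapsto> r *\<^sub>R f t\<close> applied to the constant 1, so the grid argument for
  operator families covers it.\<close>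

lemma strongly_measurable_continuous:
  fixes f :: "real \<Rightarrow> 'b::real_normed_vector"
  assumes "continuous_on {a..b} f"
  shows "strongly_measurable (lebesgue_on {a..b}) f"
proof -
  have "bounded (f ` {a..b})"
    using assms by (intro compact_imp_bounded compact_continuous_image) auto
  then obtain K where "\<forall>x\<in>f ` {a..b}. norm x \<le> K"
    by (auto simp: bounded_iff)
  then have K: "norm (f t) \<le> K" if "t \<in> {a..b}" for t using that by blast
  have *: "blinfun_scaleR_left (f t) r = r *\<^sub>R f t" for t r
    by simp
  have "strongly_measurable (lebesgue_on {a..b}) (\<lambda>t. blinfun_scaleR_left (f t) 1)"
  proof (rule strongly_measurable_operator_family[OF strongly_measurable_const])
    show "continuous_on {a..b} (\<lambda>t. blinfun_scaleR_left (f t) x)" for x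
      unfolding * by (intro continuous_intros assms)
    show "norm (blinfun_scaleR_left (f t)) \<le> K" if "t \<in> {a..b}" for t
      using K[OF that] by (intro order_trans[OF norm_blinfun_bound[of "norm (f t)"]]) (auto simp: mult.commute)
  qed
  then show ?thesis by simp
qed

subsection \<open>Integrable functions on intervals\<close>

definition L1_on :: "real \<Rightarrow> real \<Rightarrow> (real \<Rightarrow> 'b::real_normed_vector) \<Rightarrow> bool" where
  "L1_on a b f \<longleftrightarrow> strongly_measurable (lebesgue_on {a..b}) f \<and>
     integrable (lebesgue_on {a..b}) (\<lambda>t. norm (f t))"

lemma strongly_measurable_borel_interval:
  "strongly_measurable (lebesgue_on {a..b}) f \<Longrightarrow> f \<in> borel_measurable (lebesgue_on {a..b})"
  for f :: "real \<Rightarrow> 'b::real_normed_vector"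
  by (rule strongly_measurable_borel_measurable[OF complete_measure_lebesgue_on]) auto

lemma L1_on_dominated:
  fixes f :: "real \<Rightarrow> 'b::real_normed_vector"
  assumes "strongly_measurable (lebesgue_on {a..b}) f" "integrable (lebesgue_on {a..b}) h"
    and "\<And>t. t \<in> {a..b} \<Longrightarrow> norm (f t) \<le> h t"
  shows "L1_on a b f"
  unfolding L1_on_def
proof
  show "integrable (lebesgue_on {a..b}) (\<lambda>t. norm (f t))"
  proof (rule Bochner_Integration.integrable_bound[OF assms(2)])
    show "(\<lambda>t. norm (f t)) \<in> borel_measurable (lebesgue_on {a..b})"
      by (rule measurable_compose[OF strongly_measurable_borel_interval[OF assms(1)]])
        (intro borel_measurable_continuous_onI continuous_intros)
    show "AE t in lebesgue_on {a..b}. norm (norm (f t)) \<le> norm (h t)"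
    proof (rule AE_I2)
      fix t assume "t \<in> space (lebesgue_on {a..b})"
      then show "norm (norm (f t)) \<le> norm (h t)"
        using assms(3)[of t] norm_ge_zero[of "f t"] by simp
    qed
  qed
qed fact

lemma L1_on_continuous:
  fixes f :: "real \<Rightarrow> 'b::real_normed_vector"
  assumes "continuous_on {a..b} f"
  shows "L1_on a b f"
  unfolding L1_on_def
  using assms
  by (auto intro!: strongly_measurable_continuous continuous_imp_integrable_real continuous_on_norm)

lemma L1_on_add:
  assumes "L1_on a b f" "L1_on a b g"
  shows "L1_on a b (\<lambda>t. f t + g t)"
proof (rule L1_on_dominated)
  show "integrable (lebesgue_on {a..b}) (\<lambda>t. norm (f t) + norm (g t))"
    using assms by (auto simp: L1_on_def)
qed (use assms in \<open>auto simp: L1_on_def norm_triangle_ineq intro: strongly_measurable_add\<close>)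

lemma L1_on_diff:
  assumes "L1_on a b f" "L1_on a b g"
  shows "L1_on a b (\<lambda>t. f t - g t)"
proof (rule L1_on_dominated)
  show "integrable (lebesgue_on {a..b}) (\<lambda>t. norm (f t) + norm (g t))"
    using assms by (auto simp: L1_on_def)
qed (use assms in \<open>auto simp: L1_on_def norm_triangle_ineq4 intro: strongly_measurable_diff\<close>)

lemma L1_on_operator_family:
  fixes F :: "real \<Rightarrow> 'a::real_normed_vector \<Rightarrow>\<^sub>L 'b::real_normed_vector"
  assumes f: "L1_on a b f"
    and cont: "\<And>x. continuous_on {a..b} (\<lambda>t. F t x)"
    and bound: "\<And>t. t \<in> {a..b} \<Longrightarrow> norm (F t) \<le> K"
  shows "L1_on a b (\<lambda>t. F t (f t))"
proof (rule L1_on_dominated)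
  show "strongly_measurable (lebesgue_on {a..b}) (\<lambda>t. F t (f t))"
    using f strongly_measurable_operator_family[OF _ cont bound] by (simp add: L1_on_def)
  show "integrable (lebesgue_on {a..b}) (\<lambda>t. K * norm (f t))"
    using f by (auto simp: L1_on_def)
  show "norm (F t (f t)) \<le> K * norm (f t)" if "t \<in> {a..b}" for t
    using bound[OF that] by (meson norm_blinfun norm_ge_zero mult_right_mono order_trans)
qed

lemma L1_on_blinfun: "L1_on a b f \<Longrightarrow> L1_on a b (\<lambda>t. blinfun_apply F (f t))"
  by (rule L1_on_operator_family[where K = "norm F"]) auto

lemma L1_on_subset:
  assumes "L1_on a b f" "{c..d} \<subseteq> {a..b}"
  shows "L1_on c d f"
  unfolding L1_on_def
proof
  show "strongly_measurable (lebesgue_on {c..d}) f"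
    using assms by (intro strongly_measurable_subset[OF _ assms(2)]) (auto simp: L1_on_def)
  show "integrable (lebesgue_on {c..d}) (\<lambda>t. norm (f t))"
    using integrable_subinterval[of a b "\<lambda>t. norm (f t)" c d] assms by (simp add: L1_on_def)
qed

lemma L2_on_imp_L1_on:
  assumes "L2_on \<tau> u"
  shows "L1_on 0 \<tau> u"
proof (rule L1_on_dominated)
  show "integrable (lebesgue_on {0..\<tau>}) (\<lambda>t. 1 + (norm (u t))\<^sup>2)"
    using assms by (auto simp: L2_on_def intro!: Bochner_Integration.integrable_add)
  show "norm (u t) \<le> 1 + (norm (u t))\<^sup>2" for t
  proof -
    have "0 \<le> (norm (u t) - 1)\<^sup>2" "0 \<le> (norm (u t))\<^sup>2" by simp_all
    then show ?thesis unfolding power2_diff power_one mult_1_right using norm_ge_zero[of "u t"] by linarith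
  qed
qed (use assms in \<open>auto simp: L2_on_def\<close>)

text \<open>The bridge from the vector integral to Henstock-Kurzweil integrals of scalars; Duhamel
  integrals are handled through it from here on.\<close>

lemma L1_on_bint_inner:
  fixes f :: "real \<Rightarrow> 'b::{real_inner,banach}"
  assumes "L1_on a b f"
  shows "((\<lambda>t. f t \<bullet> w) has_integral (bint (lebesgue_on {a..b}) f \<bullet> w)) {a..b}"
proof -
  have "\<exists>x. has_bint (lebesgue_on {a..b}) f x"
    using assms by (intro has_bint_exists complete_measure_lebesgue_on) (auto simp: L1_on_def)
  then obtain x where x: "has_bint (lebesgue_on {a..b}) f x" ..
  have "has_bochner_integral (lebesgue_on {a..b}) (\<lambda>t. f t \<bullet> w) (x \<bullet> w)"
    by (rule has_bint_inner[OF x])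
  then have "integrable (lebesgue_on {a..b}) (\<lambda>t. f t \<bullet> w)"
    "integral\<^sup>L (lebesgue_on {a..b}) (\<lambda>t. f t \<bullet> w) = x \<bullet> w"
    by (auto simp: has_bochner_integral_iff)
  then show ?thesis
    using has_integral_integral_lebesgue_on[of "{a..b}" "\<lambda>t. f t \<bullet> w"] bint_eq[OF x] by simp
qed

section \<open>Strongly continuous semigroups\<close>

lemma has_integral_norm_bound_interval:
  fixes f :: "real \<Rightarrow> 'a::real_normed_vector"
  assumes "(f has_integral i) {a..b}" "a \<le> b" "0 \<le> B" "\<And>t. t \<in> {a..b} \<Longrightarrow> norm (f t) \<le> B"
  shows "norm i \<le> B * (b - a)"
  using has_integral_bound[of B f i a b] assms by (simp add: measure_lborel_Icc)

lemma norm_blinfun_le: "norm F \<le> K \<Longrightarrow> norm (blinfun_apply F x) \<le> K * norm x"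
  by (rule order_trans[OF norm_blinfun mult_right_mono[OF _ norm_ge_zero]])

text \<open>Uniform boundedness by a gliding hump: a point at which all the operators of a
  fast growing sequence are large is the limit of a sequence adjusted one operator at a time.\<close>

lemma banach_steinhaus:
  fixes F :: "nat \<Rightarrow> 'a::banach \<Rightarrow>\<^sub>L 'b::real_normed_vector"
  assumes bdd: "\<And>x. bounded (range (\<lambda>n. F n x))"
  shows "bounded (range F)"
proof (rule ccontr)
  assume unb: "\<not> bounded (range F)"
  \<comment> \<open>Growth 4^n against corrections of size (1/3)^n: the product (4/3)^n still tends
    to infinity.\<close>
  have "\<exists>k. norm (F k) > 4 ^ n" for n :: nat
    using unb by (auto simp: bounded_iff not_le)
  then obtain k where k: "\<And>n. norm (F (k n)) > 4 ^ n" by metis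
  define G where "G n = F (k n)" for n
  have G: "norm (G n) > 4 ^ n" for n using k by (simp add: G_def)
  have step: "\<exists>x'. norm (x' - x) \<le> (1/3) ^ n \<and> (2/3) * (1/3) ^ n * norm (G n) \<le> norm (G n x')"
    for n and x :: 'a
  proof -
    have "\<not> (\<forall>v. norm (G n v) \<le> (2/3 * norm (G n)) * norm v)"
    proof
      assume "\<forall>v. norm (G n v) \<le> (2/3 * norm (G n)) * norm v"
      then have "norm (G n) \<le> 2/3 * norm (G n)"
        by (intro norm_blinfun_bound) auto
      moreover have "norm (G n) > 0" using G[of n] by (meson zero_less_power zero_less_numeral order_less_trans)
      ultimately show False by simp
    qed
    then obtain v where v: "(2/3 * norm (G n)) * norm v < norm (G n v)" by (auto simp: not_le)
    then have "v \<noteq> 0" by auto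
    define d where "d = ((1/3) ^ n / norm v) *\<^sub>R v"
    have nd: "norm d = (1/3) ^ n" using \<open>v \<noteq> 0\<close> by (simp add: d_def)
    have "norm (G n d) = (1/3) ^ n / norm v * norm (G n v)" by (simp add: d_def blinfun.scaleR_right)
    also have "\<dots> \<ge> (1/3) ^ n / norm v * ((2/3 * norm (G n)) * norm v)"
      using v by (intro mult_left_mono) auto
    finally have Gd: "norm (G n d) \<ge> (2/3) * (1/3) ^ n * norm (G n)"
      using \<open>v \<noteq> 0\<close> by simp
    \<comment> \<open>Twice \<open>G n d\<close> is a difference of the images of
      \<open>x + d\<close> and \<open>x - d\<close>, so one of the two images is at least as large
      as \<open>G n d\<close>.\<close>
    have "2 *\<^sub>R G n d = G n (x + d) - G n (x - d)"
      by (simp add: blinfun.add_right blinfun.diff_right scaleR_2)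
    then have "2 * norm (G n d) \<le> norm (G n (x + d)) + norm (G n (x - d))"
      by (metis norm_scaleR abs_numeral norm_triangle_ineq4)
    then consider "norm (G n (x + d)) \<ge> norm (G n d)" | "norm (G n (x - d)) \<ge> norm (G n d)"
      by linarith
    then show ?thesis
    proof cases
      case 1
      with Gd nd show ?thesis by (intro exI[of _ "x + d"]) auto
    next
      case 2
      with Gd nd show ?thesis by (intro exI[of _ "x - d"]) auto
    qed
  qed
  define \<phi> where "\<phi> n x = (SOME x'. norm (x' - x) \<le> (1/3) ^ n \<and>
    (2/3) * (1/3) ^ n * norm (G n) \<le> norm (G n x'))" for n x
  have \<phi>: "norm (\<phi> n x - x) \<le> (1/3) ^ n" "(2/3) * (1/3) ^ n * norm (G n) \<le> norm (G n (\<phi> n x))" for n x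
    using someI_ex[OF step[of x n]] unfolding \<phi>_def by blast+
  define X where "X = rec_nat 0 (\<lambda>n x. \<phi> (Suc n) x)"
  have X_Suc: "X (Suc n) = \<phi> (Suc n) (X n)" for n by (simp add: X_def)
  \<comment> \<open>The sum of all corrections after the n-th is at most half of (1/3)^n, a
    geometric tail.\<close>
  have dist_X: "norm (X (n + m) - X n) \<le> (1/2) * (1/3) ^ n * (1 - (1/3) ^ m)" for n m
  proof (induction m)
    case (Suc m)
    have "norm (X (n + Suc m) - X n) \<le> norm (X (Suc (n + m)) - X (n + m)) + norm (X (n + m) - X n)"
      by (metis add_Suc_right norm_diff_triangle_le order_refl)
    also have "\<dots> \<le> (1/3) ^ Suc (n + m) + (1/2) * (1/3) ^ n * (1 - (1/3) ^ m)"
      using \<phi>(1)[of "Suc (n + m)" "X (n + m)"] Suc.IH by (intro add_mono) (auto simp: X_Suc)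
    also have "\<dots> = (1/2) * (1/3) ^ n * (1 - (1/3) ^ Suc m)"
      by (simp add: power_add field_simps)
    finally show ?case .
  qed simp
  have dist_X': "norm (X m - X n) \<le> (1/2) * (1/3) ^ n" if "n \<le> m" for n m
  proof -
    have "norm (X m - X n) \<le> (1/2) * (1/3) ^ n * (1 - (1/3) ^ (m - n))"
      using dist_X[of n "m - n"] that by simp
    also have "\<dots> \<le> (1/2) * (1/3) ^ n * 1" by (intro mult_left_mono) auto
    finally show ?thesis by simp
  qed
  have "Cauchy X"
  proof (rule metric_CauchyI)
    fix e :: real assume "e > 0"
    obtain N where N: "(1/3::real) ^ N < e" using real_arch_pow_inv[OF \<open>e > 0\<close>, of "1/3"] by auto
    show "\<exists>M. \<forall>m\<ge>M. \<forall>n\<ge>M. dist (X m) (X n) < e"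
    proof (intro exI allI impI)
      fix m n assume "N \<le> m" "N \<le> n"
      then have "norm (X m - X N) \<le> (1/2) * (1/3) ^ N" "norm (X n - X N) \<le> (1/2) * (1/3) ^ N"
        using dist_X' by auto
      moreover have "dist (X m) (X n) \<le> norm (X m - X N) + norm (X n - X N)"
        by (metis dist_norm dist_triangle2)
      ultimately show "dist (X m) (X n) < e" using N by linarith
    qed
  qed
  then obtain x where x: "X \<longlonglongrightarrow> x" by (meson Cauchy_convergent convergentD)
  have close: "norm (x - X n) \<le> (1/2) * (1/3) ^ n" for n
  proof (rule LIMSEQ_le_const2)
    show "(\<lambda>m. norm (X m - X n)) \<longlonglongrightarrow> norm (x - X n)" by (intro tendsto_intros x)
  qed (use dist_X' in blast)
  \<comment> \<open>The n-th correction secures 2/3 of \<open>(1/3) ^ n * norm (G n)\<close> and all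
    later ones destroy at most 1/2 of it; 1/6 remains.\<close>
  have big: "(1/6) * (4/3) ^ Suc n \<le> norm (G (Suc n) x)" for n
  proof -
    let ?n = "Suc n"
    have "(2/3) * (1/3) ^ ?n * norm (G ?n) \<le> norm (G ?n (X ?n))" unfolding X_Suc by (rule \<phi>(2))
    moreover have "norm (G ?n (X ?n)) \<le> norm (G ?n x) + norm (G ?n (x - X ?n))"
      using norm_triangle_sub[of "G ?n (X ?n)" "G ?n x"]
      by (simp add: blinfun.diff_right norm_minus_commute)
    moreover have "norm (G ?n (x - X ?n)) \<le> norm (G ?n) * ((1/2) * (1/3) ^ ?n)"
      by (intro order_trans[OF norm_blinfun] mult_left_mono close) auto
    ultimately have "(1/6) * ((1/3) ^ ?n * norm (G ?n)) \<le> norm (G ?n x)"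
      by (simp add: algebra_simps)
    moreover have "(1/3) ^ ?n * 4 ^ ?n \<le> (1/3) ^ ?n * norm (G ?n)"
      using G[of ?n] by (intro mult_left_mono) auto
    moreover have "(1/3) ^ ?n * 4 ^ ?n = (4/3::real) ^ ?n" by (simp add: power_mult_distrib[symmetric])
    ultimately show ?thesis by linarith
  qed
  obtain K where K: "\<And>n. norm (F n x) \<le> K" using bdd[of x] by (auto simp: bounded_iff)
  obtain n where n: "6 * K < (4/3::real) ^ n" using real_arch_pow[of "4/3" "6 * K"] by auto
  have "(4/3::real) ^ n \<ge> 0" by simp
  with n big[of n] K[of "k (Suc n)"] show False by (simp add: G_def)
qed

lemma C0_semigroup_near_zero:
  assumes "C0_semigroup S"
  shows "continuous (at 0 within {0..}) (\<lambda>t. S t x)"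
proof -
  have "((\<lambda>t. S t x) \<longlongrightarrow> S 0 x) (at_right 0)"
    using assms by (simp add: C0_semigroup_def)
  moreover have "at 0 within {0..} = at_right (0::real)"
    by (rule at_within_nhd[of _ UNIV]) auto
  ultimately show ?thesis by (simp add: continuous_within)
qed

lemma C0_semigroup_add:
  assumes "C0_semigroup S" "0 \<le> s" "0 \<le> t"
  shows "S (s + t) x = S s (S t x)"
  using assms by (simp add: C0_semigroup_def)

lemma C0_semigroup_zero: "C0_semigroup S \<Longrightarrow> S 0 x = x"
  by (simp add: C0_semigroup_def)

text \<open>If the norms were unbounded near zero, a null sequence of times would give operators
  that are pointwise bounded by strong continuity at zero, against the uniform boundedness
  principle. The semigroup law carries the bound from {0..\<delta>} to any compact interval.\<close>

lemma C0_semigroup_bounded: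
  fixes S :: "real \<Rightarrow> 'a::banach \<Rightarrow>\<^sub>L 'a"
  assumes S: "C0_semigroup S"
  shows "\<exists>K\<ge>1. \<forall>t\<in>{0..\<tau>}. norm (S t) \<le> K"
proof -
  have "\<exists>\<delta>>0. \<exists>K. \<forall>t\<in>{0..\<delta>}. norm (S t) \<le> K"
  proof (rule ccontr)
    assume "\<not> (\<exists>\<delta>>0. \<exists>K. \<forall>t\<in>{0..\<delta>}. norm (S t) \<le> K)"
    then have "\<exists>t. 0 \<le> t \<and> t \<le> \<delta> \<and> norm (S t) > K" if "\<delta> > 0" for \<delta> K
      using that by (force simp: not_le)
    then have "\<forall>n. \<exists>t. 0 \<le> t \<and> t \<le> 1 / real (Suc n) \<and> norm (S t) > real n" by simp
    then obtain r where r: "\<And>n. 0 \<le> r n" "\<And>n. r n \<le> 1 / real (Suc n)" "\<And>n. norm (S (r n)) > real n"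
      by metis
    have "r \<longlonglongrightarrow> 0"
      by (rule tendsto_sandwich[OF _ _ tendsto_const LIMSEQ_Suc[OF lim_1_over_n]])
        (use r in \<open>auto intro!: always_eventually\<close>)
    have "bounded (range (\<lambda>n. S (r n) x))" for x
    proof -
      have "(\<lambda>n. S (r n) x) \<longlonglongrightarrow> S 0 x"
        using continuous_within_tendsto_compose[OF C0_semigroup_near_zero[OF S] _ \<open>r \<longlonglongrightarrow> 0\<close>] r(1)
        by auto
      then show ?thesis by (rule convergent_imp_bounded)
    qed
    then have "bounded (range (\<lambda>n. S (r n)))" by (rule banach_steinhaus)
    then obtain K where "\<And>n. norm (S (r n)) \<le> K" by (auto simp: bounded_iff)
    moreover obtain n where "K < real n" using reals_Archimedean2 by blast
    ultimately show False using r(3)[of n] by (meson not_less order_trans less_imp_le order_less_le_trans)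
  qed
  then obtain \<delta> K0 where \<delta>: "\<delta> > 0" "\<And>t. t \<in> {0..\<delta>} \<Longrightarrow> norm (S t) \<le> K0" by blast
  define K where "K = max 1 K0"
  have K: "K \<ge> 1" "\<And>t. t \<in> {0..\<delta>} \<Longrightarrow> norm (S t) \<le> K"
    using \<delta>(2) by (auto simp: K_def le_max_iff_disj)
  have bnd: "norm (S t) \<le> K ^ n" if "t \<in> {0..real n * \<delta>}" "n > 0" for n t
    using that
  proof (induction n arbitrary: t)
    case (Suc n)
    show ?case
    proof (cases "t \<le> \<delta>")
      case True
      then have "norm (S t) \<le> K" using Suc.prems K by auto
      also have "\<dots> \<le> K ^ Suc n" using K(1) by (simp add: self_le_power)
      finally show ?thesis .
    next
      case False
      have n: "n > 0"
      proof (rule ccontr)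
        assume "\<not> n > 0"
        with Suc.prems False show False by simp
      qed
      have "t - \<delta> \<in> {0..real n * \<delta>}" using False Suc.prems by (auto simp: algebra_simps)
      then have IH: "norm (S (t - \<delta>)) \<le> K ^ n" using Suc.IH n by blast
      have "S t = S \<delta> o\<^sub>L S (t - \<delta>)"
        using C0_semigroup_add[OF S, of \<delta> "t - \<delta>"] False \<delta>(1) by (intro blinfun_eqI) simp
      then have "norm (S t) \<le> norm (S \<delta>) * norm (S (t - \<delta>))" by (simp add: norm_blinfun_compose)
      also have "\<dots> \<le> K * K ^ n" using IH K \<delta>(1) by (intro mult_mono) auto
      finally show ?thesis by simp
    qed
  qed simp
  obtain n where n: "\<tau> / \<delta> < real n" using reals_Archimedean2 by blast
  show ?thesis
  proof (intro exI[of _ "K ^ Suc n"] conjI ballI)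
    show "1 \<le> K ^ Suc n" using K(1) by (rule one_le_power)
    fix t assume "t \<in> {0..\<tau>}"
    moreover have "\<tau> \<le> real (Suc n) * \<delta>" using n \<delta>(1) by (simp add: pos_divide_less_eq algebra_simps)
    ultimately show "norm (S t) \<le> K ^ Suc n" by (intro bnd) auto
  qed
qed

text \<open>Factoring out the operator at the smaller of two times reduces both one-sided limits to
  continuity at zero; the local bound makes this uniform in the base point, which the left limit
  requires.\<close>

lemma C0_semigroup_continuous:
  fixes S :: "real \<Rightarrow> 'a::banach \<Rightarrow>\<^sub>L 'a"
  assumes S: "C0_semigroup S"
  shows "continuous_on {0..} (\<lambda>t. S t x)"
  unfolding continuous_on_iff
proof (intro ballI allI impI)
  fix t e :: real assume t: "t \<in> {0..}" and "e > 0"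
  obtain K where K: "K \<ge> 1" "\<And>s. s \<in> {0..t + 1} \<Longrightarrow> norm (S s) \<le> K"
    using C0_semigroup_bounded[OF S] by blast
  have "e / K > 0" using K(1) \<open>e > 0\<close> by auto
  then obtain d where d: "d > 0" "\<And>s. s \<in> {0..} \<Longrightarrow> dist s 0 < d \<Longrightarrow> dist (S s x) (S 0 x) < e / K"
    using C0_semigroup_near_zero[OF S, of x] unfolding continuous_within_eps_delta by metis
  have le: "dist (S r x) (S s x) < e" if "0 \<le> s" "s \<le> r" "s \<le> t + 1" "r - s < d" for r s
  proof -
    have "S r x - S s x = S s (S (r - s) x - x)"
      using C0_semigroup_add[OF S, of s "r - s" x] that by (simp add: blinfun.diff_right)
    then have "norm (S r x - S s x) \<le> K * norm (S (r - s) x - x)"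
      using K(2)[of s] that by (auto intro: norm_blinfun_le)
    also have "norm (S (r - s) x - x) < e / K"
      using d(2)[of "r - s"] that by (auto simp: dist_norm C0_semigroup_zero[OF S])
    finally show ?thesis using K(1) by (simp add: dist_norm)
  qed
  show "\<exists>d>0. \<forall>s\<in>{0..}. dist s t < d \<longrightarrow> dist (S s x) (S t x) < e"
  proof (intro exI conjI ballI impI)
    show "0 < min d 1" using d by auto
    fix s :: real assume s: "s \<in> {0..}" "dist s t < min d 1"
    then show "dist (S s x) (S t x) < e"
      using le[of s t] le[of t s] t by (cases "s \<le> t") (auto simp: dist_real_def dist_commute)
  qed
qed

text \<open>Operator and vector vary together: strong continuity handles the operator at the fixed
  vector \<open>f t\<close>, the local bound handles the increment of \<open>f\<close>.\<close>

lemma C0_semigroup_continuous_compose: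
  fixes S :: "real \<Rightarrow> 'a::banach \<Rightarrow>\<^sub>L 'a"
  assumes S: "C0_semigroup S" and f: "continuous_on D f" and g: "continuous_on D g"
    and range: "\<And>t. t \<in> D \<Longrightarrow> g t \<in> {0..\<tau>}"
  shows "continuous_on D (\<lambda>t. S (g t) (f t))"
  unfolding continuous_on_def
proof
  fix t assume t: "t \<in> D"
  obtain K where K: "K \<ge> 1" "\<And>s. s \<in> {0..\<tau>} \<Longrightarrow> norm (S s) \<le> K"
    using C0_semigroup_bounded[OF S] by blast
  have "continuous_on D (\<lambda>s. S (g s) (f t))"
    using range by (intro continuous_on_compose2[OF C0_semigroup_continuous[OF S] g]) auto
  then have "((\<lambda>s. S (g s) (f t)) \<longlongrightarrow> S (g t) (f t)) (at t within D)"
    using t by (simp add: continuous_on_def)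
  moreover have "((\<lambda>s. S (g s) (f s - f t)) \<longlongrightarrow> 0) (at t within D)"
  proof (rule Lim_null_comparison)
    have "norm (S (g s) (f s - f t)) \<le> K * norm (f s - f t)" if "s \<in> D" for s
      by (rule norm_blinfun_le[OF K(2)[OF range[OF that]]])
    then show "\<forall>\<^sub>F s in at t within D. norm (S (g s) (f s - f t)) \<le> K * norm (f s - f t)"
      unfolding eventually_at_filter by (intro always_eventually) blast
    have "((\<lambda>s. K * norm (f s - f t)) \<longlongrightarrow> K * norm (f t - f t)) (at t within D)"
      using f t by (intro tendsto_intros) (simp add: continuous_on_def)
    then show "((\<lambda>s. K * norm (f s - f t)) \<longlongrightarrow> 0) (at t within D)" by simp
  qed
  ultimately have "((\<lambda>s. S (g s) (f t) + S (g s) (f s - f t)) \<longlongrightarrow> S (g t) (f t) + 0) (at t within D)"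
    by (rule tendsto_add)
  then show "((\<lambda>s. S (g s) (f s)) \<longlongrightarrow> S (g t) (f t)) (at t within D)"
    by (simp add: blinfun.diff_right)
qed

subsection \<open>Generators\<close>

text \<open>Recasts the limit that defines the generator as a derivative within an interval, so that
  the rules of differentiation become applicable to it.\<close>

lemma has_vector_derivative_at_zero_iff:
  fixes f :: "real \<Rightarrow> 'a::real_normed_vector"
  shows "(f has_vector_derivative z) (at 0 within {0..1})
    \<longleftrightarrow> ((\<lambda>h. (f h - f 0) /\<^sub>R h) \<longlongrightarrow> z) (at_right 0)"
proof -
  have eq: "at 0 within {0..1} = at_right (0::real)" by (simp add: at_within_Icc_at_right)
  show ?thesis
    unfolding has_vector_derivative_def has_derivative_within eq
  proof -
    have "((\<lambda>y. (1 / norm (y - 0)) *\<^sub>R (f y - (f 0 + (y - 0) *\<^sub>R z))) \<longlongrightarrow> 0) (at_right 0)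
        \<longleftrightarrow> ((\<lambda>h. (f h - f 0) /\<^sub>R h - z) \<longlongrightarrow> 0) (at_right 0)"
      by (rule tendsto_cong) (auto simp: eventually_at_filter algebra_simps divide_inverse)
    then show "(bounded_linear (\<lambda>x. x *\<^sub>R z) \<and>
       ((\<lambda>y. (1 / norm (y - 0)) *\<^sub>R (f y - (f 0 + (y - 0) *\<^sub>R z))) \<longlongrightarrow> 0) (at_right 0)) =
      ((\<lambda>h. (f h - f 0) /\<^sub>R h) \<longlongrightarrow> z) (at_right 0)"
      using LIM_zero_iff[of "\<lambda>h. (f h - f 0) /\<^sub>R h" z "at_right 0"]
      by (simp add: bounded_linear_scaleR_left)
  qed
qed

lemma generates_iff:
  "generates A S \<longleftrightarrow> C0_semigroup S \<and>
     (\<forall>x z. A x = Some z \<longleftrightarrow> ((\<lambda>t. S t x) has_vector_derivative z) (at 0 within {0..1}))"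
  unfolding generates_def has_vector_derivative_at_zero_iff
  by (auto simp: C0_semigroup_def)

lemma generates_C0: "generates A S \<Longrightarrow> C0_semigroup S"
  by (simp add: generates_def)

lemma generator_commutes:
  fixes S :: "real \<Rightarrow> 'a::banach \<Rightarrow>\<^sub>L 'a"
  assumes S: "generates A S" and x: "A x = Some z" and t: "0 \<le> t"
  shows "A (S t x) = Some (S t z)"
proof -
  note C0 = generates_C0[OF S]
  have "((\<lambda>s. S s x) has_vector_derivative z) (at 0 within {0..1})"
    using S x by (simp add: generates_iff)
  then have deriv: "((\<lambda>s. S t (S s x)) has_vector_derivative S t z) (at 0 within {0..1})"
    by (rule bounded_linear.has_vector_derivative[OF blinfun.bounded_linear_right])
  have comm: "S s (S t x) = S t (S s x)" if "s \<in> {0..1}" for s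
    using that t C0_semigroup_add[OF C0, of t s x] C0_semigroup_add[OF C0, of s t x]
    by (simp add: add.commute)
  have "((\<lambda>s. S s (S t x)) has_vector_derivative S t z) (at 0 within {0..1})"
    by (rule has_vector_derivative_transform[OF _ comm deriv]) auto
  then show ?thesis using S by (simp add: generates_iff)
qed

text \<open>The generator gives only a right derivative at zero. For the left difference quotient at
  \<open>t\<close> the increment is based at the earlier time \<open>r\<close>; this produces
  \<open>S r z\<close> instead of \<open>S t z\<close>, and strong continuity closes the
  gap.\<close>

lemma semigroup_has_vector_derivative:
  fixes S :: "real \<Rightarrow> 'a::banach \<Rightarrow>\<^sub>L 'a"
  assumes S: "generates A S" and x: "A x = Some z" and t: "t \<in> {0..\<tau>}"
  shows "((\<lambda>t. S t x) has_vector_derivative S t z) (at t within {0..\<tau>})"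
proof -
  note C0 = generates_C0[OF S]
  obtain K where K: "K \<ge> 1" "\<And>s. s \<in> {0..\<tau>} \<Longrightarrow> norm (S s) \<le> K"
    using C0_semigroup_bounded[OF C0] by blast
  define \<rho> where "\<rho> h = norm ((S h x - x) /\<^sub>R h - z)" for h
  have \<rho>0: "(\<rho> \<longlongrightarrow> 0) (at_right 0)"
  proof -
    have "((\<lambda>h. (S h x - x) /\<^sub>R h) \<longlongrightarrow> z) (at_right 0)" using S x by (simp add: generates_def)
    from tendsto_norm_zero[OF LIM_zero[OF this]] show ?thesis by (simp add: \<rho>_def[abs_def])
  qed
  have le: "norm (S r x - S s x - (r - s) *\<^sub>R S s z) \<le> K * \<rho> (r - s) * (r - s)"
    if "0 \<le> s" "s < r" "r \<le> \<tau>" for r s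
  proof -
    have "S r x - S s x - (r - s) *\<^sub>R S s z = S s ((r - s) *\<^sub>R ((S (r - s) x - x) /\<^sub>R (r - s) - z))"
      using C0_semigroup_add[OF C0, of s "r - s" x] that
      by (simp add: blinfun.diff_right blinfun.scaleR_right scaleR_diff_right)
    moreover have "norm (S s ((r - s) *\<^sub>R ((S (r - s) x - x) /\<^sub>R (r - s) - z)))
        \<le> K * norm ((r - s) *\<^sub>R ((S (r - s) x - x) /\<^sub>R (r - s) - z))"
      using that by (intro norm_blinfun_le K(2)) auto
    ultimately show ?thesis using that by (simp add: \<rho>_def mult_ac)
  qed
  have cont: "continuous_on {0..\<tau>} (\<lambda>t. S t z)"
    using C0_semigroup_continuous[OF C0] by (rule continuous_on_subset) auto
  show ?thesis
    unfolding has_vector_derivative_def has_derivative_within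
  proof
    show "bounded_linear (\<lambda>h. h *\<^sub>R S t z)" by (rule bounded_linear_scaleR_left)
    show "((\<lambda>r. (1 / norm (r - t)) *\<^sub>R (S r x - (S t x + (r - t) *\<^sub>R S t z))) \<longlongrightarrow> 0) (at t within {0..\<tau>})"
    proof (rule Lim_null_comparison)
      let ?b = "\<lambda>r. K * \<rho> \<bar>r - t\<bar> + norm (S r z - S t z)"
      have "norm ((1 / norm (r - t)) *\<^sub>R (S r x - (S t x + (r - t) *\<^sub>R S t z))) \<le> ?b r"
        if r: "r \<in> {0..\<tau>}" "r \<noteq> t" for r
      proof (cases "t < r")
        case True
        have "norm (S r x - (S t x + (r - t) *\<^sub>R S t z)) \<le> ?b r * (r - t)"
        proof -
          have "norm (S r x - (S t x + (r - t) *\<^sub>R S t z)) \<le> K * \<rho> (r - t) * (r - t)"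
            using le[of t r] t r True by (simp add: diff_diff_eq)
          also have "\<dots> \<le> ?b r * (r - t)"
            using True by (intro mult_right_mono) auto
          finally show ?thesis .
        qed
        with True show ?thesis by (simp add: pos_divide_le_eq)
      next
        case False
        then have rt: "r < t" using r by simp
        have "S r x - (S t x + (r - t) *\<^sub>R S t z)
            = - (S t x - S r x - (t - r) *\<^sub>R S r z) + (t - r) *\<^sub>R (S t z - S r z)"
          by (simp add: algebra_simps)
        then have "norm (S r x - (S t x + (r - t) *\<^sub>R S t z))
            \<le> norm (S t x - S r x - (t - r) *\<^sub>R S r z) + (t - r) * norm (S t z - S r z)"
          using rt norm_triangle_ineq[of "- (S t x - S r x - (t - r) *\<^sub>R S r z)" "(t - r) *\<^sub>R (S t z - S r z)"]
          by (simp only: norm_minus_cancel norm_scaleR)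
        also have "\<dots> \<le> K * \<rho> (t - r) * (t - r) + (t - r) * norm (S t z - S r z)"
          using le[of r t] r t rt by simp
        also have "\<dots> = ?b r * (t - r)"
          using rt by (simp add: algebra_simps norm_minus_commute)
        finally show ?thesis using rt by (simp add: pos_divide_le_eq abs_if)
      qed
      then show "\<forall>\<^sub>F r in at t within {0..\<tau>}.
          norm ((1 / norm (r - t)) *\<^sub>R (S r x - (S t x + (r - t) *\<^sub>R S t z))) \<le> ?b r"
        unfolding eventually_at_filter by (intro always_eventually allI impI) simp
      have "filterlim (\<lambda>r. \<bar>r - t\<bar>) (at_right 0) (at t within {0..\<tau>})"
        unfolding filterlim_at
      proof
        have "((\<lambda>r. \<bar>r - t\<bar>) \<longlongrightarrow> \<bar>t - t\<bar>) (at t within {0..\<tau>})" by (intro tendsto_intros)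
        then show "((\<lambda>r. \<bar>r - t\<bar>) \<longlongrightarrow> 0) (at t within {0..\<tau>})" by simp
      qed (auto simp: eventually_at_filter)
      then have "((\<lambda>r. \<rho> \<bar>r - t\<bar>) \<longlongrightarrow> 0) (at t within {0..\<tau>})"
        by (rule filterlim_compose[OF \<rho>0])
      moreover have "((\<lambda>r. S r z) \<longlongrightarrow> S t z) (at t within {0..\<tau>})"
        using cont t by (simp add: continuous_on_def)
      ultimately have "(?b \<longlongrightarrow> K * 0 + norm (S t z - S t z)) (at t within {0..\<tau>})"
        by (intro tendsto_add tendsto_mult tendsto_norm tendsto_diff tendsto_const)
      then show "(?b \<longlongrightarrow> 0) (at t within {0..\<tau>})" by simp
    qed
  qed
qed

text \<open>The means of \<open>S s x\<close> over {0..h} lie in the domain and converge to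
  \<open>x\<close> as h tends to zero.\<close>

lemma generator_dense:
  fixes S :: "real \<Rightarrow> 'a::banach \<Rightarrow>\<^sub>L 'a"
  assumes S: "generates A S"
  shows "\<exists>X. (\<forall>n. A (X n) \<noteq> None) \<and> X \<longlonglongrightarrow> x"
proof -
  note C0 = generates_C0[OF S]
  define J where "J u = integral {0..u} (\<lambda>s. S s x)" for u
  have cont: "continuous_on {0..u} (\<lambda>s. S s x)" for u
    using C0_semigroup_continuous[OF C0] by (rule continuous_on_subset) auto
  have J': "(J has_vector_derivative S u x) (at u within {0..v})" if "u \<in> {0..v}" for u v
    unfolding J_def by (rule integral_has_vector_derivative[OF cont that])
  have dom: "A (J h) = Some (S h x - x)" if "h \<ge> 0" for h
  proof -
    \<comment> \<open>\<open>S t\<close> acts on the integral by translating the interval of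
      integration, so its derivative at zero comes from the two end points alone.\<close>
    have shift: "S t (J h) = J (t + h) - J t" if t: "t \<in> {0..1}" for t
    proof -
      have "S t (J h) = integral {0..h} (\<lambda>s. S t (S s x))"
        unfolding J_def using integral_linear[OF integrable_continuous_interval[OF cont[of h]]
            blinfun.bounded_linear_right[of "S t"]]
        by (simp add: o_def)
      also have "\<dots> = integral {0..h} (\<lambda>s. S (s + t) x)"
        using t by (intro integral_cong) (simp add: C0_semigroup_add[OF C0, of t, symmetric] add.commute)
      also have "\<dots> = integral {0 + t..h + t} (\<lambda>s. S s x)"
        using integral_shift_real_ivl[where a = "0 + t" and c = t and b = "h + t" and f = "\<lambda>s. S s x"] by simp
      also have "\<dots> = J (t + h) - J t"
        using Henstock_Kurzweil_Integration.integral_combine[where a = 0 and c = t and b = "h + t" and f = "\<lambda>s. S s x"] t \<open>h \<ge> 0\<close> integrable_continuous_interval[OF cont]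
        unfolding J_def by (simp add: add.commute algebra_simps)
      finally show ?thesis .
    qed
    have deriv: "((\<lambda>t. J (t + h) - J t) has_vector_derivative S h x - S 0 x) (at 0 within {0..1})"
    proof (intro has_vector_derivative_diff)
      show "(J has_vector_derivative S 0 x) (at 0 within {0..1})" by (rule J') simp
      have "(J has_vector_derivative S (0 + h) x) (at (0 + h) within (\<lambda>t. t + h) ` {0..1})"
        by (rule has_vector_derivative_within_subset[OF J'[of "0 + h" "1 + h"]]) (use \<open>h \<ge> 0\<close> in auto)
      then have "((J \<circ> (\<lambda>t. t + h)) has_vector_derivative 1 *\<^sub>R S (0 + h) x) (at 0 within {0..1})"
        by (intro vector_diff_chain_within) (auto intro!: derivative_eq_intros)
      then show "((\<lambda>t. J (t + h)) has_vector_derivative S h x) (at 0 within {0..1})"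
        by (simp add: o_def)
    qed
    have "((\<lambda>t. S t (J h)) has_vector_derivative S h x - S 0 x) (at 0 within {0..1})"
      by (rule has_vector_derivative_transform[OF _ shift deriv]) auto
    then show ?thesis using S by (simp add: generates_iff C0_semigroup_zero[OF C0])
  qed
  have lim: "((\<lambda>h. (J h - J 0) /\<^sub>R h) \<longlongrightarrow> x) (at_right 0)"
    using J'[of 0 1] by (simp add: has_vector_derivative_at_zero_iff C0_semigroup_zero[OF C0])
  have J0: "J 0 = 0" by (simp add: J_def)
  define X where "X n = J (1 / real (Suc n)) /\<^sub>R (1 / real (Suc n))" for n
  have "A (X n) \<noteq> None" for n
  proof -
    have "((\<lambda>t. S t (J (1 / real (Suc n)))) has_vector_derivative (S (1 / real (Suc n)) x - x)) (at 0 within {0..1})"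
      using dom[of "1 / real (Suc n)"] S by (simp add: generates_iff)
    then have "((\<lambda>t. S t (X n)) has_vector_derivative (S (1 / real (Suc n)) x - x) /\<^sub>R (1 / real (Suc n))) (at 0 within {0..1})"
      unfolding X_def blinfun.scaleR_right
      by (rule bounded_linear.has_vector_derivative[OF bounded_linear_scaleR_right])
    then have "A (X n) = Some ((S (1 / real (Suc n)) x - x) /\<^sub>R (1 / real (Suc n)))"
      using S by (simp add: generates_iff)
    then show ?thesis by simp
  qed
  moreover have "X \<longlonglongrightarrow> x"
  proof -
    have "filterlim (\<lambda>n. 1 / real (Suc n)) (at_right 0) sequentially"
      unfolding filterlim_at using LIMSEQ_Suc[OF lim_1_over_n] by auto
    from filterlim_compose[OF lim this] show ?thesis by (simp add: X_def[abs_def] J0)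
  qed
  ultimately show ?thesis by blast
qed

lemma eq_if_inner_eq_dense:
  fixes S :: "real \<Rightarrow> 'a::{real_inner,banach} \<Rightarrow>\<^sub>L 'a"
  assumes S: "generates A S" and eq: "\<And>x z. A x = Some z \<Longrightarrow> u \<bullet> x = v \<bullet> x"
  shows "u = v"
proof (rule eq_if_inner_eq)
  fix x
  obtain X where X: "\<And>n. A (X n) \<noteq> None" "X \<longlonglongrightarrow> x"
    using generator_dense[OF S] by blast
  have "u \<bullet> X n = v \<bullet> X n" for n using X(1)[of n] eq by blast
  moreover have "(\<lambda>n. u \<bullet> X n) \<longlonglongrightarrow> u \<bullet> x" "(\<lambda>n. v \<bullet> X n) \<longlonglongrightarrow> v \<bullet> x"
    by (intro tendsto_intros X)+
  ultimately show "u \<bullet> x = v \<bullet> x" using LIMSEQ_unique by force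
qed

text \<open>Density of the domain of \<open>A\<close> makes the adjoint value unique, so
  \<open>THE\<close> in \<open>op_adj\<close> denotes what it should.\<close>

lemma op_adj_iff:
  fixes S :: "real \<Rightarrow> 'a::{real_inner,banach} \<Rightarrow>\<^sub>L 'a"
  assumes "generates A S"
  shows "op_adj A y = Some w \<longleftrightarrow> (\<forall>x z. A x = Some z \<longrightarrow> z \<bullet> y = x \<bullet> w)"
proof -
  have uniq: "w' = w" if "\<forall>x z. A x = Some z \<longrightarrow> z \<bullet> y = x \<bullet> w" "\<forall>x z. A x = Some z \<longrightarrow> z \<bullet> y = x \<bullet> w'" for w w'
    using that by (intro eq_if_inner_eq_dense[OF assms]) (metis inner_commute)
  show ?thesis
  proof
    assume "op_adj A y = Some w"
    then have ex: "\<exists>w. \<forall>x z. A x = Some z \<longrightarrow> z \<bullet> y = x \<bullet> w"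
      and w: "w = (THE w. \<forall>x z. A x = Some z \<longrightarrow> z \<bullet> y = x \<bullet> w)"
      by (auto simp: op_adj_def split: if_splits)
    have "\<exists>!w. \<forall>x z. A x = Some z \<longrightarrow> z \<bullet> y = x \<bullet> w" using ex uniq by blast
    from theI'[OF this] show "\<forall>x z. A x = Some z \<longrightarrow> z \<bullet> y = x \<bullet> w" unfolding w .
  next
    assume w: "\<forall>x z. A x = Some z \<longrightarrow> z \<bullet> y = x \<bullet> w"
    then have "(THE w. \<forall>x z. A x = Some z \<longrightarrow> z \<bullet> y = x \<bullet> w) = w"
      using uniq by (intro the_equality) blast+
    with w show "op_adj A y = Some w" by (auto simp: op_adj_def)
  qed
qed

lemma op_plus_iff: "op_plus A F x = Some z \<longleftrightarrow> A x = Some (z - F x)"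
  by (auto simp: op_plus_def)

lemma op_adj_op_plus:
  fixes T S :: "real \<Rightarrow> 'a::{real_inner,banach} \<Rightarrow>\<^sub>L 'a"
  assumes "generates A T" "generates (op_plus A F) S"
  shows "op_adj (op_plus A F) = op_plus (op_adj A) (adj F)"
proof (rule ext)
  fix y
  have "op_adj (op_plus A F) y = Some w \<longleftrightarrow> op_plus (op_adj A) (adj F) y = Some w" for w
  proof -
    have "(\<forall>x z. op_plus A F x = Some z \<longrightarrow> z \<bullet> y = x \<bullet> w) \<longleftrightarrow> (\<forall>x z. A x = Some z \<longrightarrow> (z + F x) \<bullet> y = x \<bullet> w)"
      by (auto simp: op_plus_iff) (metis diff_add_cancel)+
    also have "\<dots> \<longleftrightarrow> (\<forall>x z. A x = Some z \<longrightarrow> z \<bullet> y = x \<bullet> (w - adj F y))"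
      by (simp add: inner_add_left inner_diff_right adj_inner algebra_simps)
    finally show ?thesis
      using op_adj_iff[OF assms(2)] op_adj_iff[OF assms(1)] by (simp add: op_plus_iff)
  qed
  then show "op_adj (op_plus A F) y = op_plus (op_adj A) (adj F) y"
    by (metis not_None_eq)
qed

subsection \<open>The adjoint semigroup\<close>

text \<open>On the domain of \<open>A\<close> this is the fundamental theorem of calculus with the
  generator moved onto \<open>y\<close>. Both sides are continuous in \<open>x\<close>, so density
  removes the restriction.\<close>

lemma semigroup_weak_identity:
  fixes S :: "real \<Rightarrow> 'a::{real_inner,banach} \<Rightarrow>\<^sub>L 'a"
  assumes S: "generates A S" and y: "op_adj A y = Some w" and t: "0 \<le> t"
  shows "((\<lambda>s. S s x \<bullet> w) has_integral (S t x \<bullet> y - x \<bullet> y)) {0..t}"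
proof -
  note C0 = generates_C0[OF S]
  have cont: "continuous_on {0..t} (\<lambda>s. S s x \<bullet> w)" for x
    by (intro continuous_intros continuous_on_subset[OF C0_semigroup_continuous[OF C0]]) auto
  have dom: "((\<lambda>s. S s x \<bullet> w) has_integral (S t x \<bullet> y - x \<bullet> y)) {0..t}" if x: "A x = Some z" for x z
  proof -
    have "((\<lambda>s. S s z \<bullet> y) has_integral (S t x \<bullet> y - S 0 x \<bullet> y)) {0..t}"
      using t by (intro fundamental_theorem_of_calculus
          bounded_linear.has_vector_derivative[OF bounded_linear_inner_left]
          semigroup_has_vector_derivative[OF S x])
    moreover have "S s z \<bullet> y = S s x \<bullet> w" if "s \<in> {0..t}" for s
      using generator_commutes[OF S x, of s] that y op_adj_iff[OF S] by auto
    ultimately show ?thesis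
      using has_integral_cong[of "{0..t}" "\<lambda>s. S s z \<bullet> y" "\<lambda>s. S s x \<bullet> w"]
      by (simp add: C0_semigroup_zero[OF C0])
  qed
  obtain K where K: "K \<ge> 1" "\<And>s. s \<in> {0..t} \<Longrightarrow> norm (S s) \<le> K"
    using C0_semigroup_bounded[OF C0] by blast
  obtain X where X: "\<And>n. A (X n) \<noteq> None" "X \<longlonglongrightarrow> x"
    using generator_dense[OF S] by blast
  let ?I = "\<lambda>x. integral {0..t} (\<lambda>s. S s x \<bullet> w)"
  have I: "?I (X n) = S t (X n) \<bullet> y - X n \<bullet> y" for n
    using X(1)[of n] dom by (blast intro: integral_unique)
  have "(\<lambda>n. ?I (X n) - ?I x) \<longlonglongrightarrow> 0"
  proof (rule Lim_null_comparison)
    have "norm (?I (X n) - ?I x) \<le> K * norm (X n - x) * norm w * t" for n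
    proof -
      have "?I (X n) - ?I x = integral {0..t} (\<lambda>s. S s (X n) \<bullet> w - S s x \<bullet> w)"
        by (intro integral_diff[symmetric] integrable_continuous_interval cont)
      also have "norm \<dots> \<le> K * norm (X n - x) * norm w * (t - 0)"
      proof (rule integral_bound[OF t])
        show "continuous_on {0..t} (\<lambda>s. S s (X n) \<bullet> w - S s x \<bullet> w)"
          by (intro continuous_on_diff cont)
        fix s assume "s \<in> {0..t}"
        then have "norm (S s (X n - x)) \<le> K * norm (X n - x)"
          using K(2) by (intro norm_blinfun_le) auto
        then have "norm (S s (X n - x)) * norm w \<le> K * norm (X n - x) * norm w"
          by (rule mult_right_mono) simp
        moreover have "norm (S s (X n - x) \<bullet> w) \<le> norm (S s (X n - x)) * norm w"
          by (simp add: Cauchy_Schwarz_ineq2)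
        ultimately show "norm (S s (X n) \<bullet> w - S s x \<bullet> w) \<le> K * norm (X n - x) * norm w"
          by (simp add: blinfun.diff_right inner_diff_left)
      qed
      finally show ?thesis by simp
    qed
    then show "\<forall>\<^sub>F n in sequentially. norm (?I (X n) - ?I x) \<le> K * norm (X n - x) * norm w * t" by simp
    have "(\<lambda>n. K * norm (X n - x) * norm w * t) \<longlonglongrightarrow> K * norm (x - x) * norm w * t"
      by (intro tendsto_intros X)
    then show "(\<lambda>n. K * norm (X n - x) * norm w * t) \<longlonglongrightarrow> 0" by simp
  qed
  then have "(\<lambda>n. ?I (X n)) \<longlonglongrightarrow> ?I x" by (rule LIM_zero_cancel)
  moreover have "(\<lambda>n. S t (X n) \<bullet> y - X n \<bullet> y) \<longlonglongrightarrow> S t x \<bullet> y - x \<bullet> y"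
    by (intro tendsto_intros X blinfun.tendsto[OF tendsto_const])
  ultimately have "?I x = S t x \<bullet> y - x \<bullet> y"
    unfolding I using LIMSEQ_unique by blast
  then show ?thesis
    using integrable_continuous_interval[OF cont[of x]] by (simp add: has_integral_iff)
qed

text \<open>A priori the adjoint operators are only weakly continuous in time. On the domain of
  \<open>op_adj A\<close> the weak identity bounds their increments in norm, linearly in time, and
  density of that domain extends strong continuity to all vectors.\<close>

theorem generates_adjoint:
  fixes S :: "real \<Rightarrow> 'a::{real_inner,banach} \<Rightarrow>\<^sub>L 'a"
  assumes S: "generates A S"
    and dense: "\<And>y. \<exists>Y. (\<forall>n. op_adj A (Y n) \<noteq> None) \<and> Y \<longlonglongrightarrow> y"
  shows "generates (op_adj A) (\<lambda>t. adj (S t))"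
proof -
  note C0 = generates_C0[OF S]
  obtain K where K: "K \<ge> 1" "\<And>s. s \<in> {0..1} \<Longrightarrow> norm (S s) \<le> K"
    using C0_semigroup_bounded[OF C0] by blast
  have K': "norm (adj (S s)) \<le> K" if "s \<in> {0..1}" for s
    using norm_adj_le[of "S s"] K(2)[OF that] by simp
  have dom_bound: "norm (adj (S t) y - y) \<le> K * norm w * t"
    if y: "op_adj A y = Some w" and t: "t \<in> {0..1}" for y w t
  proof (rule norm_le_if_inner_le)
    fix x
    have "(adj (S t) y - y) \<bullet> x = S t x \<bullet> y - x \<bullet> y"
      unfolding inner_diff_left adj_inner_left by (simp add: inner_commute)
    then have "((\<lambda>s. S s x \<bullet> w) has_integral (adj (S t) y - y) \<bullet> x) {0..t}"
      using semigroup_weak_identity[OF S y, of t x] t by simp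
    then have "norm ((adj (S t) y - y) \<bullet> x) \<le> (K * norm x * norm w) * (t - 0)"
    proof (rule has_integral_norm_bound_interval)
      fix s assume s: "s \<in> {0..t}"
      have "norm (S s x \<bullet> w) \<le> norm (S s x) * norm w" by (simp add: Cauchy_Schwarz_ineq2)
      also have "\<dots> \<le> K * norm x * norm w"
        using K(2)[of s] s t
        by (intro mult_right_mono norm_blinfun_le) auto
      finally show "norm (S s x \<bullet> w) \<le> K * norm x * norm w" .
    qed (use K(1) t in auto)
    then show "(adj (S t) y - y) \<bullet> x \<le> K * norm w * t * norm x"
      using t by (simp add: mult_ac)
  qed (use K(1) t in auto)
  have C0': "C0_semigroup (\<lambda>t. adj (S t))"
    unfolding C0_semigroup_def
  proof (intro conjI allI impI)
    show "adj (S 0) = id_blinfun"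
      by (rule blinfun_eqI, rule eq_if_inner_eq) (simp add: adj_inner_left C0_semigroup_zero[OF C0])
    show "adj (S (s + t)) = adj (S s) o\<^sub>L adj (S t)" if "0 \<le> s" "0 \<le> t" for s t
      by (rule blinfun_eqI, rule eq_if_inner_eq)
        (simp add: adj_inner_left add.commute[of s] C0_semigroup_add[OF C0] that)
    fix y
    show "((\<lambda>t. adj (S t) y) \<longlongrightarrow> y) (at_right 0)"
    proof (rule tendstoI)
      fix e :: real assume "e > 0"
      obtain Y where Y: "\<And>n. op_adj A (Y n) \<noteq> None" "Y \<longlonglongrightarrow> y" using dense by blast
      \<comment> \<open>The approximation error of \<open>Y n\<close> enters twice, once multiplied
        by \<open>K\<close> and once as it is.\<close>
      have "e / (2 * (K + 1)) > 0" using K(1) \<open>e > 0\<close> by auto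
      then obtain n where n: "dist (Y n) y < e / (2 * (K + 1))"
        using Y(2) by (meson LIMSEQ_iff_nz metric_LIMSEQ_D order_refl)
      obtain w where w: "op_adj A (Y n) = Some w" using Y(1) by blast
      have "((\<lambda>t. K * norm w * t) \<longlongrightarrow> K * norm w * 0) (at_right 0)" by (intro tendsto_intros)
      then have "\<forall>\<^sub>F t in at_right 0. K * norm w * t < e / 2"
        using \<open>e > 0\<close> by (intro order_tendstoD(2)) auto
      moreover have "\<forall>\<^sub>F t in at_right (0::real). t \<in> {0<..<1}"
        by (rule eventually_at_right_real) simp
      ultimately show "\<forall>\<^sub>F t in at_right 0. dist (adj (S t) y) y < e"
      proof eventually_elim
        case (elim t)
        then have t: "t \<in> {0..1}" by auto
        let ?a = "adj (S t) (y - Y n)" and ?b = "adj (S t) (Y n) - Y n" and ?c = "Y n - y"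
        have "adj (S t) y - y = ?a + ?b + ?c"
          by (simp add: blinfun.diff_right)
        then have "norm (adj (S t) y - y) \<le> norm ?a + norm ?b + norm ?c"
          using norm_triangle_ineq[of "?a + ?b" ?c] norm_triangle_ineq[of ?a ?b] by simp
        moreover have "norm (adj (S t) (y - Y n)) \<le> K * norm (Y n - y)"
          using norm_blinfun_le[OF K'[OF t], of "y - Y n"] by (simp add: norm_minus_commute)
        moreover have "norm (adj (S t) (Y n) - Y n) \<le> K * norm w * t" by (rule dom_bound[OF w t])
        moreover have "(K + 1) * norm (Y n - y) \<le> e / 2"
          using n K(1) by (simp add: dist_norm pos_less_divide_eq field_simps less_imp_le)
        ultimately show ?case using elim by (simp add: dist_norm distrib_right)
      qed
    qed
  qed
  have "op_adj A y = Some w \<longleftrightarrow> ((\<lambda>h. (adj (S h) y - y) /\<^sub>R h) \<longlongrightarrow> w) (at_right 0)" for y w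
  proof
    assume y: "op_adj A y = Some w"
    show "((\<lambda>h. (adj (S h) y - y) /\<^sub>R h) \<longlongrightarrow> w) (at_right 0)"
    proof (rule tendstoI)
      fix e :: real assume "e > 0"
      have "((\<lambda>t. adj (S t) w) \<longlongrightarrow> w) (at_right 0)"
        using C0' by (simp add: C0_semigroup_def)
      then have "\<forall>\<^sub>F t in at_right 0. dist (adj (S t) w) w < e / 2"
        using \<open>e > 0\<close> by (intro tendstoD) auto
      then obtain d where d: "d > 0" "\<And>t. 0 < t \<Longrightarrow> t < d \<Longrightarrow> dist (adj (S t) w) w < e / 2"
        unfolding eventually_at_right_field by auto
      have d0: "norm (adj (S t) w - w) \<le> e / 2" if "0 \<le> t" "t < d" for t
        using d(2)[of t] that \<open>e > 0\<close> C0_semigroup_zero[OF C0', of w]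
        by (cases "t = 0") (auto simp: dist_norm less_imp_le)
      have "\<forall>\<^sub>F h in at_right (0::real). h \<in> {0<..<d}" by (rule eventually_at_right_real) (rule d)
      then show "\<forall>\<^sub>F h in at_right 0. dist ((adj (S h) y - y) /\<^sub>R h) w < e"
      proof eventually_elim
        case (elim h)
        \<comment> \<open>Tested with \<open>x\<close>, the remainder is the integral over {0..h} of
          \<open>(adj (S s) w - w) \<bullet> x\<close>, which continuity of the adjoint semigroup at
          zero makes small compared with \<open>h\<close>.\<close>
        have "norm (adj (S h) y - y - h *\<^sub>R w) \<le> e / 2 * h"
        proof (rule norm_le_if_inner_le)
          fix x
          have "((\<lambda>s. S s x \<bullet> w - x \<bullet> w) has_integral ((S h x \<bullet> y - x \<bullet> y) - h * (x \<bullet> w))) {0..h}"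
            using has_integral_diff[OF semigroup_weak_identity[OF S y, of h x] has_integral_const_real[of "x \<bullet> w" 0 h]] elim
            by simp
          then have "norm ((S h x \<bullet> y - x \<bullet> y) - h * (x \<bullet> w)) \<le> (e / 2 * norm x) * (h - 0)"
          proof (rule has_integral_norm_bound_interval)
            fix s assume s: "s \<in> {0..h}"
            have "S s x \<bullet> w - x \<bullet> w = (adj (S s) w - w) \<bullet> x"
              unfolding inner_diff_left adj_inner_left by (simp add: inner_commute)
            also have "norm \<dots> \<le> norm (adj (S s) w - w) * norm x" by (simp add: Cauchy_Schwarz_ineq2)
            also have "\<dots> \<le> e / 2 * norm x" using s elim by (intro mult_right_mono d0) auto
            finally show "norm (S s x \<bullet> w - x \<bullet> w) \<le> e / 2 * norm x" .
          qed (use \<open>e > 0\<close> elim in auto)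
          moreover have "(S h x \<bullet> y - x \<bullet> y) - h * (x \<bullet> w) = (adj (S h) y - y - h *\<^sub>R w) \<bullet> x"
            unfolding inner_diff_left adj_inner_left by (simp add: inner_commute)
          ultimately show "(adj (S h) y - y - h *\<^sub>R w) \<bullet> x \<le> e / 2 * h * norm x"
            using elim by (simp add: mult_ac)
        qed (use elim \<open>e > 0\<close> in auto)
        moreover have "(adj (S h) y - y) /\<^sub>R h - w = (adj (S h) y - y - h *\<^sub>R w) /\<^sub>R h"
          using elim by (simp add: scaleR_diff_right)
        moreover have "norm ((adj (S h) y - y - h *\<^sub>R w) /\<^sub>R h) = norm (adj (S h) y - y - h *\<^sub>R w) / h"
          using elim by (simp add: divide_inverse mult.commute)
        ultimately have "norm ((adj (S h) y - y) /\<^sub>R h - w) \<le> e / 2"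
          using elim by (simp only: pos_divide_le_eq greaterThanLessThan_iff)
        then show ?case using \<open>e > 0\<close> by (simp add: dist_norm)
      qed
    qed
  next
    assume lim: "((\<lambda>h. (adj (S h) y - y) /\<^sub>R h) \<longlongrightarrow> w) (at_right 0)"
    have "z \<bullet> y = x \<bullet> w" if x: "A x = Some z" for x z
    proof (rule tendsto_unique[of "at_right (0::real)"])
      show "((\<lambda>h. ((S h x - x) /\<^sub>R h) \<bullet> y) \<longlongrightarrow> z \<bullet> y) (at_right 0)"
        using S x by (intro tendsto_intros) (simp add: generates_def)
      have "((\<lambda>h. x \<bullet> ((adj (S h) y - y) /\<^sub>R h)) \<longlongrightarrow> x \<bullet> w) (at_right 0)"
        by (intro tendsto_intros lim)
      then show "((\<lambda>h. ((S h x - x) /\<^sub>R h) \<bullet> y) \<longlongrightarrow> x \<bullet> w) (at_right 0)"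
        by (simp add: inner_diff_left inner_diff_right adj_inner)
    qed simp
    then show "op_adj A y = Some w" by (simp add: op_adj_iff[OF S])
  qed
  with C0' show ?thesis by (simp add: generates_def)
qed

section \<open>Mild and weak solutions\<close>

text \<open>Both notions are tested against vectors, and \<open>S\<close> acts on the test side:
  \<open>y' = G\<^sup>* y + g\<close>, where \<open>S\<close> is the semigroup of \<open>G\<close>. Testing makes bounded perturbations of
  the generator trivial for weak solutions.\<close>

definition mild_sol ::
  "(real \<Rightarrow> 'a::real_inner \<Rightarrow>\<^sub>L 'a) \<Rightarrow> real \<Rightarrow> real \<Rightarrow> (real \<Rightarrow> 'a) \<Rightarrow> (real \<Rightarrow> 'a) \<Rightarrow> bool" where
  "mild_sol S a b g y \<longleftrightarrow> (\<forall>t1 t2 x. a \<le> t1 \<longrightarrow> t1 \<le> t2 \<longrightarrow> t2 \<le> b \<longrightarrow>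
     ((\<lambda>s. g s \<bullet> S (t2 - s) x) has_integral (y t2 \<bullet> x - y t1 \<bullet> S (t2 - t1) x)) {t1..t2})"

definition weak_sol ::
  "('a::real_inner \<rightharpoonup> 'a) \<Rightarrow> real \<Rightarrow> real \<Rightarrow> (real \<Rightarrow> 'a) \<Rightarrow> (real \<Rightarrow> 'a) \<Rightarrow> bool" where
  "weak_sol G a b g y \<longleftrightarrow> (\<forall>x z t1 t2. G x = Some z \<longrightarrow> a \<le> t1 \<longrightarrow> t1 \<le> t2 \<longrightarrow> t2 \<le> b \<longrightarrow>
     ((\<lambda>s. y s \<bullet> z + g s \<bullet> x) has_integral (y t2 \<bullet> x - y t1 \<bullet> x)) {t1..t2})"

text \<open>A symmetric relation, so that forward and backward results are instances of one another
  with \<open>S\<close> and \<open>S'\<close> exchanged.\<close>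

definition dual_semigroups ::
  "(real \<Rightarrow> 'a::real_inner \<Rightarrow>\<^sub>L 'a) \<Rightarrow> (real \<Rightarrow> 'a \<Rightarrow>\<^sub>L 'a) \<Rightarrow> bool" where
  "dual_semigroups S S' \<longleftrightarrow> C0_semigroup S \<and> C0_semigroup S' \<and>
     (\<forall>t\<ge>0. \<forall>x y. S t x \<bullet> y = x \<bullet> S' t y)"

lemma dual_semigroups_sym: "dual_semigroups S S' \<Longrightarrow> dual_semigroups S' S"
  by (auto simp: dual_semigroups_def) (metis inner_commute)

lemma has_integral_uniform_limit:
  fixes f :: "nat \<Rightarrow> real \<Rightarrow> real"
  assumes f: "\<And>n. (f n has_integral I n) {a..b}" and cont: "continuous_on {a..b} g"
    and le: "\<And>n t. t \<in> {a..b} \<Longrightarrow> \<bar>f n t - g t\<bar> \<le> e n" and e: "e \<longlonglongrightarrow> 0" "\<And>n. 0 \<le> e n"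
    and I: "I \<longlonglongrightarrow> J" and "a \<le> b"
  shows "(g has_integral J) {a..b}"
proof -
  have g: "(g has_integral integral {a..b} g) {a..b}"
    using integrable_continuous_interval[OF cont] by (simp add: has_integral_integral)
  have "(\<lambda>n. I n - integral {a..b} g) \<longlonglongrightarrow> 0"
  proof (rule Lim_null_comparison)
    have "norm (I n - integral {a..b} g) \<le> e n * (b - a)" for n
      by (rule has_integral_norm_bound_interval[OF has_integral_diff[OF f g]]) (use le e assms in auto)
    then show "\<forall>\<^sub>F n in sequentially. norm (I n - integral {a..b} g) \<le> e n * (b - a)" by simp
    show "(\<lambda>n. e n * (b - a)) \<longlonglongrightarrow> 0" using tendsto_mult_right[OF e(1), of "b - a"] by simp
  qed
  then have "J = integral {a..b} g" using I LIM_zero_cancel LIMSEQ_unique by blast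
  with g show ?thesis by simp
qed

text \<open>Duhamel's formula from the left end point suffices: used at \<open>t1\<close> with the
  test vector \<open>S (t2 - t1) x\<close>, it yields the part of the integral over {a..t1}, which
  is subtracted from the one over {a..t2}.\<close>

lemma mild_solI:
  fixes S :: "real \<Rightarrow> 'a::{real_inner,banach} \<Rightarrow>\<^sub>L 'a"
  assumes S: "C0_semigroup S"
    and base: "\<And>t x. t \<in> {a..b} \<Longrightarrow>
      ((\<lambda>s. g s \<bullet> S (t - s) x) has_integral (y t \<bullet> x - y a \<bullet> S (t - a) x)) {a..t}"
  shows "mild_sol S a b g y"
  unfolding mild_sol_def
proof (intro allI impI)
  fix t1 t2 x assume t: "a \<le> t1" "t1 \<le> t2" "t2 \<le> b"
  let ?f = "\<lambda>s. g s \<bullet> S (t2 - s) x"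
  have "((\<lambda>s. g s \<bullet> S (t1 - s) (S (t2 - t1) x)) has_integral
      (y t1 \<bullet> S (t2 - t1) x - y a \<bullet> S (t1 - a) (S (t2 - t1) x))) {a..t1}"
    using t by (intro base) auto
  moreover have "S (t1 - s) (S (t2 - t1) x) = S (t2 - s) x" if "s \<in> {a..t1}" for s
    using C0_semigroup_add[OF S, of "t1 - s" "t2 - t1" x] that t by simp
  ultimately have 1: "(?f has_integral (y t1 \<bullet> S (t2 - t1) x - y a \<bullet> S (t2 - a) x)) {a..t1}"
    using t has_integral_cong[of "{a..t1}" "\<lambda>s. g s \<bullet> S (t1 - s) (S (t2 - t1) x)" ?f] by simp
  have 2: "(?f has_integral (y t2 \<bullet> x - y a \<bullet> S (t2 - a) x)) {a..t2}"
    using t by (intro base) auto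
  then have "?f integrable_on {t1..t2}"
    using t by (auto intro: integrable_subinterval_real)
  then have 3: "(?f has_integral integral {t1..t2} ?f) {t1..t2}" by (simp add: has_integral_integral)
  have "(y t1 \<bullet> S (t2 - t1) x - y a \<bullet> S (t2 - a) x) + integral {t1..t2} ?f
      = y t2 \<bullet> x - y a \<bullet> S (t2 - a) x"
    using has_integral_unique[OF has_integral_combine[OF t(1,2) 1 3] 2] .
  then have "integral {t1..t2} ?f = y t2 \<bullet> x - y t1 \<bullet> S (t2 - t1) x" by simp
  with 3 show "(?f has_integral (y t2 \<bullet> x - y t1 \<bullet> S (t2 - t1) x)) {t1..t2}" by simp
qed

lemma mild_sol_subset:
  "mild_sol S a b g y \<Longrightarrow> a \<le> c \<Longrightarrow> d \<le> b \<Longrightarrow> mild_sol S c d g y"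
  unfolding mild_sol_def by (meson order_trans)

lemma mild_sol_combine:
  fixes S :: "real \<Rightarrow> 'a::{real_inner,banach} \<Rightarrow>\<^sub>L 'a"
  assumes S: "C0_semigroup S" and 1: "mild_sol S a b g y" and 2: "mild_sol S b c g y"
    and "a \<le> b" "b \<le> c"
  shows "mild_sol S a c g y"
proof (rule mild_solI[OF S])
  fix t x assume t: "t \<in> {a..c}"
  show "((\<lambda>s. g s \<bullet> S (t - s) x) has_integral (y t \<bullet> x - y a \<bullet> S (t - a) x)) {a..t}"
  proof (cases "t \<le> b")
    case True
    then show ?thesis using 1 t unfolding mild_sol_def by simp
  next
    case False
    have "((\<lambda>s. g s \<bullet> S (b - s) (S (t - b) x)) has_integral
        (y b \<bullet> S (t - b) x - y a \<bullet> S (b - a) (S (t - b) x))) {a..b}"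
      using 1 assms(4) unfolding mild_sol_def by simp
    moreover have "S (b - s) (S (t - b) x) = S (t - s) x" if "s \<in> {a..b}" for s
      using C0_semigroup_add[OF S, of "b - s" "t - b" x] that False by simp
    ultimately have "((\<lambda>s. g s \<bullet> S (t - s) x) has_integral
        (y b \<bullet> S (t - b) x - y a \<bullet> S (t - a) x)) {a..b}"
      using assms(4) has_integral_cong[of "{a..b}" "\<lambda>s. g s \<bullet> S (b - s) (S (t - b) x)" "\<lambda>s. g s \<bullet> S (t - s) x"]
      by simp
    moreover have "((\<lambda>s. g s \<bullet> S (t - s) x) has_integral (y t \<bullet> x - y b \<bullet> S (t - b) x)) {b..t}"
      using 2 t False unfolding mild_sol_def by simp
    ultimately have "((\<lambda>s. g s \<bullet> S (t - s) x) has_integral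
        ((y b \<bullet> S (t - b) x - y a \<bullet> S (t - a) x) + (y t \<bullet> x - y b \<bullet> S (t - b) x))) {a..t}"
      using False by (intro has_integral_combine[OF assms(4)]) auto
    then show ?thesis by simp
  qed
qed

lemma mild_sol_add:
  assumes "mild_sol S a b g y" "mild_sol S a b h z"
  shows "mild_sol S a b (\<lambda>t. g t + h t) (\<lambda>t. y t + z t)"
  unfolding mild_sol_def
proof (intro allI impI)
  fix t1 t2 x assume "a \<le> t1" "t1 \<le> t2" "t2 \<le> b"
  then have "((\<lambda>s. g s \<bullet> S (t2 - s) x) has_integral (y t2 \<bullet> x - y t1 \<bullet> S (t2 - t1) x)) {t1..t2}"
    "((\<lambda>s. h s \<bullet> S (t2 - s) x) has_integral (z t2 \<bullet> x - z t1 \<bullet> S (t2 - t1) x)) {t1..t2}"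
    using assms by (auto simp: mild_sol_def)
  from has_integral_add[OF this]
  show "((\<lambda>s. (g s + h s) \<bullet> S (t2 - s) x) has_integral
      ((y t2 + z t2) \<bullet> x - (y t1 + z t1) \<bullet> S (t2 - t1) x)) {t1..t2}"
    by (simp add: inner_add_left algebra_simps)
qed

lemma mild_sol_diff:
  assumes "mild_sol S a b g y" "mild_sol S a b h z"
  shows "mild_sol S a b (\<lambda>t. g t - h t) (\<lambda>t. y t - z t)"
  unfolding mild_sol_def
proof (intro allI impI)
  fix t1 t2 x assume "a \<le> t1" "t1 \<le> t2" "t2 \<le> b"
  then have "((\<lambda>s. g s \<bullet> S (t2 - s) x) has_integral (y t2 \<bullet> x - y t1 \<bullet> S (t2 - t1) x)) {t1..t2}"
    "((\<lambda>s. h s \<bullet> S (t2 - s) x) has_integral (z t2 \<bullet> x - z t1 \<bullet> S (t2 - t1) x)) {t1..t2}"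
    using assms by (auto simp: mild_sol_def)
  from has_integral_diff[OF this]
  show "((\<lambda>s. (g s - h s) \<bullet> S (t2 - s) x) has_integral
      ((y t2 - z t2) \<bullet> x - (y t1 - z t1) \<bullet> S (t2 - t1) x)) {t1..t2}"
    by (simp add: inner_diff_left algebra_simps)
qed

lemma mild_sol_cong_AE:
  assumes "mild_sol S a b g y" "negligible N" "\<And>t. t \<in> {a..b} - N \<Longrightarrow> h t = g t"
    "\<And>t. t \<in> {a..b} \<Longrightarrow> z t = y t"
  shows "mild_sol S a b h z"
  unfolding mild_sol_def
proof (intro allI impI)
  fix t1 t2 x assume t: "a \<le> t1" "t1 \<le> t2" "t2 \<le> b"
  have "((\<lambda>s. g s \<bullet> S (t2 - s) x) has_integral (y t2 \<bullet> x - y t1 \<bullet> S (t2 - t1) x)) {t1..t2}"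
    using assms(1) t by (auto simp: mild_sol_def)
  then have "((\<lambda>s. h s \<bullet> S (t2 - s) x) has_integral (y t2 \<bullet> x - y t1 \<bullet> S (t2 - t1) x)) {t1..t2}"
    by (rule has_integral_spike[OF assms(2), rotated]) (use assms(3) t in auto)
  with assms(4) t show "((\<lambda>s. h s \<bullet> S (t2 - s) x) has_integral (z t2 \<bullet> x - z t1 \<bullet> S (t2 - t1) x)) {t1..t2}"
    by simp
qed

lemma weak_sol_perturb:
  fixes F :: "'a::{real_inner,banach} \<Rightarrow>\<^sub>L 'a"
  shows "weak_sol (op_plus G F) a b g y \<longleftrightarrow> weak_sol G a b (\<lambda>t. g t + adj F (y t)) y"
proof -
  have "op_plus G F x = Some z \<longleftrightarrow> (\<exists>z0. G x = Some z0 \<and> z = z0 + F x)" for x z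
    by (auto simp: op_plus_def)
  moreover have "y s \<bullet> z + (g s + adj F (y s)) \<bullet> x = y s \<bullet> (z + F x) + g s \<bullet> x" for s x z
    by (simp add: adj_inner_left inner_add_left inner_add_right)
  ultimately show ?thesis
    unfolding weak_sol_def by (simp only:) blast
qed

lemma weak_sol_diff:
  assumes "weak_sol G a b g y" "weak_sol G a b h z"
  shows "weak_sol G a b (\<lambda>t. g t - h t) (\<lambda>t. y t - z t)"
  unfolding weak_sol_def
proof (intro allI impI)
  fix x w t1 t2 assume "G x = Some w" "a \<le> t1" "t1 \<le> t2" "t2 \<le> b"
  then have "((\<lambda>s. y s \<bullet> w + g s \<bullet> x) has_integral (y t2 \<bullet> x - y t1 \<bullet> x)) {t1..t2}"
    "((\<lambda>s. z s \<bullet> w + h s \<bullet> x) has_integral (z t2 \<bullet> x - z t1 \<bullet> x)) {t1..t2}"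
    using assms by (auto simp: weak_sol_def)
  from has_integral_diff[OF this]
  show "((\<lambda>s. (y s - z s) \<bullet> w + (g s - h s) \<bullet> x) has_integral ((y t2 - z t2) \<bullet> x - (y t1 - z t1) \<bullet> x)) {t1..t2}"
    by (simp add: inner_diff_left algebra_simps)
qed

lemma has_vector_derivative_iff_quotient:
  fixes f :: "real \<Rightarrow> 'a::real_normed_vector"
  shows "(f has_vector_derivative z) (at t within D)
    \<longleftrightarrow> ((\<lambda>r. (f r - f t) /\<^sub>R (r - t)) \<longlongrightarrow> z) (at t within D)"
proof -
  have "norm ((1 / norm (r - t)) *\<^sub>R (f r - (f t + (r - t) *\<^sub>R z))) = norm ((f r - f t) /\<^sub>R (r - t) - z)"
    if "r \<noteq> t" for r
  proof -
    have "f r - (f t + (r - t) *\<^sub>R z) = (r - t) *\<^sub>R ((f r - f t) /\<^sub>R (r - t) - z)"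
      using that by (simp add: scaleR_diff_right)
    then show ?thesis using that by simp
  qed
  then have "((\<lambda>r. norm ((1 / norm (r - t)) *\<^sub>R (f r - (f t + (r - t) *\<^sub>R z)))) \<longlongrightarrow> 0) (at t within D)
    \<longleftrightarrow> ((\<lambda>r. norm ((f r - f t) /\<^sub>R (r - t) - z)) \<longlongrightarrow> 0) (at t within D)"
    by (intro tendsto_cong) (auto simp: eventually_at_filter)
  then have "((\<lambda>r. (1 / norm (r - t)) *\<^sub>R (f r - (f t + (r - t) *\<^sub>R z))) \<longlongrightarrow> 0) (at t within D)
    \<longleftrightarrow> ((\<lambda>r. (f r - f t) /\<^sub>R (r - t)) \<longlongrightarrow> z) (at t within D)"
    unfolding tendsto_norm_zero_iff LIM_zero_iff .
  then show ?thesis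
    unfolding has_vector_derivative_def has_derivative_within by (simp add: bounded_linear_scaleR_left)
qed

text \<open>For \<open>x\<close> in the domain,
  \<open>r \<mapsto> y r \<bullet> S (t2 - r) x\<close> is differentiable: the second factor
  strongly, the first only when tested against a fixed vector of the domain. The two generator terms
  cancel and leave the source. Density and a uniform bound then reach every
  \<open>x\<close>.\<close>

lemma weak_sol_imp_mild_sol_continuous:
  fixes S :: "real \<Rightarrow> 'a::{real_inner,banach} \<Rightarrow>\<^sub>L 'a"
  assumes S: "generates G S" and weak: "weak_sol G a b g y"
    and y: "continuous_on {a..b} y" and g: "continuous_on {a..b} g"
  shows "mild_sol S a b g y"
  unfolding mild_sol_def
proof (intro allI impI)
  note C0 = generates_C0[OF S]
  fix t1 t2 x assume t: "a \<le> t1" "t1 \<le> t2" "t2 \<le> b"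
  have cy: "continuous_on {t1..t2} y" and cg: "continuous_on {t1..t2} g"
    using y g t by (auto intro: continuous_on_subset)
  have cS: "continuous_on {t1..t2} (\<lambda>s. S (t2 - s) x)" for x
    by (intro C0_semigroup_continuous_compose[OF C0, where \<tau> = "t2 - t1"] continuous_intros) auto
  have dom: "((\<lambda>s. g s \<bullet> S (t2 - s) x) has_integral (y t2 \<bullet> x - y t1 \<bullet> S (t2 - t1) x)) {t1..t2}"
    if x: "G x = Some z" for x z
  proof -
    have "((\<lambda>r. y r \<bullet> S (t2 - r) x) has_vector_derivative (g s \<bullet> S (t2 - s) x)) (at s within {t1..t2})"
      if s: "s \<in> {t1..t2}" for s
    proof -
      \<comment> \<open>The test vector is frozen at time \<open>s\<close>; it stays in the domain
        because the semigroup preserves it.\<close>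
      define x' where "x' = S (t2 - s) x"
      define z' where "z' = S (t2 - s) z"
      have Gx': "G x' = Some z'"
        unfolding x'_def z'_def using s by (intro generator_commutes[OF S x]) simp
      have eq: "y r \<bullet> x' = y t1 \<bullet> x' + integral {t1..r} (\<lambda>s. y s \<bullet> z' + g s \<bullet> x')" if "r \<in> {t1..t2}" for r
      proof -
        have "((\<lambda>s. y s \<bullet> z' + g s \<bullet> x') has_integral (y r \<bullet> x' - y t1 \<bullet> x')) {t1..r}"
          using weak Gx' t that unfolding weak_sol_def by auto
        then show ?thesis by (simp add: integral_unique)
      qed
      have deriv: "((\<lambda>r. y t1 \<bullet> x' + integral {t1..r} (\<lambda>s. y s \<bullet> z' + g s \<bullet> x')) has_vector_derivative
          0 + (y s \<bullet> z' + g s \<bullet> x')) (at s within {t1..t2})"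
        using s by (intro has_vector_derivative_add has_vector_derivative_const integral_has_vector_derivative
            continuous_intros cy cg)
      have D1: "((\<lambda>r. y r \<bullet> x') has_vector_derivative 0 + (y s \<bullet> z' + g s \<bullet> x')) (at s within {t1..t2})"
        by (rule has_vector_derivative_transform[OF s eq deriv])
      have "((\<lambda>r. S r x) has_vector_derivative S (t2 - s) z) (at (t2 - s) within (\<lambda>r. t2 - r) ` {t1..t2})"
        using s by (intro has_vector_derivative_within_subset[OF semigroup_has_vector_derivative[OF S x, of "t2 - s" "t2 - t1"]]) auto
      then have "(((\<lambda>r. S r x) \<circ> (\<lambda>r. t2 - r)) has_vector_derivative (- 1) *\<^sub>R S (t2 - s) z) (at s within {t1..t2})"
        by (intro vector_diff_chain_within) (auto intro!: derivative_eq_intros)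
      then have D2: "((\<lambda>r. S (t2 - r) x) has_vector_derivative - z') (at s within {t1..t2})"
        by (simp add: o_def z'_def)
      have q1: "((\<lambda>r. (y r \<bullet> x' - y s \<bullet> x') / (r - s)) \<longlongrightarrow> y s \<bullet> z' + g s \<bullet> x') (at s within {t1..t2})"
        using D1 by (simp add: has_real_derivative_iff_has_vector_derivative[symmetric] has_field_derivative_iff)
      have q2: "((\<lambda>r. (S (t2 - r) x - S (t2 - s) x) /\<^sub>R (r - s)) \<longlongrightarrow> - z') (at s within {t1..t2})"
        using D2 by (simp add: has_vector_derivative_iff_quotient)
      have "((\<lambda>r. (y r \<bullet> x' - y s \<bullet> x') / (r - s) + y r \<bullet> ((S (t2 - r) x - S (t2 - s) x) /\<^sub>R (r - s)))
          \<longlongrightarrow> (y s \<bullet> z' + g s \<bullet> x') + y s \<bullet> (- z')) (at s within {t1..t2})"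
        using cy s by (intro tendsto_add tendsto_inner q1 q2) (auto simp: continuous_on_def)
      moreover have "(y r \<bullet> x' - y s \<bullet> x') / (r - s) + y r \<bullet> ((S (t2 - r) x - S (t2 - s) x) /\<^sub>R (r - s))
          = (y r \<bullet> S (t2 - r) x - y s \<bullet> S (t2 - s) x) / (r - s)" for r
        by (simp add: x'_def inner_diff_right divide_inverse algebra_simps)
      ultimately show ?thesis
        by (simp add: has_real_derivative_iff_has_vector_derivative[symmetric] has_field_derivative_iff x'_def)
    qed
    from fundamental_theorem_of_calculus[OF t(2) this]
    show ?thesis by (simp add: C0_semigroup_zero[OF C0])
  qed
  obtain X where X: "\<And>n. G (X n) \<noteq> None" "X \<longlonglongrightarrow> x"
    using generator_dense[OF S] by blast
  obtain K where K: "K \<ge> 1" "\<And>s. s \<in> {0..t2 - t1} \<Longrightarrow> norm (S s) \<le> K"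
    using C0_semigroup_bounded[OF C0] by blast
  have "bounded (g ` {t1..t2})"
    using cg by (intro compact_imp_bounded compact_continuous_image) auto
  then obtain L where "\<forall>x\<in>g ` {t1..t2}. norm x \<le> L" by (auto simp: bounded_iff)
  then have L: "norm (g s) \<le> L" if "s \<in> {t1..t2}" for s using that by blast
  have "0 \<le> L" using order_trans[OF norm_ge_zero L[of t1]] t by simp
  show "((\<lambda>s. g s \<bullet> S (t2 - s) x) has_integral (y t2 \<bullet> x - y t1 \<bullet> S (t2 - t1) x)) {t1..t2}"
  proof (rule has_integral_uniform_limit)
    show "((\<lambda>s. g s \<bullet> S (t2 - s) (X n)) has_integral (y t2 \<bullet> X n - y t1 \<bullet> S (t2 - t1) (X n))) {t1..t2}" for n
      using X(1)[of n] dom by blast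
    show "continuous_on {t1..t2} (\<lambda>s. g s \<bullet> S (t2 - s) x)" by (intro continuous_intros cg cS)
    show "\<bar>g s \<bullet> S (t2 - s) (X n) - g s \<bullet> S (t2 - s) x\<bar> \<le> L * (K * norm (X n - x))" if "s \<in> {t1..t2}" for n s
    proof -
      have "\<bar>g s \<bullet> S (t2 - s) (X n - x)\<bar> \<le> norm (g s) * norm (S (t2 - s) (X n - x))"
        by (rule Cauchy_Schwarz_ineq2)
      also have "\<dots> \<le> L * (K * norm (X n - x))"
        using that by (intro mult_mono L norm_blinfun_le K \<open>0 \<le> L\<close>) auto
      finally show ?thesis by (simp add: blinfun.diff_right inner_diff_right)
    qed
    have "(\<lambda>n. L * (K * norm (X n - x))) \<longlonglongrightarrow> L * (K * norm (x - x))" by (intro tendsto_intros X)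
    then show "(\<lambda>n. L * (K * norm (X n - x))) \<longlonglongrightarrow> 0" by simp
    show "0 \<le> L * (K * norm (X n - x))" for n using \<open>0 \<le> L\<close> K(1) by simp
    show "(\<lambda>n. y t2 \<bullet> X n - y t1 \<bullet> S (t2 - t1) (X n)) \<longlonglongrightarrow> y t2 \<bullet> x - y t1 \<bullet> S (t2 - t1) x"
      by (intro tendsto_intros X blinfun.tendsto[OF tendsto_const])
  qed (use t in simp)
qed

subsection \<open>Duality pairing of a forward and a backward solution\<close>

text \<open>Difference quotients are dominated by the Lipschitz constants \<open>\<beta> s\<close>.
  The diagonal \<open>s = r\<close>, where the kernel may have a kink, is a null set for each
  \<open>r\<close>.\<close>

lemma leibniz_dominated:
  fixes k k' :: "real \<Rightarrow> real \<Rightarrow> real" and a b :: real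
  defines "M \<equiv> lebesgue_on {a..b}"
  assumes int: "\<And>r. r \<in> {a..b} \<Longrightarrow> integrable M (\<lambda>s. k s r)"
    and meas: "\<And>r. r \<in> {a..b} \<Longrightarrow> (\<lambda>s. k' s r) \<in> borel_measurable M"
    and deriv: "\<And>s r. s \<in> {a..b} \<Longrightarrow> r \<in> {a..b} \<Longrightarrow> s \<noteq> r \<Longrightarrow>
      (k s has_real_derivative k' s r) (at r within {a..b})"
    and lip: "\<And>s r q. s \<in> {a..b} \<Longrightarrow> r \<in> {a..b} \<Longrightarrow> q \<in> {a..b} \<Longrightarrow> \<bar>k s r - k s q\<bar> \<le> \<beta> s * \<bar>r - q\<bar>"
    and \<beta>: "integrable M \<beta>" and r: "r \<in> {a..b}"
  shows "((\<lambda>r. integral\<^sup>L M (\<lambda>s. k s r)) has_vector_derivative integral\<^sup>L M (\<lambda>s. k' s r)) (at r within {a..b})"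
  unfolding has_real_derivative_iff_has_vector_derivative[symmetric] has_field_derivative_iff
    tendsto_at_iff_sequentially
proof (intro allI impI)
  fix X assume X: "\<forall>i. X i \<in> {a..b} - {r}" "X \<longlonglongrightarrow> r"
  let ?q = "\<lambda>i s. (k s (X i) - k s r) / (X i - r)"
  have sp: "space M = {a..b}" by (simp add: M_def)
  have lim: "(\<lambda>i. integral\<^sup>L M (?q i)) \<longlonglongrightarrow> integral\<^sup>L M (\<lambda>s. k' s r)"
  proof (rule integral_dominated_convergence[OF meas[OF r] _ \<beta>])
    show "?q i \<in> borel_measurable M" for i
      using int X r by (intro borel_measurable_divide borel_measurable_diff borel_measurable_integrable) auto
    have "AE s in lebesgue. s \<noteq> r"
      using negligible_sing[of r] by (intro AE_I'[of "{r}"]) (auto simp: negligible_iff_null_sets)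
    then have "AE s in M. s \<noteq> r"
      unfolding M_def by (simp add: AE_restrict_space_iff) (erule eventually_mono, simp)
    then show "AE s in M. (\<lambda>i. ?q i s) \<longlonglongrightarrow> k' s r"
      using AE_space
    proof eventually_elim
      case (elim s)
      then have "(k s has_real_derivative k' s r) (at r within {a..b})"
        using deriv r sp by auto
      then have "((\<lambda>q. (k s q - k s r) / (q - r)) \<longlongrightarrow> k' s r) (at r within {a..b})"
        by (simp add: has_field_derivative_iff)
      then show ?case using X unfolding tendsto_at_iff_sequentially o_def by blast
    qed
    show "AE s in M. norm (?q i s) \<le> \<beta> s" for i
    proof (rule AE_I2)
      fix s assume "s \<in> space M"
      then have "\<bar>k s (X i) - k s r\<bar> \<le> \<beta> s * \<bar>X i - r\<bar>" using lip X r sp by auto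
      then show "norm (?q i s) \<le> \<beta> s" using X by (simp add: abs_divide pos_divide_le_eq)
    qed
  qed
  have eq: "integral\<^sup>L M (?q i) = (integral\<^sup>L M (\<lambda>s. k s (X i)) - integral\<^sup>L M (\<lambda>s. k s r)) / (X i - r)" for i
  proof -
    have "integral\<^sup>L M (\<lambda>s. k s (X i) - k s r) = integral\<^sup>L M (\<lambda>s. k s (X i)) - integral\<^sup>L M (\<lambda>s. k s r)"
      using int X r by (intro Bochner_Integration.integral_diff) auto
    then show ?thesis by simp
  qed
  show "((\<lambda>q. (integral\<^sup>L M (\<lambda>s. k s q) - integral\<^sup>L M (\<lambda>s. k s r)) / (q - r)) \<circ> X)
      \<longlonglongrightarrow> integral\<^sup>L M (\<lambda>s. k' s r)"
    using lim unfolding eq o_def .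
qed

lemma L1_on_imp_integrable:
  fixes f :: "real \<Rightarrow> real"
  assumes "L1_on a b f"
  shows "integrable (lebesgue_on {a..b}) f"
  using assms strongly_measurable_borel_interval[of a b f] unfolding L1_on_def
  by (blast intro: integrable_norm_cancel)

lemma L1_on_inner:
  fixes f :: "real \<Rightarrow> 'a::{real_inner,banach}"
  assumes f: "L1_on a b f" and l: "continuous_on {a..b} l"
  shows "L1_on a b (\<lambda>t. l t \<bullet> f t)"
proof -
  have "bounded (l ` {a..b})"
    using l by (intro compact_imp_bounded compact_continuous_image) auto
  then obtain K where "\<forall>x\<in>l ` {a..b}. norm x \<le> K" by (auto simp: bounded_iff)
  then have K: "norm (l s) \<le> K" if "s \<in> {a..b}" for s using that by blast
  have "L1_on a b (\<lambda>t. blinfun_inner_right (l t) (f t))"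
  proof (rule L1_on_operator_family[OF f])
    show "continuous_on {a..b} (\<lambda>t. blinfun_inner_right (l t) x)" for x
      by (simp add: l continuous_intros)
    show "norm (blinfun_inner_right (l t)) \<le> K" if "t \<in> {a..b}" for t
    proof (rule norm_blinfun_bound)
      show "0 \<le> K" using K[OF that] norm_ge_zero[of "l t"] by linarith
      show "norm (blinfun_inner_right (l t) x) \<le> K * norm x" for x
        using Cauchy_Schwarz_ineq2[of "l t" x] mult_right_mono[OF K[OF that], of "norm x"] by simp
    qed
  qed
  then show ?thesis by simp
qed

lemma L1_on_semigroup:
  fixes S :: "real \<Rightarrow> 'a::{real_inner,banach} \<Rightarrow>\<^sub>L 'a"
  assumes S: "C0_semigroup S" and g: "L1_on a b g"
  shows "L1_on a b (\<lambda>s. S (max 0 (r - s)) (g s))"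
proof -
  obtain K where K: "K \<ge> 1" "\<And>s. s \<in> {0..\<bar>r - a\<bar>} \<Longrightarrow> norm (S s) \<le> K"
    using C0_semigroup_bounded[OF S] by blast
  show ?thesis
  proof (rule L1_on_operator_family[OF g])
    show "continuous_on {a..b} (\<lambda>t. S (max 0 (r - t)) x)" for x
      by (intro C0_semigroup_continuous_compose[OF S, where \<tau> = "\<bar>r - a\<bar>"] continuous_intros) auto
    show "norm (S (max 0 (r - t))) \<le> K" if "t \<in> {a..b}" for t
      using that by (intro K) auto
  qed
qed

lemma integrable_lebesgue_on_if:
  fixes f :: "real \<Rightarrow> real"
  assumes "integrable (lebesgue_on {a..b}) f"
  shows "integrable (lebesgue_on {a..b}) (\<lambda>s. if s \<le> r then f s else 0)"
proof (rule Bochner_Integration.integrable_bound[OF assms])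
  have [measurable]: "(\<lambda>s. s) \<in> borel_measurable (lebesgue_on {a..b})"
    by (intro measurable_restrict_space1 measurable_completion) simp
  have [measurable]: "f \<in> borel_measurable (lebesgue_on {a..b})" using assms by auto
  show "(\<lambda>s. if s \<le> r then f s else 0) \<in> borel_measurable (lebesgue_on {a..b})" by measurable
qed auto

text \<open>Both factors are merely mild solutions, so \<open>y s \<bullet> l s\<close> cannot be
  differentiated. Inserting Duhamel's formula for both reduces the claim to exchanging two
  integrations over the triangle \<open>s \<le> r\<close>. The exchange is obtained by
  differentiating \<open>?\<Phi> r\<close>, the integral of \<open>k s r\<close> over
  \<open>s\<close>, and applying the fundamental theorem of calculus.\<close>

theorem mild_sol_pairing:
  fixes S S' :: "real \<Rightarrow> 'a::{real_inner,banach} \<Rightarrow>\<^sub>L 'a"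
  assumes dual: "dual_semigroups S S'" and y: "mild_sol S a b g y" and g: "L1_on a b g"
    and l: "continuous_on {a..b} l" and h: "continuous_on {a..b} h"
    and bwd: "\<And>s r x. a \<le> s \<Longrightarrow> s \<le> r \<Longrightarrow> r \<le> b \<Longrightarrow>
      ((\<lambda>t. h t \<bullet> S' (t - s) x) has_integral (l r \<bullet> S' (r - s) x - l s \<bullet> x)) {s..r}"
    and "a \<le> b"
  shows "((\<lambda>s. g s \<bullet> l s + y s \<bullet> h s) has_integral (y b \<bullet> l b - y a \<bullet> l a)) {a..b}"
proof -
  note C0 = dual[unfolded dual_semigroups_def, THEN conjunct2, THEN conjunct1]
  have adj: "S t x \<bullet> v = x \<bullet> S' t v" if "t \<ge> 0" for t x v
    using dual that by (simp add: dual_semigroups_def)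
  let ?M = "lebesgue_on {a..b}"
  obtain K where K: "K \<ge> 1" "\<And>s. s \<in> {0..b - a} \<Longrightarrow> norm (S' s) \<le> K"
    using C0_semigroup_bounded[OF C0] by blast
  have "bounded (h ` {a..b})"
    using h by (intro compact_imp_bounded compact_continuous_image) auto
  then obtain L where "\<forall>x\<in>h ` {a..b}. norm x \<le> L" by (auto simp: bounded_iff)
  then have L: "norm (h s) \<le> L" if "s \<in> {a..b}" for s using that by blast
  have "0 \<le> L" using order_trans[OF norm_ge_zero L[of a]] \<open>a \<le> b\<close> by simp
  \<comment> \<open>By the backward equation tested with \<open>g s\<close>, this is the integral of
    \<open>h t \<bullet> S' (t - s) (g s)\<close> over {s..r}. The \<open>max 0\<close> keeps the
    semigroup at nonnegative times off the triangle as well.\<close>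
  define k where "k s r = (if s \<le> r then l r \<bullet> S' (max 0 (r - s)) (g s) - l s \<bullet> g s else 0)" for s r
  define k' where "k' s r = (if s \<le> r then h r \<bullet> S' (max 0 (r - s)) (g s) else 0)" for s r
  define \<phi> where "\<phi> s t = h t \<bullet> S' (max 0 (t - s)) (g s)" for s t
  define J where "J s r = integral {a..r} (\<phi> s)" for s r
  have c\<phi>: "continuous_on {a..b} (\<phi> s)" if "s \<in> {a..b}" for s
    unfolding \<phi>_def using that
    by (intro continuous_intros h C0_semigroup_continuous_compose[OF C0, where \<tau> = "b - a"]) auto
  have J': "(J s has_vector_derivative \<phi> s r) (at r within {a..b})" if "s \<in> {a..b}" "r \<in> {a..b}" for s r
    unfolding J_def by (rule integral_has_vector_derivative[OF c\<phi>[OF that(1)] that(2)])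
  have \<phi>_int: "(\<phi> s has_integral (J s r - J s q)) {q..r}" if "s \<in> {a..b}" "a \<le> q" "q \<le> r" "r \<le> b" for s q r
  proof (rule fundamental_theorem_of_calculus[OF that(3)])
    fix t assume "t \<in> {q..r}"
    then show "(J s has_vector_derivative \<phi> s t) (at t within {q..r})"
      using that by (intro has_vector_derivative_within_subset[OF J'[OF that(1)]]) auto
  qed
  have \<phi>_bound: "norm (\<phi> s t) \<le> L * (K * norm (g s))" if "s \<in> {a..b}" "t \<in> {a..b}" for s t
  proof -
    have "norm (\<phi> s t) \<le> norm (h t) * norm (S' (max 0 (t - s)) (g s))"
      unfolding \<phi>_def by (simp add: Cauchy_Schwarz_ineq2)
    also have "\<dots> \<le> L * (K * norm (g s))"
      using that by (intro mult_mono L norm_blinfun_le K \<open>0 \<le> L\<close>) auto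
    finally show ?thesis .
  qed
  have J_lip: "\<bar>J s r - J s q\<bar> \<le> L * (K * norm (g s)) * \<bar>r - q\<bar>"
    if s: "s \<in> {a..b}" and "r \<in> {a..b}" "q \<in> {a..b}" for s r q
  proof -
    have *: "\<bar>J s r - J s q\<bar> \<le> L * (K * norm (g s)) * (r - q)" if "a \<le> q" "q \<le> r" "r \<le> b" for r q
      using has_integral_norm_bound_interval[OF \<phi>_int[OF s that], of "L * (K * norm (g s))"]
        \<phi>_bound[OF s] that \<open>0 \<le> L\<close> K(1) by auto
    show ?thesis
      using *[of q r] *[of r q] that by (cases "q \<le> r") (auto simp: abs_minus_commute)
  qed
  \<comment> \<open>Writing the cut-off through \<open>max s r\<close> shows that \<open>k s\<close>
    is Lipschitz across the diagonal, although its derivative may jump there.\<close>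
  have k_eq: "k s r = J s (max s r) - J s s" if "s \<in> {a..b}" "r \<in> {a..b}" for s r
  proof (cases "s \<le> r")
    case True
    have "((\<lambda>t. h t \<bullet> S' (t - s) (g s)) has_integral (l r \<bullet> S' (r - s) (g s) - l s \<bullet> g s)) {s..r}"
      using that True by (intro bwd) auto
    then have "(\<phi> s has_integral (l r \<bullet> S' (r - s) (g s) - l s \<bullet> g s)) {s..r}"
      using has_integral_cong[of "{s..r}" "\<lambda>t. h t \<bullet> S' (t - s) (g s)" "\<phi> s"] by (simp add: \<phi>_def)
    moreover have "(\<phi> s has_integral (J s r - J s s)) {s..r}"
      using that True by (intro \<phi>_int) auto
    ultimately have "l r \<bullet> S' (r - s) (g s) - l s \<bullet> g s = J s r - J s s"
      by (rule has_integral_unique)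
    then show ?thesis using True by (simp add: k_def max_def)
  qed (simp add: k_def)
  have L1S: "L1_on a b (\<lambda>s. S' (max 0 (r - s)) (g s))" for r
    by (rule L1_on_semigroup[OF C0 g])
  have intS: "integrable ?M (\<lambda>s. x \<bullet> S' (max 0 (r - s)) (g s))" for r x
    by (intro L1_on_imp_integrable L1_on_inner L1S continuous_on_const)
  have intg: "integrable ?M (\<lambda>s. l s \<bullet> g s)"
    by (intro L1_on_imp_integrable L1_on_inner g l)
  have int_k: "integrable ?M (\<lambda>s. k s r)" for r
    unfolding k_def by (intro integrable_lebesgue_on_if Bochner_Integration.integrable_diff intS intg)
  have int_k': "integrable ?M (\<lambda>s. k' s r)" for r
    unfolding k'_def by (intro integrable_lebesgue_on_if intS)
  have Dk: "(k s has_real_derivative k' s r) (at r within {a..b})"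
    if s: "s \<in> {a..b}" and r: "r \<in> {a..b}" and "s \<noteq> r" for s r
  proof (cases "s < r")
    case True
    have "((\<lambda>q. J s q - J s s) has_vector_derivative \<phi> s r - 0) (at r within {a..b})"
      by (intro has_vector_derivative_diff has_vector_derivative_const J' s r)
    then have "((\<lambda>q. J s q - J s s) has_real_derivative k' s r) (at r within {a..b})"
      using True by (simp add: has_real_derivative_iff_has_vector_derivative k'_def \<phi>_def)
    then show ?thesis
    proof (rule has_field_derivative_transform_within)
      show "0 < r - s" using True by simp
      show "J s q - J s s = k s q" if "q \<in> {a..b}" "dist q r < r - s" for q
        using k_eq[OF s that(1)] that(2) by (simp add: dist_real_def abs_if max_def split: if_splits)
    qed (rule r)
  next
    case False
    have "((\<lambda>q. 0) has_real_derivative k' s r) (at r within {a..b})"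
      using False \<open>s \<noteq> r\<close> by (simp add: k'_def)
    then show ?thesis
    proof (rule has_field_derivative_transform_within)
      show "0 < s - r" using False \<open>s \<noteq> r\<close> by simp
      show "0 = k s q" if "q \<in> {a..b}" "dist q r < s - r" for q
        using that by (simp add: k_def dist_real_def abs_if split: if_splits)
    qed (rule r)
  qed
  have k_lip: "\<bar>k s r - k s q\<bar> \<le> L * (K * norm (g s)) * \<bar>r - q\<bar>"
    if "s \<in> {a..b}" "r \<in> {a..b}" "q \<in> {a..b}" for s r q
  proof -
    have "\<bar>k s r - k s q\<bar> \<le> L * (K * norm (g s)) * \<bar>max s r - max s q\<bar>"
      using J_lip[of s "max s r" "max s q"] that by (simp add: k_eq le_max_iff_disj)
    also have "\<dots> \<le> L * (K * norm (g s)) * \<bar>r - q\<bar>"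
      using \<open>0 \<le> L\<close> K(1) by (intro mult_left_mono) auto
    finally show ?thesis .
  qed
  let ?\<Phi> = "\<lambda>r. integral\<^sup>L ?M (\<lambda>s. k s r)"
  have ftc: "((\<lambda>r. integral\<^sup>L ?M (\<lambda>s. k' s r)) has_integral (?\<Phi> b - ?\<Phi> a)) {a..b}"
  proof (rule fundamental_theorem_of_calculus[OF \<open>a \<le> b\<close>])
    fix r assume "r \<in> {a..b}"
    then show "(?\<Phi> has_vector_derivative integral\<^sup>L ?M (\<lambda>s. k' s r)) (at r within {a..b})"
      using g by (intro leibniz_dominated[where \<beta> = "\<lambda>s. L * (K * norm (g s))"] int_k Dk k_lip
          borel_measurable_integrable[OF int_k']) (auto simp: L1_on_def)
  qed
  \<comment> \<open>For fixed \<open>r\<close> the derivative kernel integrates, by the forward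
    equation tested with \<open>h r\<close>, to \<open>y r \<bullet> h r\<close> minus the
    contribution of the initial value.\<close>
  have value': "integral\<^sup>L ?M (\<lambda>s. k' s r) = y r \<bullet> h r - h r \<bullet> S' (r - a) (y a)" if r: "r \<in> {a..b}" for r
  proof -
    have "((\<lambda>s. g s \<bullet> S (r - s) (h r)) has_integral (y r \<bullet> h r - y a \<bullet> S (r - a) (h r))) {a..r}"
      using y r unfolding mild_sol_def by auto
    then have "((\<lambda>s. h r \<bullet> S' (max 0 (r - s)) (g s)) has_integral (y r \<bullet> h r - h r \<bullet> S' (r - a) (y a))) {a..r}"
      using has_integral_cong[of "{a..r}" "\<lambda>s. g s \<bullet> S (r - s) (h r)" "\<lambda>s. h r \<bullet> S' (max 0 (r - s)) (g s)"] r
      by (simp add: adj inner_commute[of "g _"] inner_commute[of "y a"])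
    moreover have Int: "{..r} \<inter> {a..b} = {a..r}" using r by auto
    ultimately have "((\<lambda>s. if s \<in> {..r} then h r \<bullet> S' (max 0 (r - s)) (g s) else 0) has_integral
        (y r \<bullet> h r - h r \<bullet> S' (r - a) (y a))) {a..b}"
      unfolding has_integral_restrict_Int Int by simp
    then have "((\<lambda>s. k' s r) has_integral (y r \<bullet> h r - h r \<bullet> S' (r - a) (y a))) {a..b}"
      unfolding k'_def by simp
    moreover have "((\<lambda>s. k' s r) has_integral integral\<^sup>L ?M (\<lambda>s. k' s r)) {a..b}"
      by (rule has_integral_integral_lebesgue_on[OF int_k']) simp
    ultimately show ?thesis using has_integral_unique by blast
  qed
  have "((\<lambda>r. y r \<bullet> h r - h r \<bullet> S' (r - a) (y a)) has_integral (?\<Phi> b - ?\<Phi> a)) {a..b}"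
    by (rule has_integral_eq[OF value' ftc])
  moreover have "?\<Phi> a = 0"
  proof -
    have "?\<Phi> a = integral\<^sup>L ?M (\<lambda>s. 0)"
    proof (rule Bochner_Integration.integral_cong)
      fix s assume "s \<in> space ?M"
      then have "k s a = J s (max s a) - J s s" using \<open>a \<le> b\<close> by (intro k_eq) auto
      moreover have "max s a = s" using \<open>s \<in> space ?M\<close> by simp
      ultimately show "k s a = 0" by simp
    qed simp
    then show ?thesis by simp
  qed
  moreover have "((\<lambda>r. h r \<bullet> S' (r - a) (y a)) has_integral (l b \<bullet> S' (b - a) (y a) - l a \<bullet> y a)) {a..b}"
    using \<open>a \<le> b\<close> by (intro bwd) auto
  ultimately have yh: "((\<lambda>r. y r \<bullet> h r) has_integral (?\<Phi> b + (l b \<bullet> S' (b - a) (y a) - l a \<bullet> y a))) {a..b}"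
    using has_integral_add[of "\<lambda>r. y r \<bullet> h r - h r \<bullet> S' (r - a) (y a)" "?\<Phi> b - ?\<Phi> a" "{a..b}"
        "\<lambda>r. h r \<bullet> S' (r - a) (y a)" "l b \<bullet> S' (b - a) (y a) - l a \<bullet> y a"] by simp
  have "((\<lambda>s. k s b) has_integral ?\<Phi> b) {a..b}"
    by (rule has_integral_integral_lebesgue_on[OF int_k]) simp
  moreover have "((\<lambda>s. g s \<bullet> S (b - s) (l b)) has_integral (y b \<bullet> l b - y a \<bullet> S (b - a) (l b))) {a..b}"
    using y \<open>a \<le> b\<close> unfolding mild_sol_def by auto
  ultimately have "((\<lambda>s. g s \<bullet> S (b - s) (l b) - k s b) has_integral
      ((y b \<bullet> l b - y a \<bullet> S (b - a) (l b)) - ?\<Phi> b)) {a..b}"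
    by (rule has_integral_diff[rotated])
  moreover have "g s \<bullet> S (b - s) (l b) - k s b = g s \<bullet> l s" if "s \<in> {a..b}" for s
    using that adj[of "b - s" "l b" "g s"] by (simp add: k_def inner_commute)
  ultimately have "((\<lambda>s. g s \<bullet> l s) has_integral ((y b \<bullet> l b - y a \<bullet> S (b - a) (l b)) - ?\<Phi> b)) {a..b}"
    using has_integral_cong[of "{a..b}" "\<lambda>s. g s \<bullet> S (b - s) (l b) - k s b" "\<lambda>s. g s \<bullet> l s"] by simp
  from has_integral_add[OF this yh] show ?thesis
    using adj[of "b - a" "l b" "y a"] \<open>a \<le> b\<close> by (simp add: inner_commute)
qed

text \<open>A constant \<open>x\<close> in the domain of \<open>G\<close> solves the backward
  equation with the constant source \<open>z\<close>. Pairing \<open>y\<close> with this constant is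
  exactly the weak equation.\<close>

lemma mild_sol_imp_weak_sol:
  fixes S S' :: "real \<Rightarrow> 'a::{real_inner,banach} \<Rightarrow>\<^sub>L 'a"
  assumes dual: "dual_semigroups S S'" and S: "generates G S" and y: "mild_sol S a b g y" and g: "L1_on a b g"
  shows "weak_sol G a b g y"
  unfolding weak_sol_def
proof (intro allI impI)
  fix x z t1 t2 assume x: "G x = Some z" and t: "a \<le> t1" "t1 \<le> t2" "t2 \<le> b"
  have adj: "S t x \<bullet> v = x \<bullet> S' t v" if "t \<ge> 0" for t x v
    using dual that by (simp add: dual_semigroups_def)
  have "((\<lambda>s. g s \<bullet> x + y s \<bullet> z) has_integral (y t2 \<bullet> x - y t1 \<bullet> x)) {t1..t2}"
  proof (rule mild_sol_pairing[OF dual])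
    show "mild_sol S t1 t2 g y" by (rule mild_sol_subset[OF y]) (use t in auto)
    show "L1_on t1 t2 g" by (rule L1_on_subset[OF g]) (use t in auto)
    fix s r v assume sr: "t1 \<le> s" "s \<le> r" "r \<le> t2"
    have "((\<lambda>t. S t z \<bullet> v) has_integral (S (r - s) x \<bullet> v - S 0 x \<bullet> v)) {0..r - s}"
      using sr by (intro fundamental_theorem_of_calculus
          bounded_linear.has_vector_derivative[OF bounded_linear_inner_left]
          semigroup_has_vector_derivative[OF S x]) auto
    then have "((\<lambda>t. S (t - s) z \<bullet> v) has_integral (S (r - s) x \<bullet> v - S 0 x \<bullet> v)) {s..r}"
      using has_integral_shift_real_ivl[of "\<lambda>t. S t z \<bullet> v" _ 0 "r - s" "- s"] by simp
    then show "((\<lambda>t. z \<bullet> S' (t - s) v) has_integral (x \<bullet> S' (r - s) v - x \<bullet> v)) {s..r}"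
      using has_integral_cong[of "{s..r}" "\<lambda>t. S (t - s) z \<bullet> v" "\<lambda>t. z \<bullet> S' (t - s) v"] sr
      by (simp add: adj C0_semigroup_zero[OF generates_C0[OF S]])
  qed (use t in auto)
  then show "((\<lambda>s. y s \<bullet> z + g s \<bullet> x) has_integral (y t2 \<bullet> x - y t1 \<bullet> x)) {t1..t2}"
    by (simp add: add.commute)
qed

subsection \<open>Mild solutions for integrable right-hand sides\<close>

lemma L1_on_cong:
  assumes "L1_on a b f" "\<And>t. t \<in> {a..b} \<Longrightarrow> f t = g t"
  shows "L1_on a b g"
proof -
  from assms(1) obtain s where s: "\<And>i. simple_function (lebesgue_on {a..b}) (s i)"
    and lim: "AE t in lebesgue_on {a..b}. (\<lambda>i. s i t) \<longlonglongrightarrow> f t"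
    by (auto simp: L1_on_def strongly_measurable_def)
  have "AE t in lebesgue_on {a..b}. (\<lambda>i. s i t) \<longlonglongrightarrow> g t"
    using lim AE_space by eventually_elim (use assms(2) in simp)
  with s have "strongly_measurable (lebesgue_on {a..b}) g"
    unfolding strongly_measurable_def by blast
  moreover have "integrable (lebesgue_on {a..b}) (\<lambda>t. norm (g t))"
    using assms by (subst Bochner_Integration.integrable_cong[OF refl, of _ _ "\<lambda>t. norm (f t)"])
      (auto simp: L1_on_def)
  ultimately show ?thesis by (simp add: L1_on_def)
qed

lemma L1_on_convolution:
  fixes S :: "real \<Rightarrow> 'a::{real_inner,banach} \<Rightarrow>\<^sub>L 'a"
  assumes S: "C0_semigroup S" and g: "L1_on a b g" and t: "t \<in> {a..b}"
  shows "L1_on a t (\<lambda>s. S (t - s) (g s))"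
proof (rule L1_on_cong)
  show "L1_on a t (\<lambda>s. S (max 0 (t - s)) (g s))"
    using t by (intro L1_on_semigroup[OF S] L1_on_subset[OF g]) auto
qed auto

lemma duhamel_iff_mild_sol:
  fixes S S' :: "real \<Rightarrow> 'a::{real_inner,banach} \<Rightarrow>\<^sub>L 'a"
  assumes dual: "dual_semigroups S S'" and g: "L1_on a b g"
  shows "(\<forall>t\<in>{a..b}. y t = S' (t - a) (y a) + bint (lebesgue_on {a..t}) (\<lambda>s. S' (t - s) (g s)))
    \<longleftrightarrow> mild_sol S a b g y"
proof -
  have C0: "C0_semigroup S" "C0_semigroup S'" using dual by (auto simp: dual_semigroups_def)
  have adj: "S t x \<bullet> v = x \<bullet> S' t v" if "t \<ge> 0" for t x v
    using dual that by (simp add: dual_semigroups_def)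
  let ?I = "\<lambda>t. bint (lebesgue_on {a..t}) (\<lambda>s. S' (t - s) (g s))"
  have I: "((\<lambda>s. g s \<bullet> S (t - s) x) has_integral (?I t \<bullet> x)) {a..t}" if "t \<in> {a..b}" for t x
  proof -
    have "((\<lambda>s. S' (t - s) (g s) \<bullet> x) has_integral (?I t \<bullet> x)) {a..t}"
      by (rule L1_on_bint_inner[OF L1_on_convolution[OF C0(2) g that]])
    then show ?thesis
      using has_integral_cong[of "{a..t}" "\<lambda>s. S' (t - s) (g s) \<bullet> x" "\<lambda>s. g s \<bullet> S (t - s) x"]
        adj by (simp add: inner_commute)
  qed
  show ?thesis
  proof
    assume y: "\<forall>t\<in>{a..b}. y t = S' (t - a) (y a) + ?I t"
    show "mild_sol S a b g y"
    proof (rule mild_solI[OF C0(1)])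
      fix t x assume t: "t \<in> {a..b}"
      have "y t \<bullet> x = S' (t - a) (y a) \<bullet> x + ?I t \<bullet> x" using y t by (metis inner_add_left)
      moreover have "S' (t - a) (y a) \<bullet> x = y a \<bullet> S (t - a) x"
        using adj[of "t - a" x "y a"] t by (simp add: inner_commute)
      ultimately have "?I t \<bullet> x = y t \<bullet> x - y a \<bullet> S (t - a) x" by linarith
      with I[OF t, of x] show "((\<lambda>s. g s \<bullet> S (t - s) x) has_integral (y t \<bullet> x - y a \<bullet> S (t - a) x)) {a..t}"
        by simp
    qed
  next
    assume y: "mild_sol S a b g y"
    show "\<forall>t\<in>{a..b}. y t = S' (t - a) (y a) + ?I t"
    proof
      fix t assume t: "t \<in> {a..b}"
      show "y t = S' (t - a) (y a) + ?I t"
      proof (rule eq_if_inner_eq)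
        fix x
        have "((\<lambda>s. g s \<bullet> S (t - s) x) has_integral (y t \<bullet> x - y a \<bullet> S (t - a) x)) {a..t}"
          using y t unfolding mild_sol_def by auto
        then have "?I t \<bullet> x = y t \<bullet> x - y a \<bullet> S (t - a) x"
          using has_integral_unique I[OF t] by blast
        moreover have "S' (t - a) (y a) \<bullet> x = y a \<bullet> S (t - a) x"
          using adj[of "t - a" x "y a"] t by (simp add: inner_commute)
        ultimately show "y t \<bullet> x = (S' (t - a) (y a) + ?I t) \<bullet> x"
          unfolding inner_add_left by linarith
      qed
    qed
  qed
qed

lemma strongly_measurable_if:
  fixes a b r :: real
  assumes "strongly_measurable (lebesgue_on {a..b}) f"
  shows "strongly_measurable (lebesgue_on {a..b}) (\<lambda>s. if s \<le> r then f s else (0::'b::real_normed_vector))"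
proof -
  from assms obtain s where s: "\<And>i. simple_function (lebesgue_on {a..b}) (s i)"
    and lim: "AE t in lebesgue_on {a..b}. (\<lambda>i. s i t) \<longlonglongrightarrow> f t"
    by (auto simp: strongly_measurable_def)
  have "{t \<in> space (lebesgue_on {a..b}). t \<le> r} = {a..min b r}" by (auto simp: min_def)
  then have "{t \<in> space (lebesgue_on {a..b}). t \<le> r} \<in> sets (lebesgue_on {a..b})"
    by (simp add: sets_restrict_space_iff)
  then have "simple_function (lebesgue_on {a..b}) (\<lambda>t. if t \<le> r then s i t else 0)" for i
    by (intro simple_function_If s simple_function_const)
  moreover have "AE t in lebesgue_on {a..b}. (\<lambda>i. if t \<le> r then s i t else 0) \<longlonglongrightarrow> (if t \<le> r then f t else 0)"
    using lim by eventually_elim auto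
  ultimately show ?thesis
    unfolding strongly_measurable_def by (intro exI[of _ "\<lambda>i t. if t \<le> r then s i t else 0"]) simp
qed

text \<open>The tested equation alone would give weak continuity. For continuity in norm the
  difference of two Duhamel integrals is bounded by the integral of the norm of the difference of
  integrands, uniformly over test vectors, and dominated convergence applies.\<close>

lemma mild_sol_continuous:
  fixes S S' :: "real \<Rightarrow> 'a::{real_inner,banach} \<Rightarrow>\<^sub>L 'a"
  assumes dual: "dual_semigroups S S'" and g: "L1_on a b g" and y: "mild_sol S a b g y"
  shows "continuous_on {a..b} y"
proof (cases "a \<le> b")
  case True
  have C0: "C0_semigroup S" "C0_semigroup S'" using dual by (auto simp: dual_semigroups_def)
  have adj: "S t x \<bullet> v = x \<bullet> S' t v" if "t \<ge> 0" for t x v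
    using dual that by (simp add: dual_semigroups_def)
  let ?M = "lebesgue_on {a..b}"
  obtain K where K: "K \<ge> 1" "\<And>s. s \<in> {0..b - a} \<Longrightarrow> norm (S' s) \<le> K"
    using C0_semigroup_bounded[OF C0(2)] by blast
  \<comment> \<open>The cut-off at \<open>s \<le> r\<close> lets all Duhamel integrals run over the
    fixed interval {a..b}, as dominated convergence requires.\<close>
  define f where "f r s = (if s \<le> r then S' (max 0 (r - s)) (g s) else 0)" for r s
  have smf: "strongly_measurable ?M (f r)" for r
    unfolding f_def using L1_on_semigroup[OF C0(2) g, of r]
    by (intro strongly_measurable_if) (simp add: L1_on_def)
  have f_le: "norm (f r s) \<le> K * norm (g s)" if "s \<in> {a..b}" "r \<in> {a..b}" for r s
    unfolding f_def using that K by (auto intro!: norm_blinfun_le)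
  have intg: "integrable ?M (\<lambda>s. 2 * K * norm (g s))" using g by (simp add: L1_on_def)
  have L1f: "L1_on a b (\<lambda>s. f r s - f q s)" if "r \<in> {a..b}" "q \<in> {a..b}" for r q
  proof (rule L1_on_dominated[OF strongly_measurable_diff[OF smf smf] intg])
    fix s assume "s \<in> {a..b}"
    then show "norm (f r s - f q s) \<le> 2 * K * norm (g s)"
      using f_le[OF _ that(1), of s] f_le[OF _ that(2), of s] norm_triangle_ineq4[of "f r s" "f q s"] by simp
  qed
  define w where "w r = y r - S' (r - a) (y a)" for r
  have w: "((\<lambda>s. f r s \<bullet> x) has_integral w r \<bullet> x) {a..b}" if r: "r \<in> {a..b}" for r x
  proof -
    have "((\<lambda>s. g s \<bullet> S (r - s) x) has_integral (y r \<bullet> x - y a \<bullet> S (r - a) x)) {a..r}"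
      using y r unfolding mild_sol_def by auto
    then have "((\<lambda>s. S' (max 0 (r - s)) (g s) \<bullet> x) has_integral w r \<bullet> x) {a..r}"
      using has_integral_cong[of "{a..r}" "\<lambda>s. g s \<bullet> S (r - s) x" "\<lambda>s. S' (max 0 (r - s)) (g s) \<bullet> x"]
        adj r by (simp add: inner_commute w_def inner_diff_right)
    moreover have Int: "{..r} \<inter> {a..b} = {a..r}" using r by auto
    ultimately have "((\<lambda>s. if s \<in> {..r} then S' (max 0 (r - s)) (g s) \<bullet> x else 0) has_integral w r \<bullet> x) {a..b}"
      unfolding has_integral_restrict_Int Int by simp
    then show ?thesis
      by (rule has_integral_eq[rotated]) (simp add: f_def)
  qed
  have w_dist: "norm (w r - w q) \<le> integral\<^sup>L ?M (\<lambda>s. norm (f r s - f q s))"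
    if rq: "r \<in> {a..b}" "q \<in> {a..b}" for r q
  proof (rule norm_le_if_inner_le)
    fix x
    have "((\<lambda>s. f r s \<bullet> x - f q s \<bullet> x) has_integral (w r \<bullet> x - w q \<bullet> x)) {a..b}"
      by (intro has_integral_diff w rq)
    moreover have "((\<lambda>s. norm (f r s - f q s) * norm x) has_integral (integral\<^sup>L ?M (\<lambda>s. norm (f r s - f q s)) * norm x)) {a..b}"
      using L1f[OF rq] by (intro has_integral_mult_left has_integral_integral_lebesgue_on) (auto simp: L1_on_def)
    ultimately have "w r \<bullet> x - w q \<bullet> x \<le> integral\<^sup>L ?M (\<lambda>s. norm (f r s - f q s)) * norm x"
    proof (rule has_integral_le)
      show "f r s \<bullet> x - f q s \<bullet> x \<le> norm (f r s - f q s) * norm x" for s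
        using norm_cauchy_schwarz[of "f r s - f q s" x] by (simp add: inner_diff_left)
    qed
    then show "(w r - w q) \<bullet> x \<le> integral\<^sup>L ?M (\<lambda>s. norm (f r s - f q s)) * norm x"
      by (simp add: inner_diff_left)
  qed (simp add: Bochner_Integration.integral_nonneg)
  have "continuous_on {a..b} w"
    unfolding continuous_on_def tendsto_at_iff_sequentially
  proof (intro ballI allI impI)
    fix r X assume r: "r \<in> {a..b}" and X: "\<forall>i. X i \<in> {a..b} - {r}" "X \<longlonglongrightarrow> r"
    have "(\<lambda>i. integral\<^sup>L ?M (\<lambda>s. norm (f (X i) s - f r s))) \<longlonglongrightarrow> integral\<^sup>L ?M (\<lambda>s. 0)"
    proof (rule integral_dominated_convergence[OF _ _ intg])
      show "(\<lambda>s. norm (f (X i) s - f r s)) \<in> borel_measurable ?M" for i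
        using L1f[of "X i" r] X r by (auto simp: L1_on_def)
      show "AE s in ?M. norm (norm (f (X i) s - f r s)) \<le> 2 * K * norm (g s)" for i
      proof (rule AE_I2)
        fix s assume "s \<in> space ?M"
        then have s: "s \<in> {a..b}" by simp
        have "norm (f (X i) s - f r s) \<le> norm (f (X i) s) + norm (f r s)" by (rule norm_triangle_ineq4)
        also have "\<dots> \<le> K * norm (g s) + K * norm (g s)"
          using X r by (intro add_mono f_le[OF s]) auto
        finally show "norm (norm (f (X i) s - f r s)) \<le> 2 * K * norm (g s)" by simp
      qed
      have "AE s in lebesgue. s \<noteq> r"
        using negligible_sing[of r] by (intro AE_I'[of "{r}"]) (auto simp: negligible_iff_null_sets)
      then have "AE s in ?M. s \<noteq> r"
        by (simp add: AE_restrict_space_iff) (erule eventually_mono, simp)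
      then show "AE s in ?M. (\<lambda>i. norm (f (X i) s - f r s)) \<longlonglongrightarrow> 0"
        using AE_space
      proof eventually_elim
        case (elim s)
        have "(\<lambda>i. f (X i) s) \<longlonglongrightarrow> f r s"
        proof (cases "s < r")
          case True
          have "(\<lambda>i. max 0 (X i - s)) \<longlonglongrightarrow> max 0 (r - s)"
            by (intro tendsto_intros X)
          then have "(\<lambda>i. S' (max 0 (X i - s)) (g s)) \<longlonglongrightarrow> S' (max 0 (r - s)) (g s)"
            by (intro continuous_on_tendsto_compose[OF C0_semigroup_continuous[OF C0(2)]]) auto
          moreover have "\<forall>\<^sub>F i in sequentially. S' (max 0 (X i - s)) (g s) = f (X i) s"
            using order_tendstoD(1)[OF X(2) True] by eventually_elim (simp add: f_def)
          ultimately show ?thesis using True by (simp add: f_def tendsto_cong)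
        next
          case False
          then have "r < s" using elim by simp
          have "\<forall>\<^sub>F i in sequentially. f (X i) s = f r s"
            using order_tendstoD(2)[OF X(2) \<open>r < s\<close>] by eventually_elim (use \<open>r < s\<close> in \<open>simp add: f_def\<close>)
          then show ?thesis by (rule tendsto_eventually)
        qed
        then have "(\<lambda>i. norm (f (X i) s - f r s)) \<longlonglongrightarrow> norm (f r s - f r s)"
          by (intro tendsto_intros)
        then show ?case by simp
      qed
    qed auto
    then have lim: "(\<lambda>i. integral\<^sup>L ?M (\<lambda>s. norm (f (X i) s - f r s))) \<longlonglongrightarrow> 0" by simp
    have "(\<lambda>i. w (X i) - w r) \<longlonglongrightarrow> 0"
      by (rule Lim_null_comparison[OF _ lim]) (use w_dist X r in \<open>auto intro!: always_eventually\<close>)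
    then show "(w \<circ> X) \<longlonglongrightarrow> w r" by (simp add: o_def LIM_zero_cancel)
  qed
  moreover have "continuous_on {a..b} (\<lambda>r. S' (r - a) (y a))"
    by (intro C0_semigroup_continuous_compose[OF C0(2), where \<tau> = "b - a"] continuous_intros) auto
  ultimately have "continuous_on {a..b} (\<lambda>r. w r + S' (r - a) (y a))"
    by (rule continuous_on_add)
  then show ?thesis by (simp add: w_def)
qed simp

lemma mild_sol_exists:
  fixes S S' :: "real \<Rightarrow> 'a::{real_inner,banach} \<Rightarrow>\<^sub>L 'a"
  assumes dual: "dual_semigroups S S'" and g: "L1_on a b g" and "a \<le> b"
  shows "\<exists>y. y a = y0 \<and> mild_sol S a b g y"
proof -
  have C0: "C0_semigroup S'" using dual by (auto simp: dual_semigroups_def)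
  \<comment> \<open>The case split makes \<open>y a = y0\<close> hold by definition; consistency
    with Duhamel's formula then means that the integral over a single point vanishes.\<close>
  define y where "y t = (if t = a then y0 else
    S' (t - a) y0 + bint (lebesgue_on {a..t}) (\<lambda>s. S' (t - s) (g s)))" for t
  have "bint (lebesgue_on {a..a}) (\<lambda>s. S' (a - s) (g s)) = 0"
  proof (rule eq_if_inner_eq)
    fix x
    let ?i = "bint (lebesgue_on {a..a}) (\<lambda>s. S' (a - s) (g s))"
    have "((\<lambda>s. S' (a - s) (g s) \<bullet> x) has_integral ?i \<bullet> x) {a..a}"
      using \<open>a \<le> b\<close> by (intro L1_on_bint_inner L1_on_convolution[OF C0 g]) auto
    moreover have "((\<lambda>s. S' (a - s) (g s) \<bullet> x) has_integral 0) {a..a}"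
      using has_integral_refl(1)[of _ a] by simp
    ultimately have "?i \<bullet> x = 0" by (rule has_integral_unique)
    then show "?i \<bullet> x = 0 \<bullet> x" by simp
  qed
  then have "\<forall>t\<in>{a..b}. y t = S' (t - a) (y a) + bint (lebesgue_on {a..t}) (\<lambda>s. S' (t - s) (g s))"
    by (auto simp: y_def C0_semigroup_zero[OF C0])
  then have "mild_sol S a b g y" by (simp add: duhamel_iff_mild_sol[OF dual g])
  then show ?thesis by (intro exI[of _ y]) (simp add: y_def)
qed

lemma mild_sol_zero_unique:
  fixes S :: "real \<Rightarrow> 'a::{real_inner,banach} \<Rightarrow>\<^sub>L 'a"
  assumes "mild_sol S a b (\<lambda>_. 0) y" "y a = 0" "t \<in> {a..b}"
  shows "y t = 0"
proof (rule eq_if_inner_eq)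
  fix x
  have "((\<lambda>s. 0) has_integral (y t \<bullet> x - y a \<bullet> S (t - a) x)) {a..t}"
    using assms(1)[unfolded mild_sol_def, rule_format, of a t x] assms(3) by (simp only: inner_zero_left) simp
  then have "y t \<bullet> x - y a \<bullet> S (t - a) x = 0" by (rule has_integral_unique[OF _ has_integral_0])
  with assms(2) show "y t \<bullet> x = 0 \<bullet> x" by simp
qed

text \<open>With a source that is only integrable the differentiation argument breaks down.
  Subtracting the mild solution with the same initial value leaves a weak solution with zero source,
  where it does work, and uniqueness makes that difference vanish.\<close>

lemma weak_sol_imp_mild_sol:
  fixes S S' :: "real \<Rightarrow> 'a::{real_inner,banach} \<Rightarrow>\<^sub>L 'a"
  assumes dual: "dual_semigroups S S'" and S: "generates G S" and y: "weak_sol G a b g y"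
    and cont: "continuous_on {a..b} y" and g: "L1_on a b g" and "a \<le> b"
  shows "mild_sol S a b g y"
proof -
  obtain z where z: "z a = y a" "mild_sol S a b g z"
    using mild_sol_exists[OF dual g \<open>a \<le> b\<close>] by metis
  have "weak_sol G a b (\<lambda>t. g t - g t) (\<lambda>t. y t - z t)"
    by (rule weak_sol_diff[OF y mild_sol_imp_weak_sol[OF dual S z(2) g]])
  then have "mild_sol S a b (\<lambda>t. g t - g t) (\<lambda>t. y t - z t)"
    by (rule weak_sol_imp_mild_sol_continuous[OF S])
      (auto intro!: continuous_intros cont mild_sol_continuous[OF dual g z(2)])
  then have "y t - z t = 0" if "t \<in> {a..b}" for t
    using mild_sol_zero_unique[of S a b "\<lambda>t. y t - z t" t] that z(1) by simp
  then show ?thesis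
    using mild_sol_cong_AE[OF z(2), of "{}" g y] by simp
qed

subsection \<open>Backward solutions\<close>

text \<open>Stands for \<open>l' = - G\<^sup>* l + h\<close> with \<open>S\<close> the semigroup of
  \<open>G\<close>. It is encoded by reversing time, which changes the sign of the source, so that
  the forward results transfer.\<close>

definition back_sol ::
  "(real \<Rightarrow> 'a::real_inner \<Rightarrow>\<^sub>L 'a) \<Rightarrow> real \<Rightarrow> real \<Rightarrow> (real \<Rightarrow> 'a) \<Rightarrow> (real \<Rightarrow> 'a) \<Rightarrow> bool" where
  "back_sol S a b h l \<longleftrightarrow> mild_sol S (- b) (- a) (\<lambda>t. - h (- t)) (\<lambda>t. l (- t))"

lemma back_sol_iff:
  "back_sol S a b h l \<longleftrightarrow> (\<forall>s r x. a \<le> s \<longrightarrow> s \<le> r \<longrightarrow> r \<le> b \<longrightarrow>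
     ((\<lambda>t. h t \<bullet> S (t - s) x) has_integral (l r \<bullet> S (r - s) x - l s \<bullet> x)) {s..r})"
proof -
  have eq: "((\<lambda>t. - h (- t) \<bullet> S (t2 - t) x) has_integral (l (- t2) \<bullet> x - l (- t1) \<bullet> S (t2 - t1) x)) {t1..t2}
    \<longleftrightarrow> ((\<lambda>t. h t \<bullet> S (t - (- t2)) x) has_integral (l (- t1) \<bullet> S (- t1 - (- t2)) x - l (- t2) \<bullet> x)) {- t2..- t1}"
    for t1 t2 x
  proof -
    have "((\<lambda>t. h t \<bullet> S (t - (- t2)) x) has_integral (l (- t1) \<bullet> S (- t1 - (- t2)) x - l (- t2) \<bullet> x)) {- t2..- t1}
      \<longleftrightarrow> ((\<lambda>t. h (- t) \<bullet> S (t2 - t) x) has_integral (l (- t1) \<bullet> S (t2 - t1) x - l (- t2) \<bullet> x)) {t1..t2}"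
      using has_integral_reflect_real[where f = "\<lambda>t. h t \<bullet> S (t - (- t2)) x" and a = "- t2" and b = "- t1"] by simp
    also have "\<dots> \<longleftrightarrow> ((\<lambda>t. - (h (- t) \<bullet> S (t2 - t) x)) has_integral - (l (- t1) \<bullet> S (t2 - t1) x - l (- t2) \<bullet> x)) {t1..t2}"
      by (simp only: has_integral_neg_iff minus_minus)
    finally show ?thesis by simp
  qed
  show ?thesis
    unfolding back_sol_def mild_sol_def
  proof safe
    fix s r x assume *: "\<forall>t1 t2 x. - b \<le> t1 \<longrightarrow> t1 \<le> t2 \<longrightarrow> t2 \<le> - a \<longrightarrow>
      ((\<lambda>s. - h (- s) \<bullet> S (t2 - s) x) has_integral (l (- t2) \<bullet> x - l (- t1) \<bullet> S (t2 - t1) x)) {t1..t2}"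
      and "a \<le> s" "s \<le> r" "r \<le> b"
    then have "((\<lambda>t. - h (- t) \<bullet> S (- s - t) x) has_integral (l (- (- s)) \<bullet> x - l (- (- r)) \<bullet> S (- s - - r) x)) {- r..- s}"
      by (intro *[rule_format]) auto
    then show "((\<lambda>t. h t \<bullet> S (t - s) x) has_integral (l r \<bullet> S (r - s) x - l s \<bullet> x)) {s..r}"
      unfolding eq by simp
  next
    fix t1 t2 x assume *: "\<forall>s r x. a \<le> s \<longrightarrow> s \<le> r \<longrightarrow> r \<le> b \<longrightarrow>
      ((\<lambda>t. h t \<bullet> S (t - s) x) has_integral (l r \<bullet> S (r - s) x - l s \<bullet> x)) {s..r}"
      and "- b \<le> t1" "t1 \<le> t2" "t2 \<le> - a"
    then show "((\<lambda>s. - h (- s) \<bullet> S (t2 - s) x) has_integral (l (- t2) \<bullet> x - l (- t1) \<bullet> S (t2 - t1) x)) {t1..t2}"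
      unfolding eq by (intro *[rule_format]) auto
  qed
qed

lemma continuous_on_reflect:
  "continuous_on {a..b} f \<longleftrightarrow> continuous_on {- b..- a} (\<lambda>t. f (- t))" for a b :: real
proof -
  have "uminus ` {- b..- a} = {a..b}" "uminus ` {a..b} = {- b..- a}" by auto
  then show ?thesis
    using continuous_on_compose[of "{- b..- a}" uminus f] continuous_on_compose[of "{a..b}" uminus "\<lambda>t. f (- t)"]
    by (auto simp: o_def continuous_on_minus)
qed

lemma back_sol_diff:
  assumes "back_sol S a b g y" "back_sol S a b h z"
  shows "back_sol S a b (\<lambda>t. g t - h t) (\<lambda>t. y t - z t)"
  using mild_sol_diff[OF assms[unfolded back_sol_def]] unfolding back_sol_def by simp

lemma back_sol_add:
  assumes "back_sol S a b g y" "back_sol S a b h z"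
  shows "back_sol S a b (\<lambda>t. g t + h t) (\<lambda>t. y t + z t)"
  using mild_sol_add[OF assms[unfolded back_sol_def]] unfolding back_sol_def by simp

lemma back_sol_subset:
  "back_sol S a b g y \<Longrightarrow> a \<le> c \<Longrightarrow> d \<le> b \<Longrightarrow> back_sol S c d g y"
  unfolding back_sol_def by (rule mild_sol_subset) auto

text \<open>The detour through weak solutions replaces a perturbation series: there a bounded
  operator simply moves from the generator to the source. It arrives as \<open>adj F\<close> because
  the semigroup acts on test vectors.\<close>

lemma mild_sol_perturb_continuous:
  fixes S S' R :: "real \<Rightarrow> 'a::{real_inner,banach} \<Rightarrow>\<^sub>L 'a"
  assumes S: "dual_semigroups S S'" "generates G S" and R: "generates (op_plus G F) R"
    and y: "mild_sol S a b g y" and g: "continuous_on {a..b} g"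
  shows "mild_sol R a b (\<lambda>t. g t - adj F (y t)) y"
proof -
  have cont: "continuous_on {a..b} y"
    by (rule mild_sol_continuous[OF S(1) L1_on_continuous[OF g] y])
  have "weak_sol G a b (\<lambda>t. (g t - adj F (y t)) + adj F (y t)) y"
    using mild_sol_imp_weak_sol[OF S y L1_on_continuous[OF g]] by simp
  then have "weak_sol (op_plus G F) a b (\<lambda>t. g t - adj F (y t)) y"
    by (simp only: weak_sol_perturb)
  then show ?thesis
    by (rule weak_sol_imp_mild_sol_continuous[OF R _ cont]) (intro continuous_intros g cont)
qed

lemma mild_sol_unperturb:
  fixes S S' R R' :: "real \<Rightarrow> 'a::{real_inner,banach} \<Rightarrow>\<^sub>L 'a"
  assumes S: "dual_semigroups S S'" "generates G S"
    and R: "dual_semigroups R R'" "generates (op_plus G F) R"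
    and y: "mild_sol R a b g y" and g: "L1_on a b g" and "a \<le> b"
  shows "mild_sol S a b (\<lambda>t. g t + adj F (y t)) y"
proof -
  have cont: "continuous_on {a..b} y" by (rule mild_sol_continuous[OF R(1) g y])
  have "weak_sol G a b (\<lambda>t. g t + adj F (y t)) y"
    using mild_sol_imp_weak_sol[OF R y g] by (simp only: weak_sol_perturb)
  then show ?thesis
    by (rule weak_sol_imp_mild_sol[OF S _ cont L1_on_add[OF g L1_on_continuous]])
      (auto intro!: continuous_intros cont \<open>a \<le> b\<close>)
qed

lemma back_sol_continuous:
  fixes S S' :: "real \<Rightarrow> 'a::{real_inner,banach} \<Rightarrow>\<^sub>L 'a"
  assumes "dual_semigroups S S'" "back_sol S a b h l" "continuous_on {a..b} h"
  shows "continuous_on {a..b} l"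
proof -
  have "continuous_on {- b..- a} (\<lambda>t. - h (- t))"
    using assms(3) continuous_on_reflect by (intro continuous_on_minus) blast
  then have "continuous_on {- b..- a} (\<lambda>t. l (- t))"
    using mild_sol_continuous[OF assms(1) L1_on_continuous] assms(2) unfolding back_sol_def by blast
  then show ?thesis using continuous_on_reflect by blast
qed

lemma back_sol_perturb:
  fixes S S' R :: "real \<Rightarrow> 'a::{real_inner,banach} \<Rightarrow>\<^sub>L 'a"
  assumes S: "dual_semigroups S S'" "generates G S" and R: "generates (op_plus G F) R"
    and l: "back_sol S a b h l" and h: "continuous_on {a..b} h"
  shows "back_sol R a b (\<lambda>t. h t + adj F (l t)) l"
proof -
  have "continuous_on {- b..- a} (\<lambda>t. - h (- t))"
    using h continuous_on_reflect by (intro continuous_on_minus) blast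
  from mild_sol_perturb_continuous[OF S R l[unfolded back_sol_def] this]
  show ?thesis unfolding back_sol_def by simp
qed

lemma back_sol_unperturb:
  fixes S S' R R' :: "real \<Rightarrow> 'a::{real_inner,banach} \<Rightarrow>\<^sub>L 'a"
  assumes S: "dual_semigroups S S'" "generates G S"
    and R: "dual_semigroups R R'" "generates (op_plus G F) R"
    and l: "back_sol R a b h l" and h: "continuous_on {a..b} h" and "a \<le> b"
  shows "back_sol S a b (\<lambda>t. h t - adj F (l t)) l"
proof -
  have "continuous_on {- b..- a} (\<lambda>t. - h (- t))"
    using h continuous_on_reflect by (intro continuous_on_minus) blast
  then have "mild_sol S (- b) (- a) (\<lambda>t. - h (- t) + adj F (l (- t))) (\<lambda>t. l (- t))"
    using mild_sol_unperturb[OF S R l[unfolded back_sol_def] L1_on_continuous] \<open>a \<le> b\<close> by simp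
  then show ?thesis unfolding back_sol_def by simp
qed

section \<open>Exponentially stable semigroups\<close>

lemma mild_solD:
  "mild_sol S a b g y \<Longrightarrow> a \<le> t1 \<Longrightarrow> t1 \<le> t2 \<Longrightarrow> t2 \<le> b \<Longrightarrow>
    ((\<lambda>s. g s \<bullet> S (t2 - s) x) has_integral (y t2 \<bullet> x - y t1 \<bullet> S (t2 - t1) x)) {t1..t2}"
  by (simp add: mild_sol_def)

definition exp_stable :: "real \<Rightarrow> real \<Rightarrow> (real \<Rightarrow> 'a::real_normed_vector \<Rightarrow>\<^sub>L 'a) \<Rightarrow> bool" where
  "exp_stable K \<nu> S \<longleftrightarrow> 0 < K \<and> 0 < \<nu> \<and> (\<forall>t\<ge>0. norm (S t) \<le> K * exp (- \<nu> * t))"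

lemma exp_stable_bound: "exp_stable K \<nu> S \<Longrightarrow> 0 \<le> t \<Longrightarrow> norm (S t x) \<le> K * exp (- \<nu> * t) * norm x"
  by (auto simp: exp_stable_def intro: norm_blinfun_le)

lemma exp_stable_le: "exp_stable K \<nu> S \<Longrightarrow> 0 \<le> t \<Longrightarrow> norm (S t x) \<le> K * norm x"
proof -
  assume *: "exp_stable K \<nu> S" "0 \<le> t"
  then have "K * exp (- \<nu> * t) \<le> K * 1"
    by (intro mult_left_mono) (auto simp: exp_stable_def)
  with exp_stable_bound[OF *, of x] show ?thesis
    by (smt (verit) mult_right_mono norm_ge_zero)
qed

text \<open>The norm of a mild solution is dominated by the solution \<open>R\<close> of \<open>R' = - \<nu> R + K |g|\<close>, for
  which \<open>(R\<^sup>2)' \<le> - \<nu> R\<^sup>2 + (K\<^sup>2 / \<nu>) |g|\<^sup>2\<close>.\<close>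

lemma mild_sol_energy:
  fixes S :: "real \<Rightarrow> 'a::{real_inner,banach} \<Rightarrow>\<^sub>L 'a"
  assumes st: "exp_stable K \<nu> S" and y: "mild_sol S a b g y"
    and cy: "continuous_on {a..b} y" and g: "continuous_on {a..b} g" and "a \<le> b"
  shows "(norm (y b))\<^sup>2 + \<nu> * integral {a..b} (\<lambda>t. (norm (y t))\<^sup>2)
    \<le> K\<^sup>2 * (norm (y a))\<^sup>2 + K\<^sup>2 / \<nu> * integral {a..b} (\<lambda>t. (norm (g t))\<^sup>2)"
proof -
  have K: "0 < K" "0 < \<nu>" using st by (auto simp: exp_stable_def)
  define R where "R t = exp (- \<nu> * (t - a)) * (K * norm (y a) + K * integral {a..t} (\<lambda>s. exp (\<nu> * (s - a)) * norm (g s)))" for t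
  have c1: "continuous_on {a..b} (\<lambda>s. exp (\<nu> * (s - a)) * norm (g s))"
    by (intro continuous_intros g)
  have R': "(R has_real_derivative (- \<nu> * R t + K * norm (g t))) (at t within {a..b})" if t: "t \<in> {a..b}" for t
  proof -
    have "((\<lambda>t. integral {a..t} (\<lambda>s. exp (\<nu> * (s - a)) * norm (g s))) has_real_derivative
        exp (\<nu> * (t - a)) * norm (g t)) (at t within {a..b})"
      unfolding has_real_derivative_iff_has_vector_derivative by (rule integral_has_vector_derivative[OF c1 t])
    then have "(R has_real_derivative
        (exp (- \<nu> * (t - a)) * (K * (exp (\<nu> * (t - a)) * norm (g t)))
        + - \<nu> * exp (- \<nu> * (t - a)) * (K * norm (y a) + K * integral {a..t} (\<lambda>s. exp (\<nu> * (s - a)) * norm (g s)))))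
        (at t within {a..b})"
      unfolding R_def by (auto intro!: derivative_eq_intros)
    moreover have "exp (- \<nu> * (t - a)) * (K * (exp (\<nu> * (t - a)) * norm (g t))) = K * norm (g t)"
      by (simp add: mult.left_commute[of _ K] exp_add[symmetric] mult.assoc[symmetric])
    moreover have "- \<nu> * exp (- \<nu> * (t - a)) * (K * norm (y a) + K * integral {a..t} (\<lambda>s. exp (\<nu> * (s - a)) * norm (g s)))
        = - \<nu> * R t" by (simp add: R_def)
    ultimately show ?thesis by (simp only: add.commute)
  qed
  have cR: "continuous_on {a..b} R"
    by (rule DERIV_continuous_on[OF R'])
  have y_le: "norm (y t) \<le> R t" if t: "t \<in> {a..b}" for t
  proof (rule norm_le_if_inner_le)
    fix x
    have *: "((\<lambda>s. g s \<bullet> S (t - s) x) has_integral (y t \<bullet> x - y a \<bullet> S (t - a) x)) {a..t}"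
      using y t unfolding mild_sol_def by auto
    have "continuous_on {a..t} (\<lambda>s. exp (\<nu> * (s - a)) * norm (g s))"
      by (rule continuous_on_subset[OF c1]) (use t in auto)
    then have "((\<lambda>s. exp (\<nu> * (s - a)) * norm (g s)) has_integral integral {a..t} (\<lambda>s. exp (\<nu> * (s - a)) * norm (g s))) {a..t}"
      by (rule integrable_integral[OF integrable_continuous_interval])
    then have "((\<lambda>s. (exp (- \<nu> * (t - a)) * K * norm x) * (exp (\<nu> * (s - a)) * norm (g s))) has_integral
        (exp (- \<nu> * (t - a)) * K * norm x) * integral {a..t} (\<lambda>s. exp (\<nu> * (s - a)) * norm (g s))) {a..t}"
      by (rule has_integral_mult_right)
    with * have "y t \<bullet> x - y a \<bullet> S (t - a) x
        \<le> (exp (- \<nu> * (t - a)) * K * norm x) * integral {a..t} (\<lambda>s. exp (\<nu> * (s - a)) * norm (g s))"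
    proof (rule has_integral_le)
      fix s assume s: "s \<in> {a..t}"
      have "g s \<bullet> S (t - s) x \<le> norm (g s) * norm (S (t - s) x)" by (rule norm_cauchy_schwarz)
      also have "\<dots> \<le> norm (g s) * (K * exp (- \<nu> * (t - s)) * norm x)"
        using s by (intro mult_left_mono exp_stable_bound[OF st]) auto
      also have "exp (- \<nu> * (t - s)) = exp (- \<nu> * (t - a)) * exp (\<nu> * (s - a))"
        by (simp add: exp_add[symmetric] algebra_simps)
      finally show "g s \<bullet> S (t - s) x \<le> (exp (- \<nu> * (t - a)) * K * norm x) * (exp (\<nu> * (s - a)) * norm (g s))"
        by (simp add: mult_ac)
    qed
    moreover have "y a \<bullet> S (t - a) x \<le> norm (y a) * (K * exp (- \<nu> * (t - a)) * norm x)"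
      using t by (intro order_trans[OF norm_cauchy_schwarz] mult_left_mono exp_stable_bound[OF st]) auto
    ultimately show "y t \<bullet> x \<le> R t * norm x"
      by (simp add: R_def algebra_simps)
  next
    have "0 \<le> integral {a..t} (\<lambda>s. exp (\<nu> * (s - a)) * norm (g s))"
      by (intro integral_nonneg integrable_continuous_interval continuous_on_subset[OF c1]) (use t in auto)
    then show "0 \<le> R t" using K by (simp add: R_def)
  qed
  have "((\<lambda>t. 2 * R t * (- \<nu> * R t + K * norm (g t))) has_integral ((R b)\<^sup>2 - (R a)\<^sup>2)) {a..b}"
  proof (rule fundamental_theorem_of_calculus[OF \<open>a \<le> b\<close>])
    fix t assume "t \<in> {a..b}"
    from R'[OF this] have "((\<lambda>t. (R t)\<^sup>2) has_real_derivative 2 * R t * (- \<nu> * R t + K * norm (g t))) (at t within {a..b})"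
      by (auto intro!: derivative_eq_intros)
    then show "((\<lambda>t. (R t)\<^sup>2) has_vector_derivative 2 * R t * (- \<nu> * R t + K * norm (g t))) (at t within {a..b})"
      by (simp only: has_real_derivative_iff_has_vector_derivative)
  qed
  moreover have "((\<lambda>t. K\<^sup>2 / \<nu> * (norm (g t))\<^sup>2 - \<nu> * (norm (y t))\<^sup>2) has_integral
      (K\<^sup>2 / \<nu> * integral {a..b} (\<lambda>t. (norm (g t))\<^sup>2) - \<nu> * integral {a..b} (\<lambda>t. (norm (y t))\<^sup>2))) {a..b}"
    by (intro has_integral_diff has_integral_mult_right integrable_integral integrable_continuous_interval
        continuous_intros g cy)
  ultimately have "(R b)\<^sup>2 - (R a)\<^sup>2
      \<le> K\<^sup>2 / \<nu> * integral {a..b} (\<lambda>t. (norm (g t))\<^sup>2) - \<nu> * integral {a..b} (\<lambda>t. (norm (y t))\<^sup>2)"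
  proof (rule has_integral_le)
    fix t assume t: "t \<in> {a..b}"
    \<comment> \<open>Completing the square is Young's inequality with weight \<open>\<nu>\<close>;
      this is the origin of the factor \<open>K\<^sup>2 / \<nu>\<close>.\<close>
    have "0 \<le> (\<nu> * R t - K * norm (g t))\<^sup>2 / \<nu>" using K by simp
    also have "\<dots> = \<nu> * (R t)\<^sup>2 - 2 * R t * K * norm (g t) + K\<^sup>2 / \<nu> * (norm (g t))\<^sup>2"
      using K by (simp add: power2_diff power_mult_distrib field_simps power2_eq_square)
    finally have "2 * R t * (- \<nu> * R t + K * norm (g t)) \<le> K\<^sup>2 / \<nu> * (norm (g t))\<^sup>2 - \<nu> * (R t)\<^sup>2"
      by (simp add: power2_eq_square algebra_simps)
    moreover have "\<nu> * (norm (y t))\<^sup>2 \<le> \<nu> * (R t)\<^sup>2"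
      using K y_le[OF t] by (intro mult_left_mono power_mono) auto
    ultimately show "2 * R t * (- \<nu> * R t + K * norm (g t)) \<le> K\<^sup>2 / \<nu> * (norm (g t))\<^sup>2 - \<nu> * (norm (y t))\<^sup>2"
      by linarith
  qed
  moreover have "(norm (y b))\<^sup>2 \<le> (R b)\<^sup>2" using y_le[of b] \<open>a \<le> b\<close> by (intro power_mono) auto
  moreover have "(R a)\<^sup>2 = K\<^sup>2 * (norm (y a))\<^sup>2" by (simp add: R_def power_mult_distrib)
  ultimately show ?thesis by linarith
qed

lemma integral_reflect_interval: "integral {- b..- a} (\<lambda>t. f (- t)) = integral {a..b} (f :: real \<Rightarrow> real)"
  by (rule Henstock_Kurzweil_Integration.integral_reflect_real)

lemma back_sol_energy:
  fixes S :: "real \<Rightarrow> 'a::{real_inner,banach} \<Rightarrow>\<^sub>L 'a"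
  assumes st: "exp_stable K \<nu> S" and l: "back_sol S a b h l"
    and cl: "continuous_on {a..b} l" and h: "continuous_on {a..b} h" and "a \<le> b"
  shows "(norm (l a))\<^sup>2 + \<nu> * integral {a..b} (\<lambda>t. (norm (l t))\<^sup>2)
    \<le> K\<^sup>2 * (norm (l b))\<^sup>2 + K\<^sup>2 / \<nu> * integral {a..b} (\<lambda>t. (norm (h t))\<^sup>2)"
proof -
  have "(norm (l (- (- a))))\<^sup>2 + \<nu> * integral {- b..- a} (\<lambda>t. (norm (l (- t)))\<^sup>2)
    \<le> K\<^sup>2 * (norm (l (- (- b))))\<^sup>2 + K\<^sup>2 / \<nu> * integral {- b..- a} (\<lambda>t. (norm (- h (- t)))\<^sup>2)"
    using cl h continuous_on_reflect[of a b] \<open>a \<le> b\<close>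
    by (intro mild_sol_energy[OF st l[unfolded back_sol_def]] continuous_on_minus) auto
  then show ?thesis
    using integral_reflect_interval[of b a "\<lambda>t. (norm (l t))\<^sup>2"] integral_reflect_interval[of b a "\<lambda>t. (norm (h t))\<^sup>2"]
    by simp
qed

subsection \<open>Periodic solutions\<close>

lemma mild_sol_sup_bound:
  fixes S :: "real \<Rightarrow> 'a::{real_inner,banach} \<Rightarrow>\<^sub>L 'a"
  assumes st: "exp_stable K \<nu> S" and y: "mild_sol S a b g y" and g: "continuous_on {a..b} g" and t: "t \<in> {a..b}"
  shows "norm (y t) \<le> K * norm (y a) + K * integral {a..b} (\<lambda>s. norm (g s))"
proof (rule norm_le_if_inner_le)
  have K: "0 < K" using st by (auto simp: exp_stable_def)
  have int: "(\<lambda>s. norm (g s)) integrable_on {a..b}"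
    by (intro integrable_continuous_interval continuous_intros g)
  have nonneg: "0 \<le> integral {a..b} (\<lambda>s. norm (g s))" by (intro integral_nonneg int) auto
  then show "0 \<le> K * norm (y a) + K * integral {a..b} (\<lambda>s. norm (g s))" using K by simp
  fix x
  have *: "((\<lambda>s. g s \<bullet> S (t - s) x) has_integral (y t \<bullet> x - y a \<bullet> S (t - a) x)) {a..t}"
    using y t unfolding mild_sol_def by auto
  have int': "(\<lambda>s. norm (g s)) integrable_on {a..t}"
    by (rule integrable_subinterval_real[OF int]) (use t in auto)
  have "((\<lambda>s. (K * norm x) * norm (g s)) has_integral (K * norm x) * integral {a..t} (\<lambda>s. norm (g s))) {a..t}"
    by (intro has_integral_mult_right integrable_integral int')
  with * have "y t \<bullet> x - y a \<bullet> S (t - a) x \<le> (K * norm x) * integral {a..t} (\<lambda>s. norm (g s))"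
  proof (rule has_integral_le)
    fix s assume s: "s \<in> {a..t}"
    have "g s \<bullet> S (t - s) x \<le> norm (g s) * norm (S (t - s) x)" by (rule norm_cauchy_schwarz)
    also have "\<dots> \<le> norm (g s) * (K * norm x)"
      using s by (intro mult_left_mono exp_stable_le[OF st]) auto
    finally show "g s \<bullet> S (t - s) x \<le> (K * norm x) * norm (g s)" by (simp add: mult_ac)
  qed
  also have "\<dots> \<le> (K * norm x) * integral {a..b} (\<lambda>s. norm (g s))"
    using K t by (intro mult_left_mono integral_subset_le int int') auto
  moreover have "y a \<bullet> S (t - a) x \<le> norm (y a) * (K * norm x)"
    using t by (intro order_trans[OF norm_cauchy_schwarz] mult_left_mono exp_stable_le[OF st]) auto
  ultimately show "y t \<bullet> x \<le> (K * norm (y a) + K * integral {a..b} (\<lambda>s. norm (g s))) * norm x"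
    by (simp add: algebra_simps)
qed

lemma exp_stable_small:
  assumes "exp_stable K \<nu> S" "0 < P"
  shows "\<exists>n. K * exp (- \<nu> * (real n * P)) \<le> 1 / 2"
proof -
  have K: "0 < K" "0 < \<nu>" using assms by (auto simp: exp_stable_def)
  have "exp (- \<nu> * P) < 1" using K assms(2) by simp
  then obtain n where n: "exp (- \<nu> * P) ^ n < 1 / (2 * K)"
    using real_arch_pow_inv[of "1 / (2 * K)" "exp (- \<nu> * P)"] K by auto
  have "exp (- \<nu> * P) ^ n = exp (- \<nu> * (real n * P))"
    by (simp add: exp_of_nat_mult[symmetric] algebra_simps)
  with n K show ?thesis by (intro exI[of _ n]) (simp add: field_simps)
qed

text \<open>Iterating the period map \<open>n\<close> times until it is a contraction.\<close>

lemma periodic_mild_sol_bound: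
  fixes S :: "real \<Rightarrow> 'a::{real_inner,banach} \<Rightarrow>\<^sub>L 'a"
  assumes st: "exp_stable K \<nu> S" and C0: "C0_semigroup S" and "0 < P"
  shows "\<exists>c>0. \<forall>a g y t. mild_sol S a (a + P) g y \<longrightarrow> continuous_on {a..a + P} g \<longrightarrow> y a = y (a + P) \<longrightarrow>
    t \<in> {a..a + P} \<longrightarrow> norm (y t) \<le> c * integral {a..a + P} (\<lambda>s. norm (g s))"
proof -
  have K: "0 < K" "0 < \<nu>" using st by (auto simp: exp_stable_def)
  obtain n where n: "K * exp (- \<nu> * (real n * P)) \<le> 1 / 2"
    using exp_stable_small[OF st \<open>0 < P\<close>] by blast
  let ?c = "K * (2 * real n * K) + K"
  have "norm (y t) \<le> ?c * integral {a..a + P} (\<lambda>s. norm (g s))"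
    if y: "mild_sol S a (a + P) g y" and g: "continuous_on {a..a + P} g" and per: "y a = y (a + P)"
      and t: "t \<in> {a..a + P}" for a g y t
  proof -
    define G where "G = integral {a..a + P} (\<lambda>s. norm (g s))"
    have int: "(\<lambda>s. norm (g s)) integrable_on {a..a + P}"
      by (intro integrable_continuous_interval continuous_intros g)
    have "0 \<le> G" unfolding G_def by (intro integral_nonneg int) auto
    \<comment> \<open>Periodicity closes the mild formula over one period, and the test vector
      \<open>S (real k * P) x\<close> advances the power of the period map by one. The two semigroup
      factors are merged before they are estimated, so the same \<open>K\<close> serves for every
      \<open>k\<close>.\<close>
    have step: "y a \<bullet> S (real k * P) x \<le> y a \<bullet> S (real (Suc k) * P) x + K * G * norm x" for k x
    proof -
      have "((\<lambda>s. g s \<bullet> S (a + P - s) (S (real k * P) x)) has_integral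
          (y (a + P) \<bullet> S (real k * P) x - y a \<bullet> S (a + P - a) (S (real k * P) x))) {a..a + P}"
        using \<open>0 < P\<close> by (intro mild_solD[OF y]) auto
      moreover have "S (a + P - a) (S (real k * P) x) = S (real (Suc k) * P) x"
        using C0_semigroup_add[OF C0, of P "real k * P" x] \<open>0 < P\<close> by (simp add: algebra_simps)
      ultimately have "((\<lambda>s. g s \<bullet> S (a + P - s) (S (real k * P) x)) has_integral
          (y a \<bullet> S (real k * P) x - y a \<bullet> S (real (Suc k) * P) x)) {a..a + P}"
        using per by simp
      moreover have "((\<lambda>s. (K * norm x) * norm (g s)) has_integral (K * norm x) * G) {a..a + P}"
        unfolding G_def by (intro has_integral_mult_right integrable_integral int)
      ultimately have "y a \<bullet> S (real k * P) x - y a \<bullet> S (real (Suc k) * P) x \<le> (K * norm x) * G"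
      proof (rule has_integral_le)
        fix s assume s: "s \<in> {a..a + P}"
        have "S (a + P - s) (S (real k * P) x) = S (a + P - s + real k * P) x"
          using C0_semigroup_add[OF C0, of "a + P - s" "real k * P" x] s \<open>0 < P\<close> by simp
        then have "g s \<bullet> S (a + P - s) (S (real k * P) x) \<le> norm (g s) * norm (S (a + P - s + real k * P) x)"
          by (simp add: norm_cauchy_schwarz)
        also have "\<dots> \<le> norm (g s) * (K * norm x)"
          using s \<open>0 < P\<close> by (intro mult_left_mono exp_stable_le[OF st]) auto
        finally show "g s \<bullet> S (a + P - s) (S (real k * P) x) \<le> (K * norm x) * norm (g s)" by (simp add: mult_ac)
      qed
      then show ?thesis by (simp add: mult_ac)
    qed
    have iter: "y a \<bullet> x \<le> y a \<bullet> S (real k * P) x + real k * (K * G * norm x)" for k x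
    proof (induction k)
      case (Suc k)
      then show ?case using step[of k x] by (simp add: algebra_simps)
    qed (simp add: C0_semigroup_zero[OF C0])
    \<comment> \<open>By the choice of \<open>n\<close> the n-th power of the period map contributes
      at most half of \<open>norm (y a)\<close>, which is absorbed on the left.\<close>
    have "norm (y a) \<le> 1 / 2 * norm (y a) + real n * K * G"
    proof (rule norm_le_if_inner_le)
      fix x
      have "norm (S (real n * P) x) \<le> K * exp (- \<nu> * (real n * P)) * norm x"
        using \<open>0 < P\<close> by (intro exp_stable_bound[OF st]) auto
      also have "\<dots> \<le> 1 / 2 * norm x" by (intro mult_right_mono n) auto
      finally have "norm (y a) * norm (S (real n * P) x) \<le> norm (y a) * (1 / 2 * norm x)"
        by (intro mult_left_mono) auto
      then have "y a \<bullet> S (real n * P) x \<le> norm (y a) * (1 / 2 * norm x)"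
        using norm_cauchy_schwarz[of "y a" "S (real n * P) x"] by linarith
      with iter[of x n] show "y a \<bullet> x \<le> (1 / 2 * norm (y a) + real n * K * G) * norm x"
        by (simp add: algebra_simps)
    qed (use K \<open>0 \<le> G\<close> in auto)
    then have "norm (y a) \<le> 2 * real n * K * G" by simp
    then have "K * norm (y a) \<le> K * (2 * real n * K * G)" using K by (intro mult_left_mono) auto
    moreover have "norm (y t) \<le> K * norm (y a) + K * G"
      unfolding G_def by (rule mild_sol_sup_bound[OF st y g t])
    ultimately have "norm (y t) \<le> ?c * G" by (simp add: algebra_simps)
    then show ?thesis by (simp only: G_def)
  qed
  moreover have "?c > 0" using K by (simp add: add_nonneg_pos)
  ultimately show ?thesis by (intro exI[of _ ?c]) blast
qed

lemma exp_stable_dual: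
  fixes S S' :: "real \<Rightarrow> 'a::{real_inner,banach} \<Rightarrow>\<^sub>L 'a"
  assumes st: "exp_stable K \<nu> S" and dual: "dual_semigroups S S'"
  shows "exp_stable K \<nu> S'"
proof -
  have "norm (S' t) \<le> K * exp (- \<nu> * t)" if "0 \<le> t" for t
  proof (rule norm_blinfun_bound)
    show "0 \<le> K * exp (- \<nu> * t)" using st by (simp add: exp_stable_def)
    fix v
    show "norm (S' t v) \<le> K * exp (- \<nu> * t) * norm v"
    proof (rule norm_le_if_inner_le)
      fix x
      have "S' t v \<bullet> x = S t x \<bullet> v" using dual that by (simp add: dual_semigroups_def inner_commute)
      also have "\<dots> \<le> norm (S t x) * norm v" by (rule norm_cauchy_schwarz)
      also have "\<dots> \<le> K * exp (- \<nu> * t) * norm x * norm v"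
        by (intro mult_right_mono exp_stable_bound[OF st that]) auto
      finally show "S' t v \<bullet> x \<le> K * exp (- \<nu> * t) * norm v * norm x" by (simp add: mult_ac)
    qed (use st in \<open>auto simp: exp_stable_def\<close>)
  qed
  with st show ?thesis by (simp add: exp_stable_def)
qed

text \<open>If \<open>\<zeta>\<close> is the final value of the solution that starts at zero, a
  periodic initial value must satisfy y0 = \<zeta> + S' P y0. The Neumann series of the period map
  solves this and converges by exponential stability.\<close>

lemma periodic_mild_sol_exists:
  fixes S S' :: "real \<Rightarrow> 'a::{real_inner,banach} \<Rightarrow>\<^sub>L 'a"
  assumes st: "exp_stable K \<nu> S" and dual: "dual_semigroups S S'" and "0 < P" and g: "L1_on a (a + P) g"
  shows "\<exists>y. mild_sol S a (a + P) g y \<and> y a = y (a + P)"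
proof -
  have C0: "C0_semigroup S" "C0_semigroup S'" using dual by (auto simp: dual_semigroups_def)
  have st': "exp_stable K \<nu> S'" by (rule exp_stable_dual[OF st dual])
  have K: "0 < K" "0 < \<nu>" using st by (auto simp: exp_stable_def)
  obtain z where z: "z a = 0" "mild_sol S a (a + P) g z"
    using mild_sol_exists[OF dual g] \<open>0 < P\<close> by (metis less_eq_real_def less_add_same_cancel1)
  define \<zeta> where "\<zeta> = z (a + P)"
  let ?f = "\<lambda>k. S' (real k * P) \<zeta>"
  have "summable ?f"
  proof (rule summable_comparison_test[OF exI[of _ 0]], intro allI impI)
    have "norm (exp (- \<nu> * P)) < 1" using K \<open>0 < P\<close> by simp
    then show "summable (\<lambda>k. K * norm \<zeta> * exp (- \<nu> * P) ^ k)"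
      by (intro summable_mult summable_geometric)
    fix k
    have "norm (?f k) \<le> K * exp (- \<nu> * (real k * P)) * norm \<zeta>"
      using \<open>0 < P\<close> by (intro exp_stable_bound[OF st']) auto
    also have "exp (- \<nu> * (real k * P)) = exp (- \<nu> * P) ^ k"
      by (simp add: exp_of_nat_mult[symmetric] algebra_simps)
    finally show "norm (?f k) \<le> K * norm \<zeta> * exp (- \<nu> * P) ^ k" by (simp add: mult_ac)
  qed
  define y0 where "y0 = (\<Sum>k. ?f k)"
  have "y0 = ?f 0 + (\<Sum>k. ?f (Suc k))"
    unfolding y0_def using suminf_split_head[OF \<open>summable ?f\<close>] by simp
  also have "?f (Suc k) = S' P (?f k)" for k
    using C0_semigroup_add[OF C0(2), of P "real k * P" \<zeta>] \<open>0 < P\<close> by (simp add: algebra_simps)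
  then have "(\<Sum>k. ?f (Suc k)) = S' P y0"
    unfolding y0_def using bounded_linear.suminf[OF blinfun.bounded_linear_right \<open>summable ?f\<close>, of "S' P"] by simp
  finally have y0: "y0 = \<zeta> + S' P y0" by (simp add: C0_semigroup_zero[OF C0(2)])
  have "mild_sol S a (a + P) (\<lambda>_. 0) (\<lambda>t. S' (t - a) y0)"
    unfolding mild_sol_def
  proof (intro allI impI)
    fix t1 t2 x assume "a \<le> t1" "t1 \<le> t2"
    moreover from this have "S (t2 - t1) x \<bullet> S' (t1 - a) y0 = x \<bullet> S' (t2 - t1) (S' (t1 - a) y0)"
      using dual by (simp add: dual_semigroups_def)
    ultimately have "S' (t2 - a) y0 \<bullet> x = S' (t1 - a) y0 \<bullet> S (t2 - t1) x"
      using C0_semigroup_add[OF C0(2), of "t2 - t1" "t1 - a" y0] by (simp add: inner_commute)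
    then show "((\<lambda>s. 0 \<bullet> S (t2 - s) x) has_integral (S' (t2 - a) y0 \<bullet> x - S' (t1 - a) y0 \<bullet> S (t2 - t1) x)) {t1..t2}"
      by simp
  qed
  from mild_sol_add[OF z(2) this]
  have "mild_sol S a (a + P) g (\<lambda>t. z t + S' (t - a) y0)" by simp
  moreover have "z a + S' (a - a) y0 = z (a + P) + S' (a + P - a) y0"
    using y0 z(1) by (simp add: \<zeta>_def C0_semigroup_zero[OF C0(2)])
  ultimately show ?thesis by blast
qed

section \<open>Exponential dichotomy from integral bounds\<close>

lemma nonincreasing_if_deriv_nonpos:
  fixes f :: "real \<Rightarrow> real"
  assumes "a \<le> b"
    and deriv: "\<And>r. a \<le> r \<Longrightarrow> r \<le> b \<Longrightarrow> \<exists>d. (f has_real_derivative d) (at r within {a..b}) \<and> d \<le> 0"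
  shows "f b \<le> f a"
proof (cases "a = b")
  case False
  then have "a < b" using assms by simp
  define d where "d r = (SOME d. (f has_real_derivative d) (at r within {a..b}) \<and> d \<le> 0)" for r
  have d: "(f has_real_derivative d r) (at r within {a..b}) \<and> d r \<le> 0" if "a \<le> r" "r \<le> b" for r
    unfolding d_def by (rule someI_ex[OF deriv[OF that]])
  obtain \<xi> where \<xi>: "\<xi> \<in> {a<..<b}" "f b - f a = (*) (d \<xi>) (b - a)"
    using mvt_simple[OF \<open>a < b\<close>, of f "\<lambda>r. (*) (d r)"] d unfolding has_field_derivative_def by blast
  then have "d \<xi> * (b - a) \<le> 0"
    using d[of \<xi>] \<open>a < b\<close> by (intro mult_nonpos_nonneg) auto
  with \<xi>(2) show ?thesis by simp
qed simp

text \<open>Shrinking the interval symmetrically, \<open>\<phi>\<close> has derivative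
  \<open>- (m s + m (T - s))\<close>, so \<open>int\<close> reads \<phi> \<le> - c \<phi>' and
  \<open>\<phi>\<close> decays at rate 1/c. The mean value theorem finds a good pair of end points
  within distance 1, and \<open>pt\<close> passes from integrals to point values.\<close>

lemma dichotomy_decay:
  fixes m :: "real \<Rightarrow> real"
  assumes cont: "continuous_on {0..T} m" and nonneg: "\<And>t. t \<in> {0..T} \<Longrightarrow> 0 \<le> m t" and c: "0 < c"
    and int: "\<And>a b. 0 \<le> a \<Longrightarrow> a \<le> b \<Longrightarrow> b \<le> T \<Longrightarrow> integral {a..b} m \<le> c * (m a + m b)"
    and pt: "\<And>a b t. 0 \<le> a \<Longrightarrow> a \<le> t \<Longrightarrow> t \<le> b \<Longrightarrow> b \<le> T \<Longrightarrow> m t \<le> c * (m a + m b)"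
    and t: "t \<in> {0..T}"
  shows "m t \<le> (c + c\<^sup>2) * exp (1 / c) * (m 0 + m T) * (exp (- t / c) + exp (- (T - t) / c))"
proof -
  define \<phi> where "\<phi> s = integral {s..T - s} m" for s
  define M where "M = m 0 + m T"
  have "0 \<le> M" unfolding M_def using nonneg[of 0] nonneg[of T] t by auto
  define I where "I r = integral {0..r} m" for r
  have I': "(I has_real_derivative m r) (at r within {0..T})" if "r \<in> {0..T}" for r
    unfolding I_def has_real_derivative_iff_has_vector_derivative
    by (rule integral_has_vector_derivative[OF cont that])
  have \<phi>_eq: "\<phi> s = I (T - s) - I s" if "s \<in> {0..T/2}" for s
  proof -
    have "m integrable_on {0..T - s}"
      by (rule integrable_subinterval_real[OF integrable_continuous_interval[OF cont]]) (use that in auto)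
    then have "I s + \<phi> s = I (T - s)"
      unfolding I_def \<phi>_def using that by (intro Henstock_Kurzweil_Integration.integral_combine) auto
    then show ?thesis by simp
  qed
  have D: "((\<lambda>s. I (T - s) - I s) has_real_derivative (- (m s + m (T - s)))) (at s within {0..T/2})"
    if s: "s \<in> {0..T/2}" for s
  proof -
    have "(I has_real_derivative m (T - s)) (at (T - s) within (\<lambda>s. T - s) ` {0..T/2})"
      using s by (intro DERIV_subset[OF I']) auto
    then have "((I \<circ> (\<lambda>s. T - s)) has_real_derivative m (T - s) * (- 1)) (at s within {0..T/2})"
      by (intro DERIV_image_chain) (auto intro!: derivative_eq_intros)
    moreover have "(I has_real_derivative m s) (at s within {0..T/2})"
      using s by (intro DERIV_subset[OF I']) auto
    ultimately show ?thesis
      by (auto simp: o_def intro!: derivative_eq_intros)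
  qed
  have decay: "\<phi> s \<le> c * M * exp (- s / c)" if s: "s \<in> {0..T/2}" for s
  proof -
    \<comment> \<open>The integrating factor: the differential inequality for \<open>\<phi>\<close>
      says that this product does not increase.\<close>
    let ?\<psi> = "\<lambda>s. (I (T - s) - I s) * exp (s / c)"
    have "?\<psi> s \<le> ?\<psi> 0"
    proof (rule nonincreasing_if_deriv_nonpos[where f = ?\<psi> and a = 0 and b = s])
      show "0 \<le> s" using s by simp
      fix r assume r: "0 \<le> r" "r \<le> s"
      then have r': "r \<in> {0..T/2}" using s by simp
      have "((\<lambda>s. I (T - s) - I s) has_real_derivative (- (m r + m (T - r)))) (at r within {0..s})"
        using s by (intro DERIV_subset[OF D[OF r']]) auto
      moreover have "((\<lambda>s. exp (s / c)) has_real_derivative 1 / c * exp (r / c)) (at r within {0..s})"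
        using c by (auto intro!: derivative_eq_intros)
      ultimately have "(?\<psi> has_real_derivative (I (T - r) - I r) * (1 / c * exp (r / c)) + (- (m r + m (T - r))) * exp (r / c)) (at r within {0..s})"
        by (rule DERIV_mult')
      moreover have "(I (T - r) - I r) * (1 / c * exp (r / c)) + (- (m r + m (T - r))) * exp (r / c) \<le> 0"
      proof -
        have "\<phi> r \<le> c * (m r + m (T - r))" unfolding \<phi>_def using r' by (intro int) auto
        then have "(I (T - r) - I r) / c \<le> m r + m (T - r)"
          using c by (simp add: \<phi>_eq[OF r'] pos_divide_le_eq mult.commute)
        then have "(I (T - r) - I r) / c * exp (r / c) \<le> (m r + m (T - r)) * exp (r / c)"
          by (intro mult_right_mono) auto
        then show ?thesis by (simp add: algebra_simps diff_divide_distrib)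
      qed
      ultimately show "\<exists>y. (?\<psi> has_real_derivative y) (at r within {0..s}) \<and> y \<le> 0" by blast
    qed
    then have "\<phi> s * exp (s / c) \<le> \<phi> 0" using s by (simp add: \<phi>_eq)
    also have "\<dots> \<le> c * M" unfolding \<phi>_def M_def using t int[of 0 T] by simp
    finally have "\<phi> s * exp (s / c) * exp (- s / c) \<le> c * M * exp (- s / c)"
      by (intro mult_right_mono) auto
    then show ?thesis by (simp add: mult.assoc exp_add[symmetric])
  qed
  define s where "s = min t (T - t)"
  have s: "s \<in> {0..T/2}" "s \<le> t" "t \<le> T - s" using t by (auto simp: s_def min_def)
  have "m t \<le> (c + c\<^sup>2) * exp (1 / c) * M * exp (- s / c)"
  \<comment> \<open>Near the ends there is no room to step back by one unit; there the factor exp (1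
    / c) makes up for the missing decay. The summands \<open>c\<close> and \<open>c\<^sup>2\<close>
    of the constant stem from the two cases.\<close>
  proof (cases "s \<le> 1")
    case True
    have "m t \<le> c * M" unfolding M_def using t by (intro pt) auto
    also have "\<dots> = c * M * 1" by simp
    also have "\<dots> \<le> (c + c\<^sup>2) * M * exp ((1 - s) / c)"
      using c True \<open>0 \<le> M\<close> by (intro mult_mono) auto
    also have "exp ((1 - s) / c) = exp (1 / c) * exp (- s / c)"
      by (simp add: exp_add[symmetric] diff_divide_distrib)
    finally show ?thesis by (simp add: mult_ac)
  next
    case False
    then have s1: "s - 1 < s" "s - 1 \<in> {0..T/2}" using s by auto
    \<comment> \<open>Some \<open>\<xi>\<close> has \<open>m \<xi> + m (T - \<xi>)\<close> equal to
      the drop of \<open>\<phi>\<close> over {s - 1..s}, hence at most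
      \<open>\<phi> (s - 1)\<close>.\<close>
    have "\<exists>\<xi>\<in>{s - 1<..<s}. (\<lambda>s. I (T - s) - I s) s - (\<lambda>s. I (T - s) - I s) (s - 1)
        = (*) (- (m \<xi> + m (T - \<xi>))) (s - (s - 1))"
    proof (rule mvt_simple)
      show "s - 1 < s" by simp
      show "((\<lambda>s. I (T - s) - I s) has_derivative (*) (- (m x + m (T - x)))) (at x within {s - 1..s})"
        if "s - 1 \<le> x" "x \<le> s" for x
        unfolding has_field_derivative_def[symmetric]
        using that s s1 by (intro DERIV_subset[OF D]) auto
    qed
    then obtain \<xi> where \<xi>: "s - 1 < \<xi>" "\<xi> < s" "\<phi> s - \<phi> (s - 1) = - (m \<xi> + m (T - \<xi>))"
      using \<phi>_eq[OF s(1)] \<phi>_eq[OF s1(2)] by auto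
    have "0 \<le> \<phi> s"
      unfolding \<phi>_def using s
      by (intro integral_nonneg integrable_subinterval_real[OF integrable_continuous_interval[OF cont]] nonneg) auto
    have "m t \<le> c * (m \<xi> + m (T - \<xi>))" using \<xi> s s1 by (intro pt) auto
    also have "\<dots> \<le> c * \<phi> (s - 1)" using \<xi>(3) \<open>0 \<le> \<phi> s\<close> c by (intro mult_left_mono) auto
    also have "\<dots> \<le> c * (c * M * exp (- (s - 1) / c))" using c by (intro mult_left_mono decay s1) auto
    also have "exp (- (s - 1) / c) = exp (1 / c) * exp (- s / c)"
      by (simp add: exp_add[symmetric] diff_divide_distrib add_divide_distrib)
    also have "c * (c * M * (exp (1 / c) * exp (- s / c))) = c\<^sup>2 * exp (1 / c) * M * exp (- s / c)"
      by (simp add: power2_eq_square)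
    also have "\<dots> \<le> (c + c\<^sup>2) * exp (1 / c) * M * exp (- s / c)"
      using c \<open>0 \<le> M\<close> by (intro mult_right_mono) auto
    finally show ?thesis .
  qed
  also have "\<dots> \<le> (c + c\<^sup>2) * exp (1 / c) * M * (exp (- t / c) + exp (- (T - t) / c))"
  proof (rule mult_left_mono)
    have "s = t \<or> s = T - t" by (auto simp: s_def min_def)
    then show "exp (- s / c) \<le> exp (- t / c) + exp (- (T - t) / c)"
      by (elim disjE) (simp_all only: le_add_same_cancel1 le_add_same_cancel2 exp_ge_zero)
  qed (use c \<open>0 \<le> M\<close> in auto)
  finally show ?thesis by (simp add: M_def)
qed

section \<open>The Hamiltonian system\<close>

lemma adj_adj: "adj (adj F) = F"
  for F :: "'a::{real_inner,banach} \<Rightarrow>\<^sub>L 'b::{real_inner,banach}"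
proof (rule blinfun_eqI, rule eq_if_inner_eq)
  fix x y
  have "adj (adj F) x \<bullet> y = x \<bullet> adj F y" by (rule adj_inner_left)
  also have "\<dots> = F x \<bullet> y" by (rule adj_inner[symmetric])
  finally show "adj (adj F) x \<bullet> y = F x \<bullet> y" .
qed

lemma adj_compose: "adj (F o\<^sub>L G) x = adj G (adj F x)"
  for F :: "'b::{real_inner,banach} \<Rightarrow>\<^sub>L 'c::{real_inner,banach}"
    and G :: "'a::{real_inner,banach} \<Rightarrow>\<^sub>L 'b"
  by (rule eq_if_inner_eq) (simp add: adj_inner_left)

lemma norm_square_add_le: "(norm (x + y))\<^sup>2 \<le> 2 * (norm x)\<^sup>2 + 2 * (norm y)\<^sup>2"
  for x y :: "'a::real_normed_vector"
proof -
  have "(norm (x + y))\<^sup>2 \<le> (norm x + norm y)\<^sup>2"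
    by (intro power_mono norm_triangle_ineq) auto
  also have "\<dots> \<le> 2 * (norm x)\<^sup>2 + 2 * (norm y)\<^sup>2"
    using zero_le_power2[of "norm x - norm y"] by (simp add: power2_sum power2_diff)
  finally show ?thesis .
qed

lemma norm_square_blinfun_le: "(norm (blinfun_apply F x))\<^sup>2 \<le> (norm F)\<^sup>2 * (norm x)\<^sup>2"
  using power_mono[OF norm_blinfun[of F x] norm_ge_zero, of 2] by (simp add: power_mult_distrib)

text \<open>\<open>T\<close>, \<open>T'\<close> are the semigroups of \<open>A\<close> and \<open>A\<^sup>*\<close>; \<open>S\<close>, \<open>S'\<close> those of \<open>A + B F\<close> and its adjoint;
  \<open>R\<close> is the semigroup of \<open>A\<^sup>* + C\<^sup>* L\<close>.\<close>

locale lq =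
  fixes A :: "'x::{real_inner,banach} \<rightharpoonup> 'x"
    and B :: "'u::{real_inner,banach} \<Rightarrow>\<^sub>L 'x"
    and C :: "'x \<Rightarrow>\<^sub>L 'v::{real_inner,banach}"
    and Q :: "'u \<Rightarrow>\<^sub>L 'u"
    and T T' S S' R :: "real \<Rightarrow> 'x \<Rightarrow>\<^sub>L 'x"
    and F :: "'x \<Rightarrow>\<^sub>L 'u" and L :: "'x \<Rightarrow>\<^sub>L 'v"
    and K \<nu> :: real
  assumes T: "generates A T" and T': "generates (op_adj A) T'" and dual_T: "dual_semigroups T T'"
    and S: "generates (op_plus A (B o\<^sub>L F)) S"
    and S': "generates (op_plus (op_adj A) (adj (B o\<^sub>L F))) S'" and dual_S: "dual_semigroups S S'"
    and R: "generates (op_plus (op_adj A) (adj C o\<^sub>L L)) R"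
    and stable_S: "exp_stable K \<nu> S" and stable_R: "exp_stable K \<nu> R"
    and pos_Q: "positive_definite Q" and inv_Q: "invertible_op Q"
begin

lemma dual_T': "dual_semigroups T' T" and dual_S': "dual_semigroups S' S"
  by (rule dual_semigroups_sym[OF dual_T], rule dual_semigroups_sym[OF dual_S])

lemma stable_S': "exp_stable K \<nu> S'"
  by (rule exp_stable_dual[OF stable_S dual_S])

lemma K_pos: "0 < K" and \<nu>_pos: "0 < \<nu>"
  using stable_S by (auto simp: exp_stable_def)

abbreviation W :: "'x \<Rightarrow> 'x" where "W x \<equiv> B (inv_op Q (adj B x))"

lemma Q_sym: "Q x \<bullet> y = x \<bullet> Q y"
  using pos_Q by (simp add: positive_definite_def self_adjoint_def)

lemma inv_Q_coercive: "\<exists>q>0. \<forall>x. q * (norm x)\<^sup>2 \<le> inv_op Q x \<bullet> x"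
proof -
  obtain q where q: "q > 0" "\<And>x. q * (norm x)\<^sup>2 \<le> Q x \<bullet> x"
    using positive_definite_coercive[OF pos_Q inv_Q] by blast
  have k: "0 < 1 + (norm Q)\<^sup>2" by (simp add: add_pos_nonneg)
  have "q / (1 + (norm Q)\<^sup>2) * (norm x)\<^sup>2 \<le> inv_op Q x \<bullet> x" for x
  proof -
    have "(norm x)\<^sup>2 \<le> (norm Q)\<^sup>2 * (norm (inv_op Q x))\<^sup>2"
      using norm_square_blinfun_le[of Q "inv_op Q x"] by (simp add: inv_op_works[OF inv_Q])
    also have "\<dots> \<le> (1 + (norm Q)\<^sup>2) * (norm (inv_op Q x))\<^sup>2" by (intro mult_right_mono) auto
    finally have "q * (norm x)\<^sup>2 \<le> q * ((1 + (norm Q)\<^sup>2) * (norm (inv_op Q x))\<^sup>2)"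
      using q(1) by (intro mult_left_mono) auto
    also have "\<dots> \<le> (1 + (norm Q)\<^sup>2) * (Q (inv_op Q x) \<bullet> inv_op Q x)"
      using mult_left_mono[OF q(2)[of "inv_op Q x"], of "1 + (norm Q)\<^sup>2"] k by (simp add: mult_ac)
    finally show ?thesis
      using k by (simp add: inv_op_works[OF inv_Q] inner_commute pos_divide_le_eq mult.commute)
  qed
  moreover have "q / (1 + (norm Q)\<^sup>2) > 0" using q(1) k by simp
  ultimately show ?thesis by blast
qed

text \<open>Output injection: a trajectory of \<open>A\<close> is also one of the stable operator
  \<open>A + L\<^sup>* C\<close>, at the price of the source \<open>- L\<^sup>* C y\<close>. Thus
  input and output alone control the state.\<close>

lemma forward_detect:
  assumes "mild_sol T' a b g y" "continuous_on {a..b} g"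
  shows "mild_sol R a b (\<lambda>t. g t - adj L (C (y t))) y"
  using mild_sol_perturb_continuous[OF dual_T' T' R assms] by (simp add: adj_compose adj_adj)

text \<open>The dual of output injection: for the multiplier the observed quantity is
  \<open>adj B (l t)\<close>, and stabilizability of the state equation plays the part of
  detectability.\<close>

lemma backward_stabilize:
  assumes "back_sol T a b h l" "continuous_on {a..b} h"
  shows "back_sol S a b (\<lambda>t. h t + adj F (adj B (l t))) l"
  using back_sol_perturb[OF dual_T T S assms] by (simp add: adj_compose)

text \<open>The pairing bounds the integral \<open>I\<close> of the observed energies by the
  boundary term, which involves the free ends \<open>y b\<close> and \<open>l a\<close>. The energy
  estimates in turn bound these by the data \<open>y a\<close>, \<open>l b\<close> and by
  \<open>I\<close>. Young's inequality with a small weight breaks the circle.\<close>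

lemma hamiltonian_bound:
  obtains c where "c > 0" and "\<And>a b y l. a \<le> b \<Longrightarrow> mild_sol T' a b (\<lambda>t. W (l t)) y \<Longrightarrow>
    back_sol T a b (\<lambda>t. adj C (C (y t))) l \<Longrightarrow> continuous_on {a..b} y \<Longrightarrow> continuous_on {a..b} l \<Longrightarrow>
    (\<forall>t\<in>{a..b}. (norm (y t))\<^sup>2 + (norm (l t))\<^sup>2 \<le> c * ((norm (y a))\<^sup>2 + (norm (l b))\<^sup>2)) \<and>
    integral {a..b} (\<lambda>t. (norm (y t))\<^sup>2 + (norm (l t))\<^sup>2) \<le> c * ((norm (y a))\<^sup>2 + (norm (l b))\<^sup>2)"
proof -
  obtain q0 where q0: "q0 > 0" "\<And>x. q0 * (norm x)\<^sup>2 \<le> inv_op Q x \<bullet> x"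
    using inv_Q_coercive by blast
  \<comment> \<open>The output enters the pairing with coefficient 1 and \<open>adj B (l t)\<close>
    with coefficient \<open>q0\<close>; the minimum is a lower bound for both.\<close>
  define q where "q = min q0 1"
  have q: "q > 0" "q \<le> q0" "q \<le> 1" using q0 by (auto simp: q_def)
  \<comment> \<open>Bounds the squared sources of both stabilised equations by the observed energy
    \<open>?E\<close>; the factors 2 come from squaring a sum.\<close>
  define k where "k = 2 * (norm (B o\<^sub>L inv_op Q))\<^sup>2 + 2 * (norm (adj L))\<^sup>2 + 2 * (norm (adj C))\<^sup>2 + 2 * (norm (adj F))\<^sup>2"
  have k0: "k \<ge> 0" by (simp add: k_def)
  \<comment> \<open>\<open>\<alpha>\<close> is a common factor for both energy estimates,
    \<open>\<gamma>\<close> will bound \<open>?N + I\<close> by \<open>?N\<close>, and the two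
    summands of \<open>c\<close> serve the pointwise and the integral claim.\<close>
  define \<alpha> where "\<alpha> = 1 + K\<^sup>2 + K\<^sup>2 / \<nu> * k"
  have \<alpha>: "\<alpha> \<ge> 1" "K\<^sup>2 \<le> \<alpha>" "K\<^sup>2 / \<nu> * k \<le> \<alpha>"
    using K_pos \<nu>_pos k0 by (auto simp: \<alpha>_def)
  define \<gamma> where "\<gamma> = 1 + (1 / 2 + 2 * \<alpha> / q\<^sup>2)"
  have \<gamma>: "\<gamma> > 0" using \<alpha> q by (simp add: \<gamma>_def add_pos_nonneg)
  define c where "c = 2 * \<alpha> * \<gamma> + 2 * \<alpha> * \<gamma> / \<nu>"
  have c: "c > 0" using \<alpha> \<gamma> \<nu>_pos by (simp add: c_def add_pos_pos)
  have main: "(\<forall>t\<in>{a..b}. (norm (y t))\<^sup>2 + (norm (l t))\<^sup>2 \<le> c * ((norm (y a))\<^sup>2 + (norm (l b))\<^sup>2)) \<and>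
    integral {a..b} (\<lambda>t. (norm (y t))\<^sup>2 + (norm (l t))\<^sup>2) \<le> c * ((norm (y a))\<^sup>2 + (norm (l b))\<^sup>2)"
    if "a \<le> b" and y: "mild_sol T' a b (\<lambda>t. W (l t)) y" and l: "back_sol T a b (\<lambda>t. adj C (C (y t))) l"
      and cy: "continuous_on {a..b} y" and cl: "continuous_on {a..b} l" for a b y l
  proof -
    let ?E = "\<lambda>t. (norm (C (y t)))\<^sup>2 + (norm (adj B (l t)))\<^sup>2"
    let ?g = "\<lambda>t. W (l t) - adj L (C (y t))"
    let ?h = "\<lambda>t. adj C (C (y t)) + adj F (adj B (l t))"
    let ?N = "(norm (y a))\<^sup>2 + (norm (l b))\<^sup>2"
    have y': "mild_sol R a b ?g y" by (rule forward_detect[OF y]) (intro continuous_intros cl)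
    have l': "back_sol S a b ?h l" by (rule backward_stabilize[OF l]) (intro continuous_intros cy)
    have cE: "continuous_on {a..b} ?E" and cg: "continuous_on {a..b} ?g" and ch: "continuous_on {a..b} ?h"
      by (intro continuous_intros cy cl)+
    have gE: "(norm (?g t))\<^sup>2 \<le> k * ?E t" and hE: "(norm (?h t))\<^sup>2 \<le> k * ?E t" for t
    proof -
      have le: "\<beta> \<ge> 0 \<Longrightarrow> \<gamma> \<ge> 0 \<Longrightarrow> 2 * \<beta> \<le> k \<Longrightarrow> 2 * \<gamma> \<le> k \<Longrightarrow> r \<ge> 0 \<Longrightarrow> s \<ge> 0 \<Longrightarrow>
          2 * (\<beta> * r) + 2 * (\<gamma> * s) \<le> k * (s + r)" for \<beta> \<gamma> r s :: real
        using mult_right_mono[of "2 * \<beta>" k r] mult_right_mono[of "2 * \<gamma>" k s] by (simp add: algebra_simps)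
      have "(norm (?g t))\<^sup>2 \<le> 2 * (norm ((B o\<^sub>L inv_op Q) (adj B (l t))))\<^sup>2 + 2 * (norm (adj L (C (y t))))\<^sup>2"
        using norm_square_add_le[of "(B o\<^sub>L inv_op Q) (adj B (l t))" "- adj L (C (y t))"] by simp
      also have "\<dots> \<le> 2 * ((norm (B o\<^sub>L inv_op Q))\<^sup>2 * (norm (adj B (l t)))\<^sup>2) + 2 * ((norm (adj L))\<^sup>2 * (norm (C (y t)))\<^sup>2)"
        by (intro add_mono mult_left_mono norm_square_blinfun_le) auto
      also have "\<dots> \<le> k * ?E t" by (rule le) (auto simp: k_def)
      finally show "(norm (?g t))\<^sup>2 \<le> k * ?E t" .
      have "(norm (?h t))\<^sup>2 \<le> 2 * (norm (adj F (adj B (l t))))\<^sup>2 + 2 * (norm (adj C (C (y t))))\<^sup>2"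
        using norm_square_add_le[of "adj F (adj B (l t))" "adj C (C (y t))"] by (simp add: add.commute)
      also have "\<dots> \<le> 2 * ((norm (adj F))\<^sup>2 * (norm (adj B (l t)))\<^sup>2) + 2 * ((norm (adj C))\<^sup>2 * (norm (C (y t)))\<^sup>2)"
        by (intro add_mono mult_left_mono norm_square_blinfun_le) auto
      also have "\<dots> \<le> k * ?E t" by (rule le) (auto simp: k_def)
      finally show "(norm (?h t))\<^sup>2 \<le> k * ?E t" .
    qed
    have intE: "?E integrable_on {s..r}" if "a \<le> s" "r \<le> b" for s r
      by (rule integrable_subinterval_real[OF integrable_continuous_interval[OF cE]]) (use that in auto)
    define I where "I = integral {a..b} ?E"
    have subE: "integral {s..r} ?E \<le> I" if "a \<le> s" "r \<le> b" for s r
      unfolding I_def using that by (intro integral_subset_le intE) auto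
    have I0: "0 \<le> I" unfolding I_def by (intro integral_nonneg intE) auto
    have bound: "K\<^sup>2 * n + K\<^sup>2 / \<nu> * integral {s..r} (\<lambda>t. (norm (f t))\<^sup>2) \<le> \<alpha> * (n + I)"
      if "a \<le> s" "r \<le> b" "n \<ge> 0" "continuous_on {a..b} f" "\<And>t. (norm (f t))\<^sup>2 \<le> k * ?E t"
      for s r n and f :: "real \<Rightarrow> 'x"
    proof -
      have "(\<lambda>t. (norm (f t))\<^sup>2) integrable_on {s..r}"
        using that by (intro integrable_continuous_interval continuous_intros continuous_on_subset[OF that(4)]) auto
      then have "integral {s..r} (\<lambda>t. (norm (f t))\<^sup>2) \<le> integral {s..r} (\<lambda>t. k * ?E t)"
        using that by (intro integral_le integrable_on_mult_right intE) auto
      also have "\<dots> = k * integral {s..r} ?E" by simp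
      also have "\<dots> \<le> k * I" using that subE k0 by (intro mult_left_mono) auto
      finally have "K\<^sup>2 / \<nu> * integral {s..r} (\<lambda>t. (norm (f t))\<^sup>2) \<le> K\<^sup>2 / \<nu> * (k * I)"
        using \<nu>_pos by (intro mult_left_mono) auto
      also have "\<dots> = (K\<^sup>2 / \<nu> * k) * I" by simp
      also have "\<dots> \<le> \<alpha> * I" by (intro mult_right_mono \<alpha> I0)
      finally show ?thesis
        using mult_right_mono[OF \<alpha>(2) that(3)] by (simp add: distrib_left)
    qed
    have sub: "continuous_on {s..r} f" if "a \<le> s" "r \<le> b" "continuous_on {a..b} f" for s r and f :: "real \<Rightarrow> 'x"
      using that(3) by (rule continuous_on_subset) (use that in auto)
    have ey: "(norm (y t))\<^sup>2 + \<nu> * integral {a..t} (\<lambda>t. (norm (y t))\<^sup>2) \<le> \<alpha> * ((norm (y a))\<^sup>2 + I)" if t: "t \<in> {a..b}" for t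
      using t by (intro order_trans[OF mild_sol_energy[OF stable_R mild_sol_subset[OF y']] bound[OF _ _ _ cg gE]]
          sub[OF _ _ cy] sub[OF _ _ cg]) auto
    have el: "(norm (l t))\<^sup>2 + \<nu> * integral {t..b} (\<lambda>t. (norm (l t))\<^sup>2) \<le> \<alpha> * ((norm (l b))\<^sup>2 + I)" if t: "t \<in> {a..b}" for t
      using t by (intro order_trans[OF back_sol_energy[OF stable_S back_sol_subset[OF l']] bound[OF _ _ _ ch hE]]
          sub[OF _ _ cl] sub[OF _ _ ch]) auto
    have int_nonneg: "0 \<le> integral {s..r} (\<lambda>t. (norm (f t))\<^sup>2)" for s r and f :: "real \<Rightarrow> 'x"
      by (cases "(\<lambda>t. (norm (f t))\<^sup>2) integrable_on {s..r}") (auto intro: integral_nonneg simp: not_integrable_integral)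
    have y_le: "(norm (y t))\<^sup>2 \<le> \<alpha> * ((norm (y a))\<^sup>2 + I)" and l_le: "(norm (l t))\<^sup>2 \<le> \<alpha> * ((norm (l b))\<^sup>2 + I)"
      if "t \<in> {a..b}" for t
      using ey[OF that] el[OF that] int_nonneg[of a t y] int_nonneg[of t b l] \<nu>_pos
      by (smt (verit) mult_nonneg_nonneg)+
    have pairing: "((\<lambda>s. W (l s) \<bullet> l s + y s \<bullet> adj C (C (y s))) has_integral (y b \<bullet> l b - y a \<bullet> l a)) {a..b}"
      using l[unfolded back_sol_iff]
      by (intro mild_sol_pairing[OF dual_T' y] L1_on_continuous continuous_intros cl cy \<open>a \<le> b\<close>) auto
    have "((\<lambda>s. q * ?E s) has_integral q * I) {a..b}"
      unfolding I_def by (intro has_integral_mult_right integrable_integral intE) auto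
    then have "q * I \<le> y b \<bullet> l b - y a \<bullet> l a"
    proof (rule has_integral_le[OF _ pairing])
      fix s
      have "q * (norm (adj B (l s)))\<^sup>2 \<le> q0 * (norm (adj B (l s)))\<^sup>2" using q by (intro mult_right_mono) auto
      also have "\<dots> \<le> W (l s) \<bullet> l s" using q0(2)[of "adj B (l s)"] by (simp add: adj_inner)
      finally have "q * (norm (adj B (l s)))\<^sup>2 \<le> W (l s) \<bullet> l s" .
      moreover have "q * (norm (C (y s)))\<^sup>2 \<le> y s \<bullet> adj C (C (y s))"
        using mult_right_mono[OF q(3), of "(norm (C (y s)))\<^sup>2"] by (simp add: adj_inner[symmetric] power2_norm_eq_inner)
      ultimately show "q * ?E s \<le> W (l s) \<bullet> l s + y s \<bullet> adj C (C (y s))" by (simp add: distrib_left)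
    qed
    moreover
    \<comment> \<open>With this weight each of the two boundary products returns q/4 times
      \<open>I\<close>; together they use up half of the left-hand side
      \<open>q * I\<close>.\<close>
    define \<epsilon> where "\<epsilon> = q / (4 * \<alpha>)"
    have \<epsilon>: "\<epsilon> > 0" using q \<alpha> by (simp add: \<epsilon>_def)
    have young: "u \<bullet> v \<le> \<epsilon> * (norm u)\<^sup>2 + 1 / (4 * \<epsilon>) * (norm v)\<^sup>2" for u v :: 'x
    proof -
      have "0 \<le> (2 * \<epsilon> * norm u - norm v)\<^sup>2 / (4 * \<epsilon>)" using \<epsilon> by simp
      also have "\<dots> = \<epsilon> * (norm u)\<^sup>2 + 1 / (4 * \<epsilon>) * (norm v)\<^sup>2 - norm u * norm v"
        using \<epsilon> by (simp add: power2_diff power_mult_distrib field_simps power2_eq_square)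
      finally show ?thesis using norm_cauchy_schwarz[of u v] by linarith
    qed
    have yb: "\<epsilon> * (norm (y b))\<^sup>2 \<le> \<epsilon> * (\<alpha> * ((norm (y a))\<^sup>2 + I))"
      and la: "\<epsilon> * (norm (l a))\<^sup>2 \<le> \<epsilon> * (\<alpha> * ((norm (l b))\<^sup>2 + I))"
      using \<epsilon> \<open>a \<le> b\<close> by (intro mult_left_mono y_le l_le; simp)+
    have "y b \<bullet> l b \<le> \<epsilon> * (\<alpha> * ((norm (y a))\<^sup>2 + I)) + 1 / (4 * \<epsilon>) * (norm (l b))\<^sup>2"
      using young[of "y b" "l b"] yb by linarith
    moreover have "- (y a \<bullet> l a) \<le> \<epsilon> * (\<alpha> * ((norm (l b))\<^sup>2 + I)) + 1 / (4 * \<epsilon>) * (norm (y a))\<^sup>2"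
      using young[of "l a" "- y a"] la by (simp add: inner_commute)
    moreover have "\<epsilon> * \<alpha> = q / 4" "1 / (4 * \<epsilon>) = \<alpha> / q" using q \<alpha> by (auto simp: \<epsilon>_def field_simps)
    then have "\<epsilon> * (\<alpha> * r) = q / 4 * r" for r by (metis mult.assoc)
    ultimately have "q * I \<le> q / 4 * ((norm (y a))\<^sup>2 + I) + \<alpha> / q * (norm (l b))\<^sup>2
        + (q / 4 * ((norm (l b))\<^sup>2 + I) + \<alpha> / q * (norm (y a))\<^sup>2)"
      using \<open>1 / (4 * \<epsilon>) = \<alpha> / q\<close> by simp
    then have "q / 2 * I \<le> (q / 4 + \<alpha> / q) * ?N" by (simp add: algebra_simps)
    then have "2 / q * (q / 2 * I) \<le> 2 / q * ((q / 4 + \<alpha> / q) * ?N)"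
      using q by (intro mult_left_mono) auto
    also have "2 / q * ((q / 4 + \<alpha> / q) * ?N) = (1 / 2 + 2 * \<alpha> / q\<^sup>2) * ?N"
      using q by (simp add: field_simps power2_eq_square)
    finally have "I \<le> (1 / 2 + 2 * \<alpha> / q\<^sup>2) * ?N" using q by simp
    moreover have "\<gamma> * ?N = ?N + (1 / 2 + 2 * \<alpha> / q\<^sup>2) * ?N"
      by (simp only: \<gamma>_def distrib_right[of 1] mult_1_left)
    ultimately have NI: "?N + I \<le> \<gamma> * ?N" by linarith
    have aN: "\<alpha> * ((norm (y a))\<^sup>2 + I) \<le> \<alpha> * (\<gamma> * ?N)" "\<alpha> * ((norm (l b))\<^sup>2 + I) \<le> \<alpha> * (\<gamma> * ?N)"
      using NI \<alpha> by (intro mult_left_mono; simp add: add_increasing add_increasing2; smt (verit) zero_le_power2)+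
    have N0: "0 \<le> ?N" by simp
    have "(norm (y t))\<^sup>2 + (norm (l t))\<^sup>2 \<le> c * ?N" if t: "t \<in> {a..b}" for t
    proof -
      have "(norm (y t))\<^sup>2 + (norm (l t))\<^sup>2 \<le> \<alpha> * (\<gamma> * ?N) + \<alpha> * (\<gamma> * ?N)"
        using y_le[OF t] l_le[OF t] aN by linarith
      also have "\<dots> = 2 * \<alpha> * \<gamma> * ?N" by simp
      also have "\<dots> \<le> c * ?N" unfolding c_def using \<alpha> \<gamma> \<nu>_pos by (intro mult_right_mono N0) auto
      finally show ?thesis .
    qed
    moreover have "integral {a..b} (\<lambda>t. (norm (y t))\<^sup>2 + (norm (l t))\<^sup>2) \<le> c * ?N"
    proof -
      have "integral {a..b} (\<lambda>t. (norm (y t))\<^sup>2 + (norm (l t))\<^sup>2)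
          = integral {a..b} (\<lambda>t. (norm (y t))\<^sup>2) + integral {a..b} (\<lambda>t. (norm (l t))\<^sup>2)"
        by (intro integral_add integrable_continuous_interval continuous_intros cy cl)
      moreover have "\<nu> * integral {a..b} (\<lambda>t. (norm (y t))\<^sup>2) \<le> \<alpha> * (\<gamma> * ?N)"
        "\<nu> * integral {a..b} (\<lambda>t. (norm (l t))\<^sup>2) \<le> \<alpha> * (\<gamma> * ?N)"
      proof -
        have "b \<in> {a..b}" "a \<in> {a..b}" using \<open>a \<le> b\<close> by auto
        from ey[OF this(1)] el[OF this(2)]
        show "\<nu> * integral {a..b} (\<lambda>t. (norm (y t))\<^sup>2) \<le> \<alpha> * (\<gamma> * ?N)"
          "\<nu> * integral {a..b} (\<lambda>t. (norm (l t))\<^sup>2) \<le> \<alpha> * (\<gamma> * ?N)"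
          using aN zero_le_power2[of "norm (y b)"] zero_le_power2[of "norm (l a)"] by linarith+
      qed
      ultimately have "\<nu> * integral {a..b} (\<lambda>t. (norm (y t))\<^sup>2 + (norm (l t))\<^sup>2) \<le> 2 * \<alpha> * \<gamma> * ?N"
        by (simp add: distrib_left)
      then have "integral {a..b} (\<lambda>t. (norm (y t))\<^sup>2 + (norm (l t))\<^sup>2) \<le> (2 * \<alpha> * \<gamma> / \<nu>) * ?N"
        using \<nu>_pos by (simp add: pos_le_divide_eq mult.commute)
      also have "\<dots> \<le> c * ?N" unfolding c_def using \<alpha> \<gamma> \<nu>_pos by (intro mult_right_mono N0) auto
      finally show ?thesis .
    qed
    ultimately show ?thesis by blast
  qed
  show thesis using c main by (rule that)
qed

text \<open>Restrictions of an extremal to subintervals are extremals, so one constant serves in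
  \<open>int\<close> and \<open>pt\<close> of the decay lemma for the sum of squares. Taking the
  square root halves the rate.\<close>

lemma hamiltonian_turnpike:
  "\<exists>c>0. \<exists>\<mu>>0. \<forall>\<tau>>0. \<forall>y l. mild_sol T' 0 \<tau> (\<lambda>t. W (l t)) y \<longrightarrow>
    back_sol T 0 \<tau> (\<lambda>t. adj C (C (y t))) l \<longrightarrow> continuous_on {0..\<tau>} y \<longrightarrow> continuous_on {0..\<tau>} l \<longrightarrow>
    (\<forall>t\<in>{0..\<tau>}. norm (y t) + norm (l t)
      \<le> c * (norm (y 0) + norm (l \<tau>)) * (exp (- \<mu> * t) + exp (- \<mu> * (\<tau> - t))))"
proof -
  obtain c where c: "c > 0" and main: "\<And>a b y l. a \<le> b \<Longrightarrow> mild_sol T' a b (\<lambda>t. W (l t)) y \<Longrightarrow>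
      back_sol T a b (\<lambda>t. adj C (C (y t))) l \<Longrightarrow> continuous_on {a..b} y \<Longrightarrow> continuous_on {a..b} l \<Longrightarrow>
      (\<forall>t\<in>{a..b}. (norm (y t))\<^sup>2 + (norm (l t))\<^sup>2 \<le> c * ((norm (y a))\<^sup>2 + (norm (l b))\<^sup>2)) \<and>
      integral {a..b} (\<lambda>t. (norm (y t))\<^sup>2 + (norm (l t))\<^sup>2) \<le> c * ((norm (y a))\<^sup>2 + (norm (l b))\<^sup>2)"
    by (rule hamiltonian_bound) (rule that)
  \<comment> \<open>One factor 2 comes from the square of a sum of two norms, the factor 2 c from
    expressing both end values through the prescribed data.\<close>
  define D where "D = 2 * (((c + c\<^sup>2) * exp (1 / c)) * (2 * c))"
  have D: "D > 0" using c by (simp add: D_def add_pos_pos)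
  have "norm (y t) + norm (l t)
      \<le> sqrt D * (norm (y 0) + norm (l \<tau>)) * (exp (- (1 / (2 * c)) * t) + exp (- (1 / (2 * c)) * (\<tau> - t)))"
    if "\<tau> > 0" and y: "mild_sol T' 0 \<tau> (\<lambda>t. W (l t)) y" and l: "back_sol T 0 \<tau> (\<lambda>t. adj C (C (y t))) l"
      and cy: "continuous_on {0..\<tau>} y" and cl: "continuous_on {0..\<tau>} l" and t: "t \<in> {0..\<tau>}" for \<tau> y l t
  proof -
    let ?m = "\<lambda>t. (norm (y t))\<^sup>2 + (norm (l t))\<^sup>2"
    let ?N = "(norm (y 0))\<^sup>2 + (norm (l \<tau>))\<^sup>2"
    have sub: "(\<forall>t\<in>{a..b}. ?m t \<le> c * (?m a + ?m b)) \<and> integral {a..b} ?m \<le> c * (?m a + ?m b)"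
      if "0 \<le> a" "a \<le> b" "b \<le> \<tau>" for a b
    proof -
      have "(\<forall>t\<in>{a..b}. ?m t \<le> c * ((norm (y a))\<^sup>2 + (norm (l b))\<^sup>2)) \<and> integral {a..b} ?m \<le> c * ((norm (y a))\<^sup>2 + (norm (l b))\<^sup>2)"
        using that by (intro main mild_sol_subset[OF y] back_sol_subset[OF l]
            continuous_on_subset[OF cy] continuous_on_subset[OF cl]) auto
      moreover have "c * ((norm (y a))\<^sup>2 + (norm (l b))\<^sup>2) \<le> c * (?m a + ?m b)"
        using c by (intro mult_left_mono) auto
      ultimately show ?thesis by (meson order_trans)
    qed
    have "\<forall>t\<in>{0..\<tau>}. ?m t \<le> c * ?N"
      using main[OF _ y l cy cl] \<open>\<tau> > 0\<close> by simp
    then have "?m 0 \<le> c * ?N" "?m \<tau> \<le> c * ?N" using \<open>\<tau> > 0\<close> by (auto elim!: ballE)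
    then have mN: "?m 0 + ?m \<tau> \<le> 2 * c * ?N" by linarith
    have "?m t \<le> (c + c\<^sup>2) * exp (1 / c) * (?m 0 + ?m \<tau>) * (exp (- t / c) + exp (- (\<tau> - t) / c))"
    proof (rule dichotomy_decay[OF _ _ c _ _ t])
      show "continuous_on {0..\<tau>} ?m" by (intro continuous_intros cy cl)
    qed (use sub in auto)
    also have "(c + c\<^sup>2) * exp (1 / c) * (?m 0 + ?m \<tau>) * (exp (- t / c) + exp (- (\<tau> - t) / c))
        \<le> (c + c\<^sup>2) * exp (1 / c) * (2 * c * ?N) * (exp (- t / c) + exp (- (\<tau> - t) / c))"
      using c mN by (intro mult_right_mono mult_left_mono) (auto intro: add_nonneg_nonneg)
    finally have fin: "?m t \<le> (c + c\<^sup>2) * exp (1 / c) * (2 * c * ?N) * (exp (- t / c) + exp (- (\<tau> - t) / c))" .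
    have eq: "D * ?N * (exp (- t / c) + exp (- (\<tau> - t) / c))
        = 2 * ((c + c\<^sup>2) * exp (1 / c) * (2 * c * ?N) * (exp (- t / c) + exp (- (\<tau> - t) / c)))"
      unfolding D_def by (simp only: mult_ac)
    have m_le: "2 * ?m t \<le> D * ?N * (exp (- t / c) + exp (- (\<tau> - t) / c))"
      unfolding eq by (rule mult_left_mono[OF fin]) simp
    let ?e1 = "exp (- (1 / (2 * c)) * t)" and ?e2 = "exp (- (1 / (2 * c)) * (\<tau> - t))"
    have e: "exp (- t / c) = ?e1\<^sup>2" "exp (- (\<tau> - t) / c) = ?e2\<^sup>2"
      using c by (simp_all add: exp_double[symmetric] field_simps)
    have sq: "r\<^sup>2 + s\<^sup>2 \<le> (r + s)\<^sup>2" if "0 \<le> r" "0 \<le> s" for r s :: real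
      using that by (simp add: power2_sum)
    have "(norm (y t) + norm (l t))\<^sup>2 \<le> 2 * ?m t"
      using zero_le_power2[of "norm (y t) - norm (l t)"] by (simp add: power2_sum power2_diff)
    also note m_le
    also have "D * ?N * (exp (- t / c) + exp (- (\<tau> - t) / c)) \<le> D * (norm (y 0) + norm (l \<tau>))\<^sup>2 * (?e1 + ?e2)\<^sup>2"
      unfolding e
    proof (rule mult_mono)
      show "D * ?N \<le> D * (norm (y 0) + norm (l \<tau>))\<^sup>2"
        by (rule mult_left_mono[OF sq]) (use D in simp_all)
      show "?e1\<^sup>2 + ?e2\<^sup>2 \<le> (?e1 + ?e2)\<^sup>2" by (rule sq) (rule exp_ge_zero)+
      show "0 \<le> D * (norm (y 0) + norm (l \<tau>))\<^sup>2" using D by (intro mult_nonneg_nonneg) auto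
      show "0 \<le> ?e1\<^sup>2 + ?e2\<^sup>2" by (intro add_nonneg_nonneg zero_le_power2)
    qed
    also have "\<dots> = (sqrt D * (norm (y 0) + norm (l \<tau>)) * (?e1 + ?e2))\<^sup>2"
      using D by (simp add: power_mult_distrib)
    finally show ?thesis
      by (rule power2_le_imp_le) (use D in \<open>auto intro!: mult_nonneg_nonneg add_nonneg_nonneg\<close>)
  qed
  moreover have "sqrt D > 0" "1 / (2 * c) > 0" using D c by auto
  ultimately show ?thesis by blast
qed

end

section \<open>Existence of a periodic extremal\<close>

subsection \<open>Method of continuity\<close>

text \<open>Given surjectivity at one parameter, the equation at a nearby one is a fixed point
  problem. The a priori estimate bounds the inverse uniformly in \<open>\<theta>\<close>, hence the
  admissible step length does not shrink and finitely many steps lead from 0 to 1.\<close>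

lemma method_of_continuity:
  fixes G H :: "'a::{real_normed_vector,complete_space} \<Rightarrow> 'b::real_normed_vector"
  assumes G: "bounded_linear G" and H: "bounded_linear H" and surj: "surj G"
    and apriori: "\<And>\<theta> v. 0 \<le> \<theta> \<Longrightarrow> \<theta> \<le> 1 \<Longrightarrow> norm v \<le> c * norm (G v + \<theta> *\<^sub>R H v)"
  shows "surj (\<lambda>v. G v + H v)"
proof -
  interpret G: bounded_linear G by fact
  interpret H: bounded_linear H by fact
  let ?L = "\<lambda>\<theta> v. G v + \<theta> *\<^sub>R H v"
  have diff: "?L \<theta> (u - v) = ?L \<theta> u - ?L \<theta> v" for \<theta> u v
    by (simp add: G.diff H.diff scaleR_diff_right)
  obtain k where k: "k > 0" "\<And>v. norm (H v) \<le> norm v * k"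
    using H.pos_bounded by blast
  define d where "d = max c 0"
  have d: "d \<ge> 0" by (simp add: d_def)
  have ap: "norm v \<le> d * norm (?L \<theta> v)" if "0 \<le> \<theta>" "\<theta> \<le> 1" for \<theta> v
  proof -
    have "c * norm (?L \<theta> v) \<le> d * norm (?L \<theta> v)" by (intro mult_right_mono) (auto simp: d_def)
    with apriori[OF that, of v] show ?thesis by linarith
  qed
  have step: "surj (?L \<theta>')" if \<theta>: "0 \<le> \<theta>" "\<theta> \<le> 1" and s: "surj (?L \<theta>)" and small: "d * (\<bar>\<theta>' - \<theta>\<bar> * k) \<le> 1 / 2" for \<theta> \<theta>'
  proof (rule surjI[where f = "\<lambda>f. SOME v. ?L \<theta>' v = f"])
    fix f
    define \<Phi> where "\<Phi> v = (SOME u. ?L \<theta> u = f - (\<theta>' - \<theta>) *\<^sub>R H v)" for v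
    have \<Phi>: "?L \<theta> (\<Phi> v) = f - (\<theta>' - \<theta>) *\<^sub>R H v" for v
      unfolding \<Phi>_def using surjD[OF s, of "f - (\<theta>' - \<theta>) *\<^sub>R H v"] by (metis (mono_tags, lifting) someI_ex)
    have "\<exists>!v. v \<in> UNIV \<and> \<Phi> v = v"
    proof (rule Banach_fix[where c = "1 / 2"])
      show "complete (UNIV :: 'a set)" by (simp add: complete_UNIV)
      fix u v
      have "?L \<theta> (\<Phi> u - \<Phi> v) = (\<theta>' - \<theta>) *\<^sub>R H (v - u)"
        unfolding diff \<Phi> by (simp add: H.diff scaleR_diff_right)
      then have "norm (\<Phi> u - \<Phi> v) \<le> d * (\<bar>\<theta>' - \<theta>\<bar> * norm (H (v - u)))"
        using ap[OF \<theta>, of "\<Phi> u - \<Phi> v"] by simp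
      also have "\<dots> \<le> d * (\<bar>\<theta>' - \<theta>\<bar> * (norm (v - u) * k))"
        by (intro mult_left_mono k d) auto
      also have "\<dots> = (d * (\<bar>\<theta>' - \<theta>\<bar> * k)) * norm (u - v)" by (simp add: norm_minus_commute mult_ac)
      also have "\<dots> \<le> 1 / 2 * norm (u - v)" by (intro mult_right_mono small) auto
      finally show "dist (\<Phi> u) (\<Phi> v) \<le> 1 / 2 * dist u v" by (simp add: dist_norm)
    qed auto
    then obtain v where "\<Phi> v = v" by blast
    with \<Phi>[of v] have "?L \<theta>' v = f" by (simp add: algebra_simps)
    then show "?L \<theta>' (SOME v. ?L \<theta>' v = f) = f" by (rule someI)
  qed
  \<comment> \<open>A step of length 1/n makes the fixed point map a contraction with constant
    1/2.\<close>
  obtain n where n: "2 * d * k < real n" using reals_Archimedean2 by blast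
  have n0: "real n > 0" using n d k(1) by (smt (verit) mult_nonneg_nonneg)
  have "surj (?L (real i / real n))" if "i \<le> n" for i
    using that
  proof (induction i)
    case 0
    show ?case using surj by simp
  next
    case (Suc i)
    show ?case
    proof (rule step[of "real i / real n"])
      show "surj (?L (real i / real n))" using Suc by simp
      have "real (Suc i) / real n - real i / real n = 1 / real n" by (simp add: diff_divide_distrib[symmetric])
      then show "d * (\<bar>real (Suc i) / real n - real i / real n\<bar> * k) \<le> 1 / 2"
        using n n0 by (simp add: field_simps)
    qed (use Suc.prems n0 in auto)
  qed
  from this[of n] show ?thesis using n0 by simp
qed

subsection \<open>The cost functional on periodic trajectories\<close>

text \<open>Expand the integral of (f - m)^2, which is nonnegative, with \<open>m\<close> the mean
  value of \<open>f\<close>.\<close>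

lemma integral_square_le:
  fixes f :: "real \<Rightarrow> real"
  assumes "continuous_on {a..b} f" "a \<le> b"
  shows "(integral {a..b} f)\<^sup>2 \<le> (b - a) * integral {a..b} (\<lambda>t. (f t)\<^sup>2)"
proof (cases "a = b")
  case False
  then have ab: "b - a > 0" using assms by simp
  define m where "m = integral {a..b} f / (b - a)"
  have 1: "(f has_integral m * (b - a)) {a..b}"
    using integrable_integral[OF integrable_continuous_interval[OF assms(1)]] ab by (simp add: m_def)
  have 2: "((\<lambda>t. (f t)\<^sup>2) has_integral integral {a..b} (\<lambda>t. (f t)\<^sup>2)) {a..b}"
    by (rule integrable_integral[OF integrable_continuous_interval]) (intro continuous_intros assms)
  have "((\<lambda>t. ((f t)\<^sup>2 - (2 * m) * f t) + m\<^sup>2) has_integral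
      ((integral {a..b} (\<lambda>t. (f t)\<^sup>2) - (2 * m) * (m * (b - a))) + (b - a) *\<^sub>R m\<^sup>2)) {a..b}"
    using assms(2) has_integral_const_real[of "m\<^sup>2" a b]
    by (intro has_integral_add has_integral_diff has_integral_mult_right 1 2) auto
  then have "0 \<le> (integral {a..b} (\<lambda>t. (f t)\<^sup>2) - (2 * m) * (m * (b - a))) + (b - a) *\<^sub>R m\<^sup>2"
  proof (rule has_integral_nonneg)
    show "0 \<le> ((f t)\<^sup>2 - (2 * m) * f t) + m\<^sup>2" for t
      using zero_le_power2[of "f t - m"] by (simp add: power2_diff mult_ac)
  qed
  then have "m\<^sup>2 * (b - a) \<le> integral {a..b} (\<lambda>t. (f t)\<^sup>2)"
    by (simp add: power2_eq_square algebra_simps)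
  then have "(b - a) * (m\<^sup>2 * (b - a)) \<le> (b - a) * integral {a..b} (\<lambda>t. (f t)\<^sup>2)"
    using ab by (intro mult_left_mono) auto
  moreover have "(b - a) * (m\<^sup>2 * (b - a)) = (integral {a..b} f)\<^sup>2"
    using ab by (simp add: m_def power_divide power2_eq_square)
  ultimately show ?thesis by simp
qed simp

section \<open>Linear theory of periodic states and adjoint states\<close>

lemma mild_sol_scaleR:
  assumes "mild_sol S a b g y"
  shows "mild_sol S a b (\<lambda>t. r *\<^sub>R g t) (\<lambda>t. r *\<^sub>R y t)"
  unfolding mild_sol_def
proof (intro allI impI)
  fix t1 t2 x assume "a \<le> t1" "t1 \<le> t2" "t2 \<le> b"
  from has_integral_mult_right[OF mild_solD[OF assms this, of x], of r]
  show "((\<lambda>s. (r *\<^sub>R g s) \<bullet> S (t2 - s) x) has_integral ((r *\<^sub>R y t2) \<bullet> x - (r *\<^sub>R y t1) \<bullet> S (t2 - t1) x)) {t1..t2}"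
    by (simp add: right_diff_distrib)
qed

lemma back_sol_scaleR: "back_sol S a b h l \<Longrightarrow> back_sol S a b (\<lambda>t. r *\<^sub>R h t) (\<lambda>t. r *\<^sub>R l t)"
  unfolding back_sol_def using mild_sol_scaleR[of S "- b" "- a" "\<lambda>t. - h (- t)" _ r] by simp

locale lq_periodic = lq A B C Q T T' S S' R F L K \<nu>
  for A :: "'x::{real_inner,banach} \<rightharpoonup> 'x"
    and B :: "'u::{real_inner,banach} \<Rightarrow>\<^sub>L 'x"
    and C :: "'x \<Rightarrow>\<^sub>L 'v::{real_inner,banach}"
    and Q :: "'u \<Rightarrow>\<^sub>L 'u"
    and T T' S S' R :: "real \<Rightarrow> 'x \<Rightarrow>\<^sub>L 'x"
    and F :: "'x \<Rightarrow>\<^sub>L 'u" and L :: "'x \<Rightarrow>\<^sub>L 'v"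
    and K \<nu> :: real +
  fixes P :: real
  assumes P: "P > 0"
begin

text \<open>\<open>per_forward g z\<close>: \<open>z\<close> is the periodic solution of \<open>z' = (A + B F) z + g\<close>;
  \<open>per_backward q p\<close>: \<open>p\<close> is the periodic solution of \<open>- p' = (A + B F)\<^sup>* p + q\<close>.\<close>

definition per_forward :: "(real \<Rightarrow> 'x) \<Rightarrow> (real \<Rightarrow> 'x) \<Rightarrow> bool" where
  "per_forward g z \<longleftrightarrow> mild_sol S' 0 P g z \<and> z 0 = z P"

definition per_backward :: "(real \<Rightarrow> 'x) \<Rightarrow> (real \<Rightarrow> 'x) \<Rightarrow> bool" where
  "per_backward q p \<longleftrightarrow> back_sol S 0 P (\<lambda>t. - q t) p \<and> p 0 = p P"

lemma per_forward_exists: "L1_on 0 P g \<Longrightarrow> \<exists>z. per_forward g z"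
  using periodic_mild_sol_exists[OF stable_S' dual_S' P, of 0 g] by (simp add: per_forward_def)

lemma per_backward_exists:
  assumes "continuous_on {0..P} q"
  shows "\<exists>p. per_backward q p"
proof -
  have "continuous_on {- P..- P + P} (\<lambda>t. q (- t))"
    using assms continuous_on_reflect[of 0 P q] by simp
  then obtain y where y: "mild_sol S (- P) (- P + P) (\<lambda>t. q (- t)) y" "y (- P) = y (- P + P)"
    using periodic_mild_sol_exists[OF stable_S dual_S P L1_on_continuous] by blast
  then show ?thesis
    by (intro exI[of _ "\<lambda>t. y (- t)"]) (simp add: per_backward_def back_sol_def)
qed

lemma per_forward_bound:
  obtains c where "c > 0" "\<And>g z t. per_forward g z \<Longrightarrow> continuous_on {0..P} g \<Longrightarrow> t \<in> {0..P} \<Longrightarrow>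
    norm (z t) \<le> c * integral {0..P} (\<lambda>s. norm (g s))"
proof -
  obtain c where c: "c > 0" "\<forall>a g y t. mild_sol S' a (a + P) g y \<longrightarrow> continuous_on {a..a + P} g \<longrightarrow> y a = y (a + P) \<longrightarrow>
    t \<in> {a..a + P} \<longrightarrow> norm (y t) \<le> c * integral {a..a + P} (\<lambda>s. norm (g s))"
    using periodic_mild_sol_bound[OF stable_S' generates_C0[OF S'] P] by blast
  show thesis
    by (rule that[OF c(1)]) (use c(2)[rule_format, of 0] in \<open>auto simp: per_forward_def\<close>)
qed

lemma per_backward_bound:
  obtains c where "c > 0" "\<And>q p t. per_backward q p \<Longrightarrow> continuous_on {0..P} q \<Longrightarrow> t \<in> {0..P} \<Longrightarrow>
    norm (p t) \<le> c * integral {0..P} (\<lambda>s. norm (q s))"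
proof -
  obtain c where c: "c > 0" "\<forall>a g y t. mild_sol S a (a + P) g y \<longrightarrow> continuous_on {a..a + P} g \<longrightarrow> y a = y (a + P) \<longrightarrow>
    t \<in> {a..a + P} \<longrightarrow> norm (y t) \<le> c * integral {a..a + P} (\<lambda>s. norm (g s))"
    using periodic_mild_sol_bound[OF stable_S generates_C0[OF S] P] by blast
  show thesis
  proof (rule that[OF c(1)])
    fix q p t assume p: "per_backward q p" and q: "continuous_on {0..P} q" and t: "t \<in> {0..P}"
    have "continuous_on {- P..- P + P} (\<lambda>t. q (- t))"
      using q continuous_on_reflect[of 0 P q] by simp
    then have "norm (p (- (- t))) \<le> c * integral {- P..- P + P} (\<lambda>s. norm (q (- s)))"
      using p t by (intro c(2)[rule_format, of "- P" "\<lambda>t. q (- t)" "\<lambda>t. p (- t)"])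
        (auto simp: per_backward_def back_sol_def)
    then show "norm (p t) \<le> c * integral {0..P} (\<lambda>s. norm (q s))"
      using integral_reflect_interval[of P 0 "\<lambda>s. norm (q s)"] by simp
  qed
qed

lemma per_forward_unique:
  assumes "per_forward g z" "per_forward g z'" "t \<in> {0..P}"
  shows "z t = z' t"
proof -
  have *: "per_forward (\<lambda>t. 0) (\<lambda>t. z t - z' t)"
    using assms mild_sol_diff[of S' 0 P g z g z'] by (simp add: per_forward_def)
  obtain c where "c > 0" and c: "\<And>g z t. per_forward g z \<Longrightarrow> continuous_on {0..P} g \<Longrightarrow> t \<in> {0..P} \<Longrightarrow>
    norm (z t) \<le> c * integral {0..P} (\<lambda>s. norm (g s))"
    by (rule per_forward_bound) (rule that)
  from c[OF * continuous_on_const assms(3)] show ?thesis by simp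
qed

lemma per_backward_unique:
  assumes "per_backward q p" "per_backward q p'" "t \<in> {0..P}"
  shows "p t = p' t"
proof -
  have "back_sol S 0 P (\<lambda>t. - q t - - q t) (\<lambda>t. p t - p' t)"
    using assms back_sol_diff unfolding per_backward_def by blast
  then have *: "per_backward (\<lambda>t. 0) (\<lambda>t. p t - p' t)"
    using assms by (simp add: per_backward_def)
  obtain c where "c > 0" and c: "\<And>q p t. per_backward q p \<Longrightarrow> continuous_on {0..P} q \<Longrightarrow> t \<in> {0..P} \<Longrightarrow>
    norm (p t) \<le> c * integral {0..P} (\<lambda>s. norm (q s))"
    by (rule per_backward_bound) (rule that)
  from c[OF * continuous_on_const assms(3)] show ?thesis by simp
qed

lemma per_forward_continuous: "per_forward g z \<Longrightarrow> L1_on 0 P g \<Longrightarrow> continuous_on {0..P} z"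
  unfolding per_forward_def using mild_sol_continuous[OF dual_S'] by blast

lemma per_backward_continuous: "per_backward q p \<Longrightarrow> continuous_on {0..P} q \<Longrightarrow> continuous_on {0..P} p"
  unfolding per_backward_def using back_sol_continuous[OF dual_S] continuous_on_minus by blast

lemma per_forward_add: "per_forward g z \<Longrightarrow> per_forward g' z' \<Longrightarrow> per_forward (\<lambda>t. g t + g' t) (\<lambda>t. z t + z' t)"
  unfolding per_forward_def using mild_sol_add by fastforce

lemma per_forward_scaleR: "per_forward g z \<Longrightarrow> per_forward (\<lambda>t. r *\<^sub>R g t) (\<lambda>t. r *\<^sub>R z t)"
  unfolding per_forward_def using mild_sol_scaleR by fastforce

lemma per_backward_add:
  assumes "per_backward q p" "per_backward q' p'"
  shows "per_backward (\<lambda>t. q t + q' t) (\<lambda>t. p t + p' t)"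
  using assms back_sol_add[of S 0 P "\<lambda>t. - q t" p "\<lambda>t. - q' t" p'] unfolding per_backward_def by simp

lemma per_backward_scaleR: "per_backward q p \<Longrightarrow> per_backward (\<lambda>t. r *\<^sub>R q t) (\<lambda>t. r *\<^sub>R p t)"
  unfolding per_backward_def using back_sol_scaleR[of S 0 P "\<lambda>t. - q t" p r] by simp

text \<open>Undoing the feedback turns \<open>g\<close> into the full input
  \<open>g + B F z\<close>, and output injection then yields stability through \<open>R\<close>. The
  periodic state is thus bounded by what the cost sees, namely input and output.\<close>

lemma per_forward_detect_bound:
  obtains c where "c > 0" "\<And>g z t. per_forward g z \<Longrightarrow> continuous_on {0..P} g \<Longrightarrow> t \<in> {0..P} \<Longrightarrow>
    norm (z t) \<le> c * integral {0..P} (\<lambda>s. norm (g s + B (F (z s))) + norm (C (z s)))"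
proof -
  obtain c where c: "c > 0" and bound: "\<forall>a g y t. mild_sol R a (a + P) g y \<longrightarrow> continuous_on {a..a + P} g \<longrightarrow> y a = y (a + P) \<longrightarrow>
    t \<in> {a..a + P} \<longrightarrow> norm (y t) \<le> c * integral {a..a + P} (\<lambda>s. norm (g s))"
    using periodic_mild_sol_bound[OF stable_R generates_C0[OF R] P] by blast
  show thesis
  proof (rule that[of "c * (1 + norm (adj L))"])
    show "c * (1 + norm (adj L)) > 0" using c by (simp add: add_pos_nonneg)
    fix g z t assume z: "per_forward g z" and g: "continuous_on {0..P} g" and t: "t \<in> {0..P}"
    have cz: "continuous_on {0..P} z" by (rule per_forward_continuous[OF z L1_on_continuous[OF g]])
    have "mild_sol T' 0 P (\<lambda>t. g t + B (F (z t))) z"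
      using mild_sol_unperturb[OF dual_T' T' dual_S' S', of 0 P g z] z P L1_on_continuous[OF g]
      by (simp add: per_forward_def adj_adj)
    then have "mild_sol R 0 P (\<lambda>t. (g t + B (F (z t))) - adj L (C (z t))) z"
      by (rule forward_detect) (intro continuous_intros g cz)
    moreover have "continuous_on {0..P} (\<lambda>t. (g t + B (F (z t))) - adj L (C (z t)))"
      by (intro continuous_intros g cz)
    ultimately have "norm (z t) \<le> c * integral {0..P} (\<lambda>s. norm ((g s + B (F (z s))) - adj L (C (z s))))"
      using bound[rule_format, of 0 "\<lambda>t. (g t + B (F (z t))) - adj L (C (z t))" z t] z t
      by (simp add: per_forward_def)
    also have "\<dots> \<le> c * integral {0..P} (\<lambda>s. (1 + norm (adj L)) * (norm (g s + B (F (z s))) + norm (C (z s))))"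
    proof (intro mult_left_mono integral_le integrable_continuous_interval continuous_intros g cz)
      fix s
      have "norm ((g s + B (F (z s))) - adj L (C (z s))) \<le> norm (g s + B (F (z s))) + norm (adj L (C (z s)))"
        by (rule norm_triangle_ineq4)
      also have "\<dots> \<le> 1 * norm (g s + B (F (z s))) + norm (adj L) * norm (C (z s))"
        by (simp add: norm_blinfun)
      also have "\<dots> \<le> (1 + norm (adj L)) * norm (g s + B (F (z s))) + (1 + norm (adj L)) * norm (C (z s))"
        by (intro add_mono mult_right_mono) auto
      finally show "norm ((g s + B (F (z s))) - adj L (C (z s)))
          \<le> (1 + norm (adj L)) * (norm (g s + B (F (z s))) + norm (C (z s)))"
        by (simp add: distrib_left)
    qed (use c in auto)
    finally show "norm (z t) \<le> c * (1 + norm (adj L)) * integral {0..P} (\<lambda>s. norm (g s + B (F (z s))) + norm (C (z s)))"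
      by simp
  qed
qed

section \<open>The gradient of the periodic cost as a linear operator\<close>

text \<open>\<open>cost_grad v r\<close>: with \<open>u = F z + v\<close> and \<open>z' = (A + B F) z + B v\<close>, the gradient at \<open>v\<close> of
  \<open>\<integral> \<langle>Q u, u\<rangle> + \<parallel>C z\<parallel>\<^sup>2\<close> is \<open>2 (Q v + r)\<close>.\<close>

definition cost_grad :: "(real \<Rightarrow> 'u) \<Rightarrow> (real \<Rightarrow> 'u) \<Rightarrow> bool" where
  "cost_grad v r \<longleftrightarrow> (\<exists>z p. per_forward (\<lambda>t. B (v t)) z \<and>
     per_backward (\<lambda>t. adj F (Q (v t + F (z t))) + adj C (C (z t))) p \<and>
     (\<forall>t\<in>{0..P}. r t = Q (F (z t)) + adj B (p t)))"

lemma cost_grad_exists: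
  assumes v: "continuous_on {0..P} v"
  shows "\<exists>r. cost_grad v r"
proof -
  have cB: "continuous_on {0..P} (\<lambda>t. B (v t))" by (intro continuous_intros v)
  obtain z where z: "per_forward (\<lambda>t. B (v t)) z"
    using per_forward_exists[OF L1_on_continuous[OF cB]] by blast
  have "continuous_on {0..P} z" by (rule per_forward_continuous[OF z L1_on_continuous[OF cB]])
  then have "continuous_on {0..P} (\<lambda>t. adj F (Q (v t + F (z t))) + adj C (C (z t)))"
    by (intro continuous_intros v)
  from per_backward_exists[OF this] obtain p where
    "per_backward (\<lambda>t. adj F (Q (v t + F (z t))) + adj C (C (z t))) p" by blast
  with z show ?thesis
    unfolding cost_grad_def
    by (intro exI[of _ "\<lambda>t. Q (F (z t)) + adj B (p t)"] exI[of _ z] exI[of _ p]) simp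
qed

text \<open>Periodic solutions are determined on {0..P} only, so the gradient is a relation; its
  linearity becomes usable through this uniqueness.\<close>

lemma cost_grad_unique:
  assumes "cost_grad v r" "cost_grad v r'" "t \<in> {0..P}"
  shows "r t = r' t"
proof -
  from assms obtain z p z' p' where z: "per_forward (\<lambda>t. B (v t)) z" "per_forward (\<lambda>t. B (v t)) z'"
    and p: "per_backward (\<lambda>t. adj F (Q (v t + F (z t))) + adj C (C (z t))) p"
      "per_backward (\<lambda>t. adj F (Q (v t + F (z' t))) + adj C (C (z' t))) p'"
    and r: "\<forall>t\<in>{0..P}. r t = Q (F (z t)) + adj B (p t)" "\<forall>t\<in>{0..P}. r' t = Q (F (z' t)) + adj B (p' t)"
    unfolding cost_grad_def by blast
  have eq: "z t = z' t" if "t \<in> {0..P}" for t by (rule per_forward_unique[OF z that])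
  have "per_backward (\<lambda>t. adj F (Q (v t + F (z t))) + adj C (C (z t))) p'"
    using p(2) mild_sol_cong_AE[of S "- P" "- 0" "\<lambda>t. - (- (adj F (Q (v (- t) + F (z' (- t)))) + adj C (C (z' (- t)))))"
        "\<lambda>t. p' (- t)" "{}" "\<lambda>t. - (- (adj F (Q (v (- t) + F (z (- t)))) + adj C (C (z (- t)))))" "\<lambda>t. p' (- t)"] eq
    unfolding per_backward_def back_sol_def by auto
  with p(1) have "p t = p' t" using assms(3) by (rule per_backward_unique)
  with r eq assms(3) show ?thesis by simp
qed

lemma cost_grad_continuous:
  assumes "cost_grad v r" and v: "continuous_on {0..P} v"
  shows "continuous_on {0..P} r"
proof -
  from assms(1) obtain z p where z: "per_forward (\<lambda>t. B (v t)) z"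
    and p: "per_backward (\<lambda>t. adj F (Q (v t + F (z t))) + adj C (C (z t))) p"
    and r: "\<forall>t\<in>{0..P}. r t = Q (F (z t)) + adj B (p t)"
    unfolding cost_grad_def by blast
  have cB: "continuous_on {0..P} (\<lambda>t. B (v t))" by (intro continuous_intros v)
  have cz: "continuous_on {0..P} z" by (rule per_forward_continuous[OF z L1_on_continuous[OF cB]])
  have cp: "continuous_on {0..P} p"
    by (rule per_backward_continuous[OF p]) (intro continuous_intros v cz)
  have "continuous_on {0..P} (\<lambda>t. Q (F (z t)) + adj B (p t))" by (intro continuous_intros cz cp)
  then show ?thesis by (rule continuous_on_eq) (use r in simp)
qed

lemma cost_grad_add:
  assumes "cost_grad v r" "cost_grad v' r'"
  shows "cost_grad (\<lambda>t. v t + v' t) (\<lambda>t. r t + r' t)"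
proof -
  from assms obtain z p z' p' where z: "per_forward (\<lambda>t. B (v t)) z" "per_forward (\<lambda>t. B (v' t)) z'"
    and p: "per_backward (\<lambda>t. adj F (Q (v t + F (z t))) + adj C (C (z t))) p"
      "per_backward (\<lambda>t. adj F (Q (v' t + F (z' t))) + adj C (C (z' t))) p'"
    and r: "\<forall>t\<in>{0..P}. r t = Q (F (z t)) + adj B (p t)" "\<forall>t\<in>{0..P}. r' t = Q (F (z' t)) + adj B (p' t)"
    unfolding cost_grad_def by blast
  show ?thesis
    unfolding cost_grad_def
    using per_forward_add[OF z] per_backward_add[OF p] r
    by (intro exI[of _ "\<lambda>t. z t + z' t"] exI[of _ "\<lambda>t. p t + p' t"])
      (simp add: blinfun.add_right algebra_simps)
qed

lemma cost_grad_scaleR: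
  assumes "cost_grad v r"
  shows "cost_grad (\<lambda>t. s *\<^sub>R v t) (\<lambda>t. s *\<^sub>R r t)"
proof -
  from assms obtain z p where z: "per_forward (\<lambda>t. B (v t)) z"
    and p: "per_backward (\<lambda>t. adj F (Q (v t + F (z t))) + adj C (C (z t))) p"
    and r: "\<forall>t\<in>{0..P}. r t = Q (F (z t)) + adj B (p t)"
    unfolding cost_grad_def by blast
  show ?thesis
    unfolding cost_grad_def
    using per_forward_scaleR[OF z, of s] per_backward_scaleR[OF p, of s] r
    by (intro exI[of _ "\<lambda>t. s *\<^sub>R z t"] exI[of _ "\<lambda>t. s *\<^sub>R p t"])
      (simp add: blinfun.scaleR_right blinfun.add_right scaleR_add_right)
qed

text \<open>The smoothing property: the sup norm of \<open>r\<close> is bounded by the integral norm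
  of \<open>v\<close>, because \<open>v\<close> reaches \<open>r\<close> through two periodic
  evolution equations in succession. It upgrades mean-square information on \<open>v\<close> to
  uniform information on \<open>r\<close>.\<close>

lemma cost_grad_bound:
  obtains c where "c > 0" "\<And>v r t. cost_grad v r \<Longrightarrow> continuous_on {0..P} v \<Longrightarrow> t \<in> {0..P} \<Longrightarrow>
    norm (r t) \<le> c * integral {0..P} (\<lambda>s. norm (v s))"
proof -
  obtain c1 where c1: "c1 > 0" "\<And>g z t. per_forward g z \<Longrightarrow> continuous_on {0..P} g \<Longrightarrow> t \<in> {0..P} \<Longrightarrow>
    norm (z t) \<le> c1 * integral {0..P} (\<lambda>s. norm (g s))"
    by (rule per_forward_bound) (rule that)
  obtain c2 where c2: "c2 > 0" "\<And>q p t. per_backward q p \<Longrightarrow> continuous_on {0..P} q \<Longrightarrow> t \<in> {0..P} \<Longrightarrow>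
    norm (p t) \<le> c2 * integral {0..P} (\<lambda>s. norm (q s))"
    by (rule per_backward_bound) (rule that)
  \<comment> \<open>\<open>a\<close> bounds the state by the integral of \<open>norm (v s)\<close>,
    \<open>b\<close> bounds the integral of the adjoint source by the same quantity; the summand 1
    in \<open>c\<close> makes it positive.\<close>
  define a where "a = c1 * norm B"
  define b where "b = norm (adj F o\<^sub>L Q) + norm (adj F o\<^sub>L Q o\<^sub>L F) * (a * P) + norm (adj C o\<^sub>L C) * (a * P)"
  define c where "c = norm (Q o\<^sub>L F) * a + norm (adj B) * (c2 * b) + 1"
  have a0: "a \<ge> 0" using c1 by (simp add: a_def)
  have b0: "b \<ge> 0" using a0 P by (simp add: b_def)
  show thesis
  proof (rule that[of c])
    show "c > 0" using a0 b0 c2 by (simp add: c_def add_nonneg_pos)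
    fix v r t assume "cost_grad v r" and v: "continuous_on {0..P} v" and t: "t \<in> {0..P}"
    then obtain z p where z: "per_forward (\<lambda>t. B (v t)) z"
      and p: "per_backward (\<lambda>t. adj F (Q (v t + F (z t))) + adj C (C (z t))) p"
      and r: "\<forall>t\<in>{0..P}. r t = Q (F (z t)) + adj B (p t)"
      unfolding cost_grad_def by blast
    let ?q = "\<lambda>t. adj F (Q (v t + F (z t))) + adj C (C (z t))"
    let ?V = "integral {0..P} (\<lambda>s. norm (v s))"
    have cB: "continuous_on {0..P} (\<lambda>t. B (v t))" by (intro continuous_intros v)
    have cz: "continuous_on {0..P} z" by (rule per_forward_continuous[OF z L1_on_continuous[OF cB]])
    have V0: "?V \<ge> 0" by (intro integral_nonneg integrable_continuous_interval continuous_intros v) auto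
    have zb: "norm (z s) \<le> a * ?V" if "s \<in> {0..P}" for s
    proof -
      have "norm (z s) \<le> c1 * integral {0..P} (\<lambda>s. norm (B (v s)))" by (rule c1(2)[OF z cB that])
      also have "\<dots> \<le> c1 * integral {0..P} (\<lambda>s. norm B * norm (v s))"
        using c1(1) by (intro mult_left_mono integral_le integrable_continuous_interval continuous_intros v norm_blinfun) auto
      finally show ?thesis by (simp add: a_def)
    qed
    have qb: "norm (?q s) \<le> norm (adj F o\<^sub>L Q) * norm (v s)
        + (norm (adj F o\<^sub>L Q o\<^sub>L F) * (a * ?V) + norm (adj C o\<^sub>L C) * (a * ?V))" if s: "s \<in> {0..P}" for s
    proof -
      have "?q s = (adj F o\<^sub>L Q) (v s) + ((adj F o\<^sub>L Q o\<^sub>L F) (z s) + (adj C o\<^sub>L C) (z s))"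
        by (simp add: blinfun.add_right)
      then have "norm (?q s) \<le> norm ((adj F o\<^sub>L Q) (v s)) + (norm ((adj F o\<^sub>L Q o\<^sub>L F) (z s)) + norm ((adj C o\<^sub>L C) (z s)))"
        by (metis norm_triangle_mono norm_triangle_ineq order_refl)
      also have "\<dots> \<le> norm (adj F o\<^sub>L Q) * norm (v s)
        + (norm (adj F o\<^sub>L Q o\<^sub>L F) * (a * ?V) + norm (adj C o\<^sub>L C) * (a * ?V))"
        by (intro add_mono norm_blinfun order_trans[OF norm_blinfun mult_left_mono[OF zb[OF s]]] norm_ge_zero)
      finally show ?thesis .
    qed
    have cq: "continuous_on {0..P} ?q" by (intro continuous_intros v cz)
    have "norm (p t) \<le> c2 * integral {0..P} (\<lambda>s. norm (?q s))" by (rule c2(2)[OF p cq t])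
    also have "\<dots> \<le> c2 * integral {0..P} (\<lambda>s. norm (adj F o\<^sub>L Q) * norm (v s)
        + (norm (adj F o\<^sub>L Q o\<^sub>L F) * (a * ?V) + norm (adj C o\<^sub>L C) * (a * ?V)))"
      using c2(1) qb by (intro mult_left_mono integral_le integrable_continuous_interval continuous_intros v cz) auto
    also have "integral {0..P} (\<lambda>s. norm (adj F o\<^sub>L Q) * norm (v s)
        + (norm (adj F o\<^sub>L Q o\<^sub>L F) * (a * ?V) + norm (adj C o\<^sub>L C) * (a * ?V))) = b * ?V"
      using P by (subst integral_add)
        (auto intro!: integrable_continuous_interval continuous_intros v simp: b_def algebra_simps)
    finally have pb: "norm (p t) \<le> c2 * (b * ?V)" .
    have "r t = (Q o\<^sub>L F) (z t) + adj B (p t)" using r t by simp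
    then have "norm (r t) \<le> norm ((Q o\<^sub>L F) (z t)) + norm (adj B (p t))"
      by (simp only: norm_triangle_ineq)
    also have "\<dots> \<le> norm (Q o\<^sub>L F) * (a * ?V) + norm (adj B) * (c2 * (b * ?V))"
      by (intro add_mono order_trans[OF norm_blinfun mult_left_mono[OF zb[OF t]]]
          order_trans[OF norm_blinfun mult_left_mono[OF pb]] norm_ge_zero)
    also have "\<dots> \<le> c * ?V" using V0 by (simp add: c_def algebra_simps)
    finally show "norm (r t) \<le> c * ?V" .
  qed
qed

end

section \<open>Coercivity and solution of the gradient equation\<close>

context lq_periodic
begin

text \<open>Pairing state and adjoint state turns the form of \<open>Q v + r\<close> into the cost
  of the actual control \<open>w = v + F z\<close> and the output. Detectability bounds
  \<open>z\<close>, hence also \<open>v = w - F z\<close>, by this cost. For \<theta> between 0 and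
  1 the form is a convex combination of this one and the form of \<open>Q\<close>.\<close>

lemma cost_grad_coercive:
  obtains e where "e > 0" "\<And>v r \<theta>. cost_grad v r \<Longrightarrow> continuous_on {0..P} v \<Longrightarrow> 0 \<le> \<theta> \<Longrightarrow> \<theta> \<le> 1 \<Longrightarrow>
    e * integral {0..P} (\<lambda>t. (norm (v t))\<^sup>2) \<le> integral {0..P} (\<lambda>t. v t \<bullet> (Q (v t) + \<theta> *\<^sub>R r t))"
proof -
  obtain q where q: "q > 0" "\<And>x. q * (norm x)\<^sup>2 \<le> Q x \<bullet> x"
    using positive_definite_coercive[OF pos_Q inv_Q] by blast
  obtain c where c: "c > 0" "\<And>g z t. per_forward g z \<Longrightarrow> continuous_on {0..P} g \<Longrightarrow> t \<in> {0..P} \<Longrightarrow>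
    norm (z t) \<le> c * integral {0..P} (\<lambda>s. norm (g s + B (F (z s))) + norm (C (z s)))"
    by (rule per_forward_detect_bound) (rule that)
  \<comment> \<open>The 2 comes from v = w - F z; the rest is the bound on \<open>F z\<close>
    through \<open>c\<close>, with the integral of input and output squared by Cauchy-Schwarz on an
    interval of length \<open>P\<close>.\<close>
  define \<kappa> where "\<kappa> = 2 + 2 * (norm F)\<^sup>2 * c\<^sup>2 * P * (P * (2 * (norm B)\<^sup>2 + 2))"
  have "0 \<le> 2 * (norm F)\<^sup>2 * c\<^sup>2 * P * (P * (2 * (norm B)\<^sup>2 + 2))" using P by simp
  then have \<kappa>: "\<kappa> \<ge> 1" by (simp add: \<kappa>_def)
  define q1 where "q1 = min q 1"
  have q1: "0 < q1" "q1 \<le> q" "q1 \<le> 1" using q by (auto simp: q1_def)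
  show thesis
  proof (rule that[of "q1 / \<kappa>"])
    show "q1 / \<kappa> > 0" using q1 \<kappa> by simp
    fix v r and \<theta> :: real assume "cost_grad v r" and v: "continuous_on {0..P} v" and \<theta>: "0 \<le> \<theta>" "\<theta> \<le> 1"
    then obtain z p where z: "per_forward (\<lambda>t. B (v t)) z"
      and p: "per_backward (\<lambda>t. adj F (Q (v t + F (z t))) + adj C (C (z t))) p"
      and r: "\<forall>t\<in>{0..P}. r t = Q (F (z t)) + adj B (p t)"
      unfolding cost_grad_def by blast
    define w where "w t = v t + F (z t)" for t
    let ?q = "\<lambda>t. adj F (Q (w t)) + adj C (C (z t))"
    have cB: "continuous_on {0..P} (\<lambda>t. B (v t))" by (intro continuous_intros v)
    have cz: "continuous_on {0..P} z" by (rule per_forward_continuous[OF z L1_on_continuous[OF cB]])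
    have cw: "continuous_on {0..P} w" unfolding w_def by (intro continuous_intros v cz)
    have cq: "continuous_on {0..P} ?q" by (intro continuous_intros cw cz)
    have p': "per_backward ?q p" using p by (simp add: w_def)
    have cp: "continuous_on {0..P} p" by (rule per_backward_continuous[OF p' cq])
    have cr: "continuous_on {0..P} r" by (rule cost_grad_continuous[OF \<open>cost_grad v r\<close> v])
    let ?V = "integral {0..P} (\<lambda>t. (norm (v t))\<^sup>2)"
    let ?j = "\<lambda>t. (norm (w t))\<^sup>2 + (norm (C (z t)))\<^sup>2"
    let ?J = "integral {0..P} ?j"
    have ij: "?j integrable_on {0..P}" by (intro integrable_continuous_interval continuous_intros cw cz)
    have V_le: "?V \<le> \<kappa> * ?J"
    proof -
      define N where "N = integral {0..P} (\<lambda>s. norm (B (w s)) + norm (C (z s)))"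
      have zN: "norm (z t) \<le> c * N" if "t \<in> {0..P}" for t
        using c(2)[OF z cB that] by (simp add: N_def w_def blinfun.add_right)
      have "N\<^sup>2 \<le> (P - 0) * integral {0..P} (\<lambda>s. (norm (B (w s)) + norm (C (z s)))\<^sup>2)"
        unfolding N_def using P by (intro integral_square_le continuous_intros cw cz) auto
      also have "\<dots> \<le> (P - 0) * integral {0..P} (\<lambda>s. (2 * (norm B)\<^sup>2 + 2) * ?j s)"
      proof (intro mult_left_mono integral_le integrable_continuous_interval continuous_intros cw cz)
        fix s
        have "(norm (B (w s)) + norm (C (z s)))\<^sup>2 \<le> 2 * (norm (B (w s)))\<^sup>2 + 2 * (norm (C (z s)))\<^sup>2"
          using norm_square_add_le[of "norm (B (w s))" "norm (C (z s))"] by simp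
        also have "\<dots> \<le> 2 * ((norm B)\<^sup>2 * (norm (w s))\<^sup>2) + 2 * (norm (C (z s)))\<^sup>2"
          using norm_square_blinfun_le[of B "w s"] by simp
        also have "\<dots> \<le> (2 * (norm B)\<^sup>2 + 2) * ?j s" by (simp add: algebra_simps)
        finally show "(norm (B (w s)) + norm (C (z s)))\<^sup>2 \<le> (2 * (norm B)\<^sup>2 + 2) * ?j s" .
      qed (use P in auto)
      finally have N: "N\<^sup>2 \<le> P * (2 * (norm B)\<^sup>2 + 2) * ?J" by simp
      have "?V \<le> integral {0..P} (\<lambda>t. 2 * ?j t + 2 * (norm F)\<^sup>2 * (c\<^sup>2 * N\<^sup>2))"
      proof (intro integral_le integrable_continuous_interval continuous_intros v cw cz)
        fix t assume t: "t \<in> {0..P}"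
        have "(norm (v t))\<^sup>2 \<le> 2 * (norm (w t))\<^sup>2 + 2 * (norm (F (z t)))\<^sup>2"
          using norm_square_add_le[of "w t" "- F (z t)"] by (simp add: w_def)
        also have "(norm (F (z t)))\<^sup>2 \<le> (norm F)\<^sup>2 * (norm (z t))\<^sup>2" by (rule norm_square_blinfun_le)
        also have "(norm (z t))\<^sup>2 \<le> (c * N)\<^sup>2" by (intro power_mono zN[OF t]) auto
        finally have "(norm (v t))\<^sup>2 \<le> 2 * (norm (w t))\<^sup>2 + 2 * ((norm F)\<^sup>2 * (c * N)\<^sup>2)"
          by (simp add: mult_left_mono)
        also have "\<dots> \<le> 2 * ?j t + 2 * (norm F)\<^sup>2 * (c\<^sup>2 * N\<^sup>2)" by (simp add: power_mult_distrib)
        finally show "(norm (v t))\<^sup>2 \<le> 2 * ?j t + 2 * (norm F)\<^sup>2 * (c\<^sup>2 * N\<^sup>2)" .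
      qed
      also have "\<dots> = integral {0..P} (\<lambda>t. 2 * ?j t) + integral {0..P} (\<lambda>t. 2 * (norm F)\<^sup>2 * (c\<^sup>2 * N\<^sup>2))"
        by (intro integral_add integrable_continuous_interval continuous_intros cw cz)
      also have "\<dots> = 2 * ?J + 2 * (norm F)\<^sup>2 * c\<^sup>2 * P * N\<^sup>2"
      proof -
        have "integral {0..P} (\<lambda>t. 2 * ?j t) = 2 * ?J" by (rule integral_mult_right)
        moreover have "integral {0..P} (\<lambda>t. 2 * (norm F)\<^sup>2 * (c\<^sup>2 * N\<^sup>2)) = 2 * (norm F)\<^sup>2 * c\<^sup>2 * P * N\<^sup>2"
          using P by simp
        ultimately show ?thesis by (simp only:)
      qed
      also have "\<dots> \<le> 2 * ?J + 2 * (norm F)\<^sup>2 * c\<^sup>2 * P * (P * (2 * (norm B)\<^sup>2 + 2) * ?J)"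
        using P by (intro add_left_mono mult_left_mono N) auto
      also have "\<dots> = \<kappa> * ?J" unfolding \<kappa>_def by (simp only: distrib_right[of 2] mult.assoc)
      finally show ?thesis .
    qed
    \<comment> \<open>Periodicity of both solutions removes the boundary term, so the pairing
      contributes zero and may be added to the form at will.\<close>
    have "((\<lambda>s. B (v s) \<bullet> p s + z s \<bullet> (- ?q s)) has_integral (z P \<bullet> p P - z 0 \<bullet> p 0)) {0..P}"
    proof (rule mild_sol_pairing[OF dual_S'])
      show "mild_sol S' 0 P (\<lambda>s. B (v s)) z" using z by (simp add: per_forward_def)
      have "back_sol S 0 P (\<lambda>t. - ?q t) p" using p' by (simp add: per_backward_def)
      then show "((\<lambda>t. - ?q t \<bullet> S (t - s) x) has_integral (p r \<bullet> S (r - s) x - p s \<bullet> x)) {s..r}"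
        if "0 \<le> s" "s \<le> r" "r \<le> P" for s r x
        using that unfolding back_sol_iff by blast
    qed (use P in \<open>auto intro!: L1_on_continuous cB cp continuous_intros cw cz\<close>)
    moreover have "z P \<bullet> p P - z 0 \<bullet> p 0 = 0" using z p by (simp add: per_forward_def per_backward_def)
    ultimately have pairing: "((\<lambda>s. B (v s) \<bullet> p s + z s \<bullet> (- ?q s)) has_integral 0) {0..P}" by simp
    let ?a = "\<lambda>t. v t \<bullet> Q (v t)" and ?b = "\<lambda>t. w t \<bullet> Q (w t) + (norm (C (z t)))\<^sup>2"
    have ia: "(?a has_integral integral {0..P} ?a) {0..P}"
      by (rule integrable_integral[OF integrable_continuous_interval]) (intro continuous_intros v)
    have ib: "(?b has_integral integral {0..P} ?b) {0..P}"
      by (rule integrable_integral[OF integrable_continuous_interval]) (intro continuous_intros cw cz)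
    have "((\<lambda>s. (1 - \<theta>) * ?a s + \<theta> * (?b s + (B (v s) \<bullet> p s + z s \<bullet> (- ?q s)))) has_integral
        ((1 - \<theta>) * integral {0..P} ?a + \<theta> * (integral {0..P} ?b + 0))) {0..P}"
      by (intro has_integral_add has_integral_mult_right ia ib pairing)
    moreover have "(1 - \<theta>) * ?a s + \<theta> * (?b s + (B (v s) \<bullet> p s + z s \<bullet> (- ?q s))) = v s \<bullet> (Q (v s) + \<theta> *\<^sub>R r s)"
      if "s \<in> {0..P}" for s
    proof -
      have "z s \<bullet> ?q s = F (z s) \<bullet> Q (w s) + (norm (C (z s)))\<^sup>2"
        by (simp add: inner_add_right adj_inner[symmetric] power2_norm_eq_inner)
      moreover have "v s \<bullet> r s = v s \<bullet> Q (F (z s)) + B (v s) \<bullet> p s"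
        using r that by (simp add: inner_add_right adj_inner[symmetric])
      moreover have "w s \<bullet> Q (w s) = v s \<bullet> Q (v s) + v s \<bullet> Q (F (z s)) + F (z s) \<bullet> Q (w s)"
        by (simp add: w_def inner_add_left inner_add_right blinfun.add_right)
      ultimately have "?b s + (B (v s) \<bullet> p s + z s \<bullet> (- ?q s)) = v s \<bullet> Q (v s) + v s \<bullet> r s"
        unfolding inner_minus_right by linarith
      then have "(1 - \<theta>) * ?a s + \<theta> * (?b s + (B (v s) \<bullet> p s + z s \<bullet> (- ?q s)))
          = (1 - \<theta>) * ?a s + \<theta> * (v s \<bullet> Q (v s) + v s \<bullet> r s)" by (simp only:)
      then show ?thesis by (simp add: inner_add_right algebra_simps)
    qed
    ultimately have main: "((\<lambda>s. v s \<bullet> (Q (v s) + \<theta> *\<^sub>R r s)) has_integral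
        ((1 - \<theta>) * integral {0..P} ?a + \<theta> * integral {0..P} ?b)) {0..P}"
      using has_integral_cong[of "{0..P}" "\<lambda>s. (1 - \<theta>) * ?a s + \<theta> * (?b s + (B (v s) \<bullet> p s + z s \<bullet> (- ?q s)))"
          "\<lambda>s. v s \<bullet> (Q (v s) + \<theta> *\<^sub>R r s)"] by (simp only: add_0_right)
    have V0: "0 \<le> ?V" by (intro integral_nonneg integrable_continuous_interval continuous_intros v) auto
    have "q * ?V \<le> integral {0..P} ?a"
    proof -
      have "integral {0..P} (\<lambda>t. q * (norm (v t))\<^sup>2) \<le> integral {0..P} ?a"
        using q(2) by (intro integral_le integrable_continuous_interval continuous_intros v) (simp add: inner_commute)
      then show ?thesis by simp
    qed
    moreover have "q1 / \<kappa> * ?V \<le> q * ?V"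
    proof (rule mult_right_mono[OF _ V0])
      have "q1 / \<kappa> \<le> q1 / 1" using \<kappa> q1 by (intro divide_left_mono) auto
      then show "q1 / \<kappa> \<le> q" using q1 by simp
    qed
    ultimately have 1: "q1 / \<kappa> * ?V \<le> integral {0..P} ?a" by linarith
    have "q1 * ?J \<le> integral {0..P} ?b"
    proof -
      have "integral {0..P} (\<lambda>t. q1 * ?j t) \<le> integral {0..P} ?b"
      proof (intro integral_le integrable_continuous_interval continuous_intros cw cz)
        fix t
        have "q1 * (norm (w t))\<^sup>2 \<le> q * (norm (w t))\<^sup>2" using q1 by (intro mult_right_mono) auto
        moreover have "q1 * (norm (C (z t)))\<^sup>2 \<le> 1 * (norm (C (z t)))\<^sup>2" using q1 by (intro mult_right_mono) auto
        ultimately show "q1 * ?j t \<le> ?b t" using q(2)[of "w t"] by (simp add: distrib_left inner_commute)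
      qed
      then show ?thesis by simp
    qed
    moreover have "q1 / \<kappa> * ?V \<le> q1 * ?J"
      using mult_left_mono[OF V_le, of "q1 / \<kappa>"] q1 \<kappa> by simp
    ultimately have 2: "q1 / \<kappa> * ?V \<le> integral {0..P} ?b" by linarith
    have "q1 / \<kappa> * ?V = (1 - \<theta>) * (q1 / \<kappa> * ?V) + \<theta> * (q1 / \<kappa> * ?V)" by (simp only: distrib_right[symmetric]) simp
    also have "\<dots> \<le> (1 - \<theta>) * integral {0..P} ?a + \<theta> * integral {0..P} ?b"
      using \<theta> by (intro add_mono mult_left_mono 1 2) auto
    also have "\<dots> = integral {0..P} (\<lambda>t. v t \<bullet> (Q (v t) + \<theta> *\<^sub>R r t))"
      by (rule integral_unique[OF main, symmetric])
    finally show "q1 / \<kappa> * ?V \<le> integral {0..P} (\<lambda>t. v t \<bullet> (Q (v t) + \<theta> *\<^sub>R r t))" .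
  qed
qed

text \<open>Coercivity bounds the mean square of \<open>v\<close> by \<open>M\<close> times its
  integral norm; Cauchy-Schwarz on the period makes the integral norm itself at most a multiple of
  \<open>M\<close>, and smoothing carries this to the sup norm of \<open>r\<close>.\<close>

lemma cost_grad_apriori:
  obtains c where "c > 0" "\<And>v r \<theta> M t. cost_grad v r \<Longrightarrow> continuous_on {0..P} v \<Longrightarrow> 0 \<le> \<theta> \<Longrightarrow> \<theta> \<le> 1 \<Longrightarrow>
    \<forall>s\<in>{0..P}. norm (Q (v s) + \<theta> *\<^sub>R r s) \<le> M \<Longrightarrow> t \<in> {0..P} \<Longrightarrow> norm (r t) \<le> c * M"
proof -
  obtain e where e: "e > 0" "\<And>v r \<theta>. cost_grad v r \<Longrightarrow> continuous_on {0..P} v \<Longrightarrow> 0 \<le> \<theta> \<Longrightarrow> \<theta> \<le> 1 \<Longrightarrow>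
    e * integral {0..P} (\<lambda>t. (norm (v t))\<^sup>2) \<le> integral {0..P} (\<lambda>t. v t \<bullet> (Q (v t) + \<theta> *\<^sub>R r t))"
    by (rule cost_grad_coercive) (rule that)
  obtain c where c: "c > 0" "\<And>v r t. cost_grad v r \<Longrightarrow> continuous_on {0..P} v \<Longrightarrow> t \<in> {0..P} \<Longrightarrow>
    norm (r t) \<le> c * integral {0..P} (\<lambda>s. norm (v s))"
    by (rule cost_grad_bound) (rule that)
  show thesis
  proof (rule that[of "c * (P / e)"])
    show "c * (P / e) > 0" using c e P by simp
    fix v r and \<theta> M t :: real
    assume cg: "cost_grad v r" and v: "continuous_on {0..P} v" and \<theta>: "0 \<le> \<theta>" "\<theta> \<le> 1"
      and M': "\<forall>s\<in>{0..P}. norm (Q (v s) + \<theta> *\<^sub>R r s) \<le> M" and t: "t \<in> {0..P}"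
    have M: "norm (Q (v s) + \<theta> *\<^sub>R r s) \<le> M" if "s \<in> {0..P}" for s using M' that by blast
    have cr: "continuous_on {0..P} r" by (rule cost_grad_continuous[OF cg v])
    have "0 \<le> M" using order_trans[OF norm_ge_zero M[OF t]] .
    let ?V = "integral {0..P} (\<lambda>s. norm (v s))"
    have V0: "0 \<le> ?V" by (intro integral_nonneg integrable_continuous_interval continuous_intros v) auto
    have "?V\<^sup>2 \<le> (P - 0) * integral {0..P} (\<lambda>s. (norm (v s))\<^sup>2)"
      using P by (intro integral_square_le continuous_intros v) auto
    then have "e * ?V\<^sup>2 \<le> e * (P * integral {0..P} (\<lambda>s. (norm (v s))\<^sup>2))"
      using e(1) by (intro mult_left_mono) auto
    also have "\<dots> = P * (e * integral {0..P} (\<lambda>s. (norm (v s))\<^sup>2))" by simp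
    also have "\<dots> \<le> P * integral {0..P} (\<lambda>s. v s \<bullet> (Q (v s) + \<theta> *\<^sub>R r s))"
      using P by (intro mult_left_mono e(2) cg v \<theta>) auto
    also have "\<dots> \<le> P * integral {0..P} (\<lambda>s. M * norm (v s))"
    proof (intro mult_left_mono integral_le integrable_continuous_interval continuous_intros v cr)
      fix s assume "s \<in> {0..P}"
      then have "norm (v s) * norm (Q (v s) + \<theta> *\<^sub>R r s) \<le> norm (v s) * M"
        by (intro mult_left_mono M) auto
      then show "v s \<bullet> (Q (v s) + \<theta> *\<^sub>R r s) \<le> M * norm (v s)"
        using norm_cauchy_schwarz[of "v s" "Q (v s) + \<theta> *\<^sub>R r s"] by (simp add: mult.commute)
    qed (use P in auto)
    finally have *: "e * ?V\<^sup>2 \<le> P * (M * ?V)" by simp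
    have "?V \<le> P / e * M"
    proof (cases "?V = 0")
      case True
      have "0 \<le> P / e * M" using P e \<open>0 \<le> M\<close> by simp
      then show ?thesis unfolding True .
    next
      case False
      then have pos: "?V > 0" using V0 by simp
      have "?V * (e * ?V) \<le> ?V * (P * M)" using * by (simp add: power2_eq_square mult_ac)
      then have "e * ?V \<le> P * M" using pos by (rule mult_left_le_imp_le)
      then show ?thesis using e(1) by (simp add: pos_le_divide_eq mult.commute)
    qed
    then have "c * ?V \<le> c * (P / e * M)" using c(1) by (intro mult_left_mono) auto
    with c(2)[OF cg v t] show "norm (r t) \<le> c * (P / e) * M" by (simp add: mult.assoc)
  qed
qed

text \<open>The equation is posed in the Banach space of bounded continuous functions, with
  \<open>G\<close> the pointwise action of \<open>Q\<close> and \<open>H\<close> the gradient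
  correction. At \<theta> = 0 it is solved by the inverse of \<open>Q\<close>.\<close>

lemma cost_grad_solvable:
  assumes r0: "continuous_on {0..P} r0"
  shows "\<exists>v r. continuous_on {0..P} v \<and> cost_grad v r \<and> (\<forall>t\<in>{0..P}. Q (v t) + r t = r0 t)"
proof -
  obtain ca where ca: "ca > 0" "\<And>v r \<theta> M t. cost_grad v r \<Longrightarrow> continuous_on {0..P} v \<Longrightarrow> 0 \<le> \<theta> \<Longrightarrow> \<theta> \<le> 1 \<Longrightarrow>
    \<forall>s\<in>{0..P}. norm (Q (v s) + \<theta> *\<^sub>R r s) \<le> M \<Longrightarrow> t \<in> {0..P} \<Longrightarrow> norm (r t) \<le> ca * M"
    by (rule cost_grad_apriori) (rule that)
  obtain cb where cb: "cb > 0" "\<And>v r t. cost_grad v r \<Longrightarrow> continuous_on {0..P} v \<Longrightarrow> t \<in> {0..P} \<Longrightarrow>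
    norm (r t) \<le> cb * integral {0..P} (\<lambda>s. norm (v s))"
    by (rule cost_grad_bound) (rule that)
  \<comment> \<open>Clamping turns a continuous function on one period into an element of
    \<open>real \<Rightarrow>\<^sub>C 'u\<close>.\<close>
  define \<pi> where "\<pi> t = max 0 (min t P)" for t
  have \<pi>: "\<pi> t \<in> {0..P}" for t using P by (auto simp: \<pi>_def)
  have \<pi>_id: "\<pi> t = t" if "t \<in> {0..P}" for t using that by (auto simp: \<pi>_def)
  have c\<pi>: "continuous_on UNIV \<pi>" unfolding \<pi>_def by (intro continuous_intros)
  \<comment> \<open>The chosen representative is determined, and linear in \<open>v\<close>, on
    {0..P} only; \<open>H\<close> therefore reads it at the clamped times
    \<open>\<pi> t\<close>.\<close>
  define \<rho> where "\<rho> v = (SOME r. cost_grad v r)" for v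
  have \<rho>: "cost_grad v (\<rho> v)" if "continuous_on {0..P} v" for v
    unfolding \<rho>_def by (rule someI_ex[OF cost_grad_exists[OF that]])
  have clamp: "(\<lambda>t. f (\<pi> t)) \<in> bcontfun" if "continuous_on {0..P} f" for f :: "real \<Rightarrow> 'u"
  proof -
    have "bounded (f ` {0..P})" using that by (intro compact_imp_bounded compact_continuous_image) auto
    moreover have "range (\<lambda>t. f (\<pi> t)) \<subseteq> f ` {0..P}" using \<pi> by auto
    ultimately have "bounded (range (\<lambda>t. f (\<pi> t)))" by (rule bounded_subset)
    moreover have "continuous_on UNIV (\<lambda>t. f (\<pi> t))"
      by (rule continuous_on_compose2[OF that c\<pi>]) (use \<pi> in auto)
    ultimately show ?thesis by (simp add: bcontfun_def)
  qed
  define H where "H v = Bcontfun (\<lambda>t. \<rho> (apply_bcontfun v) (\<pi> t))" for v :: "real \<Rightarrow>\<^sub>C 'u"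
  have H: "apply_bcontfun (H v) t = \<rho> (apply_bcontfun v) (\<pi> t)" for v t
    unfolding H_def by (subst Bcontfun_inverse) (auto intro!: clamp cost_grad_continuous[OF \<rho>])
  have opQ: "(\<lambda>t. D (apply_bcontfun v t)) \<in> bcontfun" for D :: "'u \<Rightarrow>\<^sub>L 'u" and v :: "real \<Rightarrow>\<^sub>C 'u"
    by (rule bcontfun_normI[where b = "norm D * norm v"])
      (auto intro!: continuous_intros order_trans[OF norm_blinfun] mult_left_mono norm_bounded)
  define G where "G v = Bcontfun (\<lambda>t. Q (apply_bcontfun v t))" for v :: "real \<Rightarrow>\<^sub>C 'u"
  have G: "apply_bcontfun (G v) t = Q (apply_bcontfun v t)" for v t
    unfolding G_def by (subst Bcontfun_inverse) (auto intro!: opQ)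
  have "surj (\<lambda>v. G v + H v)"
  proof (rule method_of_continuity[where c = "norm (inv_op Q) * (1 + ca)"])
    show "bounded_linear G"
      by (rule bounded_linear_intro[where K = "norm Q"])
        (auto intro!: bcontfun_eqI norm_bound order_trans[OF norm_blinfun]
          simp: G blinfun.add_right blinfun.scaleR_right mult.commute[of _ "norm Q"] mult_left_mono norm_bounded)
    show "bounded_linear H"
    proof (rule bounded_linear_intro[where K = "cb * P"])
      fix u v :: "real \<Rightarrow>\<^sub>C 'u" and s
      show "H (u + v) = H u + H v"
        using cost_grad_unique[OF \<rho>[OF continuous_on_add[OF continuous_on_apply_bcontfun continuous_on_apply_bcontfun]] cost_grad_add[OF \<rho>[OF continuous_on_apply_bcontfun] \<rho>[OF continuous_on_apply_bcontfun]] \<pi>, of u v]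
        by (intro bcontfun_eqI) (simp add: H plus_bcontfun.rep_eq)
      show "H (s *\<^sub>R v) = s *\<^sub>R H v"
        using cost_grad_unique[OF \<rho>[OF continuous_on_scaleR[OF continuous_on_const continuous_on_apply_bcontfun]]
            cost_grad_scaleR[OF \<rho>[OF continuous_on_apply_bcontfun]] \<pi>, of s v]
        by (intro bcontfun_eqI) (simp add: H scaleR_bcontfun.rep_eq)
      show "norm (H v) \<le> norm v * (cb * P)"
      proof (rule norm_bound)
        fix t
        have "norm (H v t) \<le> cb * integral {0..P} (\<lambda>s. norm (v s))"
          unfolding H by (rule cb(2)[OF \<rho> _ \<pi>]) auto
        also have "integral {0..P} (\<lambda>s. norm (v s)) \<le> integral {0..P} (\<lambda>s. norm v)"
          by (intro integral_le integrable_continuous_interval continuous_intros norm_bounded) auto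
        finally show "norm (H v t) \<le> norm v * (cb * P)"
          using cb(1) P by (simp add: mult_left_mono mult_ac)
      qed
    qed
    show "surj G"
    proof (rule surjI)
      fix f :: "real \<Rightarrow>\<^sub>C 'u"
      have "apply_bcontfun (Bcontfun (\<lambda>t. inv_op Q (apply_bcontfun f t))) t = inv_op Q (apply_bcontfun f t)" for t
        by (subst Bcontfun_inverse) (auto intro!: opQ)
      then show "G (Bcontfun (\<lambda>t. inv_op Q (apply_bcontfun f t))) = f"
        by (intro bcontfun_eqI) (simp add: G inv_op_works[OF inv_Q])
    qed
    fix \<theta> :: real and v :: "real \<Rightarrow>\<^sub>C 'u" assume \<theta>: "0 \<le> \<theta>" "\<theta> \<le> 1"
    let ?f = "G v + \<theta> *\<^sub>R H v"
    have f: "apply_bcontfun ?f t = Q (v t) + \<theta> *\<^sub>R \<rho> (apply_bcontfun v) (\<pi> t)" for t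
      by (simp add: plus_bcontfun.rep_eq scaleR_bcontfun.rep_eq G H)
    have rb: "norm (\<rho> (apply_bcontfun v) (\<pi> t)) \<le> ca * norm ?f" for t
    proof (rule ca(2)[OF \<rho> _ \<theta> _ \<pi>])
      show "\<forall>s\<in>{0..P}. norm (Q (v s) + \<theta> *\<^sub>R \<rho> (apply_bcontfun v) s) \<le> norm ?f"
      proof
        fix s assume "s \<in> {0..P}"
        then show "norm (Q (v s) + \<theta> *\<^sub>R \<rho> (apply_bcontfun v) s) \<le> norm ?f"
          using norm_bounded[of ?f s] unfolding f by (simp add: \<pi>_id)
      qed
    qed auto
    \<comment> \<open>The equation itself is solved for \<open>v\<close>: it equals
      \<open>inv_op Q\<close> of the right-hand side minus \<theta> times \<open>r\<close>, and
      \<open>r\<close> is already bounded uniformly by the right-hand side.\<close>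
    show "norm v \<le> norm (inv_op Q) * (1 + ca) * norm ?f"
    proof (rule norm_bound)
      fix t
      have "v t = inv_op Q (?f t - \<theta> *\<^sub>R \<rho> (apply_bcontfun v) (\<pi> t))"
        unfolding f by (simp add: inv_op_works[OF inv_Q])
      then have "norm (v t) \<le> norm (inv_op Q) * norm (?f t - \<theta> *\<^sub>R \<rho> (apply_bcontfun v) (\<pi> t))"
        by (metis norm_blinfun)
      also have "\<dots> \<le> norm (inv_op Q) * (norm ?f + 1 * (ca * norm ?f))"
      proof (rule mult_left_mono)
        have "norm (?f t - \<theta> *\<^sub>R \<rho> (apply_bcontfun v) (\<pi> t)) \<le> norm (?f t) + \<theta> * norm (\<rho> (apply_bcontfun v) (\<pi> t))"
          using norm_triangle_ineq4[of "?f t" "\<theta> *\<^sub>R \<rho> (apply_bcontfun v) (\<pi> t)"] \<theta> by simp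
        also have "\<dots> \<le> norm ?f + 1 * (ca * norm ?f)"
          using \<theta> rb by (intro add_mono mult_mono norm_bounded) auto
        finally show "norm (?f t - \<theta> *\<^sub>R \<rho> (apply_bcontfun v) (\<pi> t)) \<le> norm ?f + 1 * (ca * norm ?f)" .
      qed simp
      also have "\<dots> = norm (inv_op Q) * (1 + ca) * norm ?f" by (simp only: distrib_left distrib_right mult_1_left mult_1_right mult.assoc)
      finally show "norm (v t) \<le> norm (inv_op Q) * (1 + ca) * norm ?f" .
    qed
  qed
  then have "\<exists>v. Bcontfun (\<lambda>t. r0 (\<pi> t)) = G v + H v" by (rule surjD)
  then obtain v where v: "G v + H v = Bcontfun (\<lambda>t. r0 (\<pi> t))" by metis
  have "Q (v t) + \<rho> (apply_bcontfun v) t = r0 t" if "t \<in> {0..P}" for t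
    using arg_cong[OF v, of "\<lambda>f. apply_bcontfun f t"] \<pi>_id[OF that]
    by (simp add: plus_bcontfun.rep_eq G H Bcontfun_inverse[OF clamp[OF r0]])
  then show ?thesis
    by (intro exI[of _ "apply_bcontfun v"] exI[of _ "\<rho> (apply_bcontfun v)"]) (auto intro!: \<rho>)
qed

text \<open>The state is split as \<open>y1 + z\<close>: \<open>y1\<close> carries the rough
  \<open>ud\<close> and is nevertheless continuous, \<open>z\<close> answers to a continuous
  correction \<open>v\<close>. A zero of the total gradient says
  \<open>Q (v t + F (y t)) = adj B (l t)\<close>, which is the stationarity condition of the
  optimality system in feedback form.\<close>

theorem periodic_extremal_exists:
  assumes ud: "L1_on 0 P ud" and yd: "continuous_on {0..P} yd"
  shows "\<exists>y l. continuous_on {0..P} y \<and> continuous_on {0..P} l \<and> y 0 = y P \<and> l 0 = l P \<and>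
    mild_sol T' 0 P (\<lambda>t. W (l t) + B (ud t)) y \<and>
    back_sol T 0 P (\<lambda>t. adj C (C (y t)) - adj C (C (yd t))) l"
proof -
  obtain y1 where y1: "per_forward (\<lambda>t. B (ud t)) y1"
    using per_forward_exists[OF L1_on_blinfun[OF ud]] by blast
  have cy1: "continuous_on {0..P} y1" by (rule per_forward_continuous[OF y1 L1_on_blinfun[OF ud]])
  let ?q0 = "\<lambda>t. adj F (Q (F (y1 t))) + adj C (C (y1 t - yd t))"
  have cq0: "continuous_on {0..P} ?q0" by (intro continuous_intros cy1 yd)
  obtain p0 where p0: "per_backward ?q0 p0" using per_backward_exists[OF cq0] by blast
  have cp0: "continuous_on {0..P} p0" by (rule per_backward_continuous[OF p0 cq0])
  \<comment> \<open>Minus the part of the gradient that \<open>y1\<close> and \<open>yd\<close>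
    contribute; only the state driven by \<open>ud\<close> enters it, hence its continuity.\<close>
  have "continuous_on {0..P} (\<lambda>t. - (adj B (p0 t) + Q (F (y1 t))))"
    by (intro continuous_intros cp0 cy1)
  from cost_grad_solvable[OF this] obtain v r where v: "continuous_on {0..P} v" and "cost_grad v r"
    and eq: "\<forall>t\<in>{0..P}. Q (v t) + r t = - (adj B (p0 t) + Q (F (y1 t)))" by blast
  then obtain z p where z: "per_forward (\<lambda>t. B (v t)) z"
    and p: "per_backward (\<lambda>t. adj F (Q (v t + F (z t))) + adj C (C (z t))) p"
    and r: "\<forall>t\<in>{0..P}. r t = Q (F (z t)) + adj B (p t)"
    unfolding cost_grad_def by blast
  have cB: "continuous_on {0..P} (\<lambda>t. B (v t))" by (intro continuous_intros v)
  have cz: "continuous_on {0..P} z" by (rule per_forward_continuous[OF z L1_on_continuous[OF cB]])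
  have cq: "continuous_on {0..P} (\<lambda>t. adj F (Q (v t + F (z t))) + adj C (C (z t)))"
    by (intro continuous_intros v cz)
  have cp: "continuous_on {0..P} p" by (rule per_backward_continuous[OF p cq])
  define y where "y t = y1 t + z t" for t
  \<comment> \<open>The sign follows the optimality system, where the multiplier is the negative of
    the adjoint state of the cost.\<close>
  define l where "l t = - (p0 t + p t)" for t
  have cy: "continuous_on {0..P} y" and cl: "continuous_on {0..P} l"
    unfolding y_def l_def by (intro continuous_intros cy1 cz cp cp0)+
  have Bl: "inv_op Q (adj B (l t)) = v t + F (y t)" if "t \<in> {0..P}" for t
  proof -
    have eq': "Q (v t) + (Q (F (z t)) + adj B (p t)) = - (adj B (p0 t) + Q (F (y1 t)))"
      using eq r that by simp
    have "adj B (l t) = - (adj B (p0 t) + Q (F (y1 t))) + Q (F (y1 t)) - adj B (p t)"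
      by (simp add: l_def blinfun.add_right blinfun.minus_right blinfun.diff_right)
    also have "\<dots> = Q (v t + F (y t))"
      unfolding eq'[symmetric] by (simp add: y_def blinfun.add_right)
    finally have "adj B (l t) = Q (v t + F (y t))" .
    then show ?thesis by (simp add: inv_op_works[OF inv_Q])
  qed
  have y: "per_forward (\<lambda>t. B (ud t) + B (v t)) y"
    unfolding y_def by (rule per_forward_add[OF y1 z])
  \<comment> \<open>Undoing the feedback in the state equation adds \<open>B F y\<close> to the
    source, and \<open>v + F y\<close> is the control correction prescribed by the
    multiplier.\<close>
  have "mild_sol T' 0 P (\<lambda>t. (B (ud t) + B (v t)) + adj (adj (B o\<^sub>L F)) (y t)) y"
    using y P by (intro mild_sol_unperturb[OF dual_T' T' dual_S' S'] L1_on_add L1_on_blinfun ud L1_on_continuous cB)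
      (auto simp: per_forward_def)
  then have 1: "mild_sol T' 0 P (\<lambda>t. W (l t) + B (ud t)) y"
    by (rule mild_sol_cong_AE[where N = "{}"]) (auto simp: adj_adj Bl blinfun.add_right)
  have "per_backward (\<lambda>t. ?q0 t + (adj F (Q (v t + F (z t))) + adj C (C (z t)))) (\<lambda>t. p0 t + p t)"
    by (rule per_backward_add[OF p0 p])
  from per_backward_scaleR[OF this, of "- 1"]
  have "back_sol S 0 P (\<lambda>t. ?q0 t + (adj F (Q (v t + F (z t))) + adj C (C (z t)))) l"
    unfolding per_backward_def l_def by (simp only: scaleR_minus1_left minus_minus)
  then have "back_sol T 0 P (\<lambda>t. (?q0 t + (adj F (Q (v t + F (z t))) + adj C (C (z t)))) - adj (B o\<^sub>L F) (l t)) l"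
    using P by (intro back_sol_unperturb[OF dual_T T dual_S S] continuous_on_add cq0 cq) auto
  \<comment> \<open>In the adjoint equation the term \<open>adj F (adj B (l t))\<close> produced by
    undoing the feedback cancels the derivative of the control cost by the same stationarity
    condition.\<close>
  moreover have "(?q0 t + (adj F (Q (v t + F (z t))) + adj C (C (z t)))) - adj (B o\<^sub>L F) (l t)
      = adj C (C (y t)) - adj C (C (yd t))" if "t \<in> {0..P}" for t
  proof -
    have "adj B (l t) = Q (v t + F (y t))"
      using Bl[OF that] by (metis inv_op_works(1)[OF inv_Q])
    then show ?thesis
      by (simp add: adj_compose y_def blinfun.add_right blinfun.diff_right)
  qed
  ultimately have 2: "back_sol T 0 P (\<lambda>t. adj C (C (y t)) - adj C (C (yd t))) l"
    unfolding back_sol_def by (elim mild_sol_cong_AE[where N = "{}"]) auto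
  have per_l: "l 0 = l P" using p0 p by (simp add: per_backward_def l_def)
  have "y 0 = y P" using y by (simp add: per_forward_def)
  with cy cl per_l 1 2 show ?thesis by blast
qed

end

section \<open>Mild solutions and the adjoint semigroup\<close>

text \<open>The semigroup of the adjoint is an arbitrary choice among those it generates, so duality
  must be proved: the orbit \<open>T s x\<close> solves the weak equation for
  \<open>op_adj A\<close>, hence the mild one for \<open>T'\<close>, which without source is the
  asserted identity.\<close>

lemma dual_of_generates:
  fixes T T' :: "real \<Rightarrow> 'a::{real_inner,banach} \<Rightarrow>\<^sub>L 'a"
  assumes T: "generates A T" and T': "generates (op_adj A) T'"
  shows "dual_semigroups T T'"
proof -
  note C0 = generates_C0[OF T]
  have "T t x \<bullet> y = x \<bullet> T' t y" if "0 \<le> t" for t x y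
  proof -
    have "weak_sol (op_adj A) 0 t (\<lambda>_. 0) (\<lambda>s. T s x)"
      unfolding weak_sol_def
    proof (intro allI impI)
      fix w v :: 'a and t1 t2 :: real
      assume w: "op_adj A w = Some v" and t: "0 \<le> t1" "t1 \<le> t2"
      have "((\<lambda>s. T s (T t1 x) \<bullet> v) has_integral (T (t2 - t1) (T t1 x) \<bullet> w - T t1 x \<bullet> w)) {0..t2 - t1}"
        using t by (intro semigroup_weak_identity[OF T w]) simp
      from has_integral_shift_real_ivl[OF this, of "- t1"]
      have "((\<lambda>s. T (s - t1) (T t1 x) \<bullet> v) has_integral (T (t2 - t1) (T t1 x) \<bullet> w - T t1 x \<bullet> w)) {t1..t2}" by simp
      moreover have "T (s - t1) (T t1 x) = T s x" if "t1 \<le> s" for s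
        using C0_semigroup_add[OF C0, of "s - t1" t1 x] that t by simp
      ultimately show "((\<lambda>s. T s x \<bullet> v + 0 \<bullet> w) has_integral (T t2 x \<bullet> w - T t1 x \<bullet> w)) {t1..t2}"
        using t has_integral_cong[of "{t1..t2}" "\<lambda>s. T (s - t1) (T t1 x) \<bullet> v" "\<lambda>s. T s x \<bullet> v + 0 \<bullet> w"] by simp
    qed
    then have "mild_sol T' 0 t (\<lambda>_. 0) (\<lambda>s. T s x)"
      by (rule weak_sol_imp_mild_sol_continuous[OF T'])
        (auto intro!: continuous_on_subset[OF C0_semigroup_continuous[OF C0]])
    from mild_solD[OF this order_refl that order_refl, of y]
    have "((\<lambda>s. 0) has_integral (T t x \<bullet> y - T 0 x \<bullet> T' t y)) {0..t}" by simp
    then have "T t x \<bullet> y - T 0 x \<bullet> T' t y = 0" by (rule has_integral_unique[OF _ has_integral_0])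
    then show ?thesis by (simp add: C0_semigroup_zero[OF C0])
  qed
  then show ?thesis
    using generates_C0[OF T] generates_C0[OF T'] by (simp add: dual_semigroups_def)
qed

lemma mild_forward_iff:
  assumes "dual_semigroups S (semigroup_of A)" "L1_on 0 \<tau> g"
  shows "mild_forward A \<tau> g y \<longleftrightarrow> mild_sol S 0 \<tau> g y"
  using duhamel_iff_mild_sol[OF assms, of y] by (simp add: mild_forward_def)

lemma mild_adjoint_iff:
  assumes dual: "dual_semigroups S (semigroup_of (op_adj A))" and h: "continuous_on {0..\<tau>} h"
  shows "mild_adjoint A \<tau> h l \<longleftrightarrow> back_sol S 0 \<tau> h l"
proof -
  let ?T = "semigroup_of (op_adj A)"
  have C0: "C0_semigroup S" "C0_semigroup ?T" using dual by (auto simp: dual_semigroups_def)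
  have adj: "S t x \<bullet> v = x \<bullet> ?T t v" if "t \<ge> 0" for t x v
    using dual that by (simp add: dual_semigroups_def)
  let ?I = "\<lambda>t. bint (lebesgue_on {t..\<tau>}) (\<lambda>s. ?T (s - t) (h s))"
  have I: "((\<lambda>s. h s \<bullet> S (s - t) x) has_integral (?I t \<bullet> x)) {t..\<tau>}" if t: "t \<in> {0..\<tau>}" for t x
  proof -
    have "continuous_on {t..\<tau>} (\<lambda>s. ?T (s - t) (h s))"
      using t by (intro C0_semigroup_continuous_compose[OF C0(2), where \<tau> = \<tau>] continuous_intros
          continuous_on_subset[OF h]) auto
    then have "((\<lambda>s. ?T (s - t) (h s) \<bullet> x) has_integral (?I t \<bullet> x)) {t..\<tau>}"
      by (rule L1_on_bint_inner[OF L1_on_continuous])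
    then show ?thesis
      using has_integral_cong[of "{t..\<tau>}" "\<lambda>s. ?T (s - t) (h s) \<bullet> x" "\<lambda>s. h s \<bullet> S (s - t) x"]
        adj by (simp add: inner_commute)
  qed
  show ?thesis
  proof
    assume l: "mild_adjoint A \<tau> h l"
    show "back_sol S 0 \<tau> h l"
      unfolding back_sol_def
    proof (rule mild_solI[OF C0(1)])
      fix r x assume "r \<in> {- \<tau>..- 0}"
      then have t: "- r \<in> {0..\<tau>}" by auto
      have "l (- r) = ?T (\<tau> - (- r)) (l \<tau>) - ?I (- r)"
        using l t unfolding mild_adjoint_def by blast
      then have "l (- r) \<bullet> x = ?T (\<tau> + r) (l \<tau>) \<bullet> x - ?I (- r) \<bullet> x"
        by (simp add: inner_diff_left)
      moreover have "?T (\<tau> + r) (l \<tau>) \<bullet> x = l \<tau> \<bullet> S (\<tau> + r) x"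
        using adj[of "\<tau> + r" x "l \<tau>"] t by (simp add: inner_commute)
      ultimately have eq: "?I (- r) \<bullet> x = - (l (- r) \<bullet> x - l \<tau> \<bullet> S (\<tau> + r) x)" by simp
      have "((\<lambda>s. h (- s) \<bullet> S (- s - (- r)) x) has_integral ?I (- r) \<bullet> x) {- \<tau>..- (- r)}"
        unfolding has_integral_reflect_real[where f = "\<lambda>s. h s \<bullet> S (s - (- r)) x"] by (rule I[OF t])
      then have "((\<lambda>s. - (h (- s) \<bullet> S (r - s) x)) has_integral - (?I (- r) \<bullet> x)) {- \<tau>..r}"
        unfolding has_integral_neg_iff by simp
      then show "((\<lambda>s. - h (- s) \<bullet> S (r - s) x) has_integral (l (- r) \<bullet> x - l (- (- \<tau>)) \<bullet> S (r - (- \<tau>)) x)) {- \<tau>..r}"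
        unfolding eq by (simp add: add.commute)
    qed
  next
    assume l: "back_sol S 0 \<tau> h l"
    show "mild_adjoint A \<tau> h l"
      unfolding mild_adjoint_def
    proof
      fix t assume t: "t \<in> {0..\<tau>}"
      show "l t = ?T (\<tau> - t) (l \<tau>) - ?I t"
      proof (rule eq_if_inner_eq)
        fix x
        have "((\<lambda>s. h s \<bullet> S (s - t) x) has_integral (l \<tau> \<bullet> S (\<tau> - t) x - l t \<bullet> x)) {t..\<tau>}"
          using l t unfolding back_sol_iff by auto
        then have "l \<tau> \<bullet> S (\<tau> - t) x - l t \<bullet> x = ?I t \<bullet> x"
          using has_integral_unique I[OF t] by blast
        moreover have "?T (\<tau> - t) (l \<tau>) \<bullet> x = l \<tau> \<bullet> S (\<tau> - t) x"
          using adj[of "\<tau> - t" x "l \<tau>"] t by (simp add: inner_commute)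
        ultimately show "l t \<bullet> x = (?T (\<tau> - t) (l \<tau>) - ?I t) \<bullet> x"
          unfolding inner_diff_left by linarith
      qed
    qed
  qed
qed

section \<open>Optimality\<close>

lemma AE_lebesgue_on_negligible:
  assumes "AE t in lebesgue_on S. Q t" "S \<in> sets lebesgue"
  obtains N where "negligible N" "\<And>t. t \<in> S - N \<Longrightarrow> Q t"
proof -
  from assms have "AE t in lebesgue. t \<in> S \<longrightarrow> Q t" by (simp add: AE_restrict_space_iff)
  then obtain N where "{t \<in> space lebesgue. \<not> (t \<in> S \<longrightarrow> Q t)} \<subseteq> N" "N \<in> null_sets lebesgue"
    by (auto elim!: AE_E simp: null_sets_def)
  then show thesis by (intro that[of N]) (auto simp: negligible_iff_null_sets)
qed

lemma AE_lebesgue_on_if_negligible: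
  assumes "negligible N" "\<And>t. t \<in> S - N \<Longrightarrow> Q t" "S \<in> sets lebesgue"
  shows "AE t in lebesgue_on S. Q t"
proof -
  have "AE t in lebesgue. t \<notin> N"
    using assms(1) by (intro AE_not_in) (simp add: negligible_iff_null_sets)
  then have "AE t in lebesgue. t \<in> S \<longrightarrow> Q t" by eventually_elim (use assms(2) in auto)
  with assms(3) show ?thesis by (simp add: AE_restrict_space_iff)
qed

lemma L2_on_continuous:
  assumes "continuous_on {0..\<tau>} f"
  shows "L2_on \<tau> f"
  unfolding L2_on_def
  using assms by (auto intro!: strongly_measurable_continuous continuous_imp_integrable_real continuous_intros)

lemma integrable_interval_dominated:
  fixes f :: "real \<Rightarrow> real"
  assumes "strongly_measurable (lebesgue_on {a..b}) f" "integrable (lebesgue_on {a..b}) h" "\<And>t. \<bar>f t\<bar> \<le> h t"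
  shows "integrable (lebesgue_on {a..b}) f"
  by (rule L1_on_imp_integrable[OF L1_on_dominated[OF assms(1,2)]]) (use assms(3) in simp)

lemma L2_on_add:
  assumes "L2_on \<tau> f" "L2_on \<tau> g"
  shows "L2_on \<tau> (\<lambda>t. f t + g t)"
proof -
  have m: "strongly_measurable (lebesgue_on {0..\<tau>}) (\<lambda>t. f t + g t)"
    using assms by (intro strongly_measurable_add) (auto simp: L2_on_def)
  have "integrable (lebesgue_on {0..\<tau>}) (\<lambda>t. (norm (f t + g t))\<^sup>2)"
  proof (rule integrable_interval_dominated)
    show "strongly_measurable (lebesgue_on {0..\<tau>}) (\<lambda>t. (norm (f t + g t))\<^sup>2)"
      by (rule strongly_measurable_compose2[OF m m, of "\<lambda>x y. (norm x)\<^sup>2"])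
        (auto simp: case_prod_unfold intro!: continuous_intros)
    show "integrable (lebesgue_on {0..\<tau>}) (\<lambda>t. 2 * (norm (f t))\<^sup>2 + 2 * (norm (g t))\<^sup>2)"
      using assms by (auto simp: L2_on_def)
  qed (use norm_square_add_le in auto)
  with m show ?thesis by (simp add: L2_on_def)
qed

lemma L2_on_blinfun:
  assumes "L2_on \<tau> f"
  shows "L2_on \<tau> (\<lambda>t. blinfun_apply F (f t))"
proof -
  have m: "strongly_measurable (lebesgue_on {0..\<tau>}) (\<lambda>t. F (f t))"
    using assms by (intro strongly_measurable_blinfun) (auto simp: L2_on_def)
  have "integrable (lebesgue_on {0..\<tau>}) (\<lambda>t. (norm (F (f t)))\<^sup>2)"
  proof (rule integrable_interval_dominated)
    show "strongly_measurable (lebesgue_on {0..\<tau>}) (\<lambda>t. (norm (F (f t)))\<^sup>2)"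
      by (rule strongly_measurable_compose2[OF m m, of "\<lambda>x y. (norm x)\<^sup>2"])
        (auto simp: case_prod_unfold intro!: continuous_intros)
    show "integrable (lebesgue_on {0..\<tau>}) (\<lambda>t. (norm F)\<^sup>2 * (norm (f t))\<^sup>2)"
      using assms by (auto simp: L2_on_def)
  qed (use norm_square_blinfun_le in auto)
  with m show ?thesis by (simp add: L2_on_def)
qed

lemma L2_on_diff:
  assumes "L2_on \<tau> f" "L2_on \<tau> g"
  shows "L2_on \<tau> (\<lambda>t. f t - g t)"
  using L2_on_add[OF assms(1) L2_on_blinfun[OF assms(2), of "- id_blinfun"]]
  by (simp add: blinfun.minus_left)

lemma L2_on_inner_integrable:
  fixes f g :: "real \<Rightarrow> 'a::real_inner"
  assumes "L2_on \<tau> f" "L2_on \<tau> g"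
  shows "integrable (lebesgue_on {0..\<tau>}) (\<lambda>t. f t \<bullet> g t)"
proof (rule integrable_interval_dominated)
  show "strongly_measurable (lebesgue_on {0..\<tau>}) (\<lambda>t. f t \<bullet> g t)"
    using assms by (intro strongly_measurable_compose2[of _ f g "\<lambda>x y. x \<bullet> y"])
      (auto simp: L2_on_def case_prod_unfold intro!: continuous_intros)
  show "integrable (lebesgue_on {0..\<tau>}) (\<lambda>t. (norm (f t))\<^sup>2 + (norm (g t))\<^sup>2)"
    using assms by (auto simp: L2_on_def)
  show "\<bar>f t \<bullet> g t\<bar> \<le> (norm (f t))\<^sup>2 + (norm (g t))\<^sup>2" for t
  proof -
    have "0 \<le> (norm (f t) - norm (g t))\<^sup>2" by simp
    then have "2 * (norm (f t) * norm (g t)) \<le> (norm (f t))\<^sup>2 + (norm (g t))\<^sup>2"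
      by (simp add: power2_diff)
    moreover have "0 \<le> norm (f t) * norm (g t)" by simp
    ultimately show ?thesis using Cauchy_Schwarz_ineq2[of "f t" "g t"] by linarith
  qed
qed

context lq
begin

text \<open>The cross terms in the expansion of the cost around an extremal vanish by duality.\<close>

lemma lq_cost_expand:
  fixes y y' l yd :: "real \<Rightarrow> 'x" and u u' ud :: "real \<Rightarrow> 'u"
  assumes "\<tau> > 0"
    and y: "mild_sol T' 0 \<tau> (\<lambda>t. B (u t)) y" "continuous_on {0..\<tau>} y" "L2_on \<tau> u"
    and y': "mild_sol T' 0 \<tau> (\<lambda>t. B (u' t)) y'" "continuous_on {0..\<tau>} y'" "L2_on \<tau> u'"
    and ud: "L2_on \<tau> ud" and yd: "continuous_on {0..\<tau>} yd"
    and l: "back_sol T 0 \<tau> (\<lambda>t. adj C (C (y t)) - adj C (C (yd t))) l" "continuous_on {0..\<tau>} l"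
    and u: "AE t in lebesgue_on {0..\<tau>}. u t = ud t + inv_op Q (adj B (l t))"
    and bd: "(y' \<tau> - y \<tau>) \<bullet> l \<tau> = (y' 0 - y 0) \<bullet> l 0"
  shows "lq_cost C Q yd ud \<tau> y' u' = lq_cost C Q yd ud \<tau> y u +
      1/2 * (LINT t|lebesgue_on {0..\<tau>}. (norm (C (y' t - y t)))\<^sup>2 + Q (u' t - u t) \<bullet> (u' t - u t))"
    and "integrable (lebesgue_on {0..\<tau>}) (\<lambda>t. (norm (C (y' t - y t)))\<^sup>2 + Q (u' t - u t) \<bullet> (u' t - u t))"
proof -
  let ?M = "lebesgue_on {0..\<tau>}"
  let ?d = "\<lambda>t. u' t - u t" and ?e = "\<lambda>t. u t - ud t"
  let ?a = "\<lambda>t. C (y t - yd t)" and ?b = "\<lambda>t. C (y' t - y t)"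
  have ca: "continuous_on {0..\<tau>} ?a" and cb: "continuous_on {0..\<tau>} ?b"
    by (intro continuous_intros y y' yd)+
  have L2: "L2_on \<tau> ?a" "L2_on \<tau> ?b" "L2_on \<tau> ?d" "L2_on \<tau> ?e"
    using L2_on_continuous[OF ca] L2_on_continuous[OF cb] L2_on_diff y(3) y'(3) ud by auto
  have int: "integrable ?M (\<lambda>t. ?a t \<bullet> ?a t)" "integrable ?M (\<lambda>t. ?b t \<bullet> ?b t)" "integrable ?M (\<lambda>t. ?a t \<bullet> ?b t)"
    "integrable ?M (\<lambda>t. Q (?e t) \<bullet> ?e t)" "integrable ?M (\<lambda>t. Q (?d t) \<bullet> ?d t)" "integrable ?M (\<lambda>t. Q (?e t) \<bullet> ?d t)"
    by (intro L2_on_inner_integrable L2_on_blinfun L2)+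
  have L1d: "L1_on 0 \<tau> (\<lambda>t. B (u' t) - B (u t))"
    by (intro L1_on_diff L1_on_blinfun L2_on_imp_L1_on y y')
  \<comment> \<open>The difference of the two states is paired with the multiplier;
    \<open>bd\<close> cancels the two end contributions.\<close>
  have "((\<lambda>s. (B (u' s) - B (u s)) \<bullet> l s + (y' s - y s) \<bullet> (adj C (C (y s)) - adj C (C (yd s))))
      has_integral ((y' \<tau> - y \<tau>) \<bullet> l \<tau> - (y' 0 - y 0) \<bullet> l 0)) {0..\<tau>}"
    using \<open>\<tau> > 0\<close> l(1)[unfolded back_sol_iff]
    by (intro mild_sol_pairing[OF dual_T' mild_sol_diff[OF y'(1) y(1)] L1d l(2)] continuous_intros y yd) auto
  then have hi: "((\<lambda>s. (B (u' s) - B (u s)) \<bullet> l s + (y' s - y s) \<bullet> (adj C (C (y s)) - adj C (C (yd s))))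
      has_integral 0) {0..\<tau>}" using bd by simp
  have ae: "AE t in ?M. (B (u' t) - B (u t)) \<bullet> l t + (y' t - y t) \<bullet> (adj C (C (y t)) - adj C (C (yd t)))
      = ?a t \<bullet> ?b t + Q (?e t) \<bullet> ?d t"
    using u
  proof eventually_elim
    case (elim t)
    then have "Q (?e t) = adj B (l t)" by (simp add: inv_op_works[OF inv_Q])
    then have "Q (?e t) \<bullet> ?d t = (B (u' t) - B (u t)) \<bullet> l t"
      by (simp add: adj_inner_left blinfun.diff_right inner_commute)
    moreover have "(y' t - y t) \<bullet> (adj C (C (y t)) - adj C (C (yd t))) = ?a t \<bullet> ?b t"
      by (simp only: blinfun.diff_right[symmetric] adj_inner[symmetric] inner_commute)
    ultimately show ?case by simp
  qed
  have cross: "integral\<^sup>L ?M (\<lambda>t. ?a t \<bullet> ?b t + Q (?e t) \<bullet> ?d t) = 0"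
  proof -
    obtain N where N: "negligible N" "\<And>t. t \<in> {0..\<tau>} - N \<Longrightarrow>
        (B (u' t) - B (u t)) \<bullet> l t + (y' t - y t) \<bullet> (adj C (C (y t)) - adj C (C (yd t))) = ?a t \<bullet> ?b t + Q (?e t) \<bullet> ?d t"
      using AE_lebesgue_on_negligible[OF ae] by auto
    have "((\<lambda>t. ?a t \<bullet> ?b t + Q (?e t) \<bullet> ?d t) has_integral 0) {0..\<tau>}"
      by (rule has_integral_spike[OF N(1) _ hi]) (use N(2) in simp)
    moreover have "((\<lambda>t. ?a t \<bullet> ?b t + Q (?e t) \<bullet> ?d t) has_integral
        integral\<^sup>L ?M (\<lambda>t. ?a t \<bullet> ?b t + Q (?e t) \<bullet> ?d t)) {0..\<tau>}"
      by (intro has_integral_integral_lebesgue_on Bochner_Integration.integrable_add int) auto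
    ultimately show ?thesis using has_integral_unique by blast
  qed
  show 2: "integrable ?M (\<lambda>t. (norm (?b t))\<^sup>2 + Q (?d t) \<bullet> ?d t)"
    using int by (simp add: power2_norm_eq_inner)
  have "integral\<^sup>L ?M (\<lambda>t. (norm (C (y' t - yd t)))\<^sup>2 + (norm (pos_sqrt Q (u' t - ud t)))\<^sup>2)
    = integral\<^sup>L ?M (\<lambda>t. ((?a t \<bullet> ?a t + Q (?e t) \<bullet> ?e t) + 2 * (?a t \<bullet> ?b t + Q (?e t) \<bullet> ?d t))
        + (?b t \<bullet> ?b t + Q (?d t) \<bullet> ?d t))"
  proof (rule Bochner_Integration.integral_cong[OF refl])
    fix t
    have 1: "C (y' t - yd t) = ?a t + ?b t" and 2: "u' t - ud t = ?e t + ?d t"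
      by (simp_all add: blinfun.add_right[symmetric])
    have "(norm (C (y' t - yd t)))\<^sup>2 = ?a t \<bullet> ?a t + 2 * (?a t \<bullet> ?b t) + ?b t \<bullet> ?b t"
      unfolding 1 power2_norm_eq_inner by (simp only: inner_add_left inner_add_right inner_commute[of "?b t" "?a t"])
    moreover have "(norm (pos_sqrt Q (u' t - ud t)))\<^sup>2 = Q (?e t) \<bullet> ?e t + 2 * (Q (?e t) \<bullet> ?d t) + Q (?d t) \<bullet> ?d t"
    proof -
      have "Q (?d t) \<bullet> ?e t = Q (?e t) \<bullet> ?d t" by (metis Q_sym inner_commute)
      then show ?thesis
        unfolding 2 pos_sqrt_norm[OF pos_Q inv_Q] by (simp only: blinfun.add_right inner_add_left inner_add_right)
    qed
    ultimately show "(norm (C (y' t - yd t)))\<^sup>2 + (norm (pos_sqrt Q (u' t - ud t)))\<^sup>2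
        = ((?a t \<bullet> ?a t + Q (?e t) \<bullet> ?e t) + 2 * (?a t \<bullet> ?b t + Q (?e t) \<bullet> ?d t)) + (?b t \<bullet> ?b t + Q (?d t) \<bullet> ?d t)"
      by (simp only: distrib_left add_ac)
  qed
  also have "\<dots> = integral\<^sup>L ?M (\<lambda>t. ?a t \<bullet> ?a t + Q (?e t) \<bullet> ?e t)
      + 2 * integral\<^sup>L ?M (\<lambda>t. ?a t \<bullet> ?b t + Q (?e t) \<bullet> ?d t) + integral\<^sup>L ?M (\<lambda>t. ?b t \<bullet> ?b t + Q (?d t) \<bullet> ?d t)"
  proof -
    have i: "integrable ?M (\<lambda>t. ?a t \<bullet> ?a t + Q (?e t) \<bullet> ?e t)" "integrable ?M (\<lambda>t. 2 * (?a t \<bullet> ?b t + Q (?e t) \<bullet> ?d t))"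
      "integrable ?M (\<lambda>t. ?b t \<bullet> ?b t + Q (?d t) \<bullet> ?d t)"
      by (intro Bochner_Integration.integrable_add integrable_mult_right int)+
    show ?thesis
      unfolding Bochner_Integration.integral_add[OF Bochner_Integration.integrable_add[OF i(1,2)] i(3)]
        Bochner_Integration.integral_add[OF i(1,2)] integral_mult_right_zero ..
  qed
  finally show "lq_cost C Q yd ud \<tau> y' u' = lq_cost C Q yd ud \<tau> y u +
      1/2 * (LINT t|lebesgue_on {0..\<tau>}. (norm (C (y' t - y t)))\<^sup>2 + Q (u' t - u t) \<bullet> (u' t - u t))"
    unfolding lq_cost_def cross pos_sqrt_norm[OF pos_Q inv_Q] power2_norm_eq_inner[symmetric]
    by (simp add: algebra_simps)
qed

lemma Q_nonneg: "0 \<le> Q x \<bullet> x"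
  using pos_Q by (cases "x = 0") (auto simp: positive_definite_def less_imp_le)

end

section \<open>Periodic extension\<close>

lemma per_ext_eq:
  assumes "P > 0" "f 0 = f P" "t \<in> {real k * P..real k * P + P}"
  shows "per_ext P f t = f (t - real k * P)"
proof (cases "t = real k * P + P")
  \<comment> \<open>At the right end of a period the remainder jumps back to 0, and
    \<open>f 0 = f P\<close> makes the value agree.\<close>
  case True
  have "(real (Suc k) * P) rmod P = 0" by (rule rmod_self_multiple_nat)
  then have "t rmod P = 0" by (simp add: True algebra_simps)
  with True assms(2) show ?thesis by (simp add: per_ext_def)
next
  case False
  have "t rmod P = t - real k * P"
    by (rule rmod_unique[where n = "int k"]) (use assms False in auto)
  then show ?thesis by (simp add: per_ext_def)
qed

lemma per_ext_continuous:
  fixes f :: "real \<Rightarrow> 'a::topological_space"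
  assumes P: "P > 0" and f: "continuous_on {0..P} f" "f 0 = f P"
  shows "continuous_on {0..real n * P} (per_ext P f)"
proof (induction n)
  case (Suc n)
  have "continuous_on {real n * P..real n * P + P} (\<lambda>t. f (t - real n * P))"
    by (rule continuous_on_compose2[OF f(1)]) (auto intro!: continuous_intros)
  then have "continuous_on {real n * P..real n * P + P} (per_ext P f)"
    by (rule continuous_on_eq) (use per_ext_eq[OF P f(2)] in simp)
  with Suc have "continuous_on ({0..real n * P} \<union> {real n * P..real n * P + P}) (per_ext P f)"
    by (intro continuous_on_closed_Un) auto
  moreover have "{0..real n * P} \<union> {real n * P..real n * P + P} = {0..real (Suc n) * P}"
    using P ivl_disj_un_two_touch(4)[of 0 "real n * P" "real n * P + P"] by (simp add: distrib_right add.commute)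
  ultimately show ?case by simp
qed (simp add: continuous_on_sing)

lemma mild_sol_shift:
  assumes "mild_sol S a b g y"
  shows "mild_sol S (a + c) (b + c) (\<lambda>t. g (t - c)) (\<lambda>t. y (t - c))"
  unfolding mild_sol_def
proof (intro allI impI)
  fix t1 t2 x assume "a + c \<le> t1" "t1 \<le> t2" "t2 \<le> b + c"
  then have "((\<lambda>s. g s \<bullet> S (t2 - c - s) x) has_integral (y (t2 - c) \<bullet> x - y (t1 - c) \<bullet> S (t2 - c - (t1 - c)) x)) {t1 - c..t2 - c}"
    by (intro mild_solD[OF assms]) auto
  from has_integral_shift_real_ivl[OF this, of "- c"]
  show "((\<lambda>s. g (s - c) \<bullet> S (t2 - s) x) has_integral (y (t2 - c) \<bullet> x - y (t1 - c) \<bullet> S (t2 - t1) x)) {t1..t2}"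
    by (simp add: algebra_simps)
qed

lemma mild_sol_trivial:
  fixes S :: "real \<Rightarrow> 'a::{real_inner,banach} \<Rightarrow>\<^sub>L 'a"
  assumes "C0_semigroup S"
  shows "mild_sol S a a g y"
proof (rule mild_solI[OF assms])
  fix t x assume "t \<in> {a..a}"
  then have "t = a" by simp
  then show "((\<lambda>s. g s \<bullet> S (t - s) x) has_integral (y t \<bullet> x - y a \<bullet> S (t - a) x)) {a..t}"
    using has_integral_refl(2)[of "\<lambda>s. g s \<bullet> S (t - s) x" a] by (simp add: C0_semigroup_zero[OF assms])
qed

text \<open>Translates of the solution over one period are joined end to end, which periodicity of
  \<open>y\<close> permits. The exceptional set is there because the source contains
  \<open>ud\<close>, periodic only almost everywhere.\<close>

lemma mild_sol_per_ext:
  fixes S :: "real \<Rightarrow> 'a::{real_inner,banach} \<Rightarrow>\<^sub>L 'a"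
  assumes S: "C0_semigroup S" and P: "P > 0" and y: "mild_sol S 0 P g y" "y 0 = y P"
    and N: "negligible N" and h: "\<And>k t. t \<in> {real k * P..real k * P + P} - N \<Longrightarrow> h t = g (t - real k * P)"
  shows "mild_sol S 0 (real n * P) h (per_ext P y)"
proof (induction n)
  case 0
  show ?case using mild_sol_trivial[OF S, where a = 0] by simp
next
  case (Suc n)
  have "mild_sol S (real n * P) (real n * P + P) h (per_ext P y)"
  proof (rule mild_sol_cong_AE[OF _ N])
    show "mild_sol S (real n * P) (real n * P + P) (\<lambda>t. g (t - real n * P)) (\<lambda>t. y (t - real n * P))"
      using mild_sol_shift[OF y(1), of "real n * P"] by (simp add: add.commute)
    show "h t = g (t - real n * P)" if "t \<in> {real n * P..real n * P + P} - N" for t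
      using h that by blast
    show "per_ext P y t = y (t - real n * P)" if "t \<in> {real n * P..real n * P + P}" for t
      by (rule per_ext_eq[OF P y(2) that])
  qed
  from mild_sol_combine[OF S Suc this] have "mild_sol S 0 (real n * P + P) h (per_ext P y)"
    using P by simp
  then show ?case by (simp add: algebra_simps)
qed

lemma back_sol_per_ext:
  fixes S :: "real \<Rightarrow> 'a::{real_inner,banach} \<Rightarrow>\<^sub>L 'a"
  assumes S: "C0_semigroup S" and P: "P > 0" and l: "back_sol S 0 P g l" "l 0 = l P"
    and h: "\<And>k t. t \<in> {real k * P..real k * P + P} \<Longrightarrow> h t = g (t - real k * P)"
  shows "back_sol S 0 (real n * P) h (per_ext P l)"
proof (induction n)
  case 0
  show ?case using mild_sol_trivial[OF S, where a = 0] by (simp add: back_sol_def)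
next
  case (Suc n)
  have "back_sol S (real n * P) (real n * P + P) h (per_ext P l)"
    unfolding back_sol_def
  proof (rule mild_sol_cong_AE)
    show "mild_sol S (- (real n * P + P)) (- (real n * P)) (\<lambda>t. - g (- t - real n * P)) (\<lambda>t. l (- t - real n * P))"
      using mild_sol_shift[OF l(1)[unfolded back_sol_def], of "- (real n * P)"] by (simp add: algebra_simps)
    show "- h (- t) = - g (- t - real n * P)" if "t \<in> {- (real n * P + P)..- (real n * P)} - {}" for t
      using h[of "- t" n] that by auto
    show "per_ext P l (- t) = l (- t - real n * P)" if "t \<in> {- (real n * P + P)..- (real n * P)}" for t
      by (rule per_ext_eq[OF P l(2)]) (use that in auto)
  qed simp
  then have "back_sol S 0 (real n * P + P) h (per_ext P l)"
    using mild_sol_combine[OF S _ Suc[unfolded back_sol_def]] P unfolding back_sol_def by simp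
  then show ?case by (simp add: algebra_simps)
qed

text \<open>Shifting by \<open>k\<close> periods collects the translates of the exceptional set of a
  single shift; the union over all \<open>k\<close> is countable, hence one null set serves for
  every period.\<close>

lemma periodic_AE:
  assumes P: "P > 0" and ae: "AE t in lebesgue_on {0..}. f (t + P) = f t"
  obtains N where "negligible N" "\<And>k t. real k * P \<le> t \<Longrightarrow> t \<notin> N \<Longrightarrow> f (t - real k * P) = f t"
proof -
  obtain N0 where N0: "negligible N0" "\<And>t. t \<in> {0..} - N0 \<Longrightarrow> f (t + P) = f t"
    using AE_lebesgue_on_negligible[OF ae] by auto
  have "\<exists>N. negligible N \<and> (\<forall>t. real k * P \<le> t \<longrightarrow> t \<notin> N \<longrightarrow> f (t - real k * P) = f t)" for k
  proof (induction k)
    case 0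
    show ?case by (intro exI[of _ "{}"]) simp
  next
    case (Suc k)
    then obtain N where N: "negligible N" "\<And>t. real k * P \<le> t \<Longrightarrow> t \<notin> N \<Longrightarrow> f (t - real k * P) = f t" by blast
    have "negligible ((+) P ` (N \<union> N0))"
      using N(1) N0(1) by (intro negligible_translation) auto
    moreover have "f (t - real (Suc k) * P) = f t" if t: "real (Suc k) * P \<le> t" "t \<notin> (+) P ` (N \<union> N0)" for t
    proof -
      have "t - P \<notin> N \<union> N0"
      proof
        assume "t - P \<in> N \<union> N0"
        then have "P + (t - P) \<in> (+) P ` (N \<union> N0)" by (rule imageI)
        with t(2) show False by simp
      qed
      moreover have kt: "real k * P \<le> t - P" using t(1) by (simp add: algebra_simps)
      moreover have "0 \<le> t - P" using kt P by (meson mult_nonneg_nonneg of_nat_0_le_iff order_trans less_imp_le)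
      ultimately have "f (t - P - real k * P) = f (t - P)" "f (t - P + P) = f (t - P)"
        using N(2)[of "t - P"] N0(2)[of "t - P"] by auto
      then show ?thesis by (simp add: algebra_simps)
    qed
    ultimately show ?case by blast
  qed
  then obtain N where N: "\<And>k. negligible (N k)" "\<And>k t. real k * P \<le> t \<Longrightarrow> t \<notin> N k \<Longrightarrow> f (t - real k * P) = f t"
    by metis
  show thesis
  proof (rule that)
    show "negligible (\<Union> (range N))" by (rule negligible_countable_Union) (use N(1) in auto)
    show "f (t - real k * P) = f t" if "real k * P \<le> t" "t \<notin> \<Union> (range N)" for k t
      using N(2)[of k t] that by blast
  qed
qed

lemma rmod_as_diff:
  assumes "P > 0" "0 \<le> t"
  obtains k :: nat where "real k * P \<le> t" "t rmod P = t - real k * P"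
proof -
  define k where "k = nat \<lfloor>t / P\<rfloor>"
  have "0 \<le> \<lfloor>t / P\<rfloor>" using assms by simp
  then have k: "real k = of_int \<lfloor>t / P\<rfloor>" by (simp add: k_def)
  have "real k * P \<le> t" unfolding k using assms by (metis floor_divide_lower)
  moreover have "t rmod P = t - real k * P" using assms by (simp add: rmod_def k mult.commute)
  ultimately show thesis by (rule that)
qed

lemma integral_norm_eq_0_if_negligible:
  assumes "negligible N" "\<And>t. t \<in> S - N \<Longrightarrow> f t = 0"
  shows "integral S (\<lambda>t. norm (f t)) = 0"
proof -
  have "((\<lambda>t. norm (f t)) has_integral 0) S"
    by (rule has_integral_negligible[OF assms(1)]) (use assms(2) in auto)
  then show ?thesis by (rule integral_unique)
qed

section \<open>Optimality, uniqueness and turnpike for the periodic problem\<close>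

context lq_periodic
begin

text \<open>The cost exceeds that of the extremal by a nonnegative quadratic form. Equality forces
  equal controls and equal outputs almost everywhere; the difference of the states is then a
  periodic trajectory with zero input and output, which detectability makes zero.\<close>

lemma periodic_extremal_optimal:
  fixes y y' l yd :: "real \<Rightarrow> 'x" and u' ud :: "real \<Rightarrow> 'u"
  assumes y: "mild_sol T' 0 P (\<lambda>t. W (l t) + B (ud t)) y" "continuous_on {0..P} y" "y 0 = y P"
    and l: "back_sol T 0 P (\<lambda>t. adj C (C (y t)) - adj C (C (yd t))) l" "continuous_on {0..P} l" "l 0 = l P"
    and ud: "L2_on P ud" and yd: "continuous_on {0..P} yd"
    and y': "mild_sol T' 0 P (\<lambda>t. B (u' t)) y'" "continuous_on {0..P} y'" "L2_on P u'" "y' 0 = y' P"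
  defines "u \<equiv> \<lambda>t. ud t + inv_op Q (adj B (l t))"
  shows "lq_cost C Q yd ud P y u \<le> lq_cost C Q yd ud P y' u'"
    and "lq_cost C Q yd ud P y' u' \<le> lq_cost C Q yd ud P y u \<Longrightarrow>
      (\<forall>t\<in>{0..P}. y' t = y t) \<and> (AE t in lebesgue_on {0..P}. u' t = u t)"
proof -
  let ?M = "lebesgue_on {0..P}"
  let ?f = "\<lambda>t. (norm (C (y' t - y t)))\<^sup>2 + Q (u' t - u t) \<bullet> (u' t - u t)"
  have u: "L2_on P u"
    unfolding u_def by (intro L2_on_add[OF ud] L2_on_blinfun L2_on_continuous l)
  have yu: "mild_sol T' 0 P (\<lambda>t. B (u t)) y"
    using y(1) by (simp add: u_def blinfun.add_right add.commute)
  have bd: "(y' P - y P) \<bullet> l P = (y' 0 - y 0) \<bullet> l 0"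
    using y(3) l(3) y'(4) by simp
  have "AE t in ?M. u t = ud t + inv_op Q (adj B (l t))" by (simp add: u_def)
  note expand = lq_cost_expand[OF P yu y(2) u y'(1-3) ud yd l(1,2) this bd]
  have f: "0 \<le> ?f t" for t using Q_nonneg by simp
  then have nonneg: "0 \<le> integral\<^sup>L ?M ?f" by (intro Bochner_Integration.integral_nonneg) simp
  then show "lq_cost C Q yd ud P y u \<le> lq_cost C Q yd ud P y' u'"
    unfolding expand(1) by simp
  assume "lq_cost C Q yd ud P y' u' \<le> lq_cost C Q yd ud P y u"
  with nonneg have "integral\<^sup>L ?M ?f = 0" unfolding expand(1) by simp
  then have ae: "AE t in ?M. ?f t = 0"
    using integral_nonneg_eq_0_iff_AE[OF expand(2)] f by simp
  have "C (y' t - y t) = 0 \<and> u' t = u t" if "?f t = 0" for t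
  proof -
    have "Q (u' t - u t) \<bullet> (u' t - u t) = 0" "(norm (C (y' t - y t)))\<^sup>2 = 0"
      using that Q_nonneg[of "u' t - u t"] zero_le_power2[of "norm (C (y' t - y t))"] by linarith+
    then show ?thesis
      using pos_Q unfolding positive_definite_def by (metis less_irrefl norm_eq_zero right_minus_eq zero_eq_power2)
  qed
  with ae have ae: "AE t in ?M. C (y' t - y t) = 0 \<and> u' t = u t" by (rule eventually_mono)
  obtain N where N: "negligible N" "\<And>t. t \<in> {0..P} - N \<Longrightarrow> C (y' t - y t) = 0 \<and> u' t = u t"
    using AE_lebesgue_on_negligible[OF ae] by auto
  have "mild_sol T' 0 P (\<lambda>_. 0) (\<lambda>t. y' t - y t)"
    by (rule mild_sol_cong_AE[OF mild_sol_diff[OF y'(1) yu] N(1)]) (use N(2) in auto)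
  then have R': "mild_sol R 0 P (\<lambda>t. 0 - adj L (C (y' t - y t))) (\<lambda>t. y' t - y t)"
    by (rule forward_detect) (rule continuous_on_const)
  obtain c where "c > 0" and c: "\<forall>a g y t. mild_sol R a (a + P) g y \<longrightarrow> continuous_on {a..a + P} g \<longrightarrow> y a = y (a + P) \<longrightarrow>
      t \<in> {a..a + P} \<longrightarrow> norm (y t) \<le> c * integral {a..a + P} (\<lambda>s. norm (g s))"
    using periodic_mild_sol_bound[OF stable_R generates_C0[OF R] P] by blast
  have "norm (y' t - y t) \<le> c * integral {0..P} (\<lambda>s. norm (0 - adj L (C (y' s - y s))))" if "t \<in> {0..P}" for t
  proof -
    have "continuous_on {0..P} (\<lambda>t. 0 - adj L (C (y' t - y t)))"
      by (intro continuous_intros y y')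
    then show ?thesis
      using c[rule_format, of 0 "\<lambda>t. 0 - adj L (C (y' t - y t))" "\<lambda>t. y' t - y t" t] R' that y(3) y'(4) by simp
  qed
  moreover have "integral {0..P} (\<lambda>s. norm (0 - adj L (C (y' s - y s)))) = 0"
    by (rule integral_norm_eq_0_if_negligible[OF N(1)]) (use N(2) in simp)
  ultimately have "\<forall>t\<in>{0..P}. y' t = y t" by simp
  moreover have "AE t in ?M. u' t = u t" using ae by (rule eventually_mono) simp
  ultimately show "(\<forall>t\<in>{0..P}. y' t = y t) \<and> (AE t in ?M. u' t = u t)" ..
qed

text \<open>The difference of two multipliers is a periodic backward solution without source whose
  image under \<open>adj B\<close> vanishes almost everywhere; after stabilisation its source is
  negligible, and the periodic bound gives zero.\<close>

lemma periodic_multiplier_unique: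
  fixes l1 l2 h :: "real \<Rightarrow> 'x"
  assumes l1: "back_sol T 0 P h l1" "continuous_on {0..P} l1" "l1 0 = l1 P"
    and l2: "back_sol T 0 P h l2" "continuous_on {0..P} l2" "l2 0 = l2 P"
    and ae: "AE t in lebesgue_on {0..P}. adj B (l1 t) = adj B (l2 t)"
    and t: "t \<in> {0..P}"
  shows "l1 t = l2 t"
proof -
  let ?d = "\<lambda>t. l1 t - l2 t" and ?q = "\<lambda>t. - adj F (adj B (l1 t - l2 t))"
  have "back_sol T 0 P (\<lambda>t. 0) ?d" using back_sol_diff[OF l1(1) l2(1)] by simp
  then have "back_sol S 0 P (\<lambda>t. 0 + adj F (adj B (?d t))) ?d"
    by (rule backward_stabilize) (rule continuous_on_const)
  then have per: "per_backward ?q ?d" using l1(3) l2(3) by (simp add: per_backward_def)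
  obtain N where N: "negligible N" "\<And>t. t \<in> {0..P} - N \<Longrightarrow> adj B (l1 t) = adj B (l2 t)"
    using AE_lebesgue_on_negligible[OF ae] by auto
  obtain c where "c > 0" and c: "\<And>q p t. per_backward q p \<Longrightarrow> continuous_on {0..P} q \<Longrightarrow> t \<in> {0..P} \<Longrightarrow>
    norm (p t) \<le> c * integral {0..P} (\<lambda>s. norm (q s))"
    by (rule per_backward_bound) (rule that)
  have "norm (?d t) \<le> c * integral {0..P} (\<lambda>s. norm (?q s))"
    by (rule c[OF per _ t]) (intro continuous_intros l1 l2)
  moreover have "integral {0..P} (\<lambda>s. norm (?q s)) = 0"
    by (rule integral_norm_eq_0_if_negligible[OF N(1)]) (use N(2) in \<open>simp add: blinfun.diff_right\<close>)
  ultimately show ?thesis by simp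
qed

text \<open>Both extremals solve the same affine system on {0..\<tau>} once the periodic one is
  extended, so the difference solves the homogeneous Hamiltonian system with end data
  \<open>y0 - y 0\<close> and \<open>- ?lE \<tau>\<close>. The second is bounded independently of
  \<tau> by periodicity.\<close>

lemma periodic_turnpike:
  fixes y l yd :: "real \<Rightarrow> 'x" and ud :: "real \<Rightarrow> 'u" and y0 :: 'x
  assumes y: "mild_sol T' 0 P (\<lambda>t. W (l t) + B (ud t)) y" "continuous_on {0..P} y" "y 0 = y P"
    and l: "back_sol T 0 P (\<lambda>t. adj C (C (y t)) - adj C (C (yd t))) l" "continuous_on {0..P} l" "l 0 = l P"
    and yd: "\<And>t. t \<ge> 0 \<Longrightarrow> yd (t + P) = yd t"
    and ud: "AE t in lebesgue_on {0..}. ud (t + P) = ud t"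
  shows "\<exists>c>0. \<exists>\<mu>>0. \<forall>\<tau>>0. \<forall>z v m. mild_sol T' 0 \<tau> (\<lambda>t. W (m t) + B (ud t)) z \<longrightarrow>
    back_sol T 0 \<tau> (\<lambda>t. adj C (C (z t)) - adj C (C (yd t))) m \<longrightarrow>
    continuous_on {0..\<tau>} z \<longrightarrow> continuous_on {0..\<tau>} m \<longrightarrow> z 0 = y0 \<longrightarrow> m \<tau> = 0 \<longrightarrow>
    (AE t in lebesgue_on {0..\<tau>}. v t = ud t + inv_op Q (adj B (m t))) \<longrightarrow>
    (AE t in lebesgue_on {0..\<tau>}. norm (z t - per_ext P y t)
        + norm (v t - per_ext P (\<lambda>t. ud t + inv_op Q (adj B (l t))) t) + norm (m t - per_ext P l t)
      \<le> c * (exp (- \<mu> * t) + exp (- \<mu> * (\<tau> - t))))"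
proof -
  let ?yE = "per_ext P y" and ?lE = "per_ext P l" and ?u = "\<lambda>t. ud t + inv_op Q (adj B (l t))"
  let ?G = "norm (inv_op Q o\<^sub>L adj B)"
  obtain c \<mu> where c: "c > 0" "\<mu> > 0" and tp: "\<forall>\<tau>>0. \<forall>y l. mild_sol T' 0 \<tau> (\<lambda>t. W (l t)) y \<longrightarrow>
    back_sol T 0 \<tau> (\<lambda>t. adj C (C (y t))) l \<longrightarrow> continuous_on {0..\<tau>} y \<longrightarrow> continuous_on {0..\<tau>} l \<longrightarrow>
    (\<forall>t\<in>{0..\<tau>}. norm (y t) + norm (l t)
      \<le> c * (norm (y 0) + norm (l \<tau>)) * (exp (- \<mu> * t) + exp (- \<mu> * (\<tau> - t))))"
    using hamiltonian_turnpike by blast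
  obtain N where N: "negligible N" "\<And>k t. real k * P \<le> t \<Longrightarrow> t \<notin> N \<Longrightarrow> ud (t - real k * P) = ud t"
    using periodic_AE[OF P ud] by auto
  have ydk: "yd (t + real k * P) = yd t" if "t \<ge> 0" for k t
  proof (induction k)
    case (Suc k)
    have "yd (t + real (Suc k) * P) = yd (t + real k * P + P)" by (simp add: algebra_simps)
    also have "\<dots> = yd (t + real k * P)" using that P by (intro yd) simp
    finally show ?case using Suc by simp
  qed simp
  have yE: "mild_sol T' 0 (real n * P) (\<lambda>t. W (?lE t) + B (ud t)) ?yE" for n
  proof (rule mild_sol_per_ext[OF generates_C0[OF T'] P y(1,3) N(1)])
    fix k t assume t: "t \<in> {real k * P..real k * P + P} - N"
    then have "?lE t = l (t - real k * P)" by (intro per_ext_eq[OF P l(3)]) simp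
    with t N(2)[of k t] show "W (?lE t) + B (ud t) = W (l (t - real k * P)) + B (ud (t - real k * P))" by simp
  qed
  have lE: "back_sol T 0 (real n * P) (\<lambda>t. adj C (C (?yE t)) - adj C (C (yd t))) ?lE" for n
  proof (rule back_sol_per_ext[OF generates_C0[OF T] P l(1,3)])
    fix k t assume t: "t \<in> {real k * P..real k * P + P}"
    then have "?yE t = y (t - real k * P)" by (intro per_ext_eq[OF P y(3)])
    with t ydk[of "t - real k * P" k]
    show "adj C (C (?yE t)) - adj C (C (yd t)) = adj C (C (y (t - real k * P))) - adj C (C (yd (t - real k * P)))" by simp
  qed
  have "bounded (l ` {0..P})" by (intro compact_imp_bounded compact_continuous_image l compact_Icc)
  then obtain M where M: "M > 0" "\<And>t. t \<in> {0..P} \<Longrightarrow> norm (l t) \<le> M"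
    by (auto simp: bounded_pos)
  have lE_le: "norm (?lE t) \<le> M" for t
    unfolding per_ext_def using P rmod_nonneg[of P t] rmod_less[of P t] by (intro M) simp
  \<comment> \<open>Bounds the mismatch at both ends for every horizon: the initial one is fixed,
    and the final multiplier is zero while the periodic one stays below \<open>M\<close>.\<close>
  define m0 where "m0 = norm (y0 - ?yE 0) + M"
  let ?c = "(1 + ?G) * (c * m0)"
  have "0 < 1 + ?G" by (simp add: add_pos_nonneg)
  moreover have "0 < m0" using M(1) by (simp add: m0_def add_nonneg_pos)
  ultimately have c_pos: "0 < ?c" using c(1) by simp
  have claim: "AE t in lebesgue_on {0..\<tau>}. norm (z t - ?yE t) + norm (v t - per_ext P ?u t) + norm (m t - ?lE t)
      \<le> ?c * (exp (- \<mu> * t) + exp (- \<mu> * (\<tau> - t)))"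
    if "\<tau> > 0" and z: "mild_sol T' 0 \<tau> (\<lambda>t. W (m t) + B (ud t)) z" "continuous_on {0..\<tau>} z" "z 0 = y0"
      and m: "back_sol T 0 \<tau> (\<lambda>t. adj C (C (z t)) - adj C (C (yd t))) m" "continuous_on {0..\<tau>} m" "m \<tau> = 0"
      and v: "AE t in lebesgue_on {0..\<tau>}. v t = ud t + inv_op Q (adj B (m t))" for \<tau> z v m
  proof -
    obtain n where "\<tau> / P < real n" using reals_Archimedean2 by blast
    then have n: "\<tau> \<le> real n * P" using P by (simp add: field_simps)
    have cont: "continuous_on {0..\<tau>} ?yE" "continuous_on {0..\<tau>} ?lE"
      using n by (auto intro: continuous_on_subset[OF per_ext_continuous[OF P y(2,3), of n]]
          continuous_on_subset[OF per_ext_continuous[OF P l(2,3), of n]])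
    have "mild_sol T' 0 \<tau> (\<lambda>t. W (m t - ?lE t)) (\<lambda>t. z t - ?yE t)"
      using mild_sol_diff[OF z(1) mild_sol_subset[OF yE order_refl n]] by (simp add: blinfun.diff_right)
    moreover have "back_sol T 0 \<tau> (\<lambda>t. adj C (C (z t - ?yE t))) (\<lambda>t. m t - ?lE t)"
      using back_sol_diff[OF m(1) back_sol_subset[OF lE order_refl n]] by (simp add: blinfun.diff_right)
    ultimately have est: "norm (z t - ?yE t) + norm (m t - ?lE t) \<le> c * (norm (z 0 - ?yE 0) + norm (m \<tau> - ?lE \<tau>))
        * (exp (- \<mu> * t) + exp (- \<mu> * (\<tau> - t)))" if "t \<in> {0..\<tau>}" for t
      using tp[rule_format, of \<tau> "\<lambda>t. m t - ?lE t" "\<lambda>t. z t - ?yE t" t] that \<open>\<tau> > 0\<close>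
      by (auto intro!: continuous_on_diff z m cont)
    have init: "norm (z 0 - ?yE 0) + norm (m \<tau> - ?lE \<tau>) \<le> m0"
      using z(3) m(3) lE_le[of \<tau>] by (simp add: m0_def)
    obtain N' where N': "negligible N'" "\<And>t. t \<in> {0..\<tau>} - N' \<Longrightarrow> v t = ud t + inv_op Q (adj B (m t))"
      using AE_lebesgue_on_negligible[OF v] by auto
    show ?thesis
    proof (rule AE_lebesgue_on_if_negligible)
      show "negligible (N \<union> N')" using N(1) N'(1) by simp
      show "norm (z t - ?yE t) + norm (v t - per_ext P ?u t) + norm (m t - ?lE t)
        \<le> ?c * (exp (- \<mu> * t) + exp (- \<mu> * (\<tau> - t)))" if t: "t \<in> {0..\<tau>} - (N \<union> N')" for t
      proof -
        let ?e = "exp (- \<mu> * t) + exp (- \<mu> * (\<tau> - t))"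
        have "0 \<le> t" using t by simp
        then obtain k where k: "real k * P \<le> t" "t rmod P = t - real k * P" using rmod_as_diff[OF P] by metis
        have "ud (t rmod P) = ud t" unfolding k(2) by (rule N(2)[OF k(1)]) (use t in simp)
        \<comment> \<open>Off the null set the reference controls cancel, so the control error is a
          bounded image of the multiplier error; hence the factor \<open>1 + ?G\<close>.\<close>
        then have "v t - per_ext P ?u t = (inv_op Q o\<^sub>L adj B) (m t - ?lE t)"
          using N'(2)[of t] t by (simp add: per_ext_def blinfun.diff_right)
        then have "norm (v t - per_ext P ?u t) \<le> ?G * norm (m t - ?lE t)" by (simp only: norm_blinfun)
        also have "\<dots> \<le> ?G * (norm (z t - ?yE t) + norm (m t - ?lE t))" by (intro mult_left_mono) auto
        finally have "norm (z t - ?yE t) + norm (v t - per_ext P ?u t) + norm (m t - ?lE t)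
            \<le> (1 + ?G) * (norm (z t - ?yE t) + norm (m t - ?lE t))" by (simp add: algebra_simps)
        also have "\<dots> \<le> (1 + ?G) * (c * m0 * ?e)"
        proof (rule mult_left_mono)
          have "c * (norm (z 0 - ?yE 0) + norm (m \<tau> - ?lE \<tau>)) * ?e \<le> c * m0 * ?e"
            using c(1) init by (intro mult_right_mono mult_left_mono) auto
          with est[of t] t show "norm (z t - ?yE t) + norm (m t - ?lE t) \<le> c * m0 * ?e" by simp
        qed simp
        finally show ?thesis by (simp only: mult.assoc)
      qed
    qed simp
  qed
  show ?thesis
    by (rule exI[of _ ?c], rule conjI[OF c_pos], rule exI[of _ \<mu>], rule conjI[OF c(2)],
        intro allI impI, rule claim; assumption)
qed

end

section \<open>From stabilizability and detectability to the concluding theorem\<close>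

lemma semigroup_of_generates: "\<exists>S. generates A S \<Longrightarrow> generates A (semigroup_of A)"
  unfolding semigroup_of_def by (erule someI_ex)

lemma exp_stable_exists_if_bounds:
  assumes "c > 0" "\<nu> > 0" "\<forall>t\<ge>0. norm (S t) \<le> c * exp (- \<nu> * t)"
    and "K \<ge> c" "0 < \<mu>" "\<mu> \<le> \<nu>"
  shows "exp_stable K \<mu> S"
  unfolding exp_stable_def
proof (intro conjI allI impI)
  fix t :: real assume t: "t \<ge> 0"
  have "norm (S t) \<le> c * exp (- \<nu> * t)" using assms(3) t by blast
  also have "\<dots> \<le> K * exp (- \<mu> * t)"
    using assms t by (intro mult_mono) (auto intro: mult_right_mono)
  finally show "norm (S t) \<le> K * exp (- \<mu> * t)" .
qed (use assms in auto)

text \<open>Density of the domain of \<open>A\<^sup>*\<close>, which \<open>generates_adjoint\<close> needs, comes from detectability: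
  \<open>A\<^sup>*\<close> has the same domain as the generator \<open>A\<^sup>* + C\<^sup>* L\<close>.\<close>

lemma lq_if_stabilizable_detectable:
  fixes A :: "'x::{real_inner,banach} \<rightharpoonup> 'x"
    and B :: "'u::{real_inner,banach} \<Rightarrow>\<^sub>L 'x"
    and C :: "'x \<Rightarrow>\<^sub>L 'v::{real_inner,banach}"
    and Q :: "'u \<Rightarrow>\<^sub>L 'u"
  assumes A: "\<exists>S. generates A S"
    and Q: "positive_definite Q" "invertible_op Q"
    and stab: "exp_stabilizable A B" and det: "exp_detectable A C"
  obtains S S' R F L K \<nu> where
    "lq A B C Q (semigroup_of A) (semigroup_of (op_adj A)) S S' R F L K \<nu>"
proof -
  obtain F S c1 \<nu>1 where S: "generates (op_plus A (B o\<^sub>L F)) S"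
    and S1: "c1 > 0" "\<nu>1 > 0" "\<forall>t\<ge>0. norm (S t) \<le> c1 * exp (- \<nu>1 * t)"
    using stab unfolding exp_stabilizable_def by blast
  obtain L R c2 \<nu>2 where R: "generates (op_plus (op_adj A) (adj C o\<^sub>L L)) R"
    and R1: "c2 > 0" "\<nu>2 > 0" "\<forall>t\<ge>0. norm (R t) \<le> c2 * exp (- \<nu>2 * t)"
    using det unfolding exp_detectable_def exp_stabilizable_def by blast
  note T = semigroup_of_generates[OF A]
  have dense: "\<exists>Y. (\<forall>n. op_adj A (Y n) \<noteq> None) \<and> Y \<longlonglongrightarrow> y" for y
    using generator_dense[OF R, of y] by (simp add: op_plus_def)
  have T': "generates (op_adj A) (semigroup_of (op_adj A))"
    by (rule semigroup_of_generates) (rule exI, rule generates_adjoint[OF T dense])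
  note op_adj_S = op_adj_op_plus[OF T S]
  \<comment> \<open>Adding a bounded operator leaves the domain of the adjoint unchanged, so its
    density carries over to the closed loop.\<close>
  have "\<exists>Y. (\<forall>n. op_adj (op_plus A (B o\<^sub>L F)) (Y n) \<noteq> None) \<and> Y \<longlonglongrightarrow> y" for y
    unfolding op_adj_S using dense[of y] by (simp add: op_plus_def)
  then have S': "generates (op_adj (op_plus A (B o\<^sub>L F))) (\<lambda>t. adj (S t))"
    by (rule generates_adjoint[OF S])
  have "lq A B C Q (semigroup_of A) (semigroup_of (op_adj A)) S (\<lambda>t. adj (S t)) R F L (max c1 c2) (min \<nu>1 \<nu>2)"
  proof
    show "dual_semigroups (semigroup_of A) (semigroup_of (op_adj A))"
      by (rule dual_of_generates[OF T T'])
    show "dual_semigroups S (\<lambda>t. adj (S t))" by (rule dual_of_generates[OF S S'])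
    show "generates (op_plus (op_adj A) (adj (B o\<^sub>L F))) (\<lambda>t. adj (S t))"
      using S' by (simp add: op_adj_S)
    show "exp_stable (max c1 c2) (min \<nu>1 \<nu>2) S"
      using S1 R1(2) by (intro exp_stable_exists_if_bounds[OF S1]) auto
    show "exp_stable (max c1 c2) (min \<nu>1 \<nu>2) R"
      using R1 S1(2) by (intro exp_stable_exists_if_bounds[OF R1]) auto
  qed (fact T T' S R Q)+
  then show thesis by (rule that)
qed

theorem theorem2:
  fixes A :: "'x::{real_inner,banach} \<rightharpoonup> 'x"
    and B :: "'u::{real_inner,banach} \<Rightarrow>\<^sub>L 'x"
    and C :: "'x \<Rightarrow>\<^sub>L 'v::{real_inner,banach}"
    and Q :: "'u \<Rightarrow>\<^sub>L 'u"
    and P :: real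
    and yd :: "real \<Rightarrow> 'x"
    and ud :: "real \<Rightarrow> 'u"
    and y0 :: 'x
  assumes "\<exists>S. generates A S"
    and "positive_definite Q" and "invertible_op Q"
    and "P > 0"
    and "continuous_on {0..} yd" and "\<forall>t\<ge>0. yd (t + P) = yd t"
    and "\<forall>\<tau>>0. L2_on \<tau> ud" and "AE t in lebesgue_on {0..}. ud (t + P) = ud t"
    and "exp_stabilizable A B" and "exp_detectable A C"
  shows "\<exists>yP uP lP.
     LQPi_solution A B C Q yd ud P yP uP \<and>
     (\<forall>y u. LQPi_solution A B C Q yd ud P y u \<longrightarrow>
        (\<forall>t\<in>{0..P}. y t = yP t) \<and> (AE t in lebesgue_on {0..P}. u t = uP t)) \<and>
     LQPi_extremal_lift A B C Q yd ud P yP uP lP \<and>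
     (\<forall>l. LQPi_extremal_lift A B C Q yd ud P yP uP l \<longrightarrow> (\<forall>t\<in>{0..P}. l t = lP t)) \<and>
     (\<exists>c>0. \<exists>\<nu>>0. \<forall>T>0. \<forall>y u l.
        LQT_optimal_triple A B C Q yd ud y0 T y u l \<longrightarrow>
        (AE t in lebesgue_on {0..T}.
           norm (y t - per_ext P yP t) + norm (u t - per_ext P uP t)
             + norm (l t - per_ext P lP t)
           \<le> c * (exp (- \<nu> * t) + exp (- \<nu> * (T - t)))))"
proof -
  note yd = assms(5) and ydP = assms(6) and ud = assms(7)
  obtain S S' R F L K \<nu> where
    "lq A B C Q (semigroup_of A) (semigroup_of (op_adj A)) S S' R F L K \<nu>"
    using lq_if_stabilizable_detectable[OF assms(1-3,9,10)] by metis
  then interpret lq_periodic A B C Q "semigroup_of A" "semigroup_of (op_adj A)" S S' R F L K \<nu> P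
    using \<open>P > 0\<close> by (simp add: lq_periodic_def lq_periodic_axioms_def)
  have ydc: "continuous_on {0..\<tau>} yd" for \<tau> using yd by (rule continuous_on_subset) auto
  have udP: "L2_on P ud" and ud1: "\<And>\<tau>. \<tau> > 0 \<Longrightarrow> L1_on 0 \<tau> ud"
    using ud \<open>P > 0\<close> L2_on_imp_L1_on by blast+
  \<comment> \<open>Together with \<open>forward\<close> this translates between Duhamel's formula
    with vector integrals and the tested equations used so far.\<close>
  have adjoint: "mild_adjoint A \<tau> (\<lambda>t. adj C (C (y t)) - adj C (C (yd t))) l
      \<longleftrightarrow> back_sol (semigroup_of A) 0 \<tau> (\<lambda>t. adj C (C (y t)) - adj C (C (yd t))) l"
    if "continuous_on {0..\<tau>} y" for \<tau> y l
    by (rule mild_adjoint_iff[OF dual_T]) (intro continuous_intros that ydc)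
  have forward: "mild_forward A \<tau> (\<lambda>t. W (l t) + B (ud t)) y
      \<longleftrightarrow> mild_sol (semigroup_of (op_adj A)) 0 \<tau> (\<lambda>t. W (l t) + B (ud t)) y"
    if "\<tau> > 0" "continuous_on {0..\<tau>} l" for \<tau> l y
    by (rule mild_forward_iff[OF dual_T'])
      (intro L1_on_add L1_on_blinfun ud1 that L1_on_continuous)
  have forward_u: "mild_forward A P (\<lambda>t. B (u t)) y \<longleftrightarrow> mild_sol (semigroup_of (op_adj A)) 0 P (\<lambda>t. B (u t)) y"
    if "L2_on P u" for u y
    by (rule mild_forward_iff[OF dual_T']) (intro L1_on_blinfun L2_on_imp_L1_on that)
  obtain yP lP where yP: "continuous_on {0..P} yP" "yP 0 = yP P"
      "mild_sol (semigroup_of (op_adj A)) 0 P (\<lambda>t. W (lP t) + B (ud t)) yP"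
    and lP: "continuous_on {0..P} lP" "lP 0 = lP P"
      "back_sol (semigroup_of A) 0 P (\<lambda>t. adj C (C (yP t)) - adj C (C (yd t))) lP"
    using periodic_extremal_exists[OF ud1[OF \<open>P > 0\<close>] ydc] by blast
  define uP where "uP = (\<lambda>t. ud t + inv_op Q (adj B (lP t)))"
  have uP: "L2_on P uP"
    unfolding uP_def by (intro L2_on_add[OF udP] L2_on_blinfun L2_on_continuous lP)
  have adm: "admissible A B P yP uP"
    unfolding admissible_def forward_u[OF uP] using yP uP by (simp add: uP_def blinfun.add_right add.commute)
  note optimal = periodic_extremal_optimal[OF yP(3,1,2) lP(3,1,2) udP ydc, folded uP_def]
  have opt: "lq_cost C Q yd ud P yP uP \<le> lq_cost C Q yd ud P y u"
    "lq_cost C Q yd ud P y u \<le> lq_cost C Q yd ud P yP uP \<Longrightarrow>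
      (\<forall>t\<in>{0..P}. y t = yP t) \<and> (AE t in lebesgue_on {0..P}. u t = uP t)"
    if "admissible A B P y u" "y 0 = y P" for y u
  proof -
    have *: "mild_sol (semigroup_of (op_adj A)) 0 P (\<lambda>t. B (u t)) y" "continuous_on {0..P} y" "L2_on P u"
      using that(1) forward_u[of u y] by (auto simp: admissible_def)
    show "lq_cost C Q yd ud P yP uP \<le> lq_cost C Q yd ud P y u"
      by (rule optimal(1)[OF * that(2)])
    show "lq_cost C Q yd ud P y u \<le> lq_cost C Q yd ud P yP uP \<Longrightarrow>
      (\<forall>t\<in>{0..P}. y t = yP t) \<and> (AE t in lebesgue_on {0..P}. u t = uP t)"
      using optimal(2)[OF * that(2)] by (simp add: uP_def)
  qed
  have sol: "LQPi_solution A B C Q yd ud P yP uP"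
    unfolding LQPi_solution_def using adm yP(2) opt(1) by blast
  have sol_unique: "(\<forall>t\<in>{0..P}. y t = yP t) \<and> (AE t in lebesgue_on {0..P}. u t = uP t)"
    if "LQPi_solution A B C Q yd ud P y u" for y u
    using opt(2)[of y u] that adm yP(2) unfolding LQPi_solution_def by blast
  have lift: "LQPi_extremal_lift A B C Q yd ud P yP uP lP"
    unfolding LQPi_extremal_lift_def extremal_system_def
    using yP lP forward[OF \<open>P > 0\<close> lP(1)] adjoint[OF yP(1)] by (simp add: uP_def)
  have lift_unique: "l t = lP t" if l: "LQPi_extremal_lift A B C Q yd ud P yP uP l" and t: "t \<in> {0..P}" for l t
  proof (rule periodic_multiplier_unique[OF _ _ _ lP(3,1,2) _ t])
    note l = l[unfolded LQPi_extremal_lift_def extremal_system_def adjoint[OF yP(1)]]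
    show "back_sol (semigroup_of A) 0 P (\<lambda>t. adj C (C (yP t)) - adj C (C (yd t))) l"
      "continuous_on {0..P} l" "l 0 = l P" using l by auto
    from l have "AE t in lebesgue_on {0..P}. uP t = ud t + inv_op Q (adj B (l t))" by blast
    then show "AE t in lebesgue_on {0..P}. adj B (l t) = adj B (lP t)"
    proof (rule eventually_mono)
      fix t assume "uP t = ud t + inv_op Q (adj B (l t))"
      \<comment> \<open>Both multipliers produce the same control \<open>uP\<close>, and applying
        \<open>Q\<close> removes the inverse, so they agree after \<open>adj B\<close>.\<close>
      then have "Q (inv_op Q (adj B (l t))) = Q (inv_op Q (adj B (lP t)))" by (simp add: uP_def)
      then show "adj B (l t) = adj B (lP t)" by (simp add: inv_op_works[OF inv_Q])
    qed
  qed
  obtain c \<mu> where c: "c > 0" "\<mu> > 0" and tp: "\<forall>\<tau>>0. \<forall>z v m.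
    mild_sol (semigroup_of (op_adj A)) 0 \<tau> (\<lambda>t. W (m t) + B (ud t)) z \<longrightarrow>
    back_sol (semigroup_of A) 0 \<tau> (\<lambda>t. adj C (C (z t)) - adj C (C (yd t))) m \<longrightarrow>
    continuous_on {0..\<tau>} z \<longrightarrow> continuous_on {0..\<tau>} m \<longrightarrow> z 0 = y0 \<longrightarrow> m \<tau> = 0 \<longrightarrow>
    (AE t in lebesgue_on {0..\<tau>}. v t = ud t + inv_op Q (adj B (m t))) \<longrightarrow>
    (AE t in lebesgue_on {0..\<tau>}. norm (z t - per_ext P yP t)
        + norm (v t - per_ext P uP t) + norm (m t - per_ext P lP t)
      \<le> c * (exp (- \<mu> * t) + exp (- \<mu> * (\<tau> - t))))"
    using periodic_turnpike[OF yP(3,1,2) lP(3,1,2) ydP[rule_format] assms(8), folded uP_def, of y0] by blast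
  have "AE t in lebesgue_on {0..\<tau>}. norm (y t - per_ext P yP t) + norm (u t - per_ext P uP t)
      + norm (l t - per_ext P lP t) \<le> c * (exp (- \<mu> * t) + exp (- \<mu> * (\<tau> - t)))"
    if "\<tau> > 0" and opt: "LQT_optimal_triple A B C Q yd ud y0 \<tau> y u l" for \<tau> y u l
  proof -
    from opt have y: "continuous_on {0..\<tau>} y" "y 0 = y0" and sys: "extremal_system A B C Q yd ud \<tau> y u l" and "l \<tau> = 0"
      by (auto simp: LQT_optimal_triple_def LQT_solution_def admissible_def)
    then have l: "continuous_on {0..\<tau>} l" by (simp add: extremal_system_def)
    show ?thesis
      using tp[rule_format, of \<tau> l y u] y l sys \<open>l \<tau> = 0\<close> \<open>\<tau> > 0\<close>
      by (simp add: extremal_system_def forward adjoint)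
  qed
  then show ?thesis
    using sol sol_unique lift lift_unique c by blast
qed

end
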